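(* Let $W$ be an irreducible finite complex reflection group with reflection representation $V\cong\mathbb{C}^N$ and reflection arrangement $\mathcal{A}$, and let $m\colon\mathcal{A}\to\mathbb{N}$ be a $W$-invariant multiplicity function. There is an isomorphism $\rho\colon\mathbf{Q}_m(V)\xrightarrow{\sim}\widetilde D_m$ of $SV^*$-modules, so the module $\widetilde D_m$ is free. The $SV^*$-module $\widetilde D_m$ has a free basis consisting of $N$ homogeneous elements $L^{(k)}=\sum_{i=1}^N f_i^{(k)}\partial_i$, $k=1,\dots,N$, where $\deg f_i^{(k)}=\frac1N\sum_{H\in\mathcal{A}}m_Hn_H$. Moreover, $\rho$ is an isomorphism of $\mathbb{C}W$-modules. Thus the $\mathbb{C}$-span $\langle L^{(k)}\colon 1\le k\le N\rangle$ in $\widetilde D_m$ is isomorphic to $\Phi(V)=\mathrm{kz}_{-m}(V)$ as a $\mathbb{C}W$-module.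
   Context: $\mathbb{N}=\{0,1,2,\dots\}$. $W$ is an irreducible finite complex reflection group, $V\cong\mathbb{C}^N$ its reflection representation, $e_1,\dots,e_N$ a basis of $V$, $x_1,\dots,x_N$ the dual basis of $V^*$, $SV^*=\mathbb{C}[x_1,\dots,x_N]$, on which $W$ acts by $(wf)(x)=f(w^{-1}x)$. $\mathcal{A}$ is the set of reflection hyperplanes; for $H\in\mathcal{A}$, $\alpha_H\in V^*$ satisfies $H=\ker\alpha_H$, $W_H$ is the (cyclic) pointwise stabiliser of $H$ in $W$, $n_H=|W_H|$, $m_H=m(H)$. Put $e_{H,i}=\sum_{w\in W_H}(\det w)^iw\in\mathbb{C}W_H$ for $1\le i\le n_H-1$, where $\det w$ is the determinant of $w$ on $V$. $V$-valued quasi-invariants: $\mathbf{Q}_m(V)$ is the set of $\varphi\in SV^*\otimes V$ such that $(1\otimes e_{H,i})(\varphi)\in\langle\alpha_H\rangle^{m_Hn_H}\otimes V$ for all $H\in\mathcal{A}$ and $1\le i\le n_H-1$, where $\langle\alpha_H\rangle\subset SV^*$ is the ideal generated by $\alpha_H$. It is an $SV^*$-submodule of $SV^*\otimes V$, and it is a $\mathbb{C}W$-module for the diagonal action of $W$. Logarithmic vector fields: $\mathrm{Der}$ is the $SV^*$-module of derivations $L=\sum_i f_i\partial_i$ ($f_i\in SV^*$, $\partial_i=\partial_{x_i}$) of $SV^*$, with $W$-action $(wL)(\varphi)=w(L(w^{-1}\varphi))$. $\widetilde D_m=\{L\in\mathrm{Der}\colon L(\alpha_H)\in\alpha_H^{m_Hn_H}SV^*\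 \text{for all }H\in\mathcal{A}\}$. A nonzero $L\in\mathrm{Der}$ is homogeneous of degree $d$ if each $L(\alpha)$, $\alpha\in V^*$, is zero or homogeneous of degree $d$ (so the statement $\deg f_i^{(k)}=d$ allows $f_i^{(k)}=0$). KZ twists: let $V_{reg}=V\setminus\bigcup_{H\in\mathcal{A}}H$. For a $W$-invariant function $k\colon\mathcal{A}\to\mathbb{Z}$ and an irreducible $W$-module $\tau$, the Knizhnik--Zamolodchikov connection on $\mathbb{C}[V_{reg}]\otimes\tau$ is $$\nabla_\xi(f\otimes v)=\partial_\xi f\otimes v+\sum_{H\in\mathcal{A}}k_H\frac{\alpha_H(\xi)}{\alpha_H}f\otimes\sum_{i=1}^{n_H-1}e_{H,i}v,\qquad \xi\in V.$$ It is flat and equivariant for the diagonal $W$-action. It is known (Opdam, Berest--Chalykh) that there is a unique up to isomorphism irreducible $W$-module $\mathrm{kz}_k(\tau)$ such that $(\mathbb{C}[V_{reg}]\otimes\tau,\nabla)$ is isomorphic, as a $\mathbb{C}[V_{reg}]$-module with $W$-equivariant flat connection, to $\mathbb{C}[V_{reg}]\otimes\mathrm{kz}_k(\tau)$ with the trivial connection and diagonal $W$-action; moreover $\mathrm{kz}_k\circ\mathrm{kz}_l=\mathrm{kz}_{k+l}$. *)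

theory Defs
  imports
    "HOL-Analysis.Analysis"
    "HOL-Algebra.Generated_Groups"
    "HOL-Library.Poly_Mapping"
    "HOL-Library.Function_Algebras"
begin

section \<open>Complex reflection groups\<close>

text \<open>
  A basis of \<open>V\<close> is fixed once and for all, so that \<open>V\<close> is \<^typ>\<open>complex^'n\<close> and
  \<open>W \<subseteq> GL(V)\<close> is a set of matrices.
\<close>

definition GL :: "(complex^'n^'n) monoid" where
  "GL = \<lparr>carrier = {A. invertible A}, monoid.mult = (**), one = mat 1\<rparr>"

definition fixed_space :: "complex^'n^'n \<Rightarrow> (complex^'n) set" where
  "fixed_space w = {v. w *v v = v}"

text \<open>Finite order is not required here; it is automatic in a finite group.\<close>

definition is_reflection :: "complex^'n^'n \<Rightarrow> bool" where
  "is_reflection w \<longleftrightarrow> invertible w \<and> vec.dim (fixed_space w) = CARD('n) - 1"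

definition finite_reflection_group :: "(complex^'n^'n) set \<Rightarrow> bool" where
  "finite_reflection_group W \<longleftrightarrow>
     finite W \<and> subgroup W GL \<and> generate GL {w \<in> W. is_reflection w} = W"

text \<open>Finite-dimensional \<open>W\<close>-modules are given as matrix representations \<open>\<sigma>\<close>.\<close>

definition representation ::
    "(complex^'n^'n) set \<Rightarrow> (complex^'n^'n \<Rightarrow> complex^'d^'d) \<Rightarrow> bool" where
  "representation W \<sigma> \<longleftrightarrow>
     \<sigma> (mat 1) = mat 1 \<and> (\<forall>w\<in>W. \<forall>u\<in>W. \<sigma> (w ** u) = \<sigma> w ** \<sigma> u)"

definition irreducible_representation ::
    "(complex^'n^'n) set \<Rightarrow> (complex^'n^'n \<Rightarrow> complex^'d^'d) \<Rightarrow> bool" where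
  "irreducible_representation W \<sigma> \<longleftrightarrow> representation W \<sigma> \<and>
     (\<forall>U. vec.subspace U \<and> (\<forall>w\<in>W. \<forall>v\<in>U. \<sigma> w *v v \<in> U) \<longrightarrow> U = {0} \<or> U = UNIV)"

definition irreducible_reflection_group :: "(complex^'n^'n) set \<Rightarrow> bool" where
  "irreducible_reflection_group W \<longleftrightarrow>
     finite_reflection_group W \<and> irreducible_representation W (\<lambda>w. w)"

definition arrangement :: "(complex^'n^'n) set \<Rightarrow> (complex^'n) set set" where
  "arrangement W = fixed_space ` {w \<in> W. is_reflection w}"

definition pointwise_stabiliser ::
    "(complex^'n^'n) set \<Rightarrow> (complex^'n) set \<Rightarrow> (complex^'n^'n) set" where
  "pointwise_stabiliser W H = {w \<in> W. \<forall>v\<in>H. w *v v = v}"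

definition n_H :: "(complex^'n^'n) set \<Rightarrow> (complex^'n) set \<Rightarrow> nat" where
  "n_H W H = card (pointwise_stabiliser W H)"

definition invariant_on_arrangement ::
    "(complex^'n^'n) set \<Rightarrow> ((complex^'n) set \<Rightarrow> 'a) \<Rightarrow> bool" where
  "invariant_on_arrangement W k \<longleftrightarrow>
     (\<forall>w\<in>W. \<forall>H\<in>arrangement W. k ((\<lambda>v. w *v v) ` H) = k H)"

text \<open>The operator by which \<open>e\<^bsub>H,i\<^esub> = \<Sum>\<^bsub>w\<in>W\<^sub>H\<^esub> (det w)\<^sup>i w\<close> acts in the representation \<open>\<sigma>\<close>.\<close>

definition e_op ::
    "(complex^'n^'n) set \<Rightarrow> (complex^'n^'n \<Rightarrow> complex^'d^'d) \<Rightarrow> (complex^'n) set \<Rightarrow> nat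
     \<Rightarrow> complex^'d^'d" where
  "e_op W \<sigma> H i = (\<Sum>w\<in>pointwise_stabiliser W H. mat (det w ^ i) ** \<sigma> w)"

text \<open>
  The linear form \<open>\<Sum>\<^sub>i a\<^sub>i x\<^sub>i\<close> is represented by its coefficient vector \<open>a\<close>; this is its value
  at \<open>v\<close> (bilinear, no complex conjugation).
\<close>

definition form_at :: "complex^'n \<Rightarrow> complex^'n \<Rightarrow> complex" where
  "form_at a v = (\<Sum>i\<in>UNIV. a $ i * v $ i)"

definition defines_arrangement ::
    "(complex^'n^'n) set \<Rightarrow> ((complex^'n) set \<Rightarrow> complex^'n) \<Rightarrow> bool" where
  "defines_arrangement W \<alpha> \<longleftrightarrow> (\<forall>H\<in>arrangement W. {v. form_at (\<alpha> H) v = 0} = H)"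


section \<open>The polynomial ring $SV^*$\<close>

type_synonym 'n poly_ring = "('n \<Rightarrow>\<^sub>0 nat) \<Rightarrow>\<^sub>0 complex"

definition const :: "complex \<Rightarrow> 'n poly_ring" where
  "const c = Poly_Mapping.single 0 c"

definition coord :: "'n \<Rightarrow> 'n poly_ring" where
  "coord i = Poly_Mapping.single (Poly_Mapping.single i 1) 1"

definition form_poly :: "complex^'n \<Rightarrow> 'n poly_ring" where
  "form_poly a = (\<Sum>i\<in>UNIV. const (a $ i) * coord i)"

text \<open>Substitution of \<open>g i\<close> for \<open>x\<^sub>i\<close>, with coefficients mapped by \<open>c\<close>.\<close>

definition insertion ::
    "(complex \<Rightarrow> 'r::comm_ring_1) \<Rightarrow> ('n::finite \<Rightarrow> 'r) \<Rightarrow> 'n poly_ring \<Rightarrow> 'r" where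
  "insertion c g p =
     (\<Sum>a\<in>Poly_Mapping.keys p.
        c (Poly_Mapping.lookup p a) * (\<Prod>i\<in>UNIV. g i ^ Poly_Mapping.lookup a i))"

definition eval_poly :: "'n::finite poly_ring \<Rightarrow> complex^'n \<Rightarrow> complex" where
  "eval_poly p v = insertion (\<lambda>c. c) (\<lambda>i. v $ i) p"

text \<open>
  \<open>(wf)(x) = f(w\<^sup>-\<^sup>1x)\<close>: the function \<open>x\<^sub>i \<circ> w\<^sup>-\<^sup>1\<close> is the linear form given by the \<open>i\<close>-th row
  of \<open>w\<^sup>-\<^sup>1\<close>.
\<close>

definition act_poly :: "complex^'n^'n \<Rightarrow> 'n::finite poly_ring \<Rightarrow> 'n poly_ring" where
  "act_poly w p = insertion const (\<lambda>i. form_poly (matrix_inv w $ i)) p"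

text \<open>The zero polynomial is homogeneous of every degree.\<close>

definition homogeneous_poly :: "nat \<Rightarrow> 'n::finite poly_ring \<Rightarrow> bool" where
  "homogeneous_poly d p \<longleftrightarrow>
     (\<forall>a\<in>Poly_Mapping.keys p. (\<Sum>i\<in>UNIV. Poly_Mapping.lookup a i) = d)"

definition partial :: "'n \<Rightarrow> 'n poly_ring \<Rightarrow> 'n poly_ring" where
  "partial i p =
     (\<Sum>a\<in>Poly_Mapping.keys p.
        Poly_Mapping.single (a - Poly_Mapping.single i 1)
          (of_nat (Poly_Mapping.lookup a i) * Poly_Mapping.lookup p a))"


section \<open>$V$-valued quasi-invariants\<close>

text \<open>
  An element \<open>\<Sum>\<^sub>i \<phi>\<^sub>i \<otimes> e\<^sub>i\<close> of \<open>SV\<^sup>* \<otimes> V\<close> is the vector of its components \<open>\<phi>\<^sub>i\<close>; the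
  \<open>SV\<^sup>*\<close>-module structure is \<^const>\<open>vector_scalar_mult\<close>.
\<close>

definition one_tensor :: "complex^'n^'n \<Rightarrow> 'n poly_ring^'n \<Rightarrow> 'n poly_ring^'n" where
  "one_tensor A \<phi> = (\<chi> i. \<Sum>j\<in>UNIV. const (A $ i $ j) * \<phi> $ j)"

definition act_tensor ::
    "complex^'n^'n \<Rightarrow> 'n::finite poly_ring^'n \<Rightarrow> 'n poly_ring^'n" where
  "act_tensor w \<phi> = one_tensor w (\<chi> j. act_poly w (\<phi> $ j))"

text \<open>
  The ideal \<open>\<langle>\<alpha>\<^sub>H\<rangle>\<^sup>k\<close> is principal, generated by \<open>\<alpha>\<^sub>H\<^sup>k\<close>, and \<open>\<phi>\<close> lies in
  \<open>\<langle>\<alpha>\<^sub>H\<rangle>\<^sup>k \<otimes> V\<close> iff all its components lie in that ideal.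
\<close>

definition quasi_invariants ::
    "(complex^'n^'n) set \<Rightarrow> ((complex^'n) set \<Rightarrow> complex^'n) \<Rightarrow> ((complex^'n) set \<Rightarrow> nat)
     \<Rightarrow> ('n::finite poly_ring^'n) set" where
  "quasi_invariants W \<alpha> m =
     {\<phi>. \<forall>H\<in>arrangement W. \<forall>i\<in>{1..n_H W H - 1}. \<forall>j.
           form_poly (\<alpha> H) ^ (m H * n_H W H) dvd one_tensor (e_op W (\<lambda>w. w) H i) \<phi> $ j}"


section \<open>Logarithmic vector fields\<close>

definition Der :: "('n poly_ring \<Rightarrow> 'n poly_ring) set" where
  "Der = {L. (\<forall>p q. L (p + q) = L p + L q) \<and> (\<forall>c p. L (const c * p) = const c * L p) \<and>
             (\<forall>p q. L (p * q) = L p * q + p * L q)}"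

text \<open>The derivation \<open>\<Sum>\<^sub>i f\<^sub>i \<partial>\<^sub>i\<close>.\<close>

definition vector_field :: "('n::finite \<Rightarrow> 'n poly_ring) \<Rightarrow> 'n poly_ring \<Rightarrow> 'n poly_ring" where
  "vector_field f = (\<lambda>p. \<Sum>i\<in>UNIV. f i * partial i p)"

definition der_scale ::
    "'n poly_ring \<Rightarrow> ('n poly_ring \<Rightarrow> 'n poly_ring) \<Rightarrow> 'n poly_ring \<Rightarrow> 'n poly_ring" where
  "der_scale f L = (\<lambda>p. f * L p)"

interpretation der: module der_scale
  by unfold_locales (auto simp: der_scale_def fun_eq_iff algebra_simps)

definition der_cscale ::
    "complex \<Rightarrow> ('n poly_ring \<Rightarrow> 'n poly_ring) \<Rightarrow> 'n poly_ring \<Rightarrow> 'n poly_ring" where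
  "der_cscale c L = der_scale (const c) L"

lemma const_add: "const (a + b) = const a + const b"
  by (simp add: const_def single_add)

lemma const_mult: "const (a * b) = const a * const b"
  by (simp add: const_def mult_single)

lemma const_1: "const 1 = 1"
  by (simp add: const_def)

interpretation der_c: vector_space der_cscale
  by unfold_locales
    (auto simp: der_cscale_def der_scale_def fun_eq_iff algebra_simps const_add const_mult const_1)

definition act_der ::
    "complex^'n^'n \<Rightarrow> ('n::finite poly_ring \<Rightarrow> 'n poly_ring) \<Rightarrow> 'n poly_ring \<Rightarrow> 'n poly_ring" where
  "act_der w L = (\<lambda>p. act_poly w (L (act_poly (matrix_inv w) p)))"

definition log_derivations ::
    "(complex^'n^'n) set \<Rightarrow> ((complex^'n) set \<Rightarrow> complex^'n) \<Rightarrow> ((complex^'n) set \<Rightarrow> nat)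
     \<Rightarrow> ('n poly_ring \<Rightarrow> 'n poly_ring) set" where
  "log_derivations W \<alpha> m =
     {L \<in> Der. \<forall>H\<in>arrangement W.
        form_poly (\<alpha> H) ^ (m H * n_H W H) dvd L (form_poly (\<alpha> H))}"

definition homogeneous_der :: "nat \<Rightarrow> ('n::finite poly_ring \<Rightarrow> 'n poly_ring) \<Rightarrow> bool" where
  "homogeneous_der d L \<longleftrightarrow> L \<noteq> 0 \<and> (\<forall>a. homogeneous_poly d (L (form_poly a)))"

text \<open>\<open>\<rho>\<close> is an isomorphism \<open>Q \<rightarrow> D\<close> of modules over \<open>SV\<^sup>*\<close>.\<close>

definition SV_module_iso ::
    "('n poly_ring^'n) set \<Rightarrow> ('n poly_ring \<Rightarrow> 'n poly_ring) set
     \<Rightarrow> ('n poly_ring^'n \<Rightarrow> 'n poly_ring \<Rightarrow> 'n poly_ring) \<Rightarrow> bool" where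
  "SV_module_iso Q D \<rho> \<longleftrightarrow> bij_betw \<rho> Q D \<and>
     (\<forall>\<phi>\<in>Q. \<forall>\<psi>\<in>Q. \<rho> (\<phi> + \<psi>) = \<rho> \<phi> + \<rho> \<psi>) \<and>
     (\<forall>f. \<forall>\<phi>\<in>Q. \<rho> (f *s \<phi>) = der_scale f (\<rho> \<phi>))"

text \<open>
  Isomorphism of \<open>\<complex>W\<close>-modules between a space \<open>U\<close> of derivations, with the action
  \<^const>\<open>act_der\<close>, and the matrix representation \<open>\<sigma>\<close>.
\<close>

definition CW_isomorphic ::
    "(complex^'n^'n) set \<Rightarrow> ('n::finite poly_ring \<Rightarrow> 'n poly_ring) set
     \<Rightarrow> (complex^'n^'n \<Rightarrow> complex^'d^'d) \<Rightarrow> bool" where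
  "CW_isomorphic W U \<sigma> \<longleftrightarrow>
     der_c.subspace U \<and> (\<forall>w\<in>W. \<forall>L\<in>U. act_der w L \<in> U) \<and>
     (\<exists>T::('n poly_ring \<Rightarrow> 'n poly_ring) \<Rightarrow> complex^'d. bij_betw T U UNIV \<and>
        (\<forall>L\<in>U. \<forall>M\<in>U. T (L + M) = T L + T M) \<and>
        (\<forall>c. \<forall>L\<in>U. T (der_cscale c L) = c *s T L) \<and>
        (\<forall>w\<in>W. \<forall>L\<in>U. T (act_der w L) = \<sigma> w *v T L))"


section \<open>KZ twists\<close>

definition V_reg :: "(complex^'n^'n) set \<Rightarrow> (complex^'n) set" where
  "V_reg W = UNIV - \<Union>(arrangement W)"

text \<open>
  Regular functions on \<open>V\<^bsub>reg\<^esub>\<close> are realised as functions on \<open>V\<close> that vanish outside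
  \<open>V\<^bsub>reg\<^esub>\<close>, so that equality of functions is equality on \<open>V\<^bsub>reg\<^esub>\<close>.  They are the elements of
  the localisation of \<open>SV\<^sup>*\<close> at \<open>\<Prod>\<^sub>H \<alpha>\<^sub>H\<close>.
\<close>

definition regular_functions ::
    "(complex^'n^'n) set \<Rightarrow> ((complex^'n) set \<Rightarrow> complex^'n)
     \<Rightarrow> (complex^'n::finite \<Rightarrow> complex) set" where
  "regular_functions W \<alpha> =
     {f. \<exists>p r. f = (\<lambda>x. if x \<in> V_reg W
             then eval_poly p x / (\<Prod>H\<in>arrangement W. form_at (\<alpha> H) x) ^ r else 0)}"

text \<open>\<open>\<complex>[V\<^bsub>reg\<^esub>] \<otimes> \<tau>\<close> for a module \<open>\<tau>\<close> with underlying space \<^typ>\<open>complex^'d\<close>.\<close>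

definition regular_sections ::
    "(complex^'n^'n) set \<Rightarrow> ((complex^'n) set \<Rightarrow> complex^'n)
     \<Rightarrow> (complex^'n::finite \<Rightarrow> complex^'d) set" where
  "regular_sections W \<alpha> = {F. \<forall>j. (\<lambda>x. F x $ j) \<in> regular_functions W \<alpha>}"

definition act_section ::
    "(complex^'n^'n \<Rightarrow> complex^'d^'d) \<Rightarrow> complex^'n^'n
     \<Rightarrow> (complex^'n \<Rightarrow> complex^'d) \<Rightarrow> complex^'n \<Rightarrow> complex^'d" where
  "act_section \<sigma> w F = (\<lambda>x. \<sigma> w *v F (matrix_inv w *v x))"

text \<open>The trivial connection: the derivative of \<open>F\<close> in direction \<open>\<xi>\<close>, on \<open>V\<^bsub>reg\<^esub>\<close>.\<close>

definition trivial_connection ::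
    "(complex^'n^'n) set \<Rightarrow> complex^'n
     \<Rightarrow> (complex^'n \<Rightarrow> complex^'d) \<Rightarrow> complex^'n \<Rightarrow> complex^'d" where
  "trivial_connection W \<xi> F =
     (\<lambda>x. if x \<in> V_reg W then \<chi> j. deriv (\<lambda>t. F (x + t *s \<xi>) $ j) 0 else 0)"

definition KZ_connection ::
    "(complex^'n^'n) set \<Rightarrow> ((complex^'n) set \<Rightarrow> complex^'n) \<Rightarrow> ((complex^'n) set \<Rightarrow> int)
     \<Rightarrow> (complex^'n^'n \<Rightarrow> complex^'d^'d) \<Rightarrow> complex^'n
     \<Rightarrow> (complex^'n \<Rightarrow> complex^'d) \<Rightarrow> complex^'n \<Rightarrow> complex^'d" where
  "KZ_connection W \<alpha> k \<tau> \<xi> F =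
     (\<lambda>x. if x \<in> V_reg W
        then trivial_connection W \<xi> F x +
          (\<Sum>H\<in>arrangement W.
             (of_int (k H) * form_at (\<alpha> H) \<xi> / form_at (\<alpha> H) x) *s
               (\<Sum>i\<in>{1..n_H W H - 1}. e_op W \<tau> H i *v F x))
        else 0)"

text \<open>
  \<open>\<sigma>\<close> is (a representative of the isomorphism class) \<open>kz\<^sub>k(\<tau>)\<close>: it is irreducible, and
  \<open>\<complex>[V\<^bsub>reg\<^esub>] \<otimes> \<tau>\<close> with the KZ connection is isomorphic to \<open>\<complex>[V\<^bsub>reg\<^esub>] \<otimes> \<sigma>\<close> with the trivial one,
  as \<open>\<complex>[V\<^bsub>reg\<^esub>]\<close>-modules with \<open>W\<close>-equivariant connection.
\<close>

definition is_kz ::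
    "(complex^'n^'n) set \<Rightarrow> ((complex^'n) set \<Rightarrow> complex^'n) \<Rightarrow> ((complex^'n) set \<Rightarrow> int)
     \<Rightarrow> (complex^'n::finite^'n \<Rightarrow> complex^'d^'d) \<Rightarrow> (complex^'n^'n \<Rightarrow> complex^'e^'e) \<Rightarrow> bool"
  where
  "is_kz W \<alpha> k \<tau> \<sigma> \<longleftrightarrow> irreducible_representation W \<sigma> \<and>
     (\<exists>\<Theta>::(complex^'n \<Rightarrow> complex^'d) \<Rightarrow> (complex^'n \<Rightarrow> complex^'e).
        bij_betw \<Theta> (regular_sections W \<alpha>) (regular_sections W \<alpha>) \<and>
        (\<forall>F\<in>regular_sections W \<alpha>. \<forall>G\<in>regular_sections W \<alpha>. \<Theta> (F + G) = \<Theta> F + \<Theta> G) \<and>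
        (\<forall>g\<in>regular_functions W \<alpha>. \<forall>F\<in>regular_sections W \<alpha>.
           \<Theta> (\<lambda>x. g x *s F x) = (\<lambda>x. g x *s \<Theta> F x)) \<and>
        (\<forall>w\<in>W. \<forall>F\<in>regular_sections W \<alpha>. \<Theta> (act_section \<tau> w F) = act_section \<sigma> w (\<Theta> F)) \<and>
        (\<forall>\<xi>. \<forall>F\<in>regular_sections W \<alpha>.
           \<Theta> (KZ_connection W \<alpha> k \<tau> \<xi> F) = trivial_connection W \<xi> (\<Theta> F)))"

end

theory Submission
  imports Defs "HOL-Computational_Algebra.Fundamental_Theorem_Algebra"
begin

text \<open>
  Write \<open>KZ\<^sub>k(\<tau>)\<close> for the connection with multiplicity \<open>k m\<close> on the trivial bundle with fibre \<open>\<tau>\<close>.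
  For a natural number \<open>j\<close>, the polynomial maps all of whose derivatives under \<open>KZ\<^bsub>-j\<^esub>(\<tau>)\<close> are regular
  contain \<open>\<delta>\<^sup>K\<close>, and the Euler field forces them to be generated by flat ones; this gives the twist \<open>kz\<^bsub>-jm\<^esub>(\<tau>)\<close>.
  There are finitely many irreducible modules, so the twists are periodic in \<open>j\<close>, and with \<open>\<Phi> = kz\<^bsub>-m\<^esub>(V)\<close>
  there are nonzero homogeneous horizontal maps \<open>KZ\<^bsub>-s\<^esub>(\<Phi>) \<rightarrow> KZ\<^bsub>-s-1\<^esub>(V)\<close> of one fixed degree for infinitely many \<open>s\<close>.
  The equations are linear in \<open>s\<close>, so such a map \<open>M\<close> also exists for \<open>s = -1\<close>: a polynomial matrix,
  invertible on \<open>V\<^bsub>reg\<^esub>\<close>, with \<open>\<partial>\<^sub>\<xi> M = M A\<^sub>\<xi>\<close> for the connection form \<open>A\<close> of \<open>\<Phi>\<close>.  The residues of \<open>A\<close> show that the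
  columns of \<open>M\<close> are quasi-invariants and bound the poles of \<open>M\<^sup>-\<^sup>1\<close>, so that every quasi-invariant is a polynomial combination
  of the columns.  The degree of \<open>M\<close> is the scalar by which \<open>\<Sum>\<^sub>H m\<^sub>H \<Sum>\<^sub>i e\<^bsub>H,i\<^esub>\<close> acts on \<open>V\<close>.
\<close>

section \<open>Polynomial functions\<close>

text \<open>The difficulty is the sign of the twist. For KZ_{-j}(\<tau>) the local exponents along H
  are 0 and j m_H n_H, so flat sections can be sought among polynomials. A logarithm could enter
  only at the resonance between the two exponents; there the obstruction would have to be
  W_H-invariant and without invariant part at once, because det has order n_H on W_H. The matrix M,
  however, is the inverse of a flat frame of KZ_1(\<Phi>), where the exponents are 0 and -m_H n_H
  and the lattice argument does not apply. Periodicity takes the place of the group law for twists: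
  it makes KZ_{-s}(\<Phi>) and KZ_{-s-1}(V) isomorphic for infinitely many s. The same exponents
  bound the poles, and so the degrees, of these isomorphisms and of their inverses uniformly in s;
  the degree is affine in s, so it is constant. After multiplication by one power of \<delta> all of
  them lie in one finite-dimensional space, which permits the passage from s >= 0 to s = -1.
  Monodromy does not enter: only rational functions and generic points of single hyperplanes are
  used.\<close>

lemma poly_mapping_sum_single:
  "p = (\<Sum>a\<in>Poly_Mapping.keys p. Poly_Mapping.single a (Poly_Mapping.lookup p a))"
proof (rule poly_mapping_eqI)
  fix k
  have "(\<Sum>a\<in>Poly_Mapping.keys p. Poly_Mapping.lookup (Poly_Mapping.single a (Poly_Mapping.lookup p a)) k)
      = (\<Sum>a\<in>Poly_Mapping.keys p. if a = k then Poly_Mapping.lookup p k else 0)"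
    by (rule sum.cong) (auto simp: lookup_single when_def)
  also have "\<dots> = Poly_Mapping.lookup p k" by (simp add: in_keys_iff)
  finally show "Poly_Mapping.lookup p k =
      Poly_Mapping.lookup (\<Sum>a\<in>Poly_Mapping.keys p. Poly_Mapping.single a (Poly_Mapping.lookup p a)) k"
    by (simp add: lookup_sum)
qed

lemma coord_power: "coord i ^ k = Poly_Mapping.single (Poly_Mapping.single i k) (1::complex)"
  by (induction k) (simp_all add: coord_def mult_single single_add[symmetric])

lemma prod_single:
  "finite S \<Longrightarrow> (\<Prod>i\<in>S. Poly_Mapping.single (f i) (1::complex)) = Poly_Mapping.single (\<Sum>i\<in>S. f i) 1"
  by (induction S rule: finite_induct) (simp_all add: mult_single)

lemma sum_single_lookup:
  fixes a :: "'n::finite \<Rightarrow>\<^sub>0 nat"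
  shows "(\<Sum>i\<in>UNIV. Poly_Mapping.single i (Poly_Mapping.lookup a i)) = a"
  by (rule poly_mapping_eqI) (simp add: lookup_sum lookup_single when_def)

lemma single_eq_monom:
  fixes a :: "'n::finite \<Rightarrow>\<^sub>0 nat"
  shows "Poly_Mapping.single a c = const c * (\<Prod>i\<in>UNIV. coord i ^ Poly_Mapping.lookup a i)"
  by (simp add: coord_power prod_single sum_single_lookup const_def mult_single)

lemma const_0 [simp]: "const 0 = 0" by (simp add: const_def)

text \<open>Constants and coordinates generate the ring. Compatibility of \<open>eval_poly\<close>,
  \<open>act_poly\<close> or a derivation with another map thus reduces to these generators.\<close>

lemma poly_ring_induct [case_names const coord add mult]:
  fixes p :: "'n::finite poly_ring"
  assumes c: "\<And>c. P (const c)" and v: "\<And>i. P (coord i)"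
    and add: "\<And>p q. P p \<Longrightarrow> P q \<Longrightarrow> P (p + q)" and mult: "\<And>p q. P p \<Longrightarrow> P q \<Longrightarrow> P (p * q)"
  shows "P p"
proof -
  have pow: "P (coord i ^ k)" for i k
    by (induction k) (use c[of 1] v mult in \<open>auto simp: const_1\<close>)
  have pr: "P (\<Prod>i\<in>S. coord i ^ k i)" if "finite S" for S and k :: "'n \<Rightarrow> nat"
    using that by (induction S rule: finite_induct) (use c[of 1] mult pow in \<open>auto simp: const_1\<close>)
  have sg: "P (Poly_Mapping.single a x)" for a x
    unfolding single_eq_monom by (intro mult c pr) simp
  have "P (\<Sum>a\<in>S. Poly_Mapping.single a (f a))" if "finite S" for S f
    using that by (induction S rule: finite_induct) (use c[of 0] add sg in auto)
  then show ?thesis by (subst poly_mapping_sum_single) simp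
qed

lemma insertion_superset:
  assumes "finite S" "Poly_Mapping.keys p \<subseteq> S" "c 0 = 0"
  shows "insertion c g p =
    (\<Sum>a\<in>S. c (Poly_Mapping.lookup p a) * (\<Prod>i\<in>UNIV. g i ^ Poly_Mapping.lookup a i))"
  unfolding insertion_def
  by (rule sum.mono_neutral_left) (use assms in \<open>auto simp: in_keys_iff\<close>)

lemma insertion_add:
  assumes "\<And>x y. c (x + y) = c x + c y"
  shows "insertion c g (p + q) = insertion c g p + insertion c g q"
proof -
  have c0: "c 0 = 0" using assms[of 0 0] by simp
  define S where "S = Poly_Mapping.keys p \<union> Poly_Mapping.keys q"
  have S: "finite S" "Poly_Mapping.keys p \<subseteq> S" "Poly_Mapping.keys q \<subseteq> S" "Poly_Mapping.keys (p+q) \<subseteq> S"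
    using Poly_Mapping.keys_add[of p q] by (auto simp: S_def)
  show ?thesis
    by (simp add: insertion_superset[where c=c, OF S(1) _ c0] S lookup_add assms distrib_right sum.distrib)
qed

lemma insertion_single:
  assumes "c 0 = 0"
  shows "insertion c g (Poly_Mapping.single a x) = c x * (\<Prod>i\<in>UNIV. g i ^ Poly_Mapping.lookup a i)"
  by (subst insertion_superset[of "{a}"]) (use assms in auto)

lemma insertion_sum:
  assumes "\<And>x y. c (x + y) = c x + c y"
  shows "insertion c g (\<Sum>a\<in>S. f a) = (\<Sum>a\<in>S. insertion c g (f a))"
proof -
  have "insertion c g 0 = 0" by (simp add: insertion_def)
  then show ?thesis by (induction S rule: infinite_finite_induct) (auto simp: insertion_add[of c, OF assms])
qed

lemma insertion_mult:
  assumes a: "\<And>x y. c (x + y) = c x + c y" and m: "\<And>x y. c (x * y) = c x * c y"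
  shows "insertion c g (p * q) = insertion c g p * insertion c g q"
proof -
  have c0: "c 0 = 0" using a[of 0 0] by simp
  have s: "insertion c g (Poly_Mapping.single u x * Poly_Mapping.single v y)
     = insertion c g (Poly_Mapping.single u x) * insertion c g (Poly_Mapping.single v y)" for u v x y
    by (simp add: mult_single insertion_single[where c=c, OF c0] m lookup_add power_add prod.distrib algebra_simps)
  have "p * q = (\<Sum>u\<in>Poly_Mapping.keys p. \<Sum>v\<in>Poly_Mapping.keys q.
      Poly_Mapping.single u (Poly_Mapping.lookup p u) * Poly_Mapping.single v (Poly_Mapping.lookup q v))"
    by (subst (1) poly_mapping_sum_single[of p], subst (1) poly_mapping_sum_single[of q]) (simp add: sum_product)
  then have d: "insertion c g (p * q) = (\<Sum>u\<in>Poly_Mapping.keys p. \<Sum>v\<in>Poly_Mapping.keys q.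
      insertion c g (Poly_Mapping.single u (Poly_Mapping.lookup p u)) * insertion c g (Poly_Mapping.single v (Poly_Mapping.lookup q v)))"
    by (simp add: insertion_sum[of c, OF a] s)
  have "insertion c g r = (\<Sum>u\<in>Poly_Mapping.keys r. insertion c g (Poly_Mapping.single u (Poly_Mapping.lookup r u)))"
    for r
    by (rule trans[OF arg_cong[OF poly_mapping_sum_single[of r], where f="insertion c g"]])
      (rule insertion_sum, rule a)
  note e = this
  have "insertion c g p * insertion c g q = (\<Sum>u\<in>Poly_Mapping.keys p. \<Sum>v\<in>Poly_Mapping.keys q.
      insertion c g (Poly_Mapping.single u (Poly_Mapping.lookup p u)) * insertion c g (Poly_Mapping.single v (Poly_Mapping.lookup q v)))"
    unfolding e[of p] e[of q] by (rule sum_product)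
  with d show ?thesis by simp
qed

lemma insertion_const:
  fixes c :: "complex \<Rightarrow> 'r::comm_ring_1"
  assumes "c 0 = 0"
  shows "insertion c g (const x :: 'n::finite poly_ring) = c x"
  unfolding const_def by (subst insertion_single) (use assms in auto)

lemma insertion_coord:
  fixes c :: "complex \<Rightarrow> 'r::comm_ring_1"
  assumes "c 0 = 0" "c 1 = 1"
  shows "insertion c g (coord i) = g i"
proof -
  have "(\<Prod>j\<in>UNIV. g j ^ Poly_Mapping.lookup (Poly_Mapping.single i 1) j) = (\<Prod>j\<in>UNIV. if j = i then g i else 1)"
    by (rule prod.cong) (auto simp: lookup_single when_def)
  then show ?thesis unfolding coord_def by (subst insertion_single) (use assms in auto)
qed

lemma eval_poly_simps [simp]:
  "eval_poly (p + q) x = eval_poly p x + eval_poly q x"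
  "eval_poly (p * q) x = eval_poly p x * eval_poly q x"
  "eval_poly (const c) x = c"
  "eval_poly (coord i) x = x $ i"
  "eval_poly 0 x = 0"
  "eval_poly 1 x = 1"
proof -
  show "eval_poly (const c) x = c" for c by (simp add: eval_poly_def insertion_const)
  from this[of 0] this[of 1] show "eval_poly 0 x = 0" "eval_poly 1 x = 1" by (simp_all add: const_1)
qed (simp_all add: eval_poly_def insertion_add insertion_mult insertion_coord)

lemma eval_poly_uminus [simp]: "eval_poly (- p) x = - eval_poly p x"
  using eval_poly_simps(1)[of "-p" p x] by (simp add: eq_neg_iff_add_eq_0)

lemma eval_poly_diff [simp]: "eval_poly (p - q) x = eval_poly p x - eval_poly q x"
  using eval_poly_simps(1)[of p "-q" x] by simp

lemma eval_poly_sum [simp]: "eval_poly (\<Sum>i\<in>S. f i) x = (\<Sum>i\<in>S. eval_poly (f i) x)"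
  by (induction S rule: infinite_finite_induct) auto

lemma eval_poly_power [simp]: "eval_poly (p ^ k) x = eval_poly p x ^ k"
  by (induction k) auto

lemma eval_form_poly [simp]: "eval_poly (form_poly a) x = form_at a x"
  by (simp add: form_poly_def form_at_def)

text \<open>Polynomials are handled as functions, because division by a form, composition with
  matrices and restriction to lines are pointwise statements. \<open>eval_poly_inject\<close>
  carries the results back to the ring.\<close>

definition poly_fun :: "(complex^'n::finite \<Rightarrow> complex) \<Rightarrow> bool" where
  "poly_fun f \<longleftrightarrow> (\<exists>p. f = eval_poly p)"

lemma poly_fun_eval [simp, intro]: "poly_fun (eval_poly p)" by (auto simp: poly_fun_def)

lemma poly_fun_const [simp, intro]: "poly_fun (\<lambda>x. c)"
  unfolding poly_fun_def by (rule exI[of _ "const c"]) auto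
lemma poly_fun_coord [simp, intro]: "poly_fun (\<lambda>x. x $ i)"
  unfolding poly_fun_def by (rule exI[of _ "coord i"]) auto
lemma poly_fun_add [intro]: "poly_fun f \<Longrightarrow> poly_fun g \<Longrightarrow> poly_fun (\<lambda>x. f x + g x)"
  unfolding poly_fun_def
proof (elim exE)
  fix p q assume "f = eval_poly p" "g = eval_poly q"
  then show "\<exists>r. (\<lambda>x. f x + g x) = eval_poly r" by (intro exI[of _ "p + q"]) auto
qed
lemma poly_fun_mult [intro]: "poly_fun f \<Longrightarrow> poly_fun g \<Longrightarrow> poly_fun (\<lambda>x. f x * g x)"
  unfolding poly_fun_def
proof (elim exE)
  fix p q assume "f = eval_poly p" "g = eval_poly q"
  then show "\<exists>r. (\<lambda>x. f x * g x) = eval_poly r" by (intro exI[of _ "p * q"]) auto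
qed
lemma poly_fun_diff [intro]: "poly_fun f \<Longrightarrow> poly_fun g \<Longrightarrow> poly_fun (\<lambda>x. f x - g x)"
  unfolding poly_fun_def
proof (elim exE)
  fix p q assume "f = eval_poly p" "g = eval_poly q"
  then show "\<exists>r. (\<lambda>x. f x - g x) = eval_poly r" by (intro exI[of _ "p - q"]) auto
qed
lemma poly_fun_sum [intro]: "(\<And>i. i \<in> S \<Longrightarrow> poly_fun (f i)) \<Longrightarrow> poly_fun (\<lambda>x. \<Sum>i\<in>S. f i x)"
  by (induction S rule: infinite_finite_induct) auto
lemma poly_fun_prod [intro]: "(\<And>i. i \<in> S \<Longrightarrow> poly_fun (f i)) \<Longrightarrow> poly_fun (\<lambda>x. \<Prod>i\<in>S. f i x)"
  by (induction S rule: infinite_finite_induct) auto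
lemma poly_fun_power [intro]: "poly_fun f \<Longrightarrow> poly_fun (\<lambda>x. f x ^ k)"
  by (induction k) auto
lemma poly_fun_form [simp, intro]: "poly_fun (\<lambda>x. form_at a x)"
  unfolding form_at_def by (intro poly_fun_sum poly_fun_mult) auto

lemma poly_fun_induct [consumes 1, case_names const coord add mult]:
  fixes f :: "complex^'n::finite \<Rightarrow> complex"
  assumes f: "poly_fun f" and c: "\<And>c. P (\<lambda>x. c)" and v: "\<And>i. P (\<lambda>x. x $ i)"
    and add: "\<And>f g. poly_fun f \<Longrightarrow> poly_fun g \<Longrightarrow> P f \<Longrightarrow> P g \<Longrightarrow> P (\<lambda>x. f x + g x)"
    and mult: "\<And>f g. poly_fun f \<Longrightarrow> poly_fun g \<Longrightarrow> P f \<Longrightarrow> P g \<Longrightarrow> P (\<lambda>x. f x * g x)"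
  shows "P f"
proof -
  have eqs: "eval_poly (const c) = (\<lambda>x::complex^'n. c)" "eval_poly (coord i) = (\<lambda>x::complex^'n. x $ i)"
    "eval_poly (p + q) = (\<lambda>x::complex^'n. eval_poly p x + eval_poly q x)"
    "eval_poly (p * q) = (\<lambda>x::complex^'n. eval_poly p x * eval_poly q x)" for c i p q
    by (rule ext, simp)+
  have "P (eval_poly p)" for p :: "'n poly_ring"
  proof (induction p rule: poly_ring_induct)
    case (const c) show ?case using c[of c] by (simp add: eqs)
  next
    case (coord i) show ?case using v[of i] by (simp add: eqs)
  next
    case (add p q) show ?case using assms(4)[OF _ _ add] by (simp add: eqs)
  next
    case (mult p q) show ?case using assms(5)[OF _ _ mult] by (simp add: eqs)
  qed
  then show ?thesis using f by (auto simp: poly_fun_def)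
qed

lemma poly_fun_compose_linear:
  fixes w :: "complex^'n^'m::finite"
  assumes "poly_fun f" shows "poly_fun (\<lambda>x. f (w *v x + b))"
  using assms
proof (induction f rule: poly_fun_induct)
  case (coord i)
  have "poly_fun (\<lambda>x::complex^'n. \<Sum>j\<in>UNIV. w $ i $ j * x $ j)" by (intro poly_fun_sum poly_fun_mult) auto
  then have "poly_fun (\<lambda>x::complex^'n. (\<Sum>j\<in>UNIV. w $ i $ j * x $ j) + b $ i)" by auto
  then show ?case by (simp add: matrix_vector_mult_def)
qed auto

lemma poly_fun_line:
  assumes "poly_fun f" shows "\<exists>q::complex poly. \<forall>t. f (x + t *s y) = poly q t"
  using assms
proof (induction f rule: poly_fun_induct)
  case (const c) show ?case by (rule exI[of _ "[:c:]"]) simp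
next
  case (coord i) show ?case by (rule exI[of _ "[:x$i, y$i:]"]) simp
next
  case (add f g)
  then obtain p q where "\<forall>t. f (x + t *s y) = poly p t" "\<forall>t. g (x + t *s y) = poly q t" by blast
  then show ?case by (intro exI[of _ "p + q"]) simp
next
  case (mult f g)
  then obtain p q where "\<forall>t. f (x + t *s y) = poly p t" "\<forall>t. g (x + t *s y) = poly q t" by blast
  then show ?case by (intro exI[of _ "p * q"]) simp
qed

text \<open>Restriction to the line through a point where \<open>D\<close> does not vanish reduces this to one variable.\<close>

lemma poly_fun_dense:
  assumes f: "poly_fun f" and D: "poly_fun D"
    and sub: "\<And>t. x + t *s y \<in> S" and p: "D (x + t0 *s y) \<noteq> 0"
    and z: "\<And>z. z \<in> S \<Longrightarrow> D z \<noteq> 0 \<Longrightarrow> f z = 0"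
  shows "f x = 0"
proof -
  obtain q where q: "\<forall>t. f (x + t *s y) = poly q t" using poly_fun_line[OF f] by blast
  obtain r where r: "\<forall>t. D (x + t *s y) = poly r t" using poly_fun_line[OF D] by blast
  have "r \<noteq> 0" using p r by auto
  have "poly (q * r) t = 0" for t using z[OF sub, of t] q r by auto
  then have "q * r = 0" by (intro iffD1[OF poly_all_0_iff_0] allI)
  with \<open>r \<noteq> 0\<close> have "q = 0" by simp
  then show ?thesis using q[rule_format, of 0] by simp
qed

lemma poly_fun_eq_0:
  assumes f: "poly_fun f" and D: "poly_fun D" and p: "D p \<noteq> 0"
    and z: "\<And>z. D z \<noteq> 0 \<Longrightarrow> f z = 0"
  shows "f x = 0"
  by (rule poly_fun_dense[OF f D, where S=UNIV and y="p - x" and ?t0.0=1]) (use p z in auto)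

lemma poly_fun_eqI:
  assumes f: "poly_fun f" and g: "poly_fun g" and D: "poly_fun D" and p: "D p \<noteq> 0"
    and z: "\<And>z. D z \<noteq> 0 \<Longrightarrow> f z = g z"
  shows "f = g"
proof
  fix x show "f x = g x"
    using poly_fun_eq_0[OF poly_fun_diff[OF f g] D p, of x] z by auto
qed

text \<open>Induction on the set of variables. As a function of the new variable the sum is a
  polynomial in one variable that vanishes everywhere; so each of its coefficients, a sum over the
  exponents with a fixed value at \<open>s\<close>, vanishes for all values of the other
  variables.\<close>

lemma poly_mapping_zero_if_fun_zero:
  fixes c :: "('n \<Rightarrow> nat) \<Rightarrow> complex"
  assumes "finite S" "finite T" "\<And>a. a \<in> T \<Longrightarrow> (\<forall>i. i \<notin> S \<longrightarrow> a i = 0)"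
    "\<And>x::'n \<Rightarrow> complex. (\<Sum>a\<in>T. c a * (\<Prod>i\<in>S. x i ^ a i)) = 0"
  shows "\<forall>a\<in>T. c a = 0"
  using assms
proof (induction S arbitrary: T c rule: finite_induct)
  case empty
  then have "T \<subseteq> {\<lambda>_. 0}" by auto
  then show ?case using empty.prems(3)[of "\<lambda>_. 0"] by (auto simp: subset_singleton_iff)
next
  case (insert s S)
  have *: "(\<Sum>a\<in>{a\<in>T. a s = k}. c a * (\<Prod>i\<in>S. x i ^ a i)) = 0" for x :: "'n \<Rightarrow> complex" and k
  proof -
    define q where "q = (\<Sum>a\<in>T. monom (c a * (\<Prod>i\<in>S. x i ^ a i)) (a s))"
    have "poly q t = 0" for t
    proof -
      have "(\<Sum>a\<in>T. c a * (\<Prod>i\<in>insert s S. (x(s:=t)) i ^ a i)) = poly q t"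
        unfolding q_def poly_sum poly_monom
      proof (rule sum.cong[OF refl])
        fix a
        have "(\<Prod>i\<in>S. (x(s:=t)) i ^ a i) = (\<Prod>i\<in>S. x i ^ a i)"
          by (rule prod.cong) (use insert.hyps in auto)
        then show "c a * (\<Prod>i\<in>insert s S. (x(s:=t)) i ^ a i) = c a * (\<Prod>i\<in>S. x i ^ a i) * t ^ a s"
          using insert.hyps by simp
      qed
      then show ?thesis using insert.prems(3) by simp
    qed
    then have "q = 0" by (intro iffD1[OF poly_all_0_iff_0] allI)
    then have "coeff q k = 0" by simp
    then have "(\<Sum>a\<in>T. if a s = k then c a * (\<Prod>i\<in>S. x i ^ a i) else 0) = 0"
      unfolding q_def coeff_sum by simp
    then show ?thesis using insert.prems(1) by (simp add: sum.inter_filter)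
  qed
  show ?case
  proof
    fix a assume a: "a \<in> T"
    \<comment> \<open>Resetting the exponent of \<open>s\<close> to 0 meets the support condition of
      the induction hypothesis and is injective on the slice \<open>b s = a s\<close>.\<close>
    define U where "U = (\<lambda>b. b(s := 0)) ` {b\<in>T. b s = a s}"
    define c' where "c' b = c (b(s := a s))" for b
    have inj: "inj_on (\<lambda>b. b(s := 0)) {b\<in>T. b s = a s}"
    proof (rule inj_onI)
      fix b b' assume b: "b \<in> {b\<in>T. b s = a s}" "b' \<in> {b\<in>T. b s = a s}" and e: "b(s:=0) = b'(s:=0)"
      show "b = b'" proof fix j show "b j = b' j" using b fun_cong[OF e, of j] by (cases "j = s") auto qed
    qed
    have "\<forall>b\<in>U. c' b = 0"
    proof (rule insert.IH)
      show "finite U" using insert.prems(1) by (simp add: U_def)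
      show "\<And>b. b \<in> U \<Longrightarrow> \<forall>i. i \<notin> S \<longrightarrow> b i = 0" using insert.prems(2) by (auto simp: U_def)
      show "(\<Sum>b\<in>U. c' b * (\<Prod>i\<in>S. x i ^ b i)) = 0" for x :: "'n \<Rightarrow> complex"
      proof -
        have "(\<Sum>b\<in>U. c' b * (\<Prod>i\<in>S. x i ^ b i)) = (\<Sum>b\<in>{b\<in>T. b s = a s}. c b * (\<Prod>i\<in>S. x i ^ b i))"
          unfolding U_def sum.reindex[OF inj] o_def
        proof (rule sum.cong[OF refl])
          fix b assume b: "b \<in> {b\<in>T. b s = a s}"
          have "(\<Prod>i\<in>S. x i ^ (b(s:=0)) i) = (\<Prod>i\<in>S. x i ^ b i)"
            by (rule prod.cong) (use insert.hyps in auto)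
          moreover have "c' (b(s:=0)) = c b" using b by (simp add: c'_def fun_upd_idem)
          ultimately show "c' (b(s := 0)) * (\<Prod>i\<in>S. x i ^ (b(s := 0)) i) = c b * (\<Prod>i\<in>S. x i ^ b i)" by simp
        qed
        then show ?thesis using * by simp
      qed
    qed
    then have "c' (a(s := 0)) = 0" using a by (simp add: U_def)
    then show "c a = 0" by (simp add: c'_def)
  qed
qed

lemma eval_poly_eq_0_imp:
  fixes p :: "'n::finite poly_ring"
  assumes "\<And>x. eval_poly p x = 0" shows "p = 0"
proof -
  define T where "T = Poly_Mapping.lookup ` Poly_Mapping.keys p"
  define c where "c a = Poly_Mapping.lookup p (Abs_poly_mapping a)" for a
  have inj: "inj_on Poly_Mapping.lookup (Poly_Mapping.keys p)" by (auto intro!: inj_onI poly_mapping_eqI)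
  have "\<forall>a\<in>T. c a = 0"
  proof (rule poly_mapping_zero_if_fun_zero[of UNIV])
    show "(\<Sum>a\<in>T. c a * (\<Prod>i\<in>UNIV. x i ^ a i)) = 0" for x :: "'n \<Rightarrow> complex"
      using assms[of "\<chi> i. x i"] inj
      by (simp add: T_def sum.reindex c_def eval_poly_def insertion_def)
  qed (auto simp: T_def)
  then have "Poly_Mapping.lookup p a = 0" for a
    by (cases "a \<in> Poly_Mapping.keys p") (auto simp: T_def c_def in_keys_iff)
  then show ?thesis by (auto intro!: poly_mapping_eqI)
qed

lemma eval_poly_inject: "eval_poly p = eval_poly q \<longleftrightarrow> p = q"
proof
  assume e: "eval_poly p = eval_poly q"
  have "p - q = 0" by (rule eval_poly_eq_0_imp) (simp add: e)
  then show "p = q" by simp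
qed auto

text \<open>Divisibility in the ring as existence of a polynomial cofactor function, the form in
  which the analysis along hyperplanes delivers it.\<close>

lemma dvd_iff_eval:
  fixes p q :: "'n::finite poly_ring"
  shows "p dvd q \<longleftrightarrow> (\<exists>g. poly_fun g \<and> (\<forall>x. eval_poly q x = eval_poly p x * g x))"
proof
  assume "p dvd q"
  then show "\<exists>g. poly_fun g \<and> (\<forall>x. eval_poly q x = eval_poly p x * g x)" by (auto elim!: dvdE)
next
  assume "\<exists>g. poly_fun g \<and> (\<forall>x. eval_poly q x = eval_poly p x * g x)"
  then obtain g where g: "\<forall>x. eval_poly q x = eval_poly p x * eval_poly g x" by (auto simp: poly_fun_def)
  then have "eval_poly q = eval_poly (p * g)" by auto
  then show "p dvd q" by (simp add: eval_poly_inject)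
qed

section \<open>Directional derivatives of localised functions\<close>

definition dir_deriv :: "complex^'n \<Rightarrow> (complex^'n \<Rightarrow> complex) \<Rightarrow> complex^'n \<Rightarrow> complex" where
  "dir_deriv \<xi> f x = deriv (\<lambda>t. f (x + t *s \<xi>)) 0"

text \<open>Values at the zeros of D are unconstrained. With D = \<open>\<delta>\<close> this
  describes the coordinate ring of \<open>V_reg\<close>; with D = \<open>dH H\<close> it describes
  functions that may have poles along every hyperplane except H.\<close>

definition localised :: "(complex^'n::finite \<Rightarrow> complex) \<Rightarrow> (complex^'n \<Rightarrow> complex) \<Rightarrow> bool" where
  "localised D f \<longleftrightarrow> (\<exists>g r. poly_fun g \<and> (\<forall>x. D x \<noteq> 0 \<longrightarrow> f x = g x / D x ^ r))"

lemma localised_cong: "(\<And>x. D x \<noteq> 0 \<Longrightarrow> f x = g x) \<Longrightarrow> localised D f \<longleftrightarrow> localised D g"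
  unfolding localised_def by (metis (no_types, lifting))

lemma localised_poly: "poly_fun f \<Longrightarrow> localised D f"
  unfolding localised_def by (intro exI[of _ f] exI[of _ 0]) auto

lemma localised_const [simp]: "localised D (\<lambda>x. c)"
  by (rule localised_poly) auto

lemma localised_add:
  assumes D: "poly_fun D" and "localised D f" "localised D g" shows "localised D (\<lambda>x. f x + g x)"
proof -
  obtain p r where p: "poly_fun p" "\<And>x. D x \<noteq> 0 \<Longrightarrow> f x = p x / D x ^ r" using assms(2) unfolding localised_def by metis
  obtain q s where q: "poly_fun q" "\<And>x. D x \<noteq> 0 \<Longrightarrow> g x = q x / D x ^ s" using assms(3) unfolding localised_def by metis
  show ?thesis unfolding localised_def
  proof (intro exI conjI allI impI)
    show "poly_fun (\<lambda>x. p x * D x ^ s + q x * D x ^ r)" using p q D by (intro poly_fun_add poly_fun_mult poly_fun_power)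
    fix x assume "D x \<noteq> 0"
    then show "f x + g x = (p x * D x ^ s + q x * D x ^ r) / D x ^ (r + s)"
      by (simp add: p q power_add field_simps)
  qed
qed

lemma localised_mult:
  assumes "localised D f" "localised D g" shows "localised D (\<lambda>x. f x * g x)"
proof -
  obtain p r where p: "poly_fun p" "\<And>x. D x \<noteq> 0 \<Longrightarrow> f x = p x / D x ^ r" using assms(1) unfolding localised_def by metis
  obtain q s where q: "poly_fun q" "\<And>x. D x \<noteq> 0 \<Longrightarrow> g x = q x / D x ^ s" using assms(2) unfolding localised_def by metis
  show ?thesis unfolding localised_def
  proof (intro exI conjI allI impI)
    show "poly_fun (\<lambda>x. p x * q x)" using p q by (intro poly_fun_mult)
    fix x assume "D x \<noteq> 0"
    then show "f x * g x = (p x * q x) / D x ^ (r + s)"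
      by (simp add: p q power_add)
  qed
qed

lemma localised_uminus: "localised D f \<Longrightarrow> localised D (\<lambda>x. - f x)"
  using localised_mult[of D "\<lambda>x. -1" f] by simp
lemma localised_diff: "poly_fun D \<Longrightarrow> localised D f \<Longrightarrow> localised D g \<Longrightarrow> localised D (\<lambda>x. f x - g x)"
  using localised_add[of D f "\<lambda>x. - g x"] localised_uminus[of D g] by simp
lemma localised_sum: "poly_fun D \<Longrightarrow> (\<And>i. i \<in> S \<Longrightarrow> localised D (f i)) \<Longrightarrow> localised D (\<lambda>x. \<Sum>i\<in>S. f i x)"
  by (induction S rule: infinite_finite_induct) (auto intro!: localised_add)
lemma localised_power: "localised D f \<Longrightarrow> localised D (\<lambda>x. f x ^ k)"
  by (induction k) (auto intro!: localised_mult)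

lemma localised_inverse_factor:
  assumes "\<And>x. D x = a x * b x" "poly_fun b" shows "localised D (\<lambda>x. c / a x)"
  unfolding localised_def
proof (intro exI conjI allI impI)
  show "poly_fun (\<lambda>x. c * b x)" using assms by auto
  fix x assume "D x \<noteq> 0"
  then show "c / a x = c * b x / D x ^ 1" using assms(1)[of x] by (auto simp: field_simps)
qed

lemma localised_mono:
  assumes "\<And>x. D x = D' x * E x" "poly_fun E" "localised D' f" shows "localised D f"
proof -
  obtain p r where p: "poly_fun p" "\<And>x. D' x \<noteq> 0 \<Longrightarrow> f x = p x / D' x ^ r" using assms(3) unfolding localised_def by metis
  show ?thesis unfolding localised_def
  proof (intro exI conjI allI impI)
    show "poly_fun (\<lambda>x. p x * E x ^ r)" using p assms by (intro poly_fun_mult poly_fun_power)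
    fix x assume "D x \<noteq> 0"
    then show "f x = (p x * E x ^ r) / D x ^ r"
      using assms(1)[of x] p(2)[of x] by (auto simp: power_mult_distrib)
  qed
qed

lemma poly_fun_has_dir_deriv_ex:
  assumes "poly_fun f"
  shows "\<exists>f'. poly_fun f' \<and> (\<forall>x. ((\<lambda>t. f (x + t *s \<xi>)) has_field_derivative f' x) (at 0))"
  using assms
proof (induction f rule: poly_fun_induct)
  case (const c)
  show ?case by (rule exI[of _ "\<lambda>x. 0"]) auto
next
  case (coord i)
  show ?case by (rule exI[of _ "\<lambda>x. \<xi> $ i"]) (auto intro!: derivative_eq_intros)
next
  case (add f g)
  then obtain f' g' where "poly_fun f'" "\<forall>x. ((\<lambda>t. f (x + t *s \<xi>)) has_field_derivative f' x) (at 0)"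
    "poly_fun g'" "\<forall>x. ((\<lambda>t. g (x + t *s \<xi>)) has_field_derivative g' x) (at 0)" by blast
  then show ?case by (intro exI[of _ "\<lambda>x. f' x + g' x"]) (auto intro!: derivative_eq_intros)
next
  case (mult f g)
  then obtain f' g' where "poly_fun f'" "\<forall>x. ((\<lambda>t. f (x + t *s \<xi>)) has_field_derivative f' x) (at 0)"
    "poly_fun g'" "\<forall>x. ((\<lambda>t. g (x + t *s \<xi>)) has_field_derivative g' x) (at 0)" by blast
  then show ?case using mult(1,2)
    by (intro exI[of _ "\<lambda>x. f' x * g x + g' x * f x"] conjI allI poly_fun_add poly_fun_mult)
       (auto intro!: derivative_eq_intros)
qed

lemma poly_fun_has_dir_deriv:
  assumes "poly_fun f" shows "((\<lambda>t. f (x + t *s \<xi>)) has_field_derivative dir_deriv \<xi> f x) (at 0)"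
  using poly_fun_has_dir_deriv_ex[OF assms, of \<xi>] unfolding dir_deriv_def by (metis DERIV_imp_deriv)

lemma poly_fun_dir_deriv:
  assumes "poly_fun f" shows "poly_fun (dir_deriv \<xi> f)"
proof -
  obtain f' where f': "poly_fun f'" "\<forall>x. ((\<lambda>t. f (x + t *s \<xi>)) has_field_derivative f' x) (at 0)"
    using poly_fun_has_dir_deriv_ex[OF assms, of \<xi>] by blast
  then have "dir_deriv \<xi> f = f'" unfolding dir_deriv_def by (auto intro!: DERIV_imp_deriv)
  then show ?thesis using f' by simp
qed

lemma poly_fun_eventually_nz:
  assumes "poly_fun D" "D x \<noteq> 0"
  shows "eventually (\<lambda>t. D (x + t *s \<xi>) \<noteq> 0) (nhds 0)"
proof -
  have "isCont (\<lambda>t. D (x + t *s \<xi>)) 0" using poly_fun_has_dir_deriv[OF assms(1)] by (rule DERIV_isCont)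
  then have "((\<lambda>t. D (x + t *s \<xi>)) \<longlongrightarrow> D (x + 0 *s \<xi>)) (nhds 0)"
    by (simp only: isCont_def tendsto_at_iff_tendsto_nhds[of "\<lambda>t. D (x + t *s \<xi>)" 0])
  then show ?thesis by (rule tendsto_imp_eventually_ne) (use assms in auto)
qed

lemma dir_deriv_cong:
  assumes "poly_fun D" "D x \<noteq> 0" "\<And>y. D y \<noteq> 0 \<Longrightarrow> f y = g y"
  shows "dir_deriv \<xi> f x = dir_deriv \<xi> g x"
  unfolding dir_deriv_def
  by (rule deriv_cong_ev) (use poly_fun_eventually_nz[OF assms(1,2), of \<xi>] assms(3) in \<open>auto elim: eventually_mono\<close>)

text \<open>Near x on the line the function agrees with g / D^r, so this is the quotient rule. The
  explicit numerator shows that \<open>localised\<close> is closed under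
  \<open>dir_deriv\<close>.\<close>

lemma has_dir_deriv_quotient:
  assumes D: "poly_fun D" "D x \<noteq> 0" and g: "poly_fun g" and f: "\<And>y. D y \<noteq> 0 \<Longrightarrow> f y = g y / D y ^ r"
  shows "((\<lambda>t. f (x + t *s \<xi>)) has_field_derivative
      (dir_deriv \<xi> g x * D x - of_nat r * g x * dir_deriv \<xi> D x) / D x ^ Suc r) (at 0)"
proof -
  have "((\<lambda>t. g (x + t *s \<xi>) / D (x + t *s \<xi>) ^ r) has_field_derivative
      (dir_deriv \<xi> g x * D x - of_nat r * g x * dir_deriv \<xi> D x) / D x ^ Suc r) (at 0)"
    apply (rule derivative_eq_intros poly_fun_has_dir_deriv[OF g] poly_fun_has_dir_deriv[OF D(1)] refl)+
    using D(2) apply simp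
    using D(2) by (cases r) (simp_all add: field_simps)
  then show ?thesis
    by (rule DERIV_cong_ev[THEN iffD1, rotated -1])
      (use poly_fun_eventually_nz[OF D, of \<xi>] f in \<open>auto elim!: eventually_mono\<close>)
qed

lemma has_dir_deriv:
  assumes D: "poly_fun D" and "localised D f" "D x \<noteq> 0"
  shows "((\<lambda>t. f (x + t *s \<xi>)) has_field_derivative dir_deriv \<xi> f x) (at 0)"
proof -
  obtain p r where p: "poly_fun p" "\<And>x. D x \<noteq> 0 \<Longrightarrow> f x = p x / D x ^ r" using assms(2) unfolding localised_def by metis
  from has_dir_deriv_quotient[OF D assms(3) p] show ?thesis unfolding dir_deriv_def
    by (metis DERIV_imp_deriv)
qed

lemma dir_deriv_eqI:
  "((\<lambda>t. f (x + t *s \<xi>)) has_field_derivative d) (at 0) \<Longrightarrow> dir_deriv \<xi> f x = d"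
  unfolding dir_deriv_def by (rule DERIV_imp_deriv)

lemma localised_dir_deriv:
  assumes D: "poly_fun D" and "localised D f" shows "localised D (dir_deriv \<xi> f)"
proof -
  obtain p r where p: "poly_fun p" "\<And>x. D x \<noteq> 0 \<Longrightarrow> f x = p x / D x ^ r" using assms(2) unfolding localised_def by metis
  show ?thesis unfolding localised_def
  proof (intro exI conjI allI impI)
    show "poly_fun (\<lambda>x. dir_deriv \<xi> p x * D x - of_nat r * p x * dir_deriv \<xi> D x)"
      using p D by (intro poly_fun_diff poly_fun_mult poly_fun_dir_deriv) auto
    fix x assume "D x \<noteq> 0"
    from has_dir_deriv_quotient[OF D this p, of \<xi>]
    show "dir_deriv \<xi> f x = (dir_deriv \<xi> p x * D x - of_nat r * p x * dir_deriv \<xi> D x) / D x ^ Suc r" by (rule dir_deriv_eqI)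
  qed
qed

lemma dir_deriv_const [simp]: "dir_deriv \<xi> (\<lambda>x. c) x = 0" by (rule dir_deriv_eqI) auto

lemma form_at_add [simp]: "form_at a (x + y) = form_at a x + form_at a y"
  by (simp add: form_at_def algebra_simps sum.distrib)
lemma form_at_diff [simp]: "form_at a (x - y) = form_at a x - form_at a y"
  by (simp add: form_at_def algebra_simps sum_subtractf)
lemma form_at_smult [simp]: "form_at a (c *s x) = c * form_at a x"
  by (simp add: form_at_def algebra_simps sum_distrib_left)
lemma form_at_0 [simp]: "form_at a 0 = 0"
  by (simp add: form_at_def)

context
  fixes D :: "complex^'n::finite \<Rightarrow> complex"
  assumes D: "poly_fun D"
begin

lemma dir_deriv_add: "localised D f \<Longrightarrow> localised D g \<Longrightarrow> D x \<noteq> 0 \<Longrightarrow> dir_deriv \<xi> (\<lambda>x. f x + g x) x = dir_deriv \<xi> f x + dir_deriv \<xi> g x"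
  by (rule dir_deriv_eqI) (auto intro!: derivative_eq_intros has_dir_deriv[OF D])

lemma dir_deriv_mult: "localised D f \<Longrightarrow> localised D g \<Longrightarrow> D x \<noteq> 0 \<Longrightarrow> dir_deriv \<xi> (\<lambda>x. f x * g x) x = dir_deriv \<xi> f x * g x + f x * dir_deriv \<xi> g x"
  by (rule dir_deriv_eqI) (use DERIV_mult[OF has_dir_deriv[OF D, of f x \<xi>] has_dir_deriv[OF D, of g x \<xi>]] in \<open>simp add: algebra_simps\<close>)

lemma dir_deriv_sum: "(\<And>i. i \<in> S \<Longrightarrow> localised D (f i)) \<Longrightarrow> D x \<noteq> 0 \<Longrightarrow> dir_deriv \<xi> (\<lambda>x. \<Sum>i\<in>S. f i x) x = (\<Sum>i\<in>S. dir_deriv \<xi> (f i) x)"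
  by (induction S rule: infinite_finite_induct) (auto simp: dir_deriv_add localised_sum[OF D])

lemma dir_deriv_diff: "localised D f \<Longrightarrow> localised D g \<Longrightarrow> D x \<noteq> 0 \<Longrightarrow> dir_deriv \<xi> (\<lambda>x. f x - g x) x = dir_deriv \<xi> f x - dir_deriv \<xi> g x"
  by (rule dir_deriv_eqI) (auto intro!: derivative_eq_intros has_dir_deriv[OF D])

text \<open>\<open>dir_deriv\<close> is a derivative along one complex line, so linearity in the
  direction is not built in; for polynomials it spreads from the coordinate functions by the sum and
  product rules.\<close>

lemma poly_dir_deriv_linear:
  fixes f :: "complex^'n \<Rightarrow> complex"
  shows "poly_fun f \<Longrightarrow> dir_deriv (a *s \<xi> + b *s \<eta>) f x = a * dir_deriv \<xi> f x + b * dir_deriv \<eta> f x"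
proof (induction f arbitrary: x rule: poly_fun_induct)
  case (coord i)
  have "dir_deriv \<zeta> (\<lambda>x. x $ i) y = \<zeta> $ i" for \<zeta> y :: "complex^'n"
    by (rule dir_deriv_eqI) (auto intro!: derivative_eq_intros)
  then show ?case by simp
next
  case (add f g)
  have "dir_deriv \<zeta> (\<lambda>x. f x + g x) y = dir_deriv \<zeta> f y + dir_deriv \<zeta> g y" for \<zeta> y :: "complex^'n"
    by (rule dir_deriv_eqI) (auto intro!: derivative_eq_intros poly_fun_has_dir_deriv add)
  then show ?case by (simp add: add.IH algebra_simps)
next
  case (mult f g)
  have "dir_deriv \<zeta> (\<lambda>x. f x * g x) y = dir_deriv \<zeta> f y * g y + f y * dir_deriv \<zeta> g y" for \<zeta> y :: "complex^'n"
    by (rule dir_deriv_eqI) (use DERIV_mult[OF poly_fun_has_dir_deriv[OF mult(1), of y \<zeta>] poly_fun_has_dir_deriv[OF mult(2), of y \<zeta>]] in \<open>simp add: algebra_simps\<close>)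
  then show ?case by (simp add: mult.IH algebra_simps)
qed simp

lemma poly_dir_deriv_commute:
  fixes f :: "complex^'n \<Rightarrow> complex"
  shows "poly_fun f \<Longrightarrow> dir_deriv \<xi> (dir_deriv \<eta> f) x = dir_deriv \<eta> (dir_deriv \<xi> f) x"
proof (induction f arbitrary: x rule: poly_fun_induct)
  case (const c)
  have "dir_deriv \<zeta> (\<lambda>x::complex^'n. c) = (\<lambda>x. 0)" for \<zeta> by auto
  then show ?case by simp
next
  case (coord i)
  have "dir_deriv \<zeta> (\<lambda>x. x $ i) = (\<lambda>y. \<zeta> $ i)" for \<zeta> :: "complex^'n"
    by (rule ext, rule dir_deriv_eqI) (auto intro!: derivative_eq_intros)
  then show ?case by simp
next
  case (add f g)
  have *: "dir_deriv \<zeta> (\<lambda>x. f x + g x) = (\<lambda>y. dir_deriv \<zeta> f y + dir_deriv \<zeta> g y)"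
    if "poly_fun f" "poly_fun g" for \<zeta> and f g :: "complex^'n \<Rightarrow> complex"
    by (rule ext, rule dir_deriv_eqI) (auto intro!: derivative_eq_intros poly_fun_has_dir_deriv that)
  show ?case by (simp add: * add poly_fun_dir_deriv add.IH)
next
  case (mult f g)
  have *: "dir_deriv \<zeta> (\<lambda>x. f x * g x) = (\<lambda>y. dir_deriv \<zeta> f y * g y + f y * dir_deriv \<zeta> g y)"
    if "poly_fun f" "poly_fun g" for \<zeta> and f g :: "complex^'n \<Rightarrow> complex"
    by (rule ext, rule dir_deriv_eqI)
      (use DERIV_mult[OF poly_fun_has_dir_deriv[OF that(1), of _ \<zeta>] poly_fun_has_dir_deriv[OF that(2), of _ \<zeta>]] in \<open>simp add: algebra_simps\<close>)
  have **: "dir_deriv \<zeta> (\<lambda>x. f x + g x) = (\<lambda>y. dir_deriv \<zeta> f y + dir_deriv \<zeta> g y)"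
    if "poly_fun f" "poly_fun g" for \<zeta> and f g :: "complex^'n \<Rightarrow> complex"
    by (rule ext, rule dir_deriv_eqI) (auto intro!: derivative_eq_intros poly_fun_has_dir_deriv that)
  show ?case by (simp add: * ** mult poly_fun_dir_deriv poly_fun_mult mult.IH)
qed

text \<open>Differentiating p = f N with N = D^r gives dp = df N + f dN. Here dp and dN are linear
  in the direction, and N is nonzero at x and can be cancelled.\<close>

lemma dir_deriv_linear:
  assumes f: "localised D f" and x: "D x \<noteq> 0"
  shows "dir_deriv (a *s \<xi> + b *s \<eta>) f x = a * dir_deriv \<xi> f x + b * dir_deriv \<eta> f x"
proof -
  obtain p r where p: "poly_fun p" "\<And>x. D x \<noteq> 0 \<Longrightarrow> f x = p x / D x ^ r" using f unfolding localised_def by metis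
  define N where "N = (\<lambda>x. D x ^ r)"
  have N: "poly_fun N" using D unfolding N_def by (rule poly_fun_power)
  have e: "dir_deriv \<zeta> p x = dir_deriv \<zeta> f x * N x + f x * dir_deriv \<zeta> N x" for \<zeta>
  proof -
    have "dir_deriv \<zeta> p x = dir_deriv \<zeta> (\<lambda>x. f x * N x) x"
      by (rule dir_deriv_cong[OF D x]) (use p in \<open>auto simp: N_def\<close>)
    then show ?thesis by (simp add: dir_deriv_mult f x localised_poly N)
  qed
  have "dir_deriv (a *s \<xi> + b *s \<eta>) f x * N x = (a * dir_deriv \<xi> f x + b * dir_deriv \<eta> f x) * N x"
    using poly_dir_deriv_linear[OF p(1), of a \<xi> b \<eta> x] poly_dir_deriv_linear[OF N, of a \<xi> b \<eta> x]
    unfolding e by (simp add: algebra_simps)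
  moreover have "N x \<noteq> 0" using x by (simp add: N_def)
  ultimately show ?thesis by simp
qed

lemma dir_deriv_commute:
  assumes f: "localised D f" and x: "D x \<noteq> 0"
  shows "dir_deriv \<xi> (dir_deriv \<eta> f) x = dir_deriv \<eta> (dir_deriv \<xi> f) x"
proof -
  obtain p r where p: "poly_fun p" "\<And>x. D x \<noteq> 0 \<Longrightarrow> f x = p x / D x ^ r" using f unfolding localised_def by metis
  define N where "N = (\<lambda>x. D x ^ r)"
  have N: "poly_fun N" using D unfolding N_def by (rule poly_fun_power)
  have e: "dir_deriv \<zeta> p x = dir_deriv \<zeta> f x * N x + f x * dir_deriv \<zeta> N x" if x: "D x \<noteq> 0" for \<zeta> x
  proof -
    have "dir_deriv \<zeta> p x = dir_deriv \<zeta> (\<lambda>x. f x * N x) x"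
      by (rule dir_deriv_cong[OF D x]) (use p in \<open>auto simp: N_def\<close>)
    then show ?thesis by (simp add: dir_deriv_mult f x localised_poly N)
  qed
  \<comment> \<open>The two mixed terms are exchanged when the directions are, so commutation for
    the polynomials p and N leaves commutation for f.\<close>
  have e2: "dir_deriv \<zeta> (dir_deriv \<zeta>' p) x = dir_deriv \<zeta> (dir_deriv \<zeta>' f) x * N x + dir_deriv \<zeta>' f x * dir_deriv \<zeta> N x + dir_deriv \<zeta> f x * dir_deriv \<zeta>' N x + f x * dir_deriv \<zeta> (dir_deriv \<zeta>' N) x"
    for \<zeta> \<zeta>'
  proof -
    have "dir_deriv \<zeta> (dir_deriv \<zeta>' p) x = dir_deriv \<zeta> (\<lambda>x. dir_deriv \<zeta>' f x * N x + f x * dir_deriv \<zeta>' N x) x"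
      by (rule dir_deriv_cong[OF D x]) (rule e)
    also have "\<dots> = dir_deriv \<zeta> (\<lambda>x. dir_deriv \<zeta>' f x * N x) x + dir_deriv \<zeta> (\<lambda>x. f x * dir_deriv \<zeta>' N x) x"
      by (rule dir_deriv_add) (rule localised_mult localised_dir_deriv[OF D] f N x localised_poly)+
    also have "dir_deriv \<zeta> (\<lambda>x. dir_deriv \<zeta>' f x * N x) x = dir_deriv \<zeta> (dir_deriv \<zeta>' f) x * N x + dir_deriv \<zeta>' f x * dir_deriv \<zeta> N x"
      by (rule dir_deriv_mult) (rule localised_mult localised_dir_deriv[OF D] f N x localised_poly)+
    also have "dir_deriv \<zeta> (\<lambda>x. f x * dir_deriv \<zeta>' N x) x = dir_deriv \<zeta> f x * dir_deriv \<zeta>' N x + f x * dir_deriv \<zeta> (dir_deriv \<zeta>' N) x"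
      by (rule dir_deriv_mult) (rule localised_mult localised_dir_deriv[OF D] f N x localised_poly)+
    finally show ?thesis by simp
  qed
  have "dir_deriv \<xi> (dir_deriv \<eta> f) x * N x = dir_deriv \<eta> (dir_deriv \<xi> f) x * N x"
    using poly_dir_deriv_commute[OF p(1), of \<xi> \<eta> x] poly_dir_deriv_commute[OF N, of \<xi> \<eta> x] unfolding e2 by simp
  moreover have "N x \<noteq> 0" using x by (simp add: N_def)
  ultimately show ?thesis by simp
qed

end

text \<open>\<open>pr\<close> projects onto the kernel along a, so f (pr x) = 0. The difference f x
  - f (pr x) is divisible by the form because this holds for coordinates and passes to sums and, by
  telescoping, to products.\<close>

lemma poly_fun_divide_form:
  assumes f: "poly_fun f" and a: "form_at \<alpha> a = 1" and z: "\<And>x. form_at \<alpha> x = 0 \<Longrightarrow> f x = 0"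
  shows "\<exists>g. poly_fun g \<and> (\<forall>x. f x = form_at \<alpha> x * g x)"
proof -
  define pr where "pr x = x - form_at \<alpha> x *s a" for x
  have pp: "poly_fun (\<lambda>x. h (pr x))" if "poly_fun h" for h
    using that
  proof (induction h rule: poly_fun_induct)
    case (coord i)
    then show ?case unfolding pr_def by (simp add: poly_fun_diff poly_fun_mult)
  qed auto
  have "\<exists>g. poly_fun g \<and> (\<forall>x. f x - f (pr x) = form_at \<alpha> x * g x)"
    using f
  proof (induction f rule: poly_fun_induct)
    case (const c) show ?case by (rule exI[of _ "\<lambda>x. 0"]) auto
  next
    case (coord i) show ?case by (rule exI[of _ "\<lambda>x. a $ i"]) (auto simp: pr_def)
  next
    case (add f g)
    from add.IH(1) obtain u where u: "poly_fun u" "\<And>x. f x - f (pr x) = form_at \<alpha> x * u x" by blast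
    from add.IH(2) obtain v where v: "poly_fun v" "\<And>x. g x - g (pr x) = form_at \<alpha> x * v x" by blast
    show ?case
    proof (intro exI conjI allI)
      show "poly_fun (\<lambda>x. u x + v x)" using u v by (intro poly_fun_add)
      fix x
      show "f x + g x - (f (pr x) + g (pr x)) = form_at \<alpha> x * (u x + v x)"
        using u(2)[of x] v(2)[of x] by algebra
    qed
  next
    case (mult f g)
    from mult.IH(1) obtain u where u: "poly_fun u" "\<And>x. f x - f (pr x) = form_at \<alpha> x * u x" by blast
    from mult.IH(2) obtain v where v: "poly_fun v" "\<And>x. g x - g (pr x) = form_at \<alpha> x * v x" by blast
    show ?case
    proof (intro exI conjI allI)
      show "poly_fun (\<lambda>x. u x * g x + f (pr x) * v x)" using u v mult pp by (intro poly_fun_add poly_fun_mult)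
      fix x
      show "f x * g x - f (pr x) * g (pr x) = form_at \<alpha> x * (u x * g x + f (pr x) * v x)"
        using u(2)[of x] v(2)[of x] by algebra
    qed
  qed
  moreover have "form_at \<alpha> (pr x) = 0" for x
    using a by (simp add: pr_def)
  ultimately show ?thesis using z by auto
qed

text \<open>The kernel is a linear space, so the line from x to x0 stays inside it and the density
  argument applies within the hyperplane.\<close>

lemma poly_fun_zero_on_kernel:
  assumes f: "poly_fun f" and D: "poly_fun D" and x0: "form_at \<alpha> x0 = 0" "D x0 \<noteq> 0"
    and z: "\<And>x. form_at \<alpha> x = 0 \<Longrightarrow> D x \<noteq> 0 \<Longrightarrow> f x = 0" and x: "form_at \<alpha> x = 0"
  shows "f x = 0"
proof (rule poly_fun_dense[OF f D, where S="{x. form_at \<alpha> x = 0}" and y="x0 - x" and ?t0.0=1])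
  show "x + t *s (x0 - x) \<in> {x. form_at \<alpha> x = 0}" for t
  proof -
    have "form_at \<alpha> (x + t *s (x0 - x)) = form_at \<alpha> x + t * (form_at \<alpha> x0 - form_at \<alpha> x)"
      by (simp add: algebra_simps)
    then show ?thesis using x x0 by simp
  qed
qed (use x0 z in auto)

text \<open>The point x0 shows that D does not vanish identically on the hyperplane. Hence the
  numerator vanishes on all of it and is divisible by the form.\<close>

lemma localised_divide_form:
  assumes D: "poly_fun D" and a: "form_at \<alpha> a = 1" and x0: "form_at \<alpha> x0 = 0" "D x0 \<noteq> 0"
    and f: "localised D f" and z: "\<And>x. form_at \<alpha> x = 0 \<Longrightarrow> D x \<noteq> 0 \<Longrightarrow> f x = 0"
  shows "\<exists>g. localised D g \<and> (\<forall>x. D x \<noteq> 0 \<longrightarrow> f x = form_at \<alpha> x * g x)"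
proof -
  obtain p r where p: "poly_fun p" "\<And>x. D x \<noteq> 0 \<Longrightarrow> f x = p x / D x ^ r" using f unfolding localised_def by metis
  have "p x = 0" if "form_at \<alpha> x = 0" for x
    by (rule poly_fun_zero_on_kernel[OF p(1) D x0 _ that]) (use p(2) z in force)
  then obtain g where g: "poly_fun g" "\<And>x. p x = form_at \<alpha> x * g x"
    using poly_fun_divide_form[OF p(1) a] by blast
  show ?thesis
  proof (intro exI conjI allI impI)
    show "localised D (\<lambda>x. g x / D x ^ r)" unfolding localised_def using g by blast
    show "D x \<noteq> 0 \<Longrightarrow> f x = form_at \<alpha> x * (g x / D x ^ r)" for x by (simp add: p g)
  qed
qed

text \<open>The form is prime and, as x0 shows, does not divide N. This is unique factorisation in
  the one case that occurs, with the factors of the form cancelled one at a time.\<close>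

lemma poly_fun_power_divide_form:
  assumes g: "poly_fun g" and N: "poly_fun N" and q: "poly_fun q"
    and a: "form_at \<alpha> a = 1" and x0: "form_at \<alpha> x0 = 0" "N x0 \<noteq> 0"
    and e: "\<And>x. g x * N x = form_at \<alpha> x ^ r * q x"
  shows "\<exists>h. poly_fun h \<and> (\<forall>x. g x = form_at \<alpha> x ^ r * h x)"
  using g q e
proof (induction r arbitrary: g q)
  case 0
  then show ?case by auto
next
  case (Suc r)
  have "g x = 0" if "form_at \<alpha> x = 0" for x
  proof (rule poly_fun_zero_on_kernel[OF Suc.prems(1) N x0 _ that])
    fix x assume "form_at \<alpha> x = 0" "N x \<noteq> 0"
    then show "g x = 0" using Suc.prems(3)[of x] by simp
  qed
  then obtain g' where g': "poly_fun g'" "\<And>x. g x = form_at \<alpha> x * g' x"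
    using poly_fun_divide_form[OF Suc.prems(1) a] by blast
  have "(\<lambda>x. g' x * N x) = (\<lambda>x. form_at \<alpha> x ^ r * q x)"
  proof (rule poly_fun_eqI)
    show "poly_fun (\<lambda>x. g' x * N x)" "poly_fun (\<lambda>x. form_at \<alpha> x ^ r * q x)"
      by (rule poly_fun_mult poly_fun_power poly_fun_form g'(1) N Suc.prems(2))+
    show "poly_fun (\<lambda>x. form_at \<alpha> x)" by simp
    show "form_at \<alpha> a \<noteq> 0" using a by simp
    show "form_at \<alpha> x \<noteq> 0 \<Longrightarrow> g' x * N x = form_at \<alpha> x ^ r * q x" for x
      using Suc.prems(3)[of x] g'(2)[of x] by simp
  qed
  from Suc.IH[OF g'(1) Suc.prems(2) fun_cong[OF this]] obtain h where "poly_fun h" "\<forall>x. g' x = form_at \<alpha> x ^ r * h x" by blast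
  then show ?case using g' by (intro exI[of _ h]) auto
qed

section \<open>Scalar multiples, sums and products of complex matrices\<close>

definition smul :: "complex \<Rightarrow> complex^'a^'b \<Rightarrow> complex^'a^'b" where
  "smul c A = (\<chi> i j. c * A $ i $ j)"

lemma smul_nth [simp]: "smul c A $ i $ j = c * A $ i $ j" by (simp add: smul_def)

lemma smul_simps [simp]: "smul 1 A = A" "smul 0 A = 0" "smul c 0 = 0" "smul a (smul b A) = smul (a * b) A"
  by (simp_all add: vec_eq_iff)

lemma smul_add_right: "smul c (A + B) = smul c A + smul c B" by (simp add: vec_eq_iff algebra_simps)
lemma smul_diff_right: "smul c (A - B) = smul c A - smul c B" by (simp add: vec_eq_iff algebra_simps)
lemma smul_minus_right: "smul c (- A) = - smul c A" by (simp add: vec_eq_iff)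
lemma smul_add_left: "smul (a + b) A = smul a A + smul b A" by (simp add: vec_eq_iff algebra_simps)
lemma smul_diff_left: "smul (a - b) A = smul a A - smul b A" by (simp add: vec_eq_iff algebra_simps)
lemma smul_minus_left: "smul (- a) A = - smul a A" by (simp add: vec_eq_iff)
lemma smul_sum_right: "smul c (\<Sum>i\<in>S. f i) = (\<Sum>i\<in>S. smul c (f i))"
  by (simp add: vec_eq_iff sum_distrib_left)
lemma smul_sum_left: "smul (\<Sum>i\<in>S. f i) A = (\<Sum>i\<in>S. smul (f i) A)"
  by (simp add: vec_eq_iff sum_distrib_right)
lemma smul_eq_0: "smul c A = 0 \<longleftrightarrow> c = 0 \<or> A = 0" by (auto simp: vec_eq_iff)
lemma smul_cancel: "c \<noteq> 0 \<Longrightarrow> smul c A = smul c B \<longleftrightarrow> A = B" by (simp add: vec_eq_iff)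

lemma matrix_mult_smul_left [simp]: "smul c A ** B = smul c (A ** B)"
  by (simp add: vec_eq_iff matrix_matrix_mult_def sum_distrib_left algebra_simps)
lemma matrix_mult_smul_right [simp]: "A ** smul c B = smul c (A ** B)"
  by (simp add: vec_eq_iff matrix_matrix_mult_def sum_distrib_left algebra_simps)
lemma matrix_mult_add_left: "(A + A') ** (B :: complex^'c^'b) = A ** B + A' ** B"
  by (simp add: vec_eq_iff matrix_matrix_mult_def sum.distrib algebra_simps)
lemma matrix_mult_add_right: "(A :: complex^'c^'b) ** (B + B') = A ** B + A ** B'"
  by (simp add: vec_eq_iff matrix_matrix_mult_def sum.distrib algebra_simps)
lemma matrix_mult_diff_left: "(A - A') ** (B :: complex^'c^'b) = A ** B - A' ** B"
  by (simp add: vec_eq_iff matrix_matrix_mult_def sum_subtractf algebra_simps)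
lemma matrix_mult_diff_right: "(A :: complex^'c^'b) ** (B - B') = A ** B - A ** B'"
  by (simp add: vec_eq_iff matrix_matrix_mult_def sum_subtractf algebra_simps)
lemma matrix_mult_minus_left: "(- A) ** (B :: complex^'c^'b) = - (A ** B)"
  by (simp add: vec_eq_iff matrix_matrix_mult_def sum_negf)
lemma matrix_mult_minus_right: "(A :: complex^'c^'b) ** (- B) = - (A ** B)"
  by (simp add: vec_eq_iff matrix_matrix_mult_def sum_negf)
lemma matrix_mult_0 [simp]: "(0 :: complex^'a^'b) ** (B :: complex^'c^'a) = 0" "(C :: complex^'b^'c) ** (0 :: complex^'a^'b) = 0"
  by (simp_all add: vec_eq_iff matrix_matrix_mult_def)

lemma matrix_mult_sum_left: "(\<Sum>i\<in>S. f i) ** (B :: complex^'c^'b) = (\<Sum>i\<in>S. f i ** B)"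
  by (induction S rule: infinite_finite_induct) (simp_all add: matrix_mult_add_left)
lemma matrix_mult_sum_right: "(B :: complex^'c^'b) ** (\<Sum>i\<in>S. f i) = (\<Sum>i\<in>S. B ** f i)"
  by (induction S rule: infinite_finite_induct) (simp_all add: matrix_mult_add_right)

lemmas mat_alg = smul_add_right smul_diff_right smul_add_left smul_diff_left smul_minus_right smul_minus_left
  matrix_mult_add_left matrix_mult_add_right matrix_mult_diff_left matrix_mult_diff_right
  matrix_mult_minus_left matrix_mult_minus_right matrix_mul_assoc

section \<open>Matrix-valued functions and their directional derivatives\<close>

definition mat_localised :: "(complex^'n::finite \<Rightarrow> complex) \<Rightarrow> (complex^'n \<Rightarrow> complex^'a^'b) \<Rightarrow> bool" where
  "mat_localised D F \<longleftrightarrow> (\<forall>i j. localised D (\<lambda>x. F x $ i $ j))"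

definition mat_poly :: "(complex^'n::finite \<Rightarrow> complex^'a^'b) \<Rightarrow> bool" where
  "mat_poly F \<longleftrightarrow> (\<forall>i j. poly_fun (\<lambda>x. F x $ i $ j))"

definition mat_deriv :: "complex^'n \<Rightarrow> (complex^'n \<Rightarrow> complex^'a^'b) \<Rightarrow> complex^'n \<Rightarrow> complex^'a^'b" where
  "mat_deriv \<xi> F x = (\<chi> i j. dir_deriv \<xi> (\<lambda>x. F x $ i $ j) x)"

lemma mat_deriv_nth [simp]: "mat_deriv \<xi> F x $ i $ j = dir_deriv \<xi> (\<lambda>x. F x $ i $ j) x" by (simp add: mat_deriv_def)

lemma mat_localised_cong: "(\<And>x. D x \<noteq> 0 \<Longrightarrow> F x = G x) \<Longrightarrow> mat_localised D F \<longleftrightarrow> mat_localised D G"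
proof -
  assume a: "\<And>x. D x \<noteq> 0 \<Longrightarrow> F x = G x"
  have "localised D (\<lambda>x. F x $ i $ j) \<longleftrightarrow> localised D (\<lambda>x. G x $ i $ j)" for i j
    by (rule localised_cong) (simp add: a)
  then show ?thesis by (simp add: mat_localised_def)
qed

lemma mat_localised_const [simp]: "mat_localised D (\<lambda>x. C)" by (simp add: mat_localised_def)
lemma mat_localised_poly: "mat_poly F \<Longrightarrow> mat_localised D F" by (simp add: mat_localised_def mat_poly_def localised_poly)
lemma mat_localised_smul: "localised D f \<Longrightarrow> mat_localised D F \<Longrightarrow> mat_localised D (\<lambda>x. smul (f x) (F x))"
  by (simp add: mat_localised_def localised_mult)
lemma mat_localised_mono:
  assumes "\<And>x. D x = D' x * E x" "poly_fun E" "mat_localised D' F" shows "mat_localised D F"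
  using localised_mono[OF assms(1,2)] assms(3) by (auto simp: mat_localised_def)

lemma mat_poly_const [simp]: "mat_poly (\<lambda>x. C)" by (simp add: mat_poly_def)
lemma mat_poly_add: "mat_poly F \<Longrightarrow> mat_poly G \<Longrightarrow> mat_poly (\<lambda>x. F x + G x)"
  by (simp add: mat_poly_def poly_fun_add)
lemma mat_poly_smul: "poly_fun f \<Longrightarrow> mat_poly F \<Longrightarrow> mat_poly (\<lambda>x. smul (f x) (F x))"
  by (simp add: mat_poly_def poly_fun_mult)
lemma mat_poly_mult: "mat_poly F \<Longrightarrow> mat_poly G \<Longrightarrow> mat_poly (\<lambda>x. F x ** G x)"
  by (auto simp: mat_poly_def matrix_matrix_mult_def intro!: poly_fun_sum poly_fun_mult)

context
  fixes D :: "complex^'n::finite \<Rightarrow> complex"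
  assumes D: "poly_fun D"
begin

lemma mat_localised_add: "mat_localised D F \<Longrightarrow> mat_localised D G \<Longrightarrow> mat_localised D (\<lambda>x. F x + G x)"
  by (simp add: mat_localised_def localised_add[OF D])
lemma mat_localised_diff: "mat_localised D F \<Longrightarrow> mat_localised D G \<Longrightarrow> mat_localised D (\<lambda>x. F x - G x)"
  by (simp add: mat_localised_def localised_diff[OF D])
lemma mat_localised_mult: "mat_localised D F \<Longrightarrow> mat_localised D G \<Longrightarrow> mat_localised D (\<lambda>x. F x ** G x)"
  by (simp add: mat_localised_def matrix_matrix_mult_def localised_sum[OF D] localised_mult)
lemma mat_localised_sum: "(\<And>i. i \<in> S \<Longrightarrow> mat_localised D (F i)) \<Longrightarrow> mat_localised D (\<lambda>x. \<Sum>i\<in>S. F i x)"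
  by (simp add: mat_localised_def localised_sum[OF D])
lemma mat_localised_mat_deriv: "mat_localised D F \<Longrightarrow> mat_localised D (mat_deriv \<xi> F)"
  by (simp add: mat_localised_def localised_dir_deriv[OF D])

lemma mat_deriv_cong: "D x \<noteq> 0 \<Longrightarrow> (\<And>y. D y \<noteq> 0 \<Longrightarrow> F y = G y) \<Longrightarrow> mat_deriv \<xi> F x = mat_deriv \<xi> G x"
  by (auto simp: vec_eq_iff intro!: dir_deriv_cong[OF D])
lemma mat_deriv_add: "mat_localised D F \<Longrightarrow> mat_localised D G \<Longrightarrow> D x \<noteq> 0 \<Longrightarrow> mat_deriv \<xi> (\<lambda>x. F x + G x) x = mat_deriv \<xi> F x + mat_deriv \<xi> G x"
  by (simp add: vec_eq_iff mat_localised_def dir_deriv_add[OF D])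
lemma mat_deriv_diff: "mat_localised D F \<Longrightarrow> mat_localised D G \<Longrightarrow> D x \<noteq> 0 \<Longrightarrow> mat_deriv \<xi> (\<lambda>x. F x - G x) x = mat_deriv \<xi> F x - mat_deriv \<xi> G x"
  by (simp add: vec_eq_iff mat_localised_def dir_deriv_diff[OF D])
lemma mat_deriv_sum: "(\<And>i. i \<in> S \<Longrightarrow> mat_localised D (F i)) \<Longrightarrow> D x \<noteq> 0 \<Longrightarrow> mat_deriv \<xi> (\<lambda>x. \<Sum>i\<in>S. F i x) x = (\<Sum>i\<in>S. mat_deriv \<xi> (F i) x)"
  by (simp add: vec_eq_iff mat_localised_def dir_deriv_sum[OF D])
lemma mat_deriv_smul: "localised D f \<Longrightarrow> mat_localised D F \<Longrightarrow> D x \<noteq> 0 \<Longrightarrow>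
    mat_deriv \<xi> (\<lambda>x. smul (f x) (F x)) x = smul (dir_deriv \<xi> f x) (F x) + smul (f x) (mat_deriv \<xi> F x)"
  by (simp add: vec_eq_iff mat_localised_def dir_deriv_mult[OF D])
lemma mat_deriv_mult: "mat_localised D F \<Longrightarrow> mat_localised D G \<Longrightarrow> D x \<noteq> 0 \<Longrightarrow>
    mat_deriv \<xi> (\<lambda>x. F x ** G x) x = mat_deriv \<xi> F x ** G x + F x ** mat_deriv \<xi> G x"
  by (simp add: vec_eq_iff mat_localised_def matrix_matrix_mult_def dir_deriv_sum[OF D] localised_mult dir_deriv_mult[OF D] sum.distrib)
lemma mat_deriv_linear: "mat_localised D F \<Longrightarrow> D x \<noteq> 0 \<Longrightarrow> mat_deriv (a *s \<xi> + b *s \<eta>) F x = smul a (mat_deriv \<xi> F x) + smul b (mat_deriv \<eta> F x)"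
  by (simp add: vec_eq_iff mat_localised_def dir_deriv_linear[OF D])
lemma mat_deriv_commute: "mat_localised D F \<Longrightarrow> D x \<noteq> 0 \<Longrightarrow> mat_deriv \<xi> (mat_deriv \<eta> F) x = mat_deriv \<eta> (mat_deriv \<xi> F) x"
  by (simp add: vec_eq_iff mat_localised_def dir_deriv_commute[OF D])

lemma mat_localised_divide_form:
  assumes a: "form_at \<alpha> a = 1" and x0: "form_at \<alpha> x0 = 0" "D x0 \<noteq> 0"
    and f: "mat_localised D F" and z: "\<And>x. form_at \<alpha> x = 0 \<Longrightarrow> D x \<noteq> 0 \<Longrightarrow> F x = 0"
  shows "\<exists>G. mat_localised D G \<and> (\<forall>x. D x \<noteq> 0 \<longrightarrow> F x = smul (form_at \<alpha> x) (G x))"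
proof -
  have "\<exists>g. localised D g \<and> (\<forall>x. D x \<noteq> 0 \<longrightarrow> F x $ i $ j = form_at \<alpha> x * g x)" for i j
    by (rule localised_divide_form[OF D a x0]) (use f z in \<open>auto simp: mat_localised_def\<close>)
  then obtain g where g: "\<And>i j. localised D (g i j)" "\<And>i j x. D x \<noteq> 0 \<Longrightarrow> F x $ i $ j = form_at \<alpha> x * g i j x" by metis
  then show ?thesis by (intro exI[of _ "\<lambda>x. \<chi> i j. g i j x"]) (auto simp: mat_localised_def vec_eq_iff)
qed

end

lemma mat_deriv_const [simp]: "mat_deriv \<xi> (\<lambda>x. C) x = 0" by (simp add: vec_eq_iff)

section \<open>The reflection arrangement\<close>

lemma matrix_inv_mult:
  fixes A :: "'a::field^'n^'n"
  assumes "invertible A" shows "A ** matrix_inv A = mat 1" "matrix_inv A ** A = mat 1"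
proof -
  have "A ** matrix_inv A = mat 1 \<and> matrix_inv A ** A = mat 1"
    using assms unfolding matrix_inv_def invertible_def by (rule someI_ex)
  then show "A ** matrix_inv A = mat 1" "matrix_inv A ** A = mat 1" by auto
qed

lemma invertible_matrix_inv: "invertible A \<Longrightarrow> invertible (matrix_inv (A :: 'a::field^'n^'n))"
  using matrix_inv_mult[of A] unfolding invertible_def by blast

lemma matrix_inv_unique:
  fixes A :: "'a::field^'n^'n"
  assumes "A ** B = mat 1" shows "matrix_inv A = B"
proof -
  have "B ** A = mat 1" using assms by (rule matrix_left_right_inverse[THEN iffD1])
  with assms have "invertible A" unfolding invertible_def by blast
  then have "matrix_inv A ** (A ** B) = B" by (simp add: matrix_mul_assoc matrix_inv_mult)
  with assms show ?thesis by simp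
qed

lemma invertible_iff_det: "invertible (A :: complex^'n^'n) \<longleftrightarrow> det A \<noteq> 0"
  by (rule invertible_det_nz)

lemma mat_mult_eq_smul: "mat c ** A = smul c (A :: complex^'n^'m)"
proof -
  have "(\<Sum>k\<in>UNIV. (if i = k then c else 0) * A $ k $ j) = c * A $ i $ j" for i j
    by (subst sum.cong[OF refl, of _ _ "\<lambda>k. if i = k then c * A $ i $ j else 0"]) auto
  then show ?thesis by (simp add: vec_eq_iff matrix_matrix_mult_def mat_def)
qed

lemma sum_const_smul: "(\<Sum>w\<in>S. C) = smul (of_nat (card S)) (C :: complex^'a^'b)"
  by (induction S rule: infinite_finite_induct) (simp_all add: smul_add_left del: sum_constant)

lemma smul_vector: "smul c A *v x = c *s (A *v x)"
  by (simp add: vec_eq_iff matrix_vector_mult_def sum_distrib_left algebra_simps)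

lemma sum_matrix_vector: "(\<Sum>i\<in>S. f i) *v (x :: complex^'n) = (\<Sum>i\<in>S. f i *v x)"
  by (induction S rule: infinite_finite_induct) (simp_all add: matrix_vector_mult_add_rdistrib)

lemma mv_smult: "A *v (c *s x) = c *s (A *v (x :: complex^'n))"
  by (simp add: vec_eq_iff matrix_vector_mult_def sum_distrib_left algebra_simps)
lemma mv_sum: "A *v (\<Sum>i\<in>S. f i) = (\<Sum>i\<in>S. A *v (f i :: complex^'n))"
  by (induction S rule: infinite_finite_induct) (simp_all add: matrix_vector_right_distrib)
lemma form_at_sum: "form_at a (\<Sum>i\<in>S. f i) = (\<Sum>i\<in>S. form_at a (f i))"
  by (induction S rule: infinite_finite_induct) simp_all

lemma form_at_mv: "form_at a (w *v x) = form_at (a v* w) x"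
  by (simp add: form_at_def matrix_vector_mult_def vector_matrix_mult_def sum_distrib_left sum_distrib_right)
     (subst sum.swap, simp add: mult_ac)

text \<open>In coordinates where \<beta> is the k-th coordinate, the identity plus a rank one map
  with this form differs from the identity in a single column, and Cramer's rule evaluates its
  determinant.\<close>

lemma det_rank_one_update:
  fixes w :: "complex^'n::finite^'n"
  assumes w: "\<And>x. w *v x = x + form_at \<beta> x *s b"
  shows "det w = 1 + form_at \<beta> b"
proof (cases "\<beta> = 0")
  case True
  then have "w = mat 1" by (simp add: matrix_eq w form_at_def)
  then show ?thesis using True by (simp add: form_at_def)
next
  case False
  then obtain k where k: "\<beta> $ k \<noteq> 0" by (auto simp: vec_eq_iff)
  \<comment> \<open>The change of coordinates that takes \<beta> as k-th coordinate; it is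
    invertible because the k-th coefficient of \<beta> is nonzero.\<close>
  define S :: "complex^'n^'n" where "S = (\<chi> i. if i = k then \<beta> else axis i 1)"
  have S: "(S *v x) $ i = (if i = k then form_at \<beta> x else x $ i)" for x i
    by (simp add: S_def matrix_vector_mult_def form_at_def axis_def if_distrib[of "\<lambda>z. z * _"] cong: if_cong)
  have "x = 0" if "S *v x = 0" for x
  proof -
    have x: "x $ i = 0" if "i \<noteq> k" for i using S[of x i] \<open>S *v x = 0\<close> that by simp
    have "form_at \<beta> x = (\<Sum>i\<in>UNIV. if i = k then \<beta> $ k * x $ k else 0)"
      unfolding form_at_def by (rule sum.cong) (auto simp: x)
    then have "\<beta> $ k * x $ k = 0" using S[of x k] \<open>S *v x = 0\<close> by simp
    then show "x = 0" using x k by (auto simp: vec_eq_iff) (metis)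
  qed
  then have "\<exists>B. B ** S = mat 1" using matrix_left_invertible_ker by blast
  then have "invertible S" by (simp add: invertible_left_inverse)
  then have dS: "det S \<noteq> 0" by (simp add: invertible_det_nz)
  define y where "y = axis k 1 + S *v b"
  define T :: "complex^'n^'n" where "T = (\<chi> i j. if j = k then y $ i else (mat 1 :: complex^'n^'n) $ i $ j)"
  have dT: "det T = 1 + form_at \<beta> b"
    using cramer_lemma[of k "mat 1" y, unfolded matrix_vector_mul_lid] by (simp add: T_def y_def S)
  have Tx: "T *v x = x + x $ k *s (S *v b)" for x
  proof -
    have "(\<Sum>j\<in>UNIV. T $ i $ j * x $ j) = x $ i + x $ k * (S *v b) $ i" for i
    proof -
      have "(\<Sum>j\<in>UNIV. T $ i $ j * x $ j) = (\<Sum>j\<in>UNIV. (if j = i then x $ i else 0) + (if j = k then x $ k * (S *v b) $ i else 0))"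
        by (rule sum.cong) (auto simp: T_def y_def axis_def mat_def algebra_simps)
      then show ?thesis by (simp add: sum.distrib)
    qed
    then show ?thesis by (simp add: vec_eq_iff matrix_vector_mult_def)
  qed
  \<comment> \<open>T is w in the new coordinates, so the determinant of S cancels.\<close>
  have "S ** w = T ** S"
    by (simp add: matrix_eq matrix_vector_mul_assoc[symmetric] Tx w S matrix_vector_right_distrib
        mv_smult)
  then have "det S * det w = det T * det S" by (metis det_mul)
  with dS dT show ?thesis by simp
qed

locale refl_arr =
  fixes W :: "(complex^'n::finite^'n) set"
    and \<alpha> :: "(complex^'n) set \<Rightarrow> complex^'n"
    and m :: "(complex^'n) set \<Rightarrow> nat"
  assumes irrW: "irreducible_reflection_group W"
    and def_arr: "defines_arrangement W \<alpha>"
    and inv_m: "invariant_on_arrangement W m"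
begin

abbreviation "arr \<equiv> arrangement W"
abbreviation "frm H \<equiv> form_at (\<alpha> H)"
abbreviation "WH \<equiv> pointwise_stabiliser W"
abbreviation "nH \<equiv> n_H W"
abbreviation "act w \<equiv> \<lambda>H. (\<lambda>v. w *v v) ` H"

lemma fin_refl: "finite_reflection_group W" using irrW by (simp add: irreducible_reflection_group_def)
lemma finite_W: "finite W" using fin_refl by (simp add: finite_reflection_group_def)

lemma group_GL: "group (GL :: (complex^'n^'n) monoid)"
proof (rule groupI)
  fix x y :: "complex^'n^'n"
  assume x: "x \<in> carrier GL"
  then show "\<exists>y\<in>carrier GL. y \<otimes>\<^bsub>GL\<^esub> x = \<one>\<^bsub>GL\<^esub>"
    by (intro bexI[of _ "matrix_inv x"]) (auto simp: GL_def matrix_inv_mult invertible_matrix_inv)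
  assume y: "y \<in> carrier GL"
  show "x \<otimes>\<^bsub>GL\<^esub> y \<in> carrier GL" using x y by (auto simp: GL_def invertible_mult)
qed (auto simp: GL_def matrix_mul_assoc intro: exI[of _ "mat 1"] simp: invertible_def)

lemma sub_GL: "subgroup W (GL :: (complex^'n^'n) monoid)"
  using fin_refl by (simp add: finite_reflection_group_def)

lemma one_W: "mat 1 \<in> W" using subgroup.one_closed[OF sub_GL] by (simp add: GL_def)
lemma mult_W: "u \<in> W \<Longrightarrow> w \<in> W \<Longrightarrow> u ** w \<in> W" using subgroup.m_closed[OF sub_GL, of u w] by (simp add: GL_def)
lemma invertible_W: "w \<in> W \<Longrightarrow> invertible w" using subgroup.subset[OF sub_GL] by (auto simp: GL_def)
lemma inv_W: assumes "w \<in> W" shows "matrix_inv w \<in> W"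
proof -
  have "inv\<^bsub>GL\<^esub> w = matrix_inv w"
    by (rule group.inv_equality[OF group_GL])
       (use invertible_W[OF assms] in \<open>auto simp: GL_def matrix_inv_mult invertible_matrix_inv\<close>)
  then show ?thesis using subgroup.m_inv_closed[OF sub_GL assms] by simp
qed
lemma W_inv_mult: "w \<in> W \<Longrightarrow> w ** matrix_inv w = mat 1" "w \<in> W \<Longrightarrow> matrix_inv w ** w = mat 1"
  using matrix_inv_mult invertible_W by auto
lemma W_inv_vec [simp]: "w \<in> W \<Longrightarrow> w *v (matrix_inv w *v x) = x" "w \<in> W \<Longrightarrow> matrix_inv w *v (w *v x) = x"
  by (simp_all add: matrix_vector_mul_assoc W_inv_mult)
lemma inv_inv_W: "w \<in> W \<Longrightarrow> matrix_inv (matrix_inv w) = w"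
  by (rule matrix_inv_unique) (rule W_inv_mult)
lemma inv_mult_W: "u \<in> W \<Longrightarrow> w \<in> W \<Longrightarrow> matrix_inv (u ** w) = matrix_inv w ** matrix_inv u"
  by (rule matrix_inv_unique) (metis W_inv_mult(1) matrix_mul_assoc matrix_mul_lid)

lemma finite_arr: "finite arr" unfolding arrangement_def using finite_W by auto

lemma arr_kernel: "H \<in> arr \<Longrightarrow> v \<in> H \<longleftrightarrow> frm H v = 0"
  using def_arr unfolding defines_arrangement_def by blast

text \<open>The fixed space of a reflection has dimension N - 1 with N > 0, so H is a proper
  subspace and its form is nonzero.\<close>

lemma arr_proper:
  assumes "H \<in> arr" shows "\<exists>a. frm H a = 1"
proof -
  obtain w where w: "H = fixed_space w" "is_reflection w" using assms by (auto simp: arrangement_def)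
  have "H \<noteq> UNIV"
  proof
    assume "H = UNIV"
    then have "CARD('n) = CARD('n) - 1" using w vec_dim_card[where 'a=complex and 'n='n] unfolding is_reflection_def by metis
    moreover have "CARD('n) > 0" by simp
    ultimately show False by linarith
  qed
  then obtain v where "frm H v \<noteq> 0" using arr_kernel[OF assms] by blast
  then show ?thesis by (intro exI[of _ "(1 / frm H v) *s v"]) simp
qed

lemma V_reg_iff: "x \<in> V_reg W \<longleftrightarrow> (\<forall>H\<in>arr. frm H x \<noteq> 0)"
  by (auto simp: V_reg_def arr_kernel)

lemma form_kernel_subset:
  assumes a: "form_at \<beta> a = 1" and sub: "\<And>x. form_at \<beta> x = 0 \<Longrightarrow> form_at \<gamma> x = 0"
  shows "form_at \<gamma> x = form_at \<gamma> a * form_at \<beta> x"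
proof -
  have "form_at \<gamma> (x - form_at \<beta> x *s a) = 0" by (rule sub) (simp add: a)
  then show ?thesis by simp
qed

lemma arr_distinct:
  assumes "H \<in> arr" "H' \<in> arr" "H \<noteq> H'" shows "\<exists>x. frm H x = 0 \<and> frm H' x \<noteq> 0"
proof (rule ccontr)
  assume "\<not> ?thesis"
  then have s: "\<And>x. frm H x = 0 \<Longrightarrow> frm H' x = 0" by blast
  obtain a a' where a: "frm H a = 1" "frm H' a' = 1" using arr_proper assms by blast
  have e: "frm H' x = frm H' a * frm H x" for x by (rule form_kernel_subset[OF a(1) s])
  then have "frm H' a \<noteq> 0" using a(2) by (metis mult_zero_left zero_neq_one)
  then have "v \<in> H \<longleftrightarrow> v \<in> H'" for v using e[of v] arr_kernel assms(1,2) by simp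
  then show False using assms(3) by blast
qed

text \<open>A complex vector space is not a finite union of proper subspaces. Given x good for S and
  y good for b, all but finitely many points x + t y are good for both.\<close>

lemma avoid_forms:
  assumes "finite S" "\<And>\<beta>. \<beta> \<in> S \<Longrightarrow> \<exists>y. form_at \<gamma> y = 0 \<and> form_at \<beta> y \<noteq> 0"
  shows "\<exists>x. form_at \<gamma> x = 0 \<and> (\<forall>\<beta>\<in>S. form_at \<beta> x \<noteq> 0)"
  using assms
proof (induction S rule: finite_induct)
  case empty
  show ?case by (rule exI[of _ 0]) simp
next
  case (insert b S)
  then obtain x where x: "form_at \<gamma> x = 0" "\<forall>\<beta>\<in>S. form_at \<beta> x \<noteq> 0" by auto
  obtain y where y: "form_at \<gamma> y = 0" "form_at b y \<noteq> 0" using insert.prems by blast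
  have "finite ((\<lambda>\<beta>. - form_at \<beta> y / form_at \<beta> x) ` S \<union> {- form_at b x / form_at b y} \<union> {0} :: complex set)"
    using insert.hyps by simp
  \<comment> \<open>For a form that is nonzero at y the quotient is the only t at which it vanishes
    on the line. A form that vanishes at y is constant on the line and belongs to S, hence is
    nonzero there.\<close>
  define B where "B = (\<lambda>\<beta>. - form_at \<beta> x / form_at \<beta> y) ` insert b S"
  have "finite B" using insert.hyps by (simp add: B_def)
  then obtain t where t: "t \<notin> B" using ex_new_if_finite[OF infinite_UNIV_char_0] by blast
  show ?case
  proof (intro exI conjI ballI)
    show "form_at \<gamma> (x + t *s y) = 0" using x y by simp
    fix \<beta> assume b: "\<beta> \<in> insert b S"
    then have t': "t \<noteq> - form_at \<beta> x / form_at \<beta> y" using t unfolding B_def by blast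
    show "form_at \<beta> (x + t *s y) \<noteq> 0"
    proof (cases "form_at \<beta> y = 0")
      case True then show ?thesis using b x y by auto
    next
      case False then show ?thesis using t' by (auto simp: field_simps add_eq_0_iff)
    qed
  qed
qed

definition "\<delta> x = (\<Prod>H\<in>arr. frm H x)"
text \<open>Inverting \<open>dH H\<close> but not \<open>frm H\<close> describes functions near the
  generic points of H, those that lie on no other hyperplane.\<close>

definition "dH H x = (\<Prod>H'\<in>arr - {H}. frm H' x)"

lemma poly_\<delta> [simp]: "poly_fun \<delta>" unfolding \<delta>_def by (intro poly_fun_prod) auto
lemma poly_dH [simp]: "poly_fun (dH H)" unfolding dH_def by (intro poly_fun_prod) auto
lemma \<delta>_split: "H \<in> arr \<Longrightarrow> \<delta> x = frm H x * dH H x"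
  unfolding \<delta>_def dH_def by (rule prod.remove[OF finite_arr])
lemma \<delta>_nz: "\<delta> x \<noteq> 0 \<longleftrightarrow> x \<in> V_reg W" by (simp add: \<delta>_def V_reg_iff finite_arr)
lemma dH_nz: "dH H x \<noteq> 0 \<longleftrightarrow> (\<forall>H'\<in>arr - {H}. frm H' x \<noteq> 0)" by (simp add: dH_def finite_arr)

lemma V_reg_frm: "x \<in> V_reg W \<Longrightarrow> H \<in> arr \<Longrightarrow> frm H x \<noteq> 0" by (simp add: V_reg_iff)
lemma V_reg_dH: "x \<in> V_reg W \<Longrightarrow> dH H x \<noteq> 0" by (simp add: V_reg_iff dH_nz)

lemma hyperplane_point:
  assumes "H \<in> arr" shows "\<exists>x. frm H x = 0 \<and> dH H x \<noteq> 0"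
proof -
  have "\<exists>x. frm H x = 0 \<and> (\<forall>\<beta>\<in>\<alpha> ` (arr - {H}). form_at \<beta> x \<noteq> 0)"
    by (rule avoid_forms) (use finite_arr arr_distinct assms in auto)
  then show ?thesis by (auto simp: dH_nz)
qed

lemma V_reg_nonempty: "\<exists>x. x \<in> V_reg W"
proof -
  \<comment> \<open>The zero form has the whole space as its kernel.\<close>
  have "\<exists>x. form_at 0 x = 0 \<and> (\<forall>\<beta>\<in>\<alpha> ` arr. form_at \<beta> x \<noteq> 0)"
  proof (rule avoid_forms)
    fix \<beta> assume "\<beta> \<in> \<alpha> ` arr"
    then obtain H where H: "H \<in> arr" "\<beta> = \<alpha> H" by blast
    then obtain a where "frm H a = 1" using arr_proper by blast
    then show "\<exists>y. form_at 0 y = 0 \<and> form_at \<beta> y \<noteq> 0" using H by (intro exI[of _ a]) (simp add: form_at_def)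
  qed (use finite_arr in auto)
  then show ?thesis by (auto simp: V_reg_iff)
qed

section \<open>Pointwise stabilisers of hyperplanes and the determinant character\<close>

lemma WH_sub: "w \<in> WH H \<Longrightarrow> w \<in> W" by (simp add: pointwise_stabiliser_def)
lemma WH_fix: "w \<in> WH H \<Longrightarrow> v \<in> H \<Longrightarrow> w *v v = v" by (simp add: pointwise_stabiliser_def)
lemma finite_WH: "finite (WH H)" using finite_W by (simp add: pointwise_stabiliser_def)
lemma one_WH: "mat 1 \<in> WH H" by (simp add: pointwise_stabiliser_def one_W)
lemma mult_WH: "u \<in> WH H \<Longrightarrow> w \<in> WH H \<Longrightarrow> u ** w \<in> WH H"
  by (simp add: pointwise_stabiliser_def mult_W matrix_vector_mul_assoc[symmetric])
lemma inv_WH: assumes "w \<in> WH H" shows "matrix_inv w \<in> WH H"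
proof -
  have "matrix_inv w *v v = v" if "v \<in> H" for v
    using W_inv_vec(2)[of w v] WH_fix[OF assms that] WH_sub[OF assms] by simp
  then show ?thesis using assms inv_W by (simp add: pointwise_stabiliser_def)
qed

lemma nH_pos: "nH H > 0" using one_WH finite_WH by (auto simp: n_H_def card_gt_0_iff)

lemma nH_ge_2: assumes "H \<in> arr" shows "nH H \<ge> 2"
proof -
  obtain w where w: "H = fixed_space w" "is_reflection w" "w \<in> W" using assms by (auto simp: arrangement_def)
  have "w \<noteq> mat 1"
  proof
    assume "w = mat 1"
    then have "fixed_space w = UNIV" by (simp add: fixed_space_def)
    then have "CARD('n) = CARD('n) - 1" using w vec_dim_card[where 'a=complex and 'n='n] unfolding is_reflection_def by metis
    moreover have "CARD('n) > 0" by simp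
    ultimately show False by linarith
  qed
  moreover have "{mat 1, w} \<subseteq> WH H" using w one_WH by (auto simp: pointwise_stabiliser_def fixed_space_def)
  ultimately show ?thesis unfolding n_H_def using card_mono[OF finite_WH, of "{mat 1, w}" H] by simp
qed

text \<open>Since w fixes H pointwise, w - 1 has rank at most one with image spanned by b, and the
  determinant formula for such maps identifies the eigenvalue on V / H.\<close>

lemma WH_frm:
  assumes H: "H \<in> arr" and w: "w \<in> WH H" shows "frm H (w *v x) = det w * frm H x"
proof -
  obtain a where a: "frm H a = 1" using arr_proper[OF H] by blast
  define b where "b = w *v a - a"
  have wx: "w *v x = x + frm H x *s b" for x
  proof -
    have "x - frm H x *s a \<in> H" using a by (simp add: arr_kernel[OF H])
    then have "w *v (x - frm H x *s a) = x - frm H x *s a" using WH_fix[OF w] by blast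
    then show ?thesis unfolding b_def
      by (simp add: matrix_vector_mult_diff_distrib mv_smult algebra_simps)
  qed
  from det_rank_one_update[OF wx] show ?thesis by (simp add: wx algebra_simps)
qed

lemma det_nz_W: "w \<in> W \<Longrightarrow> det w \<noteq> 0" using invertible_W by (simp add: invertible_det_nz)

lemma bij_WH_mult: assumes "u \<in> WH H" shows "bij_betw (\<lambda>w. u ** w) (WH H) (WH H)"
  by (rule bij_betw_byWitness[where f'="\<lambda>w. matrix_inv u ** w"])
     (use assms mult_WH inv_WH W_inv_mult[OF WH_sub[OF assms]] in \<open>auto simp: matrix_mul_assoc\<close>)

text \<open>Averaging det(u)^{-1} u over W_H projects onto the part of V on which W_H acts by det;
  by \<open>WH_frm\<close> the average keeps the value 1 of the form.\<close>

lemma coroot_exists: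
  assumes H: "H \<in> arr"
  shows "\<exists>a. frm H a = 1 \<and> (\<forall>u\<in>WH H. u *v a = det u *s a)"
proof -
  obtain b where b: "frm H b = 1" using arr_proper[OF H] by blast
  define a where "a = (1 / of_nat (nH H)) *s (\<Sum>u\<in>WH H. (1 / det u) *s (u *v b))"
  have "frm H a = (1 / of_nat (nH H)) * (\<Sum>u\<in>WH H. 1)"
    unfolding a_def using det_nz_W WH_sub by (simp add: form_at_sum WH_frm[OF H] b)
  then have "frm H a = 1" using nH_pos[of H] by (simp add: n_H_def)
  moreover have "w *v a = det w *s a" if w: "w \<in> WH H" for w
  proof -
    have dw: "det w \<noteq> 0" using det_nz_W WH_sub w by blast
    have "w *v (\<Sum>u\<in>WH H. (1 / det u) *s (u *v b)) = (\<Sum>u\<in>WH H. det w *s ((1 / det (w ** u)) *s ((w ** u) *v b)))"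
      unfolding mv_sum by (rule sum.cong) (use dw in \<open>simp_all add: mv_smult det_mul matrix_vector_mul_assoc\<close>)
    also have "\<dots> = (\<Sum>u\<in>WH H. det w *s ((1 / det u) *s (u *v b)))"
      by (rule sum.reindex_bij_betw[OF bij_WH_mult[OF w], of "\<lambda>u. det w *s ((1 / det u) *s (u *v b))"])
    also have "\<dots> = det w *s (\<Sum>u\<in>WH H. (1 / det u) *s (u *v b))"
      by (simp only: vec.scale_sum_right)
    finally show ?thesis unfolding a_def by (simp add: mv_smult mult.commute)
  qed
  ultimately show ?thesis by blast
qed

text \<open>A root of H: it spans the line complementary to H on which W_H acts by det. The
  normalisation makes x -> \<open>frm H x *s coroot H\<close> the projection onto this line along
  H.\<close>

definition "coroot H = (SOME a. frm H a = 1 \<and> (\<forall>u\<in>WH H. u *v a = det u *s a))"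

lemma coroot: assumes "H \<in> arr" shows frm_coroot: "frm H (coroot H) = 1" and WH_coroot: "u \<in> WH H \<Longrightarrow> u *v coroot H = det u *s coroot H"
proof -
  have "frm H (coroot H) = 1 \<and> (\<forall>u\<in>WH H. u *v coroot H = det u *s coroot H)"
    unfolding coroot_def by (rule someI_ex) (rule coroot_exists[OF assms])
  then show "frm H (coroot H) = 1" "u \<in> WH H \<Longrightarrow> u *v coroot H = det u *s coroot H" by auto
qed

lemma WH_apply:
  assumes H: "H \<in> arr" and w: "w \<in> WH H"
  shows "w *v x = x + ((det w - 1) * frm H x) *s coroot H"
proof -
  have "x - frm H x *s coroot H \<in> H" by (simp add: arr_kernel[OF H] frm_coroot[OF H])
  then have "w *v (x - frm H x *s coroot H) = x - frm H x *s coroot H" using WH_fix[OF w] by blast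
  then show ?thesis using WH_coroot[OF H w]
    by (simp add: matrix_vector_mult_diff_distrib mv_smult) (simp add: vec_eq_iff algebra_simps)
qed

lemma WH_det_inj: "H \<in> arr \<Longrightarrow> u \<in> WH H \<Longrightarrow> w \<in> WH H \<Longrightarrow> det u = det w \<Longrightarrow> u = w"
  by (simp add: matrix_eq WH_apply)

lemma WH_det_power: assumes w: "w \<in> WH H" shows "det w ^ nH H = 1"
proof -
  have "(\<Prod>u\<in>WH H. det u) = (\<Prod>u\<in>WH H. det (w ** u))"
    by (rule prod.reindex_bij_betw[OF bij_WH_mult[OF w], symmetric])
  also have "\<dots> = det w ^ nH H * (\<Prod>u\<in>WH H. det u)" by (simp add: det_mul prod.distrib n_H_def)
  finally show ?thesis using det_nz_W WH_sub finite_WH by (auto simp: prod_zero_iff)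
qed

lemma WH_character_sum:
  fixes ch :: "complex^'n^'n \<Rightarrow> complex"
  assumes mult: "\<And>u w. u \<in> WH H \<Longrightarrow> w \<in> WH H \<Longrightarrow> ch (u ** w) = ch u * ch w"
    and u: "u \<in> WH H" "ch u \<noteq> 1"
  shows "(\<Sum>w\<in>WH H. ch w) = 0"
proof -
  have "(\<Sum>w\<in>WH H. ch w) = (\<Sum>w\<in>WH H. ch (u ** w))"
    by (rule sum.reindex_bij_betw[OF bij_WH_mult[OF u(1)], symmetric])
  also have "\<dots> = ch u * (\<Sum>w\<in>WH H. ch w)" by (simp add: mult u sum_distrib_left)
  finally show ?thesis using u(2) by simp
qed

lemma WH_det_sum_range:
  assumes H: "H \<in> arr" and w: "w \<in> WH H"
  shows "(\<Sum>i\<in>{1..nH H - 1}. det w ^ i) = (if w = mat 1 then of_nat (nH H) else 0) - 1"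
proof -
  \<comment> \<open>Adjoining the exponent 0 completes a geometric sum and accounts for the
    -1.\<close>
  have e: "{..<nH H} = insert 0 {1..nH H - 1}" using nH_pos[of H] by auto
  have "(\<Sum>i<nH H. det w ^ i) = (if w = mat 1 then of_nat (nH H) else 0)"
  proof (cases "w = mat 1")
    case False
    then have "det w \<noteq> 1" using WH_det_inj[OF H w one_WH] by auto
    then show ?thesis using False by (simp add: geometric_sum WH_det_power[OF w])
  qed simp
  then show ?thesis unfolding e by (simp add: algebra_simps)
qed

text \<open>det is injective on W_H, and at most i complex numbers satisfy z^i = 1. Hence det^i is a
  nontrivial character for 0 < i < n_H, and its sum vanishes.\<close>

lemma WH_det_sum_power:
  assumes H: "H \<in> arr"
  shows "(\<Sum>w\<in>WH H. det w ^ nH H) = of_nat (nH H)"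
    and "1 \<le> i \<Longrightarrow> i < nH H \<Longrightarrow> (\<Sum>w\<in>WH H. det w ^ i) = 0"
proof -
  show "(\<Sum>w\<in>WH H. det w ^ nH H) = of_nat (nH H)" by (simp add: WH_det_power) (simp add: n_H_def)
  assume i: "1 \<le> i" "i < nH H"
  have "\<exists>u\<in>WH H. det u ^ i \<noteq> 1"
  proof (rule ccontr)
    assume "\<not> ?thesis"
    then have sub: "det ` WH H \<subseteq> {z. z ^ i = 1}" by auto
    have fin: "finite {z::complex. z ^ i = 1}" using i by (intro finite_roots_unity) auto
    have "card {z::complex. z ^ i = 1} \<le> i" using i by (intro card_roots_unity) auto
    then have "card (det ` WH H) \<le> i" using card_mono[OF fin sub] by linarith
    moreover have "card (det ` WH H) = nH H" unfolding n_H_def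
      by (rule card_image) (auto intro!: inj_onI WH_det_inj[OF H])
    ultimately show False using i by simp
  qed
  then obtain u where "u \<in> WH H" "det u ^ i \<noteq> 1" by blast
  then show "(\<Sum>w\<in>WH H. det w ^ i) = 0"
    by (intro WH_character_sum[where ch="\<lambda>w. det w ^ i"]) (auto simp: det_mul power_mult_distrib)
qed

text \<open>The residue of the connection along H for multiplicity 1. \<open>avg\<close> is the
  projection onto the W_H-invariants and \<open>prj\<close> the complementary projection.\<close>

definition Kop :: "(complex^'n^'n \<Rightarrow> complex^'d^'d) \<Rightarrow> (complex^'n) set \<Rightarrow> complex^'d^'d" where
  "Kop \<tau> H = (\<Sum>i\<in>{1..nH H - 1}. e_op W \<tau> H i)"
definition avg :: "(complex^'n^'n \<Rightarrow> complex^'d^'d) \<Rightarrow> (complex^'n) set \<Rightarrow> complex^'d^'d" where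
  "avg \<tau> H = smul (1 / of_nat (nH H)) (\<Sum>w\<in>WH H. \<tau> w)"
definition prj :: "(complex^'n^'n \<Rightarrow> complex^'d^'d) \<Rightarrow> (complex^'n) set \<Rightarrow> complex^'d^'d" where
  "prj \<tau> H = mat 1 - avg \<tau> H"

lemma rep_one: "representation W \<tau> \<Longrightarrow> \<tau> (mat 1) = mat 1" by (simp add: representation_def)
lemma rep_mult: "representation W \<tau> \<Longrightarrow> u \<in> W \<Longrightarrow> w \<in> W \<Longrightarrow> \<tau> (u ** w) = \<tau> u ** \<tau> w"
  by (simp add: representation_def)
lemma rep_inv:
  assumes "representation W \<tau>" "w \<in> W"
  shows "\<tau> w ** \<tau> (matrix_inv w) = mat 1" "\<tau> (matrix_inv w) ** \<tau> w = mat 1"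
  using rep_mult[OF assms(1,2) inv_W[OF assms(2)]] rep_mult[OF assms(1) inv_W[OF assms(2)] assms(2)]
  by (simp_all add: W_inv_mult assms rep_one)

lemma rep_id: "representation W (\<lambda>w. w)" by (simp add: representation_def)

text \<open>After interchanging the sums, w has the coefficient n_H - 1 if it is the identity and -1
  otherwise. So whatever \<tau> is, the residue has no eigenvalues other than 0 and n_H.\<close>

lemma Kop_eq:
  assumes rep: "representation W \<tau>" and H: "H \<in> arr"
  shows "Kop \<tau> H = smul (of_nat (nH H)) (prj \<tau> H)"
proof -
  have "Kop \<tau> H = (\<Sum>w\<in>WH H. smul (\<Sum>i\<in>{1..nH H - 1}. det w ^ i) (\<tau> w))"
    unfolding Kop_def e_op_def mat_mult_eq_smul smul_sum_left by (rule sum.swap)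
  also have "\<dots> = (\<Sum>w\<in>WH H. (if w = mat 1 then smul (of_nat (nH H)) (mat 1) else 0) - \<tau> w)"
  proof (rule sum.cong[OF refl])
    fix w assume "w \<in> WH H"
    from WH_det_sum_range[OF H this]
    show "smul (\<Sum>i\<in>{1..nH H - 1}. det w ^ i) (\<tau> w) = (if w = mat 1 then smul (of_nat (nH H)) (mat 1) else 0) - \<tau> w"
      by (simp only:) (simp add: smul_diff_left rep_one[OF rep])
  qed
  also have "\<dots> = smul (of_nat (nH H)) (mat 1) - (\<Sum>w\<in>WH H. \<tau> w)"
    by (simp add: sum_subtractf finite_WH one_WH)
  finally show ?thesis using nH_pos[of H] by (simp add: prj_def avg_def smul_diff_right)
qed

lemma avg_absorb:
  assumes rep: "representation W \<tau>" and u: "u \<in> WH H"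
  shows "\<tau> u ** avg \<tau> H = avg \<tau> H" "avg \<tau> H ** \<tau> u = avg \<tau> H"
proof -
  have "(\<Sum>w\<in>WH H. \<tau> u ** \<tau> w) = (\<Sum>w\<in>WH H. \<tau> (u ** w))"
    by (rule sum.cong) (use rep_mult[OF rep] WH_sub u in auto)
  also have "\<dots> = (\<Sum>w\<in>WH H. \<tau> w)" by (rule sum.reindex_bij_betw[OF bij_WH_mult[OF u]])
  finally show "\<tau> u ** avg \<tau> H = avg \<tau> H" by (simp add: avg_def matrix_mult_sum_right)
  have b: "bij_betw (\<lambda>w. w ** u) (WH H) (WH H)"
    by (rule bij_betw_byWitness[where f'="\<lambda>w. w ** matrix_inv u"])
       (use u mult_WH inv_WH W_inv_mult[OF WH_sub[OF u]] in \<open>auto simp: matrix_mul_assoc[symmetric]\<close>)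
  have "(\<Sum>w\<in>WH H. \<tau> w ** \<tau> u) = (\<Sum>w\<in>WH H. \<tau> (w ** u))"
    by (rule sum.cong) (use rep_mult[OF rep] WH_sub u in auto)
  also have "\<dots> = (\<Sum>w\<in>WH H. \<tau> w)" by (rule sum.reindex_bij_betw[OF b])
  finally show "avg \<tau> H ** \<tau> u = avg \<tau> H" by (simp add: avg_def matrix_mult_sum_left)
qed

lemma avg_idem: assumes rep: "representation W \<tau>" shows "avg \<tau> H ** avg \<tau> H = avg \<tau> H"
proof -
  have "avg \<tau> H ** avg \<tau> H = smul (1 / of_nat (nH H)) (\<Sum>w\<in>WH H. \<tau> w ** avg \<tau> H)"
    by (subst (1) avg_def) (simp add: matrix_mult_sum_left)
  also have "(\<Sum>w\<in>WH H. \<tau> w ** avg \<tau> H) = (\<Sum>w\<in>WH H. avg \<tau> H)"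
    by (rule sum.cong) (use avg_absorb[OF rep] in auto)
  also have "\<dots> = smul (of_nat (nH H)) (avg \<tau> H)" unfolding sum_const_smul n_H_def ..
  finally show ?thesis using nH_pos[of H] by simp
qed

lemma prj_simps:
  assumes rep: "representation W \<tau>"
  shows "prj \<tau> H ** prj \<tau> H = prj \<tau> H" "avg \<tau> H ** prj \<tau> H = 0" "prj \<tau> H ** avg \<tau> H = 0"
    "avg \<tau> H + prj \<tau> H = mat 1"
  by (simp_all add: prj_def matrix_mult_diff_left matrix_mult_diff_right avg_idem[OF rep])

lemma avg_commute:
  assumes rep: "representation W \<tau>" and C: "\<And>u. u \<in> WH H \<Longrightarrow> \<tau> u ** C = C ** \<tau> u"
  shows "avg \<tau> H ** C = C ** avg \<tau> H" "prj \<tau> H ** C = C ** prj \<tau> H"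
proof -
  show "avg \<tau> H ** C = C ** avg \<tau> H"
    by (simp add: avg_def matrix_mult_sum_left matrix_mult_sum_right C cong: sum.cong)
  then show "prj \<tau> H ** C = C ** prj \<tau> H"
    by (simp add: prj_def matrix_mult_diff_left matrix_mult_diff_right)
qed

section \<open>The action of W on hyperplanes, forms and residues\<close>

lemma act_fixed_space:
  assumes w: "w \<in> W" shows "act w (fixed_space s) = fixed_space (w ** s ** matrix_inv w)"
proof (rule Set.set_eqI, rule iffI)
  fix x assume "x \<in> act w (fixed_space s)"
  then show "x \<in> fixed_space (w ** s ** matrix_inv w)"
    using w by (auto simp: fixed_space_def matrix_vector_mul_assoc[symmetric])
next
  fix x assume "x \<in> fixed_space (w ** s ** matrix_inv w)"
  then have "w *v (s *v (matrix_inv w *v x)) = x" by (simp add: fixed_space_def matrix_vector_mul_assoc[symmetric])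
  then have "s *v (matrix_inv w *v x) = matrix_inv w *v x" using W_inv_vec(2)[OF w] by metis
  then show "x \<in> act w (fixed_space s)" using w
    by (intro image_eqI[of _ _ "matrix_inv w *v x"]) (auto simp: fixed_space_def)
qed

lemma W_inj: "w \<in> W \<Longrightarrow> w *v x = w *v y \<longleftrightarrow> x = y" by (metis W_inv_vec(2))

lemma act_arr:
  assumes w: "w \<in> W" and H: "H \<in> arr" shows "act w H \<in> arr"
proof -
  obtain s where s: "H = fixed_space s" "is_reflection s" "s \<in> W" using H by (auto simp: arrangement_def)
  have "vec.dim (act w (fixed_space s)) = vec.dim (fixed_space s)"
    by (rule vec.dim_image_eq) (auto simp: inj_on_def W_inj[OF w])
  then have "is_reflection (w ** s ** matrix_inv w)"
    using s w unfolding is_reflection_def act_fixed_space[OF w, symmetric]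
    by (simp add: invertible_mult invertible_W inv_W)
  moreover have "w ** s ** matrix_inv w \<in> W" using w s by (intro mult_W inv_W)
  ultimately show ?thesis unfolding arrangement_def s(1) act_fixed_space[OF w] by blast
qed

lemma act_inv: assumes w: "w \<in> W" shows "act (matrix_inv w) (act w H) = H" "act w (act (matrix_inv w) H) = H"
  using w by (auto simp: image_image)

lemma bij_act: assumes w: "w \<in> W" shows "bij_betw (act w) arr arr"
  by (rule bij_betw_byWitness[where f'="act (matrix_inv w)"]) (use act_inv[OF w] act_arr w inv_W in auto)

lemma act_WH: assumes "u \<in> WH H" shows "act u H = H"
  using WH_fix[OF assms] by force

text \<open>The forms are chosen separately for each hyperplane, so the family \<alpha> is
  equivariant only up to scalars. The connection contains quotients of two values of one form, in
  which the scalar cancels.\<close>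

lemma act_frm:
  assumes w: "w \<in> W" and H: "H \<in> arr"
  shows "\<exists>c. c \<noteq> 0 \<and> (\<forall>x. frm (act w H) (w *v x) = c * frm H x)"
proof -
  obtain a where a: "frm H a = 1" using arr_proper[OF H] by blast
  define c where "c = frm (act w H) (w *v a)"
  have k: "frm (act w H) (w *v x) = 0 \<longleftrightarrow> frm H x = 0" for x
    unfolding arr_kernel[OF act_arr[OF w H], symmetric] arr_kernel[OF H, symmetric]
    by (auto simp: W_inj[OF w])
  have e: "form_at (\<alpha> (act w H) v* w) x = form_at (\<alpha> (act w H) v* w) a * frm H x" for x
    by (rule form_kernel_subset[OF a]) (simp add: form_at_mv[symmetric] k)
  show ?thesis
  proof (intro exI conjI allI)
    show "c \<noteq> 0" using k[of a] a by (simp add: c_def)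
    show "frm (act w H) (w *v x) = c * frm H x" for x using e[of x] by (simp only: form_at_mv c_def)
  qed
qed

lemma act_ratio:
  assumes "w \<in> W" "H \<in> arr"
  shows "frm (act w H) (w *v \<xi>) / frm (act w H) (w *v x) = frm H \<xi> / frm H x"
  using act_frm[OF assms] by auto

lemma V_reg_act: assumes w: "w \<in> W" shows "w *v x \<in> V_reg W \<longleftrightarrow> x \<in> V_reg W"
proof -
  have "w *v x \<in> V_reg W" if w: "w \<in> W" and x: "x \<in> V_reg W" for w x
    unfolding V_reg_iff
  proof
    fix H assume H: "H \<in> arr"
    have "frm (act w (act (matrix_inv w) H)) (w *v x) \<noteq> 0"
      using act_frm[OF w act_arr[OF inv_W[OF w] H]] V_reg_frm[OF x act_arr[OF inv_W[OF w] H]] by auto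
    then show "frm H (w *v x) \<noteq> 0" by (simp add: act_inv[OF w])
  qed
  from this[OF w, of x] this[OF inv_W[OF w], of "w *v x"] show ?thesis using w by auto
qed

lemma WH_act:
  assumes w: "w \<in> W" shows "WH (act w H) = (\<lambda>u. w ** u ** matrix_inv w) ` WH H"
proof (rule Set.set_eqI, rule iffI)
  fix x assume "x \<in> (\<lambda>u. w ** u ** matrix_inv w) ` WH H"
  then show "x \<in> WH (act w H)" using w
    by (auto simp: pointwise_stabiliser_def matrix_vector_mul_assoc[symmetric] intro!: mult_W inv_W)
next
  fix x assume x: "x \<in> WH (act w H)"
  have "matrix_inv w ** x ** w \<in> WH H" using x w
    by (auto simp: pointwise_stabiliser_def matrix_vector_mul_assoc[symmetric] intro!: mult_W inv_W)
  moreover have "x = w ** (matrix_inv w ** x ** w) ** matrix_inv w"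
  proof -
    have "w ** (matrix_inv w ** x ** w) ** matrix_inv w = (w ** matrix_inv w) ** x ** (w ** matrix_inv w)"
      by (simp only: matrix_mul_assoc)
    then show ?thesis by (simp add: W_inv_mult[OF w])
  qed
  ultimately show "x \<in> (\<lambda>u. w ** u ** matrix_inv w) ` WH H" by blast
qed

lemma inj_conj: assumes w: "w \<in> W" shows "inj_on (\<lambda>u. w ** u ** matrix_inv w) S"
proof (rule inj_onI)
  fix u v assume "w ** u ** matrix_inv w = w ** v ** matrix_inv w"
  then have "matrix_inv w ** (w ** u ** matrix_inv w) ** w = matrix_inv w ** (w ** v ** matrix_inv w) ** w" by simp
  then have "(matrix_inv w ** w) ** u ** (matrix_inv w ** w) = (matrix_inv w ** w) ** v ** (matrix_inv w ** w)"
    by (simp only: matrix_mul_assoc)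
  then show "u = v" by (simp add: W_inv_mult[OF w])
qed

lemma nH_act: "w \<in> W \<Longrightarrow> nH (act w H) = nH H"
  unfolding n_H_def WH_act by (rule card_image) (rule inj_conj)

lemma m_act: "w \<in> W \<Longrightarrow> H \<in> arr \<Longrightarrow> m (act w H) = m H"
  using inv_m unfolding invariant_on_arrangement_def by blast

lemma Kop_act:
  assumes rep: "representation W \<tau>" and w: "w \<in> W" and H: "H \<in> arr"
  shows "\<tau> w ** Kop \<tau> H ** \<tau> (matrix_inv w) = Kop \<tau> (act w H)"
proof -
  have "(\<Sum>u\<in>WH (act w H). \<tau> u) = (\<Sum>u\<in>WH H. \<tau> (w ** u ** matrix_inv w))"
    unfolding WH_act[OF w] by (subst sum.reindex[OF inj_conj[OF w]]) simp
  also have "\<dots> = (\<Sum>u\<in>WH H. \<tau> w ** \<tau> u ** \<tau> (matrix_inv w))"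
    by (rule sum.cong) (use w WH_sub rep_mult[OF rep] mult_W inv_W in auto)
  finally have "avg \<tau> (act w H) = \<tau> w ** avg \<tau> H ** \<tau> (matrix_inv w)"
    by (simp add: avg_def nH_act[OF w] matrix_mult_sum_left matrix_mult_sum_right)
  then show ?thesis
    by (simp add: Kop_eq[OF rep] H act_arr[OF w H] prj_def nH_act[OF w] mat_alg rep_inv[OF rep w])
qed

text \<open>The one-form sum of m_H K_H d alpha_H / alpha_H, contracted with \<xi> at x.
  \<open>Bcon\<close> omits one hyperplane and is therefore regular at its generic points.\<close>

definition Acon :: "(complex^'n^'n \<Rightarrow> complex^'d^'d) \<Rightarrow> complex^'n \<Rightarrow> complex^'n \<Rightarrow> complex^'d^'d" where
  "Acon \<tau> \<xi> x = (\<Sum>H\<in>arr. smul (of_nat (m H) * (frm H \<xi> / frm H x)) (Kop \<tau> H))"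
definition Bcon :: "(complex^'n^'n \<Rightarrow> complex^'d^'d) \<Rightarrow> (complex^'n) set \<Rightarrow> complex^'n \<Rightarrow> complex^'n \<Rightarrow> complex^'d^'d" where
  "Bcon \<tau> H0 \<xi> x = (\<Sum>H\<in>arr - {H0}. smul (of_nat (m H) * (frm H \<xi> / frm H x)) (Kop \<tau> H))"

lemma Acon_split: "H \<in> arr \<Longrightarrow> Acon \<tau> \<xi> x = smul (of_nat (m H) * (frm H \<xi> / frm H x)) (Kop \<tau> H) + Bcon \<tau> H \<xi> x"
  unfolding Acon_def Bcon_def by (rule sum.remove[OF finite_arr])

text \<open>W permutes the hyperplanes; multiplicities and ratios of form values are invariant, and
  residues are conjugated. It is stated for a stable subset S so as to cover both all hyperplanes
  and all but one.\<close>

lemma conj_sum: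
  assumes rep: "representation W \<tau>" and w: "w \<in> W" and S: "S \<subseteq> arr" "bij_betw (act w) S S"
  shows "\<tau> w ** (\<Sum>H\<in>S. smul (of_nat (m H) * (frm H \<xi> / frm H x)) (Kop \<tau> H)) ** \<tau> (matrix_inv w)
    = (\<Sum>H\<in>S. smul (of_nat (m H) * (frm H (w *v \<xi>) / frm H (w *v x))) (Kop \<tau> H))"
proof -
  have "\<tau> w ** (\<Sum>H\<in>S. smul (of_nat (m H) * (frm H \<xi> / frm H x)) (Kop \<tau> H)) ** \<tau> (matrix_inv w)
    = (\<Sum>H\<in>S. smul (of_nat (m (act w H)) * (frm (act w H) (w *v \<xi>) / frm (act w H) (w *v x))) (Kop \<tau> (act w H)))"
    unfolding matrix_mult_sum_left matrix_mult_sum_right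
  proof (rule sum.cong[OF refl])
    fix H assume "H \<in> S"
    then have H: "H \<in> arr" using S by blast
    show "\<tau> w ** smul (of_nat (m H) * (frm H \<xi> / frm H x)) (Kop \<tau> H) ** \<tau> (matrix_inv w)
      = smul (of_nat (m (act w H)) * (frm (act w H) (w *v \<xi>) / frm (act w H) (w *v x))) (Kop \<tau> (act w H))"
      unfolding act_ratio[OF w H] m_act[OF w H] Kop_act[OF rep w H, symmetric] by simp
  qed
  also have "\<dots> = (\<Sum>H\<in>S. smul (of_nat (m H) * (frm H (w *v \<xi>) / frm H (w *v x))) (Kop \<tau> H))"
    by (rule sum.reindex_bij_betw[OF S(2)])
  finally show ?thesis .
qed

lemma Acon_equiv:
  assumes "representation W \<tau>" "w \<in> W"
  shows "\<tau> w ** Acon \<tau> \<xi> x ** \<tau> (matrix_inv w) = Acon \<tau> (w *v \<xi>) (w *v x)"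
  unfolding Acon_def by (rule conj_sum[OF assms _ bij_act[OF assms(2)]]) simp

text \<open>Elements of W_H map H to itself and therefore permute the remaining hyperplanes.\<close>

lemma Bcon_equiv:
  assumes rep: "representation W \<tau>" and u: "u \<in> WH H"
  shows "\<tau> u ** Bcon \<tau> H \<xi> x ** \<tau> (matrix_inv u) = Bcon \<tau> H (u *v \<xi>) (u *v x)"
  unfolding Bcon_def
proof (rule conj_sum[OF rep WH_sub[OF u]])
  have uW: "u \<in> W" by (rule WH_sub[OF u])
  show "bij_betw (act u) (arr - {H}) (arr - {H})"
  proof (rule bij_betw_byWitness[where f'="act (matrix_inv u)"])
    show "act u ` (arr - {H}) \<subseteq> arr - {H}" 
      using act_arr[OF uW] act_inv(1)[OF uW] act_WH[OF inv_WH[OF u]] by force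
    show "act (matrix_inv u) ` (arr - {H}) \<subseteq> arr - {H}"
      using act_arr[OF inv_W[OF uW]] act_inv(2)[OF uW] act_WH[OF u] by force
  qed (use act_inv[OF uW] in auto)
qed simp

lemma localised_frm_ratio: "H \<in> arr \<Longrightarrow> localised \<delta> (\<lambda>x. c / frm H x)"
  by (rule localised_inverse_factor[OF \<delta>_split]) auto

lemma localised_dH_ratio: "H' \<in> arr \<Longrightarrow> H' \<noteq> H \<Longrightarrow> localised (dH H) (\<lambda>x. c / frm H' x)"
proof (rule localised_inverse_factor)
  assume "H' \<in> arr" "H' \<noteq> H"
  then show "dH H x = frm H' x * (\<Prod>G\<in>arr - {H} - {H'}. frm G x)" for x
    unfolding dH_def using finite_arr by (intro prod.remove) auto
qed (auto intro!: poly_fun_prod)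

lemma mat_localised_Acon: "mat_localised \<delta> (Acon \<tau> \<xi>)"
  unfolding Acon_def
  by (intro mat_localised_sum mat_localised_smul localised_mult localised_frm_ratio) auto

lemma mat_localised_Bcon: "mat_localised (dH H) (Bcon \<tau> H \<xi>)"
  unfolding Bcon_def
  by (intro mat_localised_sum mat_localised_smul localised_mult localised_dH_ratio) auto

lemma mat_localised_dH_imp: "H \<in> arr \<Longrightarrow> mat_localised (dH H) F \<Longrightarrow> mat_localised \<delta> F"
  by (rule mat_localised_mono[of _ "dH H" "frm H"]) (auto simp: \<delta>_split mult.commute)

lemma Acon_linear: "Acon \<tau> (a *s \<xi> + b *s \<eta>) x = smul a (Acon \<tau> \<xi> x) + smul b (Acon \<tau> \<eta> x)"
  unfolding Acon_def smul_sum_right sum.distrib[symmetric] smul_simps smul_add_left[symmetric]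
  by (rule sum.cong[OF refl]) (simp add: algebra_simps add_divide_distrib)

lemma Bcon_linear: "Bcon \<tau> H (a *s \<xi> + b *s \<eta>) x = smul a (Bcon \<tau> H \<xi> x) + smul b (Bcon \<tau> H \<eta> x)"
  unfolding Bcon_def smul_sum_right sum.distrib[symmetric] smul_simps smul_add_left[symmetric]
  by (rule sum.cong[OF refl]) (simp add: algebra_simps add_divide_distrib)

end

section \<open>The Knizhnik--Zamolodchikov connection\<close>

lemma localised_line_tendsto:
  assumes "poly_fun D" "localised D f" "D x \<noteq> 0"
  shows "((\<lambda>t. f (x + t *s \<xi>)) \<longlongrightarrow> f x) (at 0)"
  using DERIV_isCont[OF has_dir_deriv[OF assms, of \<xi>]] by (simp add: isCont_def)

lemma has_dir_deriv_frm_inverse: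
  assumes "form_at \<beta> x \<noteq> 0"
  shows "dir_deriv \<xi> (\<lambda>x. c / form_at \<beta> x) x = - c * form_at \<beta> \<xi> / (form_at \<beta> x)\<^sup>2"
  by (rule dir_deriv_eqI) (use assms in \<open>auto intro!: derivative_eq_intros simp: power2_eq_square\<close>)

lemma dir_deriv_form_power: "dir_deriv \<xi> (\<lambda>x. form_at \<beta> x ^ i) x = of_nat i * form_at \<beta> x ^ (i - 1) * form_at \<beta> \<xi>"
  by (rule dir_deriv_eqI) (auto intro!: derivative_eq_intros)

context refl_arr begin

text \<open>Poles occur in codimension one only: a fraction whose denominator can be avoided at the
  generic points of every hyperplane has no denominator. The hyperplanes are removed from the
  denominator one after the other, by unique factorisation with respect to one form.\<close>

lemma regular_imp_poly:
  assumes f: "localised \<delta> f" and reg: "\<And>H. H \<in> arr \<Longrightarrow> \<exists>g. localised (dH H) g \<and> (\<forall>x\<in>V_reg W. f x = g x)"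
  shows "\<exists>p. poly_fun p \<and> (\<forall>x\<in>V_reg W. f x = p x)"
proof -
  obtain p0 where p0: "p0 \<in> V_reg W" using V_reg_nonempty by blast
  \<comment> \<open>T consists of the hyperplanes already removed from the denominator.\<close>
  have "\<exists>p r. poly_fun p \<and> (\<forall>x\<in>V_reg W. f x * (\<Prod>H\<in>arr - T. frm H x) ^ r = p x)" if "T \<subseteq> arr" "finite T" for T
    using that(2,1)
  proof (induction T rule: finite_induct)
    case empty
    obtain p r where "poly_fun p" "\<And>x. \<delta> x \<noteq> 0 \<Longrightarrow> f x = p x / \<delta> x ^ r" using f unfolding localised_def by metis
    then have "\<forall>x\<in>V_reg W. f x * \<delta> x ^ r = p x" by (simp add: \<delta>_nz)
    then show ?case using \<open>poly_fun p\<close> by (auto simp: \<delta>_def)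
  next
    case (insert H T)
    then have H: "H \<in> arr" by simp
    obtain p r where p: "poly_fun p" "\<And>x. x \<in> V_reg W \<Longrightarrow> f x * (\<Prod>H\<in>arr - T. frm H x) ^ r = p x"
      using insert.IH insert.prems by auto
    define D' where "D' x = (\<Prod>G\<in>arr - insert H T. frm G x)" for x
    have D': "poly_fun D'" unfolding D'_def by (intro poly_fun_prod) auto
    have S: "arr - T = insert H (arr - insert H T)" using H insert.hyps by auto
    have split: "(\<Prod>G\<in>arr - T. frm G x) = frm H x * D' x" for x
      unfolding D'_def S by (subst prod.insert) (simp_all add: finite_arr)
    obtain g where g: "localised (dH H) g" "\<And>x. x \<in> V_reg W \<Longrightarrow> f x = g x" using reg[OF H] by blast
    obtain q s where q: "poly_fun q" "\<And>x. dH H x \<noteq> 0 \<Longrightarrow> g x = q x / dH H x ^ s" using g(1) unfolding localised_def by metis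
    obtain x0 where x0: "frm H x0 = 0" "dH H x0 \<noteq> 0" using hyperplane_point[OF H] by blast
    \<comment> \<open>Two fractions for f, one with denominator a power of \<open>frm H\<close>
      times D', the other with denominator a power of \<open>dH H\<close>, multiplied
      crosswise.\<close>
    have e: "(\<lambda>x. p x * dH H x ^ s) = (\<lambda>x. frm H x ^ r * (D' x ^ r * q x))"
    proof (rule poly_fun_eqI[OF _ _ poly_\<delta>])
      show "poly_fun (\<lambda>x. p x * dH H x ^ s)" by (rule poly_fun_mult p(1) poly_fun_power poly_dH)+
      show "poly_fun (\<lambda>x. frm H x ^ r * (D' x ^ r * q x))"
        by (rule poly_fun_mult q(1) poly_fun_power D' poly_fun_form)+
      show "\<delta> p0 \<noteq> 0" using p0 by (simp add: \<delta>_nz)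
      fix z assume "\<delta> z \<noteq> 0"
      then have z: "z \<in> V_reg W" by (simp add: \<delta>_nz)
      have "p z = f z * (frm H z * D' z) ^ r" using p(2)[OF z] split by simp
      moreover have "f z * dH H z ^ s = q z" using g(2)[OF z] q(2) V_reg_dH[OF z, of H] by simp
      ultimately show "p z * dH H z ^ s = frm H z ^ r * (D' z ^ r * q z)"
        by (simp add: power_mult_distrib mult_ac)
    qed
    obtain a where a: "frm H a = 1" using arr_proper[OF H] by blast
    have N: "poly_fun (\<lambda>x. dH H x ^ s)" by (rule poly_fun_power poly_dH)+
    have Q: "poly_fun (\<lambda>x. D' x ^ r * q x)" by (rule poly_fun_mult poly_fun_power q(1) D')+
    obtain h where h: "poly_fun h" "\<And>x. p x = frm H x ^ r * h x"
      using poly_fun_power_divide_form[OF p(1) N Q a x0(1) _ fun_cong[OF e]] x0 by auto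
    have "f x * D' x ^ r = h x" if x: "x \<in> V_reg W" for x
    proof -
      have "frm H x ^ r * (f x * D' x ^ r) = frm H x ^ r * h x"
        using p(2)[OF x] h(2)[of x] split[of x] by (simp add: power_mult_distrib mult_ac)
      then show ?thesis using V_reg_frm[OF x H] by simp
    qed
    then show ?case using h(1) unfolding D'_def by blast
  qed
  from this[of arr] show ?thesis using finite_arr by auto
qed

text \<open>The values of U outside \<open>V_reg\<close> are irrelevant; G is the continuation of U
  across the generic points of H.\<close>

definition regH :: "(complex^'n) set \<Rightarrow> (complex^'n \<Rightarrow> complex^'e^'d) \<Rightarrow> bool" where
  "regH H U \<longleftrightarrow> (\<exists>G. mat_localised (dH H) G \<and> (\<forall>x\<in>V_reg W. U x = G x))"

lemma regH_I: "mat_localised (dH H) G \<Longrightarrow> (\<And>x. x \<in> V_reg W \<Longrightarrow> U x = G x) \<Longrightarrow> regH H U"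
  unfolding regH_def by blast
lemma regH_cong: "(\<And>x. x \<in> V_reg W \<Longrightarrow> U x = V x) \<Longrightarrow> regH H U \<longleftrightarrow> regH H V"
  unfolding regH_def by auto

lemma mat_localised_on_V_reg:
  assumes "\<And>x. x \<in> V_reg W \<Longrightarrow> F x = G x" shows "mat_localised \<delta> F \<longleftrightarrow> mat_localised \<delta> G"
  by (rule mat_localised_cong) (simp add: \<delta>_nz assms)

lemma mregular_imp_mat_poly:
  assumes f: "mat_localised \<delta> F" and reg: "\<And>H. H \<in> arr \<Longrightarrow> regH H F"
  shows "\<exists>P. mat_poly P \<and> (\<forall>x\<in>V_reg W. F x = P x)"
proof -
  have "\<exists>p. poly_fun p \<and> (\<forall>x\<in>V_reg W. F x $ i $ j = p x)" for i j
  proof (rule regular_imp_poly)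
    show "localised \<delta> (\<lambda>x. F x $ i $ j)" using f by (simp add: mat_localised_def)
    fix H assume "H \<in> arr"
    then obtain G where "mat_localised (dH H) G" "\<forall>x\<in>V_reg W. F x = G x" using reg unfolding regH_def by blast
    then show "\<exists>g. localised (dH H) g \<and> (\<forall>x\<in>V_reg W. F x $ i $ j = g x)"
      by (intro exI[of _ "\<lambda>x. G x $ i $ j"]) (simp add: mat_localised_def)
  qed
  then obtain p where p: "\<And>i j. poly_fun (p i j)" "\<And>i j x. x \<in> V_reg W \<Longrightarrow> F x $ i $ j = p i j x" by metis
  then show ?thesis by (intro exI[of _ "\<lambda>x. \<chi> i j. p i j x"]) (auto simp: mat_poly_def vec_eq_iff)
qed

lemma poly_zero_on_V_reg:
  assumes "poly_fun f" "\<And>x. x \<in> V_reg W \<Longrightarrow> f x = 0" shows "f x = 0"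
proof -
  obtain p0 where "p0 \<in> V_reg W" using V_reg_nonempty by blast
  then show ?thesis using poly_fun_eq_0[OF assms(1) poly_\<delta>, of p0 x] assms(2) by (simp add: \<delta>_nz)
qed

lemma mat_poly_zero_on_V_reg: "mat_poly F \<Longrightarrow> (\<And>x. x \<in> V_reg W \<Longrightarrow> F x = 0) \<Longrightarrow> F x = 0"
  using poly_zero_on_V_reg[of "\<lambda>x. F x $ i $ j" x for i j] by (simp add: mat_poly_def vec_eq_iff)

text \<open>The degree is an integer and scaling is tested on \<open>V_reg\<close> only, so that
  rational matrices of negative degree are covered.\<close>

definition mat_homog :: "int \<Rightarrow> (complex^'n \<Rightarrow> complex^'e^'d) \<Rightarrow> bool" where
  "mat_homog d F \<longleftrightarrow> (\<forall>x\<in>V_reg W. \<forall>t. t \<noteq> 0 \<longrightarrow> F (t *s x) = smul (t powi d) (F x))"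

lemma V_reg_scale: "t \<noteq> 0 \<Longrightarrow> t *s x \<in> V_reg W \<longleftrightarrow> x \<in> V_reg W"
  by (simp add: V_reg_iff)

text \<open>Along the ray through x an entry is a polynomial q such that q(t) t^k is constant with k
  > 0; putting t = 0 shows that the constant is 0.\<close>

lemma mat_poly_negative_degree:
  assumes F: "mat_poly F" and h: "mat_homog d F" and d: "d < 0" shows "F x = 0"
proof -
  have "F x = 0" if x: "x \<in> V_reg W" for x
  proof -
    have "F x $ i $ j = 0" for i j
    proof -
      have "poly_fun (\<lambda>x. F x $ i $ j)" using F by (simp add: mat_poly_def)
      then obtain q where q: "\<forall>t. F (0 + t *s x) $ i $ j = poly q t" using poly_fun_line by blast
      define k where "k = nat (- d)"
      have k: "k > 0" "d = - int k" using d by (auto simp: k_def)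
      have e: "poly (q * monom 1 k - [:F x $ i $ j:]) t = 0" if "t \<noteq> 0" for t
      proof -
        have "F (t *s x) = smul (t powi d) (F x)" using h x that by (simp add: mat_homog_def)
        then have "poly q t = t powi d * F x $ i $ j" using q[rule_format, of t] by simp
        then show ?thesis using that by (simp add: poly_monom k(2) power_int_minus field_simps)
      qed
      have "infinite (UNIV - {0} :: complex set)" by (intro Diff_infinite_finite infinite_UNIV_char_0) simp
      moreover have "UNIV - {0} \<subseteq> {t. poly (q * monom 1 k - [:F x $ i $ j:]) t = 0}" using e by auto
      ultimately have "infinite {t. poly (q * monom 1 k - [:F x $ i $ j:]) t = 0}" using infinite_super by blast
      then have "q * monom 1 k - [:F x $ i $ j:] = 0" using poly_roots_finite by blast
      then have "poly (q * monom 1 k - [:F x $ i $ j:]) 0 = 0" by simp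
      then show ?thesis using k(1) by (simp add: poly_monom zero_power)
    qed
    then show ?thesis by (simp add: vec_eq_iff)
  qed
  then show ?thesis by (rule mat_poly_zero_on_V_reg[OF F])
qed

lemma Acon_scale: "t \<noteq> 0 \<Longrightarrow> Acon \<tau> \<xi> (t *s x) = smul (1 / t) (Acon \<tau> \<xi> x)"
  unfolding Acon_def smul_sum_right by (rule sum.cong) (auto simp: field_simps)

text \<open>If x lies in H and \<zeta> is tangent to H, both are fixed by W_H. Equivariance of
  \<open>Bcon\<close> then becomes commutation with W_H and hence with the residue. This is the
  integrability condition along H.\<close>

lemma Bcon_commute:
  assumes rep: "representation W \<tau>" and H: "H \<in> arr" and z: "frm H \<zeta> = 0" and x: "frm H x = 0"
  shows "Kop \<tau> H ** Bcon \<tau> H \<zeta> x = Bcon \<tau> H \<zeta> x ** Kop \<tau> H"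
proof -
  have c: "\<tau> u ** Bcon \<tau> H \<zeta> x = Bcon \<tau> H \<zeta> x ** \<tau> u" if u: "u \<in> WH H" for u
  proof -
    have "u *v \<zeta> = \<zeta>" "u *v x = x" using WH_apply[OF H u] z x by simp_all
    then have "\<tau> u ** Bcon \<tau> H \<zeta> x ** \<tau> (matrix_inv u) ** \<tau> u = Bcon \<tau> H \<zeta> x ** \<tau> u"
      using Bcon_equiv[OF rep u, of \<zeta> x] by simp
    then show ?thesis using rep_inv[OF rep WH_sub[OF u]] by (simp add: matrix_mul_assoc[symmetric])
  qed
  show ?thesis by (simp add: Kop_eq[OF rep H] avg_commute(2)[OF rep c])
qed

text \<open>Along H the double pole of the commutator cancels, and its simple pole is the commutator
  of the residue with \<open>Bcon\<close> in a direction tangent to H, which vanishes on H. So the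
  commutator is polynomial; being homogeneous of degree -2, it is zero.\<close>

lemma Acon_commute:
  assumes rep: "representation W \<tau>" and x: "x \<in> V_reg W"
  shows "Acon \<tau> \<xi> x ** Acon \<tau> \<eta> x = Acon \<tau> \<eta> x ** Acon \<tau> \<xi> x"
proof -
  define G where "G x = Acon \<tau> \<xi> x ** Acon \<tau> \<eta> x - Acon \<tau> \<eta> x ** Acon \<tau> \<xi> x" for x
  have GL: "mat_localised \<delta> G" unfolding G_def by (intro mat_localised_diff mat_localised_mult mat_localised_Acon) auto
  have "regH H G" if H: "H \<in> arr" for H
  proof -
    \<comment> \<open>This combination is annihilated by \<open>frm H\<close>, hence tangent to H,
      and it is the one that appears in the simple pole.\<close>
    define \<zeta> where "\<zeta> = frm H \<xi> *s \<eta> + (- frm H \<eta>) *s \<xi>"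
    define C where "C x = Kop \<tau> H ** Bcon \<tau> H \<zeta> x - Bcon \<tau> H \<zeta> x ** Kop \<tau> H" for x
    obtain x0 where x0: "frm H x0 = 0" "dH H x0 \<noteq> 0" using hyperplane_point[OF H] by blast
    have "\<exists>E. mat_localised (dH H) E \<and> (\<forall>x. dH H x \<noteq> 0 \<longrightarrow> C x = smul (frm H x) (E x))"
    proof (rule mat_localised_divide_form[OF poly_dH frm_coroot[OF H] x0])
      show "mat_localised (dH H) C" unfolding C_def by (intro mat_localised_diff mat_localised_mult mat_localised_Bcon) auto
      show "frm H x = 0 \<Longrightarrow> C x = 0" for x
        unfolding C_def using Bcon_commute[OF rep H, of \<zeta> x] by (simp add: \<zeta>_def)
    qed
    then obtain E where E: "mat_localised (dH H) E" "\<And>x. dH H x \<noteq> 0 \<Longrightarrow> C x = smul (frm H x) (E x)" by blast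
    show ?thesis
    proof (rule regH_I)
      show "mat_localised (dH H) (\<lambda>x. smul (of_nat (m H)) (E x) + (Bcon \<tau> H \<xi> x ** Bcon \<tau> H \<eta> x - Bcon \<tau> H \<eta> x ** Bcon \<tau> H \<xi> x))"
        by (intro mat_localised_add mat_localised_diff mat_localised_mult mat_localised_smul mat_localised_Bcon E(1)) auto
      fix x assume x: "x \<in> V_reg W"
      have f: "frm H x \<noteq> 0" by (rule V_reg_frm[OF x H])
      have "G x = smul (of_nat (m H) / frm H x) (C x) + (Bcon \<tau> H \<xi> x ** Bcon \<tau> H \<eta> x - Bcon \<tau> H \<eta> x ** Bcon \<tau> H \<xi> x)"
        unfolding G_def C_def \<zeta>_def Acon_split[OF H] Bcon_linear
        by (simp add: vec_eq_iff mat_alg algebra_simps)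
      also have "smul (of_nat (m H) / frm H x) (C x) = smul (of_nat (m H)) (E x)"
        using E(2)[OF V_reg_dH[OF x]] f by simp
      finally show "G x = smul (of_nat (m H)) (E x) + (Bcon \<tau> H \<xi> x ** Bcon \<tau> H \<eta> x - Bcon \<tau> H \<eta> x ** Bcon \<tau> H \<xi> x)" .
    qed
  qed
  then obtain P where P: "mat_poly P" "\<And>x. x \<in> V_reg W \<Longrightarrow> G x = P x" using mregular_imp_mat_poly[OF GL] by blast
  have "mat_homog (-2) P" unfolding mat_homog_def
  proof (intro ballI allI impI)
    fix x t assume x: "x \<in> V_reg W" and t: "(t::complex) \<noteq> 0"
    have "G (t *s x) = smul (t powi -2) (G x)"
      using t by (simp add: G_def Acon_scale smul_diff_right power_int_minus power2_eq_square field_simps)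
    then show "P (t *s x) = smul (t powi -2) (P x)" using P(2) x t by (simp add: V_reg_scale)
  qed
  then have "P x = 0" by (rule mat_poly_negative_degree[OF P(1)]) simp
  then show ?thesis using P(2)[OF x] by (simp add: G_def)
qed

text \<open>The result is symmetric in \<xi> and \<eta>, which says that the connection form is
  closed.\<close>

lemma mat_deriv_Acon:
  assumes x: "x \<in> V_reg W"
  shows "mat_deriv \<xi> (Acon \<tau> \<eta>) x = (\<Sum>H\<in>arr. smul (- of_nat (m H) * frm H \<eta> * frm H \<xi> / (frm H x)\<^sup>2) (Kop \<tau> H))"
proof -
  have dx: "\<delta> x \<noteq> 0" using x by (simp add: \<delta>_nz)
  have l: "localised \<delta> (\<lambda>x. of_nat (m H) * (frm H \<eta> / frm H x))" if "H \<in> arr" for H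
    by (intro localised_mult localised_frm_ratio that localised_const)
  have "mat_deriv \<xi> (Acon \<tau> \<eta>) x = (\<Sum>H\<in>arr. mat_deriv \<xi> (\<lambda>x. smul (of_nat (m H) * (frm H \<eta> / frm H x)) (Kop \<tau> H)) x)"
    unfolding Acon_def by (rule mat_deriv_sum[OF poly_\<delta> _ dx]) (rule mat_localised_smul[OF l mat_localised_const])
  also have "\<dots> = (\<Sum>H\<in>arr. smul (- of_nat (m H) * frm H \<eta> * frm H \<xi> / (frm H x)\<^sup>2) (Kop \<tau> H))"
  proof (rule sum.cong[OF refl])
    fix H assume H: "H \<in> arr"
    show "mat_deriv \<xi> (\<lambda>x. smul (of_nat (m H) * (frm H \<eta> / frm H x)) (Kop \<tau> H)) x
      = smul (- of_nat (m H) * frm H \<eta> * frm H \<xi> / (frm H x)\<^sup>2) (Kop \<tau> H)"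
      using has_dir_deriv_frm_inverse[OF V_reg_frm[OF x H], of \<xi> "of_nat (m H) * frm H \<eta>"]
      by (subst mat_deriv_smul[OF poly_\<delta> l[OF H] mat_localised_const dx]) simp
  qed
  finally show ?thesis .
qed

text \<open>The connection \<open>KZ\<^sub>k(\<tau>)\<close>; the columns of \<open>U\<close> are its sections.\<close>

definition nabla :: "complex \<Rightarrow> (complex^'n^'n \<Rightarrow> complex^'d^'d) \<Rightarrow> complex^'n
    \<Rightarrow> (complex^'n \<Rightarrow> complex^'e^'d) \<Rightarrow> complex^'n \<Rightarrow> complex^'e^'d" where
  "nabla k \<tau> \<xi> U x = mat_deriv \<xi> U x + smul k (Acon \<tau> \<xi> x ** U x)"

lemma mat_localised_nabla: "mat_localised \<delta> U \<Longrightarrow> mat_localised \<delta> (nabla k \<tau> \<xi> U)"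
  unfolding nabla_def by (intro mat_localised_add mat_localised_mat_deriv mat_localised_smul mat_localised_mult mat_localised_Acon) auto

lemma mat_deriv_cong_reg: "x \<in> V_reg W \<Longrightarrow> (\<And>y. y \<in> V_reg W \<Longrightarrow> F y = G y) \<Longrightarrow> mat_deriv \<xi> F x = mat_deriv \<xi> G x"
  by (rule mat_deriv_cong[OF poly_\<delta>]) (auto simp: \<delta>_nz)

lemma nabla_cong: "x \<in> V_reg W \<Longrightarrow> (\<And>y. y \<in> V_reg W \<Longrightarrow> F y = G y) \<Longrightarrow> nabla k \<tau> \<xi> F x = nabla k \<tau> \<xi> G x"
  unfolding nabla_def using mat_deriv_cong_reg[of x F G] by simp

lemma nabla_add: "mat_localised \<delta> F \<Longrightarrow> mat_localised \<delta> G \<Longrightarrow> x \<in> V_reg W \<Longrightarrow>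
    nabla k \<tau> \<xi> (\<lambda>x. F x + G x) x = nabla k \<tau> \<xi> F x + nabla k \<tau> \<xi> G x"
  unfolding nabla_def by (simp add: mat_deriv_add[OF poly_\<delta>] \<delta>_nz mat_alg)

lemma nabla_smul: "localised \<delta> f \<Longrightarrow> mat_localised \<delta> U \<Longrightarrow> x \<in> V_reg W \<Longrightarrow>
    nabla k \<tau> \<xi> (\<lambda>x. smul (f x) (U x)) x = smul (dir_deriv \<xi> f x) (U x) + smul (f x) (nabla k \<tau> \<xi> U x)"
  unfolding nabla_def by (simp add: mat_deriv_smul[OF poly_\<delta>] \<delta>_nz mat_alg mult.commute)

lemma nabla_mult: "mat_localised \<delta> U \<Longrightarrow> mat_localised \<delta> G \<Longrightarrow> x \<in> V_reg W \<Longrightarrow>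
    nabla k \<tau> \<xi> (\<lambda>x. U x ** G x) x = nabla k \<tau> \<xi> U x ** G x + U x ** mat_deriv \<xi> G x"
  unfolding nabla_def by (simp add: mat_deriv_mult[OF poly_\<delta>] \<delta>_nz mat_alg)

lemma nabla_linear: "mat_localised \<delta> U \<Longrightarrow> x \<in> V_reg W \<Longrightarrow>
    nabla k \<tau> (a *s \<xi> + b *s \<eta>) U x = smul a (nabla k \<tau> \<xi> U x) + smul b (nabla k \<tau> \<eta> U x)"
  unfolding nabla_def by (simp add: mat_deriv_linear[OF poly_\<delta>] \<delta>_nz mat_alg Acon_linear mult.commute)

text \<open>The curvature has a part linear in k, the derivative of the connection form, and a part
  quadratic in k, its commutator. They vanish separately, so the connection is flat for every
  complex k.\<close>

lemma nabla_commute: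
  assumes rep: "representation W \<tau>" and U: "mat_localised \<delta> U" and x: "x \<in> V_reg W"
  shows "nabla k \<tau> \<xi> (nabla k \<tau> \<eta> U) x = nabla k \<tau> \<eta> (nabla k \<tau> \<xi> U) x"
proof -
  have dx: "\<delta> x \<noteq> 0" using x by (simp add: \<delta>_nz)
  have e: "nabla k \<tau> \<xi> (nabla k \<tau> \<eta> U) x = mat_deriv \<xi> (mat_deriv \<eta> U) x + smul k (mat_deriv \<xi> (Acon \<tau> \<eta>) x ** U x)
      + smul k (Acon \<tau> \<eta> x ** mat_deriv \<xi> U x) + smul k (Acon \<tau> \<xi> x ** mat_deriv \<eta> U x) + smul (k * k) (Acon \<tau> \<xi> x ** Acon \<tau> \<eta> x ** U x)" for \<xi> \<eta>
  proof -
    have "mat_deriv \<xi> (nabla k \<tau> \<eta> U) x = mat_deriv \<xi> (\<lambda>x. mat_deriv \<eta> U x + smul k (Acon \<tau> \<eta> x ** U x)) x"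
      by (rule mat_deriv_cong_reg[OF x]) (simp add: nabla_def)
    also have "\<dots> = mat_deriv \<xi> (mat_deriv \<eta> U) x + mat_deriv \<xi> (\<lambda>x. smul k (Acon \<tau> \<eta> x ** U x)) x"
      by (rule mat_deriv_add[OF poly_\<delta>]) (intro mat_localised_mat_deriv mat_localised_smul mat_localised_mult mat_localised_Acon U poly_\<delta> localised_const dx)+
    also have "mat_deriv \<xi> (\<lambda>x. smul k (Acon \<tau> \<eta> x ** U x)) x = smul k (mat_deriv \<xi> (\<lambda>x. Acon \<tau> \<eta> x ** U x) x)"
      by (subst mat_deriv_smul[OF poly_\<delta>]) (simp_all add: mat_localised_mult mat_localised_Acon U dx)
    also have "mat_deriv \<xi> (\<lambda>x. Acon \<tau> \<eta> x ** U x) x = mat_deriv \<xi> (Acon \<tau> \<eta>) x ** U x + Acon \<tau> \<eta> x ** mat_deriv \<xi> U x"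
      by (rule mat_deriv_mult[OF poly_\<delta> mat_localised_Acon U dx])
    finally have d: "mat_deriv \<xi> (nabla k \<tau> \<eta> U) x = mat_deriv \<xi> (mat_deriv \<eta> U) x
      + smul k (mat_deriv \<xi> (Acon \<tau> \<eta>) x ** U x + Acon \<tau> \<eta> x ** mat_deriv \<xi> U x)" .
    show ?thesis
      by (simp only: nabla_def[of k \<tau> \<xi> "nabla k \<tau> \<eta> U" x] d) (simp add: nabla_def[of k \<tau> \<eta> U x] mat_alg)
  qed
  have "mat_deriv \<xi> (Acon \<tau> \<eta>) x = mat_deriv \<eta> (Acon \<tau> \<xi>) x"
    unfolding mat_deriv_Acon[OF x] by (simp add: mult_ac)
  then show ?thesis unfolding e using mat_deriv_commute[OF poly_\<delta> U dx, of \<xi> \<eta>] Acon_commute[OF rep x, of \<xi> \<eta>]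
    by (simp add: algebra_simps)
qed

lemma mat_deriv_compose_mult:
  assumes U: "mat_localised \<delta> U" and x: "w *v x \<in> V_reg W"
  shows "mat_deriv \<xi> (\<lambda>x. C ** U (w *v x)) x = C ** mat_deriv (w *v \<xi>) U (w *v x)"
proof -
  have "dir_deriv \<xi> (\<lambda>x. \<Sum>k\<in>UNIV. C $ i $ k * U (w *v x) $ k $ j) x = (\<Sum>k\<in>UNIV. C $ i $ k * dir_deriv (w *v \<xi>) (\<lambda>x. U x $ k $ j) (w *v x))" for i j
  proof (rule dir_deriv_eqI)
    have "((\<lambda>t. U (w *v x + t *s (w *v \<xi>)) $ k $ j) has_field_derivative dir_deriv (w *v \<xi>) (\<lambda>x. U x $ k $ j) (w *v x)) (at 0)" for k
      by (rule has_dir_deriv[OF poly_\<delta>]) (use U x in \<open>auto simp: mat_localised_def \<delta>_nz\<close>)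
    then show "((\<lambda>t. \<Sum>k\<in>UNIV. C $ i $ k * U (w *v (x + t *s \<xi>)) $ k $ j) has_field_derivative
       (\<Sum>k\<in>UNIV. C $ i $ k * dir_deriv (w *v \<xi>) (\<lambda>x. U x $ k $ j) (w *v x))) (at 0)"
      by (auto intro!: DERIV_sum DERIV_cmult simp: matrix_vector_right_distrib mv_smult)
  qed
  then show ?thesis by (simp add: vec_eq_iff matrix_matrix_mult_def)
qed

lemma nabla_equiv:
  assumes rep: "representation W \<tau>" and U: "mat_localised \<delta> U" and w: "w \<in> W" and x: "x \<in> V_reg W"
  shows "nabla k \<tau> (w *v \<xi>) (\<lambda>x. \<tau> w ** U (matrix_inv w *v x)) x = \<tau> w ** nabla k \<tau> \<xi> U (matrix_inv w *v x)"
proof -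
  have x': "matrix_inv w *v x \<in> V_reg W" using x V_reg_act[OF inv_W[OF w]] by simp
  have A: "\<tau> w ** Acon \<tau> \<xi> (matrix_inv w *v x) = Acon \<tau> (w *v \<xi>) x ** \<tau> w"
  proof -
    have "\<tau> w ** Acon \<tau> \<xi> (matrix_inv w *v x) ** \<tau> (matrix_inv w) ** \<tau> w = Acon \<tau> (w *v \<xi>) x ** \<tau> w"
      using Acon_equiv[OF rep w, of \<xi> "matrix_inv w *v x"] w by simp
    then show ?thesis using rep_inv[OF rep w] by (simp add: matrix_mul_assoc[symmetric])
  qed
  show ?thesis unfolding nabla_def mat_deriv_compose_mult[OF U x']
    using w by (simp add: mat_alg A)
qed

end

section \<open>Local regularity along a hyperplane\<close>

context refl_arr begin

text \<open>The two local exponents of KZ_{-j}(\<tau>) along H are 0 and this number.\<close>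

definition resH :: "nat \<Rightarrow> (complex^'n) set \<Rightarrow> nat" where "resH j H = j * m H * nH H"

text \<open>\<open>\<alpha>\<^sub>H\<close> times the connection \<open>KZ\<^bsub>-j\<^esub>(\<tau>)\<close> in the direction of the coroot, which extends across \<open>H\<close>.\<close>

definition theta :: "nat \<Rightarrow> (complex^'n^'n \<Rightarrow> complex^'d^'d) \<Rightarrow> (complex^'n) set
    \<Rightarrow> (complex^'n \<Rightarrow> complex^'e^'d) \<Rightarrow> complex^'n \<Rightarrow> complex^'e^'d" where
  "theta j \<tau> H U x = smul (frm H x) (mat_deriv (coroot H) U x - smul (of_nat j) (Bcon \<tau> H (coroot H) x ** U x))
     - smul (of_nat (resH j H)) (prj \<tau> H ** U x)"

definition eqvH :: "(complex^'n^'n \<Rightarrow> complex^'d^'d) \<Rightarrow> (complex^'n) set \<Rightarrow> (complex^'n \<Rightarrow> complex^'e^'d) \<Rightarrow> bool" where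
  "eqvH \<tau> H U \<longleftrightarrow> (\<forall>u\<in>WH H. \<forall>x. dH H x \<noteq> 0 \<longrightarrow> U (u *v x) = \<tau> u ** U x)"

lemma dH_act: assumes H: "H \<in> arr" and u: "u \<in> WH H" and x: "dH H x \<noteq> 0" shows "dH H (u *v x) \<noteq> 0"
  unfolding dH_nz
proof
  have uW: "u \<in> W" by (rule WH_sub[OF u])
  fix H' assume H': "H' \<in> arr - {H}"
  define G where "G = act (matrix_inv u) H'"
  have e: "H' = act u G" by (simp add: G_def act_inv[OF uW])
  have "G \<in> arr" using act_arr[OF inv_W[OF uW]] H' by (simp add: G_def)
  moreover have "G \<noteq> H" using e H' act_WH[OF u] by auto
  ultimately have "frm G x \<noteq> 0" using x by (simp add: dH_nz)
  then show "frm H' (u *v x) \<noteq> 0" using act_frm[OF uW \<open>G \<in> arr\<close>] e by auto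
qed

lemma mat_localised_theta: "mat_localised (dH H) U \<Longrightarrow> mat_localised (dH H) (theta j \<tau> H U)"
  unfolding theta_def
  by (intro mat_localised_diff mat_localised_smul mat_localised_mult mat_localised_mat_deriv mat_localised_Bcon mat_localised_const localised_const localised_poly poly_fun_form poly_dH)

lemma theta_nabla:
  assumes rep: "representation W \<tau>" and H: "H \<in> arr" and x: "x \<in> V_reg W"
  shows "smul (frm H x) (nabla (- of_nat j) \<tau> (coroot H) U x) = theta j \<tau> H U x"
proof -
  have f: "frm H x \<noteq> 0" by (rule V_reg_frm[OF x H])
  show ?thesis unfolding nabla_def theta_def Acon_split[OF H] frm_coroot[OF H] Kop_eq[OF rep H] resH_def
    using f by (simp add: mat_alg mult_ac)
qed

lemma theta_on_H: "frm H x = 0 \<Longrightarrow> theta j \<tau> H U x = - smul (of_nat (resH j H)) (prj \<tau> H ** U x)"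
  by (simp add: theta_def)

lemma theta_diff:
  "mat_localised (dH H) U \<Longrightarrow> mat_localised (dH H) V \<Longrightarrow> dH H x \<noteq> 0 \<Longrightarrow> theta j \<tau> H (\<lambda>x. U x - V x) x = theta j \<tau> H U x - theta j \<tau> H V x"
  unfolding theta_def by (simp add: mat_deriv_diff[OF poly_dH] mat_alg)

lemma theta_smul_const:
  "mat_localised (dH H) U \<Longrightarrow> dH H x \<noteq> 0 \<Longrightarrow> theta j \<tau> H (\<lambda>x. smul e (U x)) x = smul e (theta j \<tau> H U x)"
  unfolding theta_def by (simp add: mat_deriv_smul[OF poly_dH] mat_alg mult_ac)

text \<open>The product rule with alpha_H(coroot) = 1: on the coefficient of alpha_H^i the operator
  acts as theta + i, as in the method of Frobenius.\<close>

lemma theta_power: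
  assumes H: "H \<in> arr" and U: "mat_localised (dH H) U" and x: "dH H x \<noteq> 0"
  shows "theta j \<tau> H (\<lambda>x. smul (frm H x ^ i) (U x)) x = smul (frm H x ^ i) (theta j \<tau> H U x + smul (of_nat i) (U x))"
proof -
  have "localised (dH H) (\<lambda>x. frm H x ^ i)" by (intro localised_poly poly_fun_power poly_fun_form)
  then have "mat_deriv (coroot H) (\<lambda>x. smul (frm H x ^ i) (U x)) x
     = smul (of_nat i * frm H x ^ (i - 1)) (U x) + smul (frm H x ^ i) (mat_deriv (coroot H) U x)"
    by (simp add: mat_deriv_smul[OF poly_dH _ U x] dir_deriv_form_power frm_coroot[OF H])
  moreover have "frm H x * (of_nat i * frm H x ^ (i - 1)) = of_nat i * frm H x ^ i"
    by (cases i) simp_all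
  ultimately show ?thesis unfolding theta_def
    by (cases i) (simp_all add: mat_alg algebra_simps)
qed

text \<open>An element u of W_H multiplies alpha_H by det u and the derivative in the coroot
  direction by the inverse of det u, so their product commutes with u; the same cancellation occurs
  for the \<open>Bcon\<close> term.\<close>

lemma theta_eqv:
  assumes rep: "representation W \<tau>" and H: "H \<in> arr" and U: "mat_localised (dH H) U" and e: "eqvH \<tau> H U"
  shows "eqvH \<tau> H (theta j \<tau> H U)"
  unfolding eqvH_def
proof (intro ballI allI impI)
  fix u x assume u: "u \<in> WH H" and x: "dH H x \<noteq> 0"
  let ?a = "coroot H"
  have ux: "dH H (u *v x) \<noteq> 0" by (rule dH_act[OF H u x])
  have Ux: "U (u *v x) = \<tau> u ** U x" using e u x by (simp add: eqvH_def)
  have ua: "u *v ?a = det u *s ?a + 0 *s ?a" by (simp add: WH_coroot[OF H u])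
  have "mat_deriv ?a (\<lambda>y. U (u *v y)) x = mat_deriv (u *v ?a) U (u *v x)"
    by (simp add: vec_eq_iff dir_deriv_def matrix_vector_right_distrib mv_smult)
  moreover have "mat_deriv ?a (\<lambda>y. U (u *v y)) x = mat_deriv ?a (\<lambda>y. \<tau> u ** U y) x"
    by (rule mat_deriv_cong[OF poly_dH x]) (use e u in \<open>auto simp: eqvH_def\<close>)
  moreover have "mat_deriv ?a (\<lambda>y. \<tau> u ** U y) x = \<tau> u ** mat_deriv ?a U x"
    by (simp add: mat_deriv_mult[OF poly_dH mat_localised_const U x])
  moreover have "mat_deriv (u *v ?a) U (u *v x) = smul (det u) (mat_deriv ?a U (u *v x))"
    unfolding ua by (subst mat_deriv_linear[OF poly_dH U ux]) simp
  ultimately have d: "smul (det u) (mat_deriv ?a U (u *v x)) = \<tau> u ** mat_deriv ?a U x" by simp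
  have "\<tau> u ** Bcon \<tau> H ?a x ** \<tau> (matrix_inv u) = smul (det u) (Bcon \<tau> H ?a (u *v x))"
    unfolding Bcon_equiv[OF rep u] ua by (subst Bcon_linear) simp
  then have "\<tau> u ** Bcon \<tau> H ?a x ** \<tau> (matrix_inv u) ** (\<tau> u ** U x) = smul (det u) (Bcon \<tau> H ?a (u *v x) ** U (u *v x))"
    by (simp add: Ux)
  moreover have "\<tau> u ** Bcon \<tau> H ?a x ** \<tau> (matrix_inv u) ** (\<tau> u ** U x)
     = \<tau> u ** Bcon \<tau> H ?a x ** (\<tau> (matrix_inv u) ** \<tau> u) ** U x" by (simp only: matrix_mul_assoc)
  ultimately have b: "smul (det u) (Bcon \<tau> H ?a (u *v x) ** U (u *v x)) = \<tau> u ** Bcon \<tau> H ?a x ** U x"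
    using rep_inv[OF rep WH_sub[OF u]] by simp
  have p: "prj \<tau> H ** U (u *v x) = \<tau> u ** (prj \<tau> H ** U x)"
    unfolding Ux prj_def by (simp add: mat_alg avg_absorb[OF rep u])
  have "theta j \<tau> H U (u *v x) = smul (frm H x) (smul (det u) (mat_deriv ?a U (u *v x))
      - smul (of_nat j) (smul (det u) (Bcon \<tau> H ?a (u *v x) ** U (u *v x))))
     - smul (of_nat (resH j H)) (prj \<tau> H ** U (u *v x))"
    unfolding theta_def WH_frm[OF H u] by (simp add: mat_alg mult_ac)
  also have "\<dots> = \<tau> u ** theta j \<tau> H U x"
    unfolding d b p theta_def by (simp add: mat_alg)
  finally show "theta j \<tau> H U (u *v x) = \<tau> u ** theta j \<tau> H U x" .
qed

text \<open>The leading coefficient along \<open>H\<close> of an equivariant function vanishing to order \<open>i\<close> transforms by \<open>det\<^sup>i\<close>.\<close>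

lemma leading_coeff_eqv:
  assumes H: "H \<in> arr" and P: "mat_localised (dH H) P" and x: "frm H x = 0" "dH H x \<noteq> 0" and u: "u \<in> WH H"
    and e: "\<And>y. y \<in> V_reg W \<Longrightarrow> smul d (P (u *v y)) = C ** P y ** D"
  shows "smul d (P x) = C ** P x ** D"
proof -
  let ?a = "coroot H"
  \<comment> \<open>Slightly off x in the coroot direction one is in \<open>V_reg\<close>, where the
    hypothesis holds; the identity at x is the limit.\<close>
  have ev: "eventually (\<lambda>t. x + t *s ?a \<in> V_reg W) (at 0)"
  proof -
    have "eventually (\<lambda>t. dH H (x + t *s ?a) \<noteq> 0) (nhds 0)" by (rule poly_fun_eventually_nz[OF poly_dH x(2)])
    then have "eventually (\<lambda>t. t \<noteq> 0 \<longrightarrow> x + t *s ?a \<in> V_reg W) (nhds 0)"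
    proof (rule eventually_mono)
      fix t :: complex assume "dH H (x + t *s ?a) \<noteq> 0"
      then show "t \<noteq> 0 \<longrightarrow> x + t *s ?a \<in> V_reg W"
        using x frm_coroot[OF H] by (simp add: \<delta>_nz[symmetric] \<delta>_split[OF H])
    qed
    then show ?thesis by (simp add: eventually_at_filter)
  qed
  have l: "((\<lambda>t. P (x + t *s \<xi>) $ i $ k) \<longlongrightarrow> P x $ i $ k) (at 0)" for \<xi> i k
    by (rule localised_line_tendsto[OF poly_dH _ x(2)]) (use P in \<open>simp add: mat_localised_def\<close>)
  have ux: "u *v (x + t *s ?a) = x + t *s (u *v ?a)" for t
    using WH_apply[OF H u, of x] x by (simp add: matrix_vector_right_distrib mv_smult)
  have "(smul d (P x)) $ i $ k = (C ** P x ** D) $ i $ k" for i k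
  proof (rule tendsto_unique[OF trivial_limit_at])
    show "((\<lambda>t. d * P (u *v (x + t *s ?a)) $ i $ k) \<longlongrightarrow> smul d (P x) $ i $ k) (at 0)"
      unfolding ux smul_nth by (intro tendsto_mult tendsto_const l)
    have "((\<lambda>t. (C ** P (x + t *s ?a) ** D) $ i $ k) \<longlongrightarrow> (C ** P x ** D) $ i $ k) (at 0)"
      unfolding matrix_matrix_mult_def vec_lambda_beta by (intro tendsto_sum tendsto_mult tendsto_const l)
    moreover have "eventually (\<lambda>t. (C ** P (x + t *s ?a) ** D) $ i $ k = d * P (u *v (x + t *s ?a)) $ i $ k) (at 0)"
      using ev by (rule eventually_mono) (simp add: e[symmetric])
    ultimately show "((\<lambda>t. d * P (u *v (x + t *s ?a)) $ i $ k) \<longlongrightarrow> (C ** P x ** D) $ i $ k) (at 0)"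
      by (rule Lim_transform_eventually)
  qed
  then show ?thesis by (simp add: vec_eq_iff)
qed

text \<open>\<open>avg\<close> projects onto the trivial isotypic part, so it fixes or kills P
  according to whether the character by which P transforms is trivial.\<close>

lemma avg_of_character:
  assumes rep: "representation W \<tau>" and c: "\<And>u. u \<in> WH H \<Longrightarrow> smul (ch u) P = \<tau> u ** P"
    and mult: "\<And>u w. u \<in> WH H \<Longrightarrow> w \<in> WH H \<Longrightarrow> ch (u ** w) = ch u * ch w"
  shows "(\<forall>u\<in>WH H. ch u = 1) \<Longrightarrow> avg \<tau> H ** P = P"
    and "\<not> (\<forall>u\<in>WH H. ch u = 1) \<Longrightarrow> avg \<tau> H ** P = 0"
proof -
  have "avg \<tau> H ** P = smul (1 / of_nat (nH H)) (\<Sum>u\<in>WH H. smul (ch u) P)"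
    by (simp add: avg_def matrix_mult_sum_left c cong: sum.cong)
  then have a: "avg \<tau> H ** P = smul ((\<Sum>u\<in>WH H. ch u) / of_nat (nH H)) P"
    by (simp add: smul_sum_left[symmetric])
  show "avg \<tau> H ** P = P" if "\<forall>u\<in>WH H. ch u = 1"
  proof -
    have "(\<Sum>u\<in>WH H. ch u) = of_nat (nH H)" using that by (simp add: n_H_def)
    then show ?thesis using a nH_pos[of H] by simp
  qed
  show "avg \<tau> H ** P = 0" if n: "\<not> (\<forall>u\<in>WH H. ch u = 1)"
  proof -
    obtain u where "u \<in> WH H" "ch u \<noteq> 1" using n by blast
    then have "(\<Sum>u\<in>WH H. ch u) = 0" by (intro WH_character_sum mult)
    then show ?thesis using a by simp
  qed
qed

lemma det_power_resH: "u \<in> WH H \<Longrightarrow> det u ^ resH j H = 1"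
  unfolding resH_def by (metis WH_det_power mult.commute power_mult power_one)

text \<open>The method of Frobenius for a flat section with value \<open>avg \<tau> H\<close> on H.
  The error of order i can be removed if theta + i is invertible on its leading coefficient \<psi>.
  The resonance i = \<open>resH j H\<close> concerns only the part of \<psi> that is not
  W_H-invariant; but equivariance makes \<psi> transform by det^i, and at the resonance det^i = 1,
  so \<psi> is invariant. Hence no logarithm arises.\<close>

lemma horizontal_lift:
  assumes rep: "representation W \<tau>" and H: "H \<in> arr" and i: "i \<ge> 1"
  shows "\<exists>h \<psi>. mat_localised (dH H) h \<and> mat_localised (dH H) \<psi> \<and> eqvH \<tau> H h \<and> (\<forall>x. frm H x = 0 \<longrightarrow> dH H x \<noteq> 0 \<longrightarrow> h x = avg \<tau> H) \<and>
     (\<forall>x. dH H x \<noteq> 0 \<longrightarrow> theta j \<tau> H h x = smul (frm H x ^ i) (\<psi> x))"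
  using i
proof (induction i rule: dec_induct)
  \<comment> \<open>For the constant \<open>avg\<close> the residue term vanishes because
    \<open>prj\<close> kills it; the \<open>Bcon\<close> term is left, and it carries one factor
    alpha_H.\<close>
  case base
  show ?case
  proof (intro exI conjI)
    show "mat_localised (dH H) (\<lambda>x. avg \<tau> H)" by simp
    show "mat_localised (dH H) (\<lambda>x. smul (- of_nat j) (Bcon \<tau> H (coroot H) x ** avg \<tau> H))"
      by (intro mat_localised_smul mat_localised_mult mat_localised_Bcon mat_localised_const localised_const poly_dH)
    show "eqvH \<tau> H (\<lambda>x. avg \<tau> H)" by (simp add: eqvH_def avg_absorb[OF rep])
  qed (simp_all add: theta_def prj_simps[OF rep] mat_alg)
next
  case (step i)
  then obtain h \<psi> where h: "mat_localised (dH H) h" "mat_localised (dH H) \<psi>" "eqvH \<tau> H h"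
    "\<And>x. frm H x = 0 \<Longrightarrow> dH H x \<noteq> 0 \<Longrightarrow> h x = avg \<tau> H"
    "\<And>x. dH H x \<noteq> 0 \<Longrightarrow> theta j \<tau> H h x = smul (frm H x ^ i) (\<psi> x)" by blast
  have te: "eqvH \<tau> H (theta j \<tau> H h)" by (rule theta_eqv[OF rep H h(1) h(3)])
  have lead: "smul (det u ^ i) (\<psi> x) = \<tau> u ** \<psi> x" if x: "frm H x = 0" "dH H x \<noteq> 0" and u: "u \<in> WH H" for u x
  proof -
    have "smul (det u ^ i) (\<psi> x) = \<tau> u ** \<psi> x ** mat 1"
    proof (rule leading_coeff_eqv[OF H h(2) x u])
      fix y assume y: "y \<in> V_reg W"
      have "smul (frm H (u *v y) ^ i) (\<psi> (u *v y)) = \<tau> u ** smul (frm H y ^ i) (\<psi> y)"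
        using te u h(5)[OF V_reg_dH[OF y]] h(5)[OF dH_act[OF H u V_reg_dH[OF y]]] V_reg_dH[OF y, of H] by (simp add: eqvH_def)
      then have "smul (frm H y ^ i) (smul (det u ^ i) (\<psi> (u *v y))) = smul (frm H y ^ i) (\<tau> u ** \<psi> y)"
        by (simp add: WH_frm[OF H u] power_mult_distrib mult.commute)
      then show "smul (det u ^ i) (\<psi> (u *v y)) = \<tau> u ** \<psi> y ** mat 1"
        using smul_cancel[of "frm H y ^ i" "smul (det u ^ i) (\<psi> (u *v y))" "\<tau> u ** \<psi> y"] V_reg_frm[OF y H]
        by (simp del: smul_simps)
    qed
    then show ?thesis by simp
  qed
  \<comment> \<open>The scalar by which theta + i acts on \<psi> along H: either \<psi> is
    W_H-invariant and the residue acts by 0, or \<psi> has no invariant part and it acts by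
    \<open>resH j H\<close>.\<close>
  define e :: complex where "e = (if \<forall>u\<in>WH H. det u ^ i = 1 then of_nat i else of_nat i - of_nat (resH j H))"
  have e0: "e \<noteq> 0"
  proof (cases "\<forall>u\<in>WH H. det u ^ i = 1")
    case False
    then have "i \<noteq> resH j H" using det_power_resH by metis
    then show ?thesis unfolding e_def if_not_P[OF False] by simp
  next
    case True
    then show ?thesis unfolding e_def if_P[OF True] using step by simp
  qed
  have ev: "smul (of_nat i) (\<psi> x) - smul (of_nat (resH j H)) (prj \<tau> H ** \<psi> x) = smul e (\<psi> x)"
    if x: "frm H x = 0" "dH H x \<noteq> 0" for x
  proof -
    note av = avg_of_character[OF rep, where ch="\<lambda>u. det u ^ i" and P="\<psi> x" and H=H, OF lead[OF x]]
    show ?thesis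
    proof (cases "\<forall>u\<in>WH H. det u ^ i = 1")
      case True
      then have "avg \<tau> H ** \<psi> x = \<psi> x" by (intro av(1)) (auto simp: det_mul power_mult_distrib)
      then show ?thesis unfolding e_def if_P[OF True] by (simp add: prj_def mat_alg)
    next
      case False
      then have "avg \<tau> H ** \<psi> x = 0" by (intro av(2)) (auto simp: det_mul power_mult_distrib)
      then show ?thesis unfolding e_def if_not_P[OF False] by (simp add: prj_def mat_alg)
    qed
  qed
  define g where "g x = \<psi> x - smul (1 / e) (theta j \<tau> H \<psi> x + smul (of_nat i) (\<psi> x))" for x
  obtain x0 where x0: "frm H x0 = 0" "dH H x0 \<noteq> 0" using hyperplane_point[OF H] by blast
  have "\<exists>E. mat_localised (dH H) E \<and> (\<forall>x. dH H x \<noteq> 0 \<longrightarrow> g x = smul (frm H x) (E x))"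
  proof (rule mat_localised_divide_form[OF poly_dH frm_coroot[OF H] x0])
    show "mat_localised (dH H) g" unfolding g_def by (intro mat_localised_diff mat_localised_add mat_localised_smul mat_localised_theta h localised_const poly_dH)
    fix x assume x: "frm H x = 0" "dH H x \<noteq> 0"
    have "theta j \<tau> H \<psi> x + smul (of_nat i) (\<psi> x) = smul e (\<psi> x)"
      using ev[OF x] theta_on_H[OF x(1), of j \<tau> \<psi>] by simp
    then show "g x = 0" using e0 by (simp add: g_def)
  qed
  then obtain E where E: "mat_localised (dH H) E" "\<And>x. dH H x \<noteq> 0 \<Longrightarrow> g x = smul (frm H x) (E x)" by blast
  \<comment> \<open>One correction gives theta h' = alpha_H^i (\<psi> - (1/e) (theta \<psi> + i
    \<psi>)), and the bracket vanishes on H by the choice of e.\<close>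
  define h' where "h' x = h x - smul (1 / e) (theta j \<tau> H h x)" for x
  have lp: "localised (dH H) (\<lambda>x. frm H x ^ i)" by (intro localised_poly poly_fun_power poly_fun_form)
  show ?case
  proof (intro exI conjI allI impI)
    show "mat_localised (dH H) h'" unfolding h'_def by (intro mat_localised_diff mat_localised_smul mat_localised_theta h localised_const poly_dH)
    show "mat_localised (dH H) E" by (rule E)
    show "eqvH \<tau> H h'" using h(3) te by (simp add: eqvH_def h'_def mat_alg)
    show "h' x = avg \<tau> H" if "frm H x = 0" "dH H x \<noteq> 0" for x
      using h(4,5)[of x] that step by (simp add: h'_def zero_power)
    fix x assume x: "dH H x \<noteq> 0"
    have "theta j \<tau> H h' x = theta j \<tau> H h x - theta j \<tau> H (\<lambda>x. smul (1 / e) (theta j \<tau> H h x)) x"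
      unfolding h'_def by (rule theta_diff) (intro mat_localised_smul mat_localised_theta h localised_const poly_dH x)+
    also have "theta j \<tau> H (\<lambda>x. smul (1 / e) (theta j \<tau> H h x)) x = smul (1 / e) (theta j \<tau> H (theta j \<tau> H h) x)"
      by (rule theta_smul_const[OF mat_localised_theta[OF h(1)] x])
    also have "theta j \<tau> H (theta j \<tau> H h) x = theta j \<tau> H (\<lambda>x. smul (frm H x ^ i) (\<psi> x)) x"
      unfolding theta_def[of j \<tau> H "theta j \<tau> H h"] theta_def[of j \<tau> H "\<lambda>x. smul (frm H x ^ i) (\<psi> x)"]
      using mat_deriv_cong[OF poly_dH x, where F="theta j \<tau> H h" and G="\<lambda>x. smul (frm H x ^ i) (\<psi> x)"] h(5) x by simp
    also have "\<dots> = smul (frm H x ^ i) (theta j \<tau> H \<psi> x + smul (of_nat i) (\<psi> x))"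
      by (rule theta_power[OF H h(2) x])
    finally have "theta j \<tau> H h' x = smul (frm H x ^ i) (g x)"
      unfolding h(5)[OF x] g_def by (simp add: mat_alg mult_ac)
    then show "theta j \<tau> H h' x = smul (frm H x ^ Suc i) (E x)" using E(2)[OF x] by (simp add: mult.commute)
  qed
qed

lemma mat_localised_eq_on_V_reg_frm: "H \<in> arr \<Longrightarrow> x \<in> V_reg W \<Longrightarrow> smul (frm H x) A = smul (frm H x) B \<Longrightarrow> A = B"
  using V_reg_frm smul_cancel by blast

text \<open>Sections of the form h f + alpha_H^c \<psi> with f and \<psi> regular are stable under
  the connection, where h is the approximately flat section with value \<open>avg\<close> on H.
  Differentiating alpha_H^c \<psi> lowers the order by one, but the new leading term is c
  \<open>avg\<close> \<psi> and is absorbed into h f.\<close>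

lemma local_regular:
  assumes rep: "representation W \<tau>" and H: "H \<in> arr" and \<psi>: "mat_localised (dH H) \<psi>"
  shows "regH H (((nabla (- of_nat j) \<tau> (coroot H)) ^^ r) (\<lambda>x. smul (frm H x ^ resH j H) (\<psi> x)))"
proof (cases "resH j H = 0")
  case True
  let ?N = "nabla (- of_nat j) \<tau> (coroot H)"
  \<comment> \<open>If the exponent is 0, then j = 0 or m_H = 0, and the connection has no pole
    along H.\<close>
  have jm: "j * m H = 0" using True nH_pos[of H] by (simp add: resH_def)
  have st: "regH H (?N U)" if U: "regH H U" for U :: "complex^'n \<Rightarrow> complex^'b^'a"
  proof -
    obtain G where G: "mat_localised (dH H) G" "\<And>x. x \<in> V_reg W \<Longrightarrow> U x = G x" using U unfolding regH_def by blast
    show ?thesis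
    proof (rule regH_I)
      show "mat_localised (dH H) (\<lambda>x. mat_deriv (coroot H) G x + smul (- of_nat j) (Bcon \<tau> H (coroot H) x ** G x))"
        by (intro mat_localised_add mat_localised_mat_deriv mat_localised_smul mat_localised_mult mat_localised_Bcon G localised_const poly_dH)
      fix x assume x: "x \<in> V_reg W"
      have "(of_nat j :: complex) = 0 \<or> (of_nat (m H) :: complex) = 0" using jm by auto
      then have e: "nabla (- of_nat j) \<tau> (coroot H) G x = mat_deriv (coroot H) G x + smul (- of_nat j) (Bcon \<tau> H (coroot H) x ** G x)"
        unfolding nabla_def Acon_split[OF H] by (auto simp: mat_alg)
      show "?N U x = mat_deriv (coroot H) G x + smul (- of_nat j) (Bcon \<tau> H (coroot H) x ** G x)"
        unfolding e[symmetric] by (rule nabla_cong[OF x G(2)])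
    qed
  qed
  show ?thesis
  proof (induction r)
    case 0
    show ?case by (rule regH_I[OF \<psi>]) (simp add: True)
  qed (simp add: st)
next
  case False
  let ?N = "nabla (- of_nat j) \<tau> (coroot H)"
  define c where "c = resH j H"
  have c: "c \<ge> 1" using False by (simp add: c_def)
  \<comment> \<open>\<open>theta\<close> is alpha_H times the connection, so order
    \<open>Suc c\<close> here leaves order c for the covariant derivative of h.\<close>
  obtain h ph where h: "mat_localised (dH H) h" "mat_localised (dH H) ph"
    "\<And>x. frm H x = 0 \<Longrightarrow> dH H x \<noteq> 0 \<Longrightarrow> h x = avg \<tau> H"
    "\<And>x. dH H x \<noteq> 0 \<Longrightarrow> theta j \<tau> H h x = smul (frm H x ^ Suc c) (ph x)"
    using horizontal_lift[OF rep H, of "Suc c" j] by auto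
  note ml = mat_localised_dH_imp[OF H]
  have lp: "localised D (\<lambda>x. frm H x ^ i)" for D i by (intro localised_poly poly_fun_power poly_fun_form)
  have nh: "?N h x = smul (frm H x ^ c) (ph x)" if x: "x \<in> V_reg W" for x
    by (rule mat_localised_eq_on_V_reg_frm[OF H x]) (simp add: theta_nabla[OF rep H x] h(4)[OF V_reg_dH[OF x]])
  define Lam where "Lam U \<longleftrightarrow> (\<exists>f \<psi>. mat_localised (dH H) f \<and> mat_localised (dH H) \<psi> \<and>
     (\<forall>x\<in>V_reg W. U x = h x ** f x + smul (frm H x ^ c) (\<psi> x)))" for U :: "complex^'n \<Rightarrow> complex^'b^'a"
  have step: "Lam (?N U)" if U: "Lam U" for U
  proof -
    obtain f \<psi> where f: "mat_localised (dH H) f" "mat_localised (dH H) \<psi>"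
      and Ue: "\<And>x. x \<in> V_reg W \<Longrightarrow> U x = h x ** f x + smul (frm H x ^ c) (\<psi> x)" using U unfolding Lam_def by blast
    \<comment> \<open>On H theta \<psi> = -c \<open>prj\<close> \<psi>, so theta \<psi> + c \<psi>
      equals c \<open>avg\<close> \<psi> = c h \<psi> there, and g vanishes.\<close>
    define g where "g x = theta j \<tau> H \<psi> x + smul (of_nat c) (\<psi> x) - smul (of_nat c) (h x ** \<psi> x)" for x
    obtain x0 where x0: "frm H x0 = 0" "dH H x0 \<noteq> 0" using hyperplane_point[OF H] by blast
    have "\<exists>E. mat_localised (dH H) E \<and> (\<forall>x. dH H x \<noteq> 0 \<longrightarrow> g x = smul (frm H x) (E x))"
    proof (rule mat_localised_divide_form[OF poly_dH frm_coroot[OF H] x0])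
      show "mat_localised (dH H) g" unfolding g_def by (intro mat_localised_diff mat_localised_add mat_localised_smul mat_localised_mult mat_localised_theta f h localised_const poly_dH)
      fix x assume x: "frm H x = 0" "dH H x \<noteq> 0"
      show "g x = 0" unfolding g_def theta_on_H[OF x(1)] h(3)[OF x] c_def[symmetric]
        by (simp add: prj_def mat_alg)
    qed
    then obtain E where E: "mat_localised (dH H) E" "\<And>x. dH H x \<noteq> 0 \<Longrightarrow> g x = smul (frm H x) (E x)" by blast
    show ?thesis unfolding Lam_def
    proof (intro exI conjI ballI)
      show "mat_localised (dH H) (\<lambda>x. mat_deriv (coroot H) f x + smul (of_nat c * frm H x ^ (c - 1)) (\<psi> x))"
        by (intro mat_localised_add mat_localised_mat_deriv mat_localised_smul f localised_mult localised_const lp poly_dH)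
      show "mat_localised (dH H) (\<lambda>x. ph x ** f x + E x)" by (intro mat_localised_add mat_localised_mult h f E poly_dH)
      fix x assume x: "x \<in> V_reg W"
      have fx: "frm H x \<noteq> 0" by (rule V_reg_frm[OF x H])
      have "?N U x = ?N (\<lambda>x. h x ** f x + smul (frm H x ^ c) (\<psi> x)) x"
        by (rule nabla_cong[OF x Ue])
      also have "\<dots> = ?N (\<lambda>x. h x ** f x) x + ?N (\<lambda>x. smul (frm H x ^ c) (\<psi> x)) x"
        by (rule nabla_add[OF _ _ x]) (intro mat_localised_mult mat_localised_smul ml h f lp poly_\<delta>)+
      also have "?N (\<lambda>x. h x ** f x) x = smul (frm H x ^ c) (ph x ** f x) + h x ** mat_deriv (coroot H) f x"
        using nabla_mult[OF ml[OF h(1)] ml[OF f(1)] x] nh[OF x] by simp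
      also have "?N (\<lambda>x. smul (frm H x ^ c) (\<psi> x)) x = smul (frm H x ^ (c - 1)) (theta j \<tau> H \<psi> x + smul (of_nat c) (\<psi> x))"
      proof (rule mat_localised_eq_on_V_reg_frm[OF H x])
        show "smul (frm H x) (?N (\<lambda>x. smul (frm H x ^ c) (\<psi> x)) x) = smul (frm H x) (smul (frm H x ^ (c - 1)) (theta j \<tau> H \<psi> x + smul (of_nat c) (\<psi> x)))"
          unfolding theta_nabla[OF rep H x] theta_power[OF H f(2) V_reg_dH[OF x]]
          using c by (cases c) simp_all
      qed
      also have "theta j \<tau> H \<psi> x + smul (of_nat c) (\<psi> x) = smul (of_nat c) (h x ** \<psi> x) + smul (frm H x) (E x)"
        using E(2)[OF V_reg_dH[OF x]] by (simp add: g_def algebra_simps)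
      finally show "?N U x = h x ** (mat_deriv (coroot H) f x + smul (of_nat c * frm H x ^ (c - 1)) (\<psi> x)) + smul (frm H x ^ c) (ph x ** f x + E x)"
        using c by (cases c) (simp_all add: mat_alg algebra_simps)
    qed
  qed
  have "Lam ((?N ^^ r) (\<lambda>x. smul (frm H x ^ c) (\<psi> x)))"
  proof (induction r)
    case 0
    show ?case unfolding Lam_def
      by (intro exI[of _ "\<lambda>x. 0"] exI[of _ \<psi>]) (simp add: \<psi>)
  qed (simp add: step)
  then obtain f \<psi>' where "mat_localised (dH H) f" "mat_localised (dH H) \<psi>'"
    "\<forall>x\<in>V_reg W. (?N ^^ r) (\<lambda>x. smul (frm H x ^ c) (\<psi> x)) x = h x ** f x + smul (frm H x ^ c) (\<psi>' x)" unfolding Lam_def by blast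
  then show ?thesis unfolding c_def[symmetric]
    by (intro regH_I[where G="\<lambda>x. h x ** f x + smul (frm H x ^ c) (\<psi>' x)"]) (auto intro!: mat_localised_add mat_localised_mult mat_localised_smul lp h)
qed

end

section \<open>Flat sections\<close>

lemma det_pencil_poly: "\<exists>q::complex poly. \<forall>z. det (A + smul z B) = poly q z"
proof -
  define q where "q = (\<Sum>p\<in>{p. p permutes (UNIV::'a set)}. [:of_int (sign p):] * (\<Prod>i\<in>UNIV. [:A $ i $ p i, B $ i $ p i:]))"
  have "det (A + smul z B) = poly q z" for z
    unfolding det_def q_def poly_sum poly_mult poly_prod by simp
  then show ?thesis by blast
qed

text \<open>The characteristic polynomial is not constant: otherwise det (-1 + s C) = s^d det (C -
  1/s) would be a fixed multiple of s^d for all nonzero s, hence zero at s = 0, where its value is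
  det (-1).\<close>

lemma eigenvector_exists:
  fixes C :: "complex^'d::finite^'d"
  shows "\<exists>c v. v \<noteq> 0 \<and> C *v v = c *s v"
proof -
  obtain q where q: "\<And>z. det (C + smul z (- mat 1)) = poly q z" using det_pencil_poly[of C "- mat 1"] by blast
  obtain r where r: "\<And>z. det (- mat 1 + smul z C) = poly r z" using det_pencil_poly[of "- mat 1" C] by blast
  have det_smul: "det (smul z (A :: complex^'d^'d)) = z ^ CARD('d) * det A" for z A
  proof -
    have "det (mat z :: complex^'d^'d) = z ^ CARD('d)"
      by (subst det_diagonal) (simp_all add: mat_def)
    then show ?thesis by (simp add: mat_mult_eq_smul[symmetric] det_mul)
  qed
  have "\<not> constant (poly q)"
  proof
    assume "constant (poly q)"
    then have c: "poly q z = poly q 0" for z by (simp add: constant_def)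
    have "poly r s = s ^ CARD('d) * poly q 0" if "s \<noteq> 0" for s
    proof -
      have "- mat 1 + smul s C = smul s (C + smul (1 / s) (- mat 1))"
        using that by (simp add: smul_add_right)
      then have "poly r s = s ^ CARD('d) * poly q (1 / s)" by (metis det_smul q r)
      then show ?thesis using c by metis
    qed
    then have "poly (r - monom (poly q 0) CARD('d)) s = 0" if "s \<noteq> 0" for s
      using that by (simp add: poly_monom)
    then have "UNIV - {0} \<subseteq> {s. poly (r - monom (poly q 0) CARD('d)) s = 0}" by auto
    moreover have "infinite (UNIV - {0} :: complex set)" by (intro Diff_infinite_finite infinite_UNIV_char_0) simp
    ultimately have "infinite {s. poly (r - monom (poly q 0) CARD('d)) s = 0}" using infinite_super by blast
    then have "r - monom (poly q 0) CARD('d) = 0" using poly_roots_finite by blast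
    then have "poly r 0 = poly (monom (poly q 0) CARD('d)) 0" by simp
    then have "poly r 0 = 0" by (simp add: poly_monom)
    moreover have "poly r 0 = det (smul (- 1) (mat 1 :: complex^'d^'d))" using r[of 0] by (simp add: smul_minus_left)
    ultimately show False by (simp add: det_smul)
  qed
  then obtain z where "poly q z = 0" using fundamental_theorem_of_algebra by blast
  then have "\<not> invertible (C + smul z (- mat 1))" by (simp add: q[symmetric] invertible_det_nz)
  then obtain v where v: "v \<noteq> 0" "(C + smul z (- mat 1)) *v v = 0"
    using matrix_left_invertible_ker[of "C + smul z (- mat 1)"] by (auto simp: invertible_left_inverse)
  then have "C *v v = z *s v"
    by (simp add: matrix_vector_mult_diff_rdistrib smul_vector smul_minus_right)
  then show ?thesis using v by blast
qed

context refl_arr begin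

section \<open>Schur's lemma and the action of the Euler field\<close>

lemma irr_rep: "irreducible_representation W \<tau> \<Longrightarrow> representation W \<tau>"
  by (simp add: irreducible_representation_def)

lemma schur:
  assumes irr: "irreducible_representation W \<tau>" and C: "\<And>w. w \<in> W \<Longrightarrow> \<tau> w ** C = C ** \<tau> w"
  shows "\<exists>c. C = smul c (mat 1)"
proof -
  obtain c v where v: "v \<noteq> 0" "C *v v = c *s v" using eigenvector_exists by blast
  define U where "U = {v. C *v v = c *s v}"
  have "vec.subspace U"
    unfolding vec.subspace_def U_def
    by (simp add: matrix_vector_right_distrib mv_smult vec.scale_right_distrib mult.commute)
  moreover have "\<forall>w\<in>W. \<forall>v\<in>U. \<tau> w *v v \<in> U"
    unfolding U_def by (auto simp: matrix_vector_mul_assoc C[symmetric]) (simp add: matrix_vector_mul_assoc[symmetric] mv_smult)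
  ultimately have "U = {0} \<or> U = UNIV" using irr unfolding irreducible_representation_def by blast
  then have "U = UNIV" using v unfolding U_def by blast
  then have "C *v x = smul c (mat 1) *v x" for x unfolding U_def by (simp add: smul_vector set_eq_iff)
  then show ?thesis by (auto simp: matrix_eq)
qed

text \<open>The connection form contracted with the Euler field; it does not depend on x. Its scalar
  on an irreducible module determines the degrees of flat sections.\<close>

definition Csum :: "(complex^'n^'n \<Rightarrow> complex^'d^'d) \<Rightarrow> complex^'d^'d" where
  "Csum \<tau> = (\<Sum>H\<in>arr. smul (of_nat (m H)) (Kop \<tau> H))"
definition kz_scalar :: "(complex^'n^'n \<Rightarrow> complex^'d^'d) \<Rightarrow> complex" where
  "kz_scalar \<tau> = (SOME c. Csum \<tau> = smul c (mat 1))"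

lemma Acon_euler: "x \<in> V_reg W \<Longrightarrow> Acon \<tau> x x = Csum \<tau>"
  unfolding Acon_def Csum_def by (rule sum.cong) (simp_all add: V_reg_frm)

text \<open>Equivariance of \<open>Acon\<close> for \<xi> = x shows that \<open>Csum\<close>
  commutes with W, and Schur's lemma applies.\<close>

lemma Csum_kz_scalar: assumes irr: "irreducible_representation W \<tau>" shows "Csum \<tau> = smul (kz_scalar \<tau>) (mat 1)"
proof -
  note rep = irr_rep[OF irr]
  obtain p where p: "p \<in> V_reg W" using V_reg_nonempty by blast
  have "\<tau> w ** Csum \<tau> = Csum \<tau> ** \<tau> w" if w: "w \<in> W" for w
  proof -
    have "\<tau> w ** Csum \<tau> ** \<tau> (matrix_inv w) ** \<tau> w = Csum \<tau> ** \<tau> w"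
      using Acon_equiv[OF rep w, of p p] Acon_euler p V_reg_act[OF w] by metis
    then show ?thesis using rep_inv[OF rep w] by (simp add: matrix_mul_assoc[symmetric])
  qed
  from schur[OF irr this] show ?thesis unfolding kz_scalar_def by (rule someI_ex)
qed

lemma mat_homog_smul: "mat_homog d F \<Longrightarrow> mat_homog d (\<lambda>x. smul c (F x))"
  by (simp add: mat_homog_def mult.commute)
lemma mat_homog_add: "mat_homog d F \<Longrightarrow> mat_homog d G \<Longrightarrow> mat_homog d (\<lambda>x. F x + G x)"
  by (simp add: mat_homog_def smul_add_right)
lemma mat_homog_cong: "(\<And>x. x \<in> V_reg W \<Longrightarrow> F x = G x) \<Longrightarrow> mat_homog d F \<longleftrightarrow> mat_homog d G"
  by (simp add: mat_homog_def V_reg_scale)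

lemma mat_deriv_scale:
  assumes h: "mat_homog d U" and U: "mat_localised \<delta> U" and x: "x \<in> V_reg W" and t: "t \<noteq> 0"
  shows "mat_deriv \<xi> U (t *s x) = smul (t powi (d - 1)) (mat_deriv \<xi> U x)"
proof -
  have mt: "mat t *v y = t *s y" for y :: "complex^'n"
    using smul_vector[of t "mat 1" y] mat_mult_eq_smul[of t "mat 1 :: complex^'n^'n"] by simp
  have "mat_deriv \<xi> (\<lambda>y. mat 1 ** U (mat t *v y)) x = mat 1 ** mat_deriv (mat t *v \<xi>) U (mat t *v x)"
    by (rule mat_deriv_compose_mult[OF U]) (use x t in \<open>simp add: V_reg_scale mt\<close>)
  then have "mat_deriv \<xi> (\<lambda>y. U (t *s y)) x = mat_deriv (t *s \<xi>) U (t *s x)" by (simp add: mt)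
  moreover have "mat_deriv (t *s \<xi> + 0 *s \<xi>) U (t *s x) = smul t (mat_deriv \<xi> U (t *s x))"
    using x t by (subst mat_deriv_linear[OF poly_\<delta> U]) (simp_all add: \<delta>_nz V_reg_scale)
  moreover have "mat_deriv \<xi> (\<lambda>y. U (t *s y)) x = mat_deriv \<xi> (\<lambda>y. smul (t powi d) (U y)) x"
    by (rule mat_deriv_cong_reg[OF x]) (use h t in \<open>simp add: mat_homog_def\<close>)
  moreover have "mat_deriv \<xi> (\<lambda>y. smul (t powi d) (U y)) x = smul (t powi d) (mat_deriv \<xi> U x)"
    using x by (subst mat_deriv_smul[OF poly_\<delta> localised_const U]) (simp_all add: \<delta>_nz)
  ultimately have "smul t (mat_deriv \<xi> U (t *s x)) = smul (t powi d) (mat_deriv \<xi> U x)" by simp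
  then have "smul (1 / t) (smul t (mat_deriv \<xi> U (t *s x))) = smul (1 / t) (smul (t powi d) (mat_deriv \<xi> U x))" by simp
  then show ?thesis using t by (simp add: power_int_diff)
qed

lemma mat_deriv_euler:
  assumes h: "mat_homog d U" and U: "mat_localised \<delta> U" and x: "x \<in> V_reg W"
  shows "mat_deriv x U x = smul (of_int d) (U x)"
proof -
  have "dir_deriv x (\<lambda>y. U y $ i $ j) x = of_int d * U x $ i $ j" for i j
  proof (rule dir_deriv_eqI)
    have "((\<lambda>t. (1 + t) powi d * U x $ i $ j) has_field_derivative of_int d * U x $ i $ j) (at 0)"
      by (auto intro!: derivative_eq_intros)
    moreover have "eventually (\<lambda>t::complex. 1 + t \<noteq> 0) (nhds 0)"
    proof -
      have "((\<lambda>t::complex. 1 + t) \<longlongrightarrow> 1 + 0) (nhds 0)" by (intro tendsto_add tendsto_const tendsto_ident_at) (simp add: filterlim_ident)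
      then show ?thesis by (rule tendsto_imp_eventually_ne) simp
    qed
    then have "eventually (\<lambda>t. U (x + t *s x) $ i $ j = (1 + t) powi d * U x $ i $ j) (nhds 0)"
    proof (rule eventually_mono)
      fix t :: complex assume "1 + t \<noteq> 0"
      then have "U ((1 + t) *s x) = smul ((1 + t) powi d) (U x)" using h x unfolding mat_homog_def by blast
      moreover have "x + t *s x = (1 + t) *s x" by (simp add: vec_eq_iff algebra_simps)
      ultimately show "U (x + t *s x) $ i $ j = (1 + t) powi d * U x $ i $ j" by (simp only: smul_nth)
    qed
    ultimately show "((\<lambda>t. U (x + t *s x) $ i $ j) has_field_derivative of_int d * U x $ i $ j) (at 0)"
      by (subst DERIV_cong_ev[OF refl _ refl]) 
  qed
  then show ?thesis by (simp add: vec_eq_iff)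
qed

lemma mat_homog_nabla:
  assumes h: "mat_homog d U" and U: "mat_localised \<delta> U" shows "mat_homog (d - 1) (nabla k \<tau> \<xi> U)"
  unfolding mat_homog_def
proof (intro ballI allI impI)
  fix x t assume x: "x \<in> V_reg W" and t: "(t::complex) \<noteq> 0"
  have "U (t *s x) = smul (t powi d) (U x)" using h x t by (simp add: mat_homog_def)
  moreover have "t powi (d - 1) = t powi d / t" using t by (simp add: power_int_diff)
  ultimately show "nabla k \<tau> \<xi> U (t *s x) = smul (t powi (d - 1)) (nabla k \<tau> \<xi> U x)"
    unfolding nabla_def mat_deriv_scale[OF h U x t] Acon_scale[OF t] using t by (simp add: mat_alg mult_ac)
qed

text \<open>On homogeneous sections the covariant derivative along the Euler field is a scalar.
  Division by it replaces integration of the flatness equations.\<close>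

lemma nabla_euler:
  assumes irr: "irreducible_representation W \<tau>" and h: "mat_homog d U" and U: "mat_localised \<delta> U" and x: "x \<in> V_reg W"
  shows "nabla k \<tau> x U x = smul (of_int d + k * kz_scalar \<tau>) (U x)"
  unfolding nabla_def mat_deriv_euler[OF h U x] Acon_euler[OF x] Csum_kz_scalar[OF irr] by (simp add: mat_alg)

lemma nabla_sum_dir:
  assumes U: "mat_localised \<delta> U" and x: "x \<in> V_reg W" and S: "finite S"
  shows "nabla k \<tau> (\<Sum>i\<in>S. c i *s e i) U x = (\<Sum>i\<in>S. smul (c i) (nabla k \<tau> (e i) U x))"
  using S
proof (induction S rule: finite_induct)
  case empty
  show ?case using nabla_linear[OF U x, of k \<tau> 0 0 0 0] by simp
next
  case (insert i S)
  then show ?case using nabla_linear[OF U x, of k \<tau> "c i" "e i" 1 "\<Sum>i\<in>S. c i *s e i"] by simp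
qed

lemma nabla_euler_sum:
  assumes U: "mat_localised \<delta> U" and x: "x \<in> V_reg W"
  shows "nabla k \<tau> x U x = (\<Sum>i\<in>UNIV. smul (x $ i) (nabla k \<tau> (axis i 1) U x))"
proof -
  have "x = (\<Sum>i\<in>UNIV. x $ i *s axis i 1)" by (rule basis_expansion[symmetric])
  then show ?thesis using nabla_sum_dir[OF U x, of UNIV k \<tau> "\<lambda>i. x $ i" "\<lambda>i. axis i 1"] by simp
qed

section \<open>The lattice of sections with regular derivatives\<close>

abbreviation "Na j \<tau> H \<equiv> nabla (- of_nat j) \<tau> (coroot H)"

lemma nabla_pow_mat_localised: "mat_localised \<delta> U \<Longrightarrow> mat_localised \<delta> ((nabla k \<tau> \<xi> ^^ r) U)"
  by (induction r) (simp_all add: mat_localised_nabla)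

lemma nabla_pow_cong: "(\<And>y. y \<in> V_reg W \<Longrightarrow> F y = G y) \<Longrightarrow> x \<in> V_reg W \<Longrightarrow> (nabla k \<tau> \<xi> ^^ r) F x = (nabla k \<tau> \<xi> ^^ r) G x"
proof (induction r arbitrary: x)
  case (Suc r)
  show ?case unfolding funpow.simps o_def by (rule nabla_cong[OF Suc.prems(2)]) (rule Suc.IH[OF Suc.prems(1)])
qed simp

lemma nabla_smul_const: "mat_localised \<delta> U \<Longrightarrow> x \<in> V_reg W \<Longrightarrow> nabla k \<tau> \<xi> (\<lambda>x. smul c (U x)) x = smul c (nabla k \<tau> \<xi> U x)"
  by (subst nabla_smul) simp_all

lemma nabla_pow_lin:
  assumes "mat_localised \<delta> F" "mat_localised \<delta> G" "x \<in> V_reg W"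
  shows "(nabla k \<tau> \<xi> ^^ r) (\<lambda>x. F x + smul c (G x)) x = (nabla k \<tau> \<xi> ^^ r) F x + smul c ((nabla k \<tau> \<xi> ^^ r) G x)"
  using assms(3)
proof (induction r arbitrary: x)
  case (Suc r)
  let ?N = "nabla k \<tau> \<xi>"
  have "?N ((?N ^^ r) (\<lambda>x. F x + smul c (G x))) x = ?N (\<lambda>x. (?N ^^ r) F x + smul c ((?N ^^ r) G x)) x"
    by (rule nabla_cong[OF Suc.prems]) (rule Suc.IH)
  also have "\<dots> = ?N ((?N ^^ r) F) x + ?N (\<lambda>x. smul c ((?N ^^ r) G x)) x"
    by (rule nabla_add) (intro nabla_pow_mat_localised assms mat_localised_smul localised_const Suc.prems)+
  also have "?N (\<lambda>x. smul c ((?N ^^ r) G x)) x = smul c (?N ((?N ^^ r) G) x)"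
    by (rule nabla_smul_const) (intro nabla_pow_mat_localised assms Suc.prems)+
  finally show ?case by simp
qed simp

lemma nabla_pow_commute:
  assumes rep: "representation W \<tau>" and U: "mat_localised \<delta> U" and x: "x \<in> V_reg W"
  shows "(nabla k \<tau> \<xi> ^^ r) (nabla k \<tau> \<eta> U) x = nabla k \<tau> \<eta> ((nabla k \<tau> \<xi> ^^ r) U) x"
  using x
proof (induction r arbitrary: x)
  case (Suc r)
  let ?N = "nabla k \<tau> \<xi>"
  have "?N ((?N ^^ r) (nabla k \<tau> \<eta> U)) x = ?N (nabla k \<tau> \<eta> ((?N ^^ r) U)) x"
    by (rule nabla_cong[OF Suc.prems]) (rule Suc.IH)
  also have "\<dots> = nabla k \<tau> \<eta> (?N ((?N ^^ r) U)) x"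
    by (rule nabla_commute[OF rep nabla_pow_mat_localised[OF U] Suc.prems])
  finally show ?case by simp
qed simp

lemma regH_add: assumes "regH H F" "regH H G" shows "regH H (\<lambda>x. F x + smul c (G x))"
proof -
  obtain F' G' where "mat_localised (dH H) F'" "\<forall>x\<in>V_reg W. F x = F' x" "mat_localised (dH H) G'" "\<forall>x\<in>V_reg W. G x = G' x"
    using assms unfolding regH_def by blast
  then show ?thesis
    by (intro regH_I[of _ "\<lambda>x. F' x + smul c (G' x)"]) (simp_all add: mat_localised_add mat_localised_smul)
qed

text \<open>In a direction tangent to H the polar term of the connection has the coefficient
  \<open>frm H \<zeta>\<close> = 0.\<close>

lemma regH_nabla:
  assumes H: "H \<in> arr" and z: "frm H \<zeta> = 0" and U: "regH H U"
  shows "regH H (nabla k \<tau> \<zeta> U)"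
proof -
  obtain G where G: "mat_localised (dH H) G" "\<And>x. x \<in> V_reg W \<Longrightarrow> U x = G x" using U unfolding regH_def by blast
  show ?thesis
  proof (rule regH_I)
    show "mat_localised (dH H) (\<lambda>x. mat_deriv \<zeta> G x + smul k (Bcon \<tau> H \<zeta> x ** G x))"
      by (intro mat_localised_add mat_localised_mat_deriv mat_localised_smul mat_localised_mult mat_localised_Bcon G localised_const poly_dH)
    fix x assume x: "x \<in> V_reg W"
    have "nabla k \<tau> \<zeta> U x = nabla k \<tau> \<zeta> G x" by (rule nabla_cong[OF x G(2)])
    then show "nabla k \<tau> \<zeta> U x = mat_deriv \<zeta> G x + smul k (Bcon \<tau> H \<zeta> x ** G x)"
      unfolding nabla_def Acon_split[OF H] by (simp add: z)
  qed
qed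

text \<open>Only iterated derivatives in the coroot directions are tested; \<open>Elat_nabla\<close>
  shows that the condition then passes to derivatives in all directions.\<close>

definition Elat :: "nat \<Rightarrow> (complex^'n^'n \<Rightarrow> complex^'d^'d) \<Rightarrow> (complex^'n \<Rightarrow> complex^'e^'d) \<Rightarrow> bool" where
  "Elat j \<tau> U \<longleftrightarrow> mat_localised \<delta> U \<and> (\<forall>H\<in>arr. \<forall>r. regH H ((Na j \<tau> H ^^ r) U))"

text \<open>Split \<xi> along H. The tangential part preserves regularity and commutes with the
  coroot derivative by flatness; the multiple of the coroot only raises r by one.\<close>

lemma Elat_nabla:
  assumes rep: "representation W \<tau>" and E: "Elat j \<tau> U" shows "Elat j \<tau> (nabla (- of_nat j) \<tau> \<xi> U)"
  unfolding Elat_def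
proof (intro conjI ballI allI)
  have U: "mat_localised \<delta> U" using E by (simp add: Elat_def)
  then show "mat_localised \<delta> (nabla (- of_nat j) \<tau> \<xi> U)" by (rule mat_localised_nabla)
  fix H r assume H: "H \<in> arr"
  define \<zeta> where "\<zeta> = \<xi> - frm H \<xi> *s coroot H"
  have z: "frm H \<zeta> = 0" by (simp add: \<zeta>_def frm_coroot[OF H])
  have xi: "\<xi> = 1 *s \<zeta> + frm H \<xi> *s coroot H" by (simp add: \<zeta>_def)
  let ?N = "Na j \<tau> H"
  have e: "nabla (- of_nat j) \<tau> \<xi> U x = nabla (- of_nat j) \<tau> \<zeta> U x + smul (frm H \<xi>) (?N U x)" if "x \<in> V_reg W" for x
    using nabla_linear[OF U that, of "- of_nat j" \<tau> 1 \<zeta> "frm H \<xi>" "coroot H"] xi by simp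
  have "(?N ^^ r) (nabla (- of_nat j) \<tau> \<xi> U) x = nabla (- of_nat j) \<tau> \<zeta> ((?N ^^ r) U) x + smul (frm H \<xi>) ((?N ^^ Suc r) U x)"
    if x: "x \<in> V_reg W" for x
  proof -
    have "(?N ^^ r) (nabla (- of_nat j) \<tau> \<xi> U) x = (?N ^^ r) (\<lambda>x. nabla (- of_nat j) \<tau> \<zeta> U x + smul (frm H \<xi>) (?N U x)) x"
      by (rule nabla_pow_cong[OF e x])
    also have "\<dots> = (?N ^^ r) (nabla (- of_nat j) \<tau> \<zeta> U) x + smul (frm H \<xi>) ((?N ^^ r) (?N U) x)"
      by (rule nabla_pow_lin[OF mat_localised_nabla[OF U] mat_localised_nabla[OF U] x])
    also have "(?N ^^ r) (nabla (- of_nat j) \<tau> \<zeta> U) x = nabla (- of_nat j) \<tau> \<zeta> ((?N ^^ r) U) x"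
      by (rule nabla_pow_commute[OF rep U x])
    finally show ?thesis by (simp add: funpow_swap1)
  qed
  then have "regH H ((?N ^^ r) (nabla (- of_nat j) \<tau> \<xi> U)) \<longleftrightarrow>
      regH H (\<lambda>x. nabla (- of_nat j) \<tau> \<zeta> ((?N ^^ r) U) x + smul (frm H \<xi>) ((?N ^^ Suc r) U x))"
    by (rule regH_cong)
  moreover have "regH H (\<lambda>x. nabla (- of_nat j) \<tau> \<zeta> ((?N ^^ r) U) x + smul (frm H \<xi>) ((?N ^^ Suc r) U x))"
    by (rule regH_add[OF regH_nabla[OF H z]]) (use E H in \<open>auto simp: Elat_def simp del: funpow.simps\<close>)
  ultimately show "regH H ((?N ^^ r) (nabla (- of_nat j) \<tau> \<xi> U))" by blast
qed

lemma Elat_mat_poly: assumes "Elat j \<tau> U" shows "\<exists>P. mat_poly P \<and> (\<forall>x\<in>V_reg W. U x = P x)"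
proof (rule mregular_imp_mat_poly)
  show "mat_localised \<delta> U" using assms by (simp add: Elat_def)
  show "H \<in> arr \<Longrightarrow> regH H U" for H using assms unfolding Elat_def by (metis funpow_0)
qed

text \<open>Summing the exponents over all hyperplanes gives a number that is at least as large as
  each of them.\<close>

definition Kexp :: "nat \<Rightarrow> nat" where "Kexp j = (\<Sum>H\<in>arr. resH j H)"

text \<open>The power of \<delta> contains alpha_H to the exponent \<open>resH j H\<close> for each
  H, so \<open>local_regular\<close> applies along every hyperplane.\<close>

lemma Elat_delta: 
  assumes rep: "representation W \<tau>" shows "Elat j \<tau> (\<lambda>x. smul (\<delta> x ^ Kexp j) C)"
  unfolding Elat_def
proof (intro conjI ballI allI)
  show "mat_localised \<delta> (\<lambda>x. smul (\<delta> x ^ Kexp j) C)"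
    by (intro mat_localised_smul localised_poly poly_fun_power poly_\<delta> mat_localised_const)
  fix H r assume H: "H \<in> arr"
  let ?c = "resH j H" let ?K = "Kexp j"
  have le: "?c \<le> ?K" unfolding Kexp_def by (rule member_le_sum) (use H finite_arr in auto)
  define \<psi> where "\<psi> x = smul (frm H x ^ (?K - ?c) * dH H x ^ ?K) C" for x
  have e: "(\<lambda>x. smul (\<delta> x ^ ?K) C) = (\<lambda>x. smul (frm H x ^ ?c) (\<psi> x))"
  proof
    fix x
    have "\<delta> x ^ ?K = frm H x ^ ?c * (frm H x ^ (?K - ?c) * dH H x ^ ?K)"
      unfolding \<delta>_split[OF H] power_mult_distrib using le by (simp add: power_add[symmetric] mult.assoc[symmetric])
    then show "smul (\<delta> x ^ ?K) C = smul (frm H x ^ ?c) (\<psi> x)" by (simp add: \<psi>_def)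
  qed
  have "mat_localised (dH H) \<psi>" unfolding \<psi>_def
    by (intro mat_localised_smul localised_poly poly_fun_mult poly_fun_power poly_dH poly_fun_form mat_localised_const)
  from local_regular[OF rep H this, where j=j and r=r] show "regH H ((Na j \<tau> H ^^ r) (\<lambda>x. smul (\<delta> x ^ ?K) C))" unfolding e .
qed

text \<open>Induction on the degree: the derivatives of U have degree D - 1 and vanish. So does the
  Euler derivative, which is U times the nonzero number D - j
  \<open>kz_scalar \<tau>\<close>.\<close>

lemma Elat_low_degree:
  assumes irr: "irreducible_representation W \<tau>"
  shows "Elat j \<tau> U \<Longrightarrow> mat_homog D U \<Longrightarrow> (\<And>D'. D' \<le> D \<Longrightarrow> of_int D' \<noteq> of_nat j * kz_scalar \<tau>) \<Longrightarrow> x \<in> V_reg W \<Longrightarrow> U x = 0"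
proof (induction "nat (D + 1)" arbitrary: D U x)
  case 0
  obtain P where P: "mat_poly P" "\<And>x. x \<in> V_reg W \<Longrightarrow> U x = P x" using Elat_mat_poly[OF 0(2)] by blast
  have "mat_homog D P" using mat_homog_cong[OF P(2), where d=D] 0(3) by simp
  moreover have "D < 0" using 0(1) by simp
  ultimately have "P x = 0" by (rule mat_poly_negative_degree[OF P(1)])
  then show ?case using P(2)[OF 0(5)] by simp
next
  case (Suc n)
  have U: "mat_localised \<delta> U" using Suc.prems(1) by (simp add: Elat_def)
  have "nabla (- of_nat j) \<tau> \<xi> U x = 0" for \<xi>
  proof (rule Suc.hyps(1)[of "D - 1"])
    show "n = nat (D - 1 + 1)" using Suc.hyps(2) by simp
    show "Elat j \<tau> (nabla (- of_nat j) \<tau> \<xi> U)" by (rule Elat_nabla[OF irr_rep[OF irr] Suc.prems(1)])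
    show "mat_homog (D - 1) (nabla (- of_nat j) \<tau> \<xi> U)" by (rule mat_homog_nabla[OF Suc.prems(2) U])
  qed (use Suc.prems in auto)
  then have "smul (of_int D + - of_nat j * kz_scalar \<tau>) (U x) = 0"
    using nabla_euler[OF irr Suc.prems(2) U Suc.prems(4), of "- of_nat j"] by simp
  moreover have "of_int D + - of_nat j * kz_scalar \<tau> \<noteq> 0" using Suc.prems(3)[of D] by simp
  ultimately show ?case by (simp add: smul_eq_0)
qed

definition flatD :: "nat \<Rightarrow> (complex^'n^'n \<Rightarrow> complex^'d^'d) \<Rightarrow> int \<Rightarrow> (complex^'n \<Rightarrow> complex^'e^'d) \<Rightarrow> bool" where
  "flatD j \<tau> D F \<longleftrightarrow> mat_poly F \<and> mat_homog D F \<and> (\<forall>\<xi>. \<forall>x\<in>V_reg W. nabla (- of_nat j) \<tau> \<xi> F x = 0)"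

inductive flat_span :: "nat \<Rightarrow> (complex^'n^'n \<Rightarrow> complex^'d^'d) \<Rightarrow> int \<Rightarrow> (complex^'n \<Rightarrow> complex^'e^'d) \<Rightarrow> bool"
  for j \<tau> D where
  zero: "flat_span j \<tau> D (\<lambda>x. 0)"
| add: "flat_span j \<tau> D U \<Longrightarrow> flatD j \<tau> D F \<Longrightarrow> poly_fun g \<Longrightarrow> flat_span j \<tau> D (\<lambda>x. smul (g x) (F x) + U x)"

lemma flat_span_smul: "flat_span j \<tau> D U \<Longrightarrow> poly_fun g \<Longrightarrow> flat_span j \<tau> D (\<lambda>x. smul (g x) (U x))"
proof (induction rule: flat_span.induct)
  case zero
  then show ?case using flat_span.zero by simp
next
  case (add U F h)
  from flat_span.add[OF add.IH[OF add.prems] add.hyps(2) poly_fun_mult[OF add.prems add.hyps(3)]]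
  show ?case by (simp add: smul_add_right)
qed

lemma flat_span_add: "flat_span j \<tau> D U \<Longrightarrow> flat_span j \<tau> D V \<Longrightarrow> flat_span j \<tau> D (\<lambda>x. U x + V x)"
proof (induction rule: flat_span.induct)
  case (add U F h)
  from flat_span.add[OF add.IH[OF add.prems] add.hyps(2,3)] show ?case by (simp add: add.assoc)
qed simp

lemma flat_span_sum: "finite S \<Longrightarrow> (\<And>i. i \<in> S \<Longrightarrow> flat_span j \<tau> D (f i)) \<Longrightarrow> flat_span j \<tau> D (\<lambda>x. \<Sum>i\<in>S. f i x)"
  by (induction S rule: finite_induct) (auto intro: flat_span_add flat_span.zero)

text \<open>In a degree D other than D0 the Euler scalar D - D0 is nonzero, so U is a combination,
  with the coordinates as coefficients, of its derivatives, which lie in the span by induction. In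
  degree D0 the derivatives have too small a degree and vanish, so U itself is flat.\<close>

lemma Elat_flat_span:
  assumes irr: "irreducible_representation W \<tau>" and D0: "of_int D0 = of_nat j * kz_scalar \<tau>"
  shows "Elat j \<tau> U \<Longrightarrow> mat_homog D U \<Longrightarrow> \<exists>V. flat_span j \<tau> D0 V \<and> (\<forall>x\<in>V_reg W. U x = V x)"
\<comment> \<open>The measure is 0 exactly when D < D0.\<close>
proof (induction "nat (D + 1 - D0)" arbitrary: D U)
  case 0
  have "of_int D' \<noteq> of_nat j * kz_scalar \<tau>" if "D' \<le> D" for D'
    using 0(1) that unfolding D0[symmetric] of_int_eq_iff by simp
  then have "\<forall>x\<in>V_reg W. U x = 0" using Elat_low_degree[OF irr 0(2,3)] by blast
  then show ?case using flat_span.zero by blast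
next
  case (Suc n)
  let ?k = "- of_nat j :: complex"
  have U: "mat_localised \<delta> U" using Suc.prems(1) by (simp add: Elat_def)
  have N: "Elat j \<tau> (nabla ?k \<tau> \<xi> U)" "mat_homog (D - 1) (nabla ?k \<tau> \<xi> U)" for \<xi>
    by (rule Elat_nabla[OF irr_rep[OF irr] Suc.prems(1)], rule mat_homog_nabla[OF Suc.prems(2) U])
  show ?case
  proof (cases "D = D0")
    case True
    have f: "nabla ?k \<tau> \<xi> U x = 0" if "x \<in> V_reg W" for \<xi> x
    proof (rule Elat_low_degree[OF irr N _ that])
      fix D' assume "D' \<le> D - 1"
      then show "of_int D' \<noteq> of_nat j * kz_scalar \<tau>" unfolding D0[symmetric] of_int_eq_iff using True by simp
    qed
    obtain P where P: "mat_poly P" "\<And>x. x \<in> V_reg W \<Longrightarrow> U x = P x" using Elat_mat_poly[OF Suc.prems(1)] by blast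
    have "nabla ?k \<tau> \<xi> P x = 0" if x: "x \<in> V_reg W" for \<xi> x
      using f[OF x, of \<xi>] nabla_cong[OF x P(2), where k="?k" and \<tau>=\<tau> and \<xi>=\<xi>] by simp
    then have "flatD j \<tau> D0 P" using P mat_homog_cong[OF P(2), where d=D] Suc.prems(2) True by (simp add: flatD_def)
    from flat_span.add[OF flat_span.zero this, of "\<lambda>x. 1"] have "flat_span j \<tau> D0 P" by simp
    then show ?thesis using P by blast
  next
    case False
    have "\<exists>V. flat_span j \<tau> D0 V \<and> (\<forall>x\<in>V_reg W. nabla ?k \<tau> (axis i 1) U x = V x)" for i
      by (rule Suc.hyps(1)[of "D - 1"]) (use Suc.hyps(2) N in auto)
    then obtain V where V: "\<And>i. flat_span j \<tau> D0 (V i)" "\<And>i x. x \<in> V_reg W \<Longrightarrow> nabla ?k \<tau> (axis i 1) U x = V i x" by metis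
    let ?e = "of_int D - of_nat j * kz_scalar \<tau>"
    have e: "?e \<noteq> 0" using False unfolding D0[symmetric] by simp
    show ?thesis
    proof (intro exI conjI ballI)
      show "flat_span j \<tau> D0 (\<lambda>x. smul (1 / ?e) (\<Sum>i\<in>UNIV. smul (x $ i) (V i x)))"
        by (intro flat_span_smul flat_span_sum V) auto
      fix x assume x: "x \<in> V_reg W"
      have "smul ?e (U x) = (\<Sum>i\<in>UNIV. smul (x $ i) (V i x))"
        using nabla_euler[OF irr Suc.prems(2) U x, of ?k] nabla_euler_sum[OF U x, of ?k \<tau>] V(2)[OF x] by simp
      then have "smul (1 / ?e) (smul ?e (U x)) = smul (1 / ?e) (\<Sum>i\<in>UNIV. smul (x $ i) (V i x))" by simp
      then show "U x = smul (1 / ?e) (\<Sum>i\<in>UNIV. smul (x $ i) (V i x))" using e by simp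
    qed
  qed
qed

end

section \<open>Unique continuation and fundamental matrices\<close>

lemma poly_fun_dir_deriv_line:
  assumes "poly_fun G" "\<And>t. G (p + t *s \<xi>) = poly q t"
  shows "dir_deriv \<xi> G (p + t *s \<xi>) = poly (pderiv q) t"
proof (rule dir_deriv_eqI)
  have "((\<lambda>s. poly q (t + s)) has_field_derivative poly (pderiv q) t) (at 0)"
    by (auto intro!: derivative_eq_intros DERIV_chain2[where f="poly q"] poly_DERIV)
  moreover have "G (p + t *s \<xi> + s *s \<xi>) = poly q (t + s)" for s
    using assms(2)[of "t + s"] by (simp add: vec.scale_left_distrib add.assoc)
  ultimately show "((\<lambda>s. G (p + t *s \<xi> + s *s \<xi>)) has_field_derivative poly (pderiv q) t) (at 0)" by simp
qed

text \<open>Taylor's formula: up to factorials the coefficients of the restriction of G to the line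
  are its iterated derivatives at p.\<close>

lemma poly_fun_line_zero:
  assumes G: "poly_fun G" and z: "\<And>r. ((dir_deriv \<xi> ^^ r) G) p = 0"
  shows "G (p + t *s \<xi>) = 0"
proof -
  obtain q where q: "\<And>t. G (p + t *s \<xi>) = poly q t" using poly_fun_line[OF G] by blast
  have "poly_fun ((dir_deriv \<xi> ^^ r) G) \<and> (\<forall>t. (dir_deriv \<xi> ^^ r) G (p + t *s \<xi>) = poly ((pderiv ^^ r) q) t)" for r
  proof (induction r)
    case (Suc r)
    then show ?case using poly_fun_dir_deriv[of "(dir_deriv \<xi> ^^ r) G" \<xi>] poly_fun_dir_deriv_line[of "(dir_deriv \<xi> ^^ r) G" p \<xi> "(pderiv ^^ r) q"] by simp
  qed (use G q in simp)
  then have "poly ((pderiv ^^ r) q) 0 = 0" for r using z[of r] by (metis add.right_neutral vector_smult_lzero)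
  then have "coeff ((pderiv ^^ r) q) 0 = 0" for r by (simp add: poly_0_coeff_0)
  then have "coeff q r = 0" for r by (simp add: coeff_higher_pderiv pochhammer_fact[symmetric])
  then have "q = 0" by (simp add: poly_eq_iff)
  then show ?thesis using q by simp
qed

lemma mat_localised_common_denominator:
  assumes P: "mat_localised D P" and D: "poly_fun D"
  shows "\<exists>G r. mat_poly G \<and> (\<forall>x. D x \<noteq> 0 \<longrightarrow> P x = smul (1 / D x ^ r) (G x))"
proof -
  have "\<exists>g r. poly_fun g \<and> (\<forall>x. D x \<noteq> 0 \<longrightarrow> P x $ i $ j = g x / D x ^ r)" for i j
    using P unfolding mat_localised_def localised_def by blast
  then obtain g r where g: "\<And>i j. poly_fun (g i j)" "\<And>i j x. D x \<noteq> 0 \<Longrightarrow> P x $ i $ j = g i j x / D x ^ r i j" by metis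
  define R where "R = (\<Sum>i\<in>UNIV. \<Sum>j\<in>UNIV. r i j)"
  have le: "r i j \<le> R" for i j
  proof -
    have "r i j \<le> (\<Sum>j\<in>UNIV. r i j)" by (rule member_le_sum) auto
    also have "\<dots> \<le> R" unfolding R_def by (rule member_le_sum[of i UNIV "\<lambda>i. \<Sum>j\<in>UNIV. r i j"]) auto
    finally show ?thesis .
  qed
  show ?thesis
  proof (intro exI conjI allI impI)
    show "mat_poly (\<lambda>x. \<chi> i j. g i j x * D x ^ (R - r i j))"
      unfolding mat_poly_def by (simp add: poly_fun_mult poly_fun_power g D)
    fix x assume x: "D x \<noteq> 0"
    have "g i j x / D x ^ r i j = (g i j x * D x ^ (R - r i j)) / D x ^ R" for i j
      using x le[of i j] by (simp add: power_diff)
    then show "P x = smul (1 / D x ^ R) (\<chi> i j. g i j x * D x ^ (R - r i j))"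
      using g(2)[OF x] by (simp add: vec_eq_iff)
  qed
qed

context refl_arr begin

text \<open>Linear combinations of the entries of P with coefficients in the coordinate ring of
  \<open>V_reg\<close> are closed under differentiation, because of the equation, and all of them
  vanish at p. The line from p to x may meet hyperplanes; so Taylor's formula is applied to the
  polynomial numerator of an entry, which is again such a combination.\<close>

lemma unique_continuation:
  assumes P: "mat_localised \<delta> P"
    and ode: "\<And>\<xi>. \<exists>L R. mat_localised \<delta> L \<and> mat_localised \<delta> R \<and> (\<forall>x\<in>V_reg W. mat_deriv \<xi> P x = L x ** P x + P x ** R x)"
    and p: "p \<in> V_reg W" "P p = 0" and x: "x \<in> V_reg W"
  shows "P x = 0"
proof -
  define M where "M f \<longleftrightarrow> (\<exists>c. (\<forall>i j. localised \<delta> (c i j)) \<and> (\<forall>x\<in>V_reg W. f x = (\<Sum>i\<in>UNIV. \<Sum>j\<in>UNIV. c i j x * P x $ i $ j)))" for f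
  have Madd: "M (\<lambda>x. f x + g x)" if f: "M f" and g: "M g" for f g
  proof -
    obtain c d where "\<forall>i j. localised \<delta> (c i j)" "\<forall>x\<in>V_reg W. f x = (\<Sum>i\<in>UNIV. \<Sum>j\<in>UNIV. c i j x * P x $ i $ j)"
      "\<forall>i j. localised \<delta> (d i j)" "\<forall>x\<in>V_reg W. g x = (\<Sum>i\<in>UNIV. \<Sum>j\<in>UNIV. d i j x * P x $ i $ j)"
      using f g unfolding M_def by blast
    then show ?thesis unfolding M_def
      by (intro exI[of _ "\<lambda>i j x. c i j x + d i j x"]) (simp add: localised_add algebra_simps sum.distrib)
  qed
  have M0: "M (\<lambda>x. 0)" unfolding M_def by (intro exI[of _ "\<lambda>i j x. 0"]) simp
  have Msum: "M (\<lambda>x. \<Sum>i\<in>S. f i x)" if "finite S" "\<And>i. i \<in> S \<Longrightarrow> M (f i)" for S and f :: "'z \<Rightarrow> complex^'n \<Rightarrow> complex"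
    using that by (induction S rule: finite_induct) (auto intro: Madd M0)
  have Mmult: "M (\<lambda>x. h x * f x)" if h: "localised \<delta> h" and f: "M f" for h f
  proof -
    obtain c where "\<forall>i j. localised \<delta> (c i j)" "\<forall>x\<in>V_reg W. f x = (\<Sum>i\<in>UNIV. \<Sum>j\<in>UNIV. c i j x * P x $ i $ j)"
      using f unfolding M_def by blast
    then show ?thesis unfolding M_def using h
      by (intro exI[of _ "\<lambda>i j x. h x * c i j x"]) (simp add: localised_mult sum_distrib_left mult.assoc)
  qed
  have Ment: "M (\<lambda>x. P x $ i $ j)" for i j
  proof -
    have "P x $ i $ j = (\<Sum>a\<in>UNIV. \<Sum>b\<in>UNIV. (if a = i \<and> b = j then 1 else 0) * P x $ a $ b)" for x
    proof -
      have "(\<Sum>a\<in>UNIV. \<Sum>b\<in>UNIV. (if a = i \<and> b = j then 1 else 0) * P x $ a $ b)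
        = (\<Sum>a\<in>UNIV. if a = i then P x $ i $ j else 0)"
      proof (rule sum.cong[OF refl])
        fix a
        have "(\<Sum>b\<in>UNIV. (if a = i \<and> b = j then 1 else 0) * P x $ a $ b) = (\<Sum>b\<in>UNIV. if b = j then (if a = i then P x $ i $ j else 0) else 0)"
          by (rule sum.cong) auto
        then show "(\<Sum>b\<in>UNIV. (if a = i \<and> b = j then 1 else 0) * P x $ a $ b) = (if a = i then P x $ i $ j else 0)" by simp
      qed
      then show ?thesis by simp
    qed
    then show ?thesis unfolding M_def by (intro exI[of _ "\<lambda>a b x. if a = i \<and> b = j then 1 else 0"]) simp
  qed
  have Mcong: "M f \<longleftrightarrow> M g" if "\<And>x. x \<in> V_reg W \<Longrightarrow> f x = g x" for f g using that by (simp add: M_def)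
  have Mdd: "M (dir_deriv \<xi> f)" if f: "M f" for \<xi> f
  proof -
    obtain c where c0: "(\<forall>i j. localised \<delta> (c i j)) \<and> (\<forall>x\<in>V_reg W. f x = (\<Sum>i\<in>UNIV. \<Sum>j\<in>UNIV. c i j x * P x $ i $ j))"
      using f unfolding M_def by blast
    then have c: "\<And>i j. localised \<delta> (c i j)" "\<And>x. x \<in> V_reg W \<Longrightarrow> f x = (\<Sum>i\<in>UNIV. \<Sum>j\<in>UNIV. c i j x * P x $ i $ j)"
      by blast+
    obtain L R where LR: "mat_localised \<delta> L" "mat_localised \<delta> R" "\<And>x. x \<in> V_reg W \<Longrightarrow> mat_deriv \<xi> P x = L x ** P x + P x ** R x"
      using ode[of \<xi>] by blast
    have Pl: "localised \<delta> (\<lambda>x. P x $ i $ j)" for i j using P by (simp add: mat_localised_def)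
    have e: "dir_deriv \<xi> f x = (\<Sum>i\<in>UNIV. \<Sum>j\<in>UNIV. dir_deriv \<xi> (c i j) x * P x $ i $ j
        + c i j x * ((\<Sum>k\<in>UNIV. L x $ i $ k * P x $ k $ j) + (\<Sum>k\<in>UNIV. R x $ k $ j * P x $ i $ k)))" if x: "x \<in> V_reg W" for x
    proof -
      have dx: "\<delta> x \<noteq> 0" using x by (simp add: \<delta>_nz)
      have ent: "dir_deriv \<xi> (\<lambda>x. P x $ i $ j) x = (\<Sum>k\<in>UNIV. L x $ i $ k * P x $ k $ j) + (\<Sum>k\<in>UNIV. R x $ k $ j * P x $ i $ k)" for i j
      proof -
        have "dir_deriv \<xi> (\<lambda>x. P x $ i $ j) x = mat_deriv \<xi> P x $ i $ j" by simp
        also have "\<dots> = (\<Sum>k\<in>UNIV. L x $ i $ k * P x $ k $ j) + (\<Sum>k\<in>UNIV. R x $ k $ j * P x $ i $ k)"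
          unfolding LR(3)[OF x] by (simp add: matrix_matrix_mult_def mult.commute)
        finally show ?thesis .
      qed
      have "dir_deriv \<xi> f x = dir_deriv \<xi> (\<lambda>x. \<Sum>i\<in>UNIV. \<Sum>j\<in>UNIV. c i j x * P x $ i $ j) x"
        by (rule dir_deriv_cong[OF poly_\<delta> dx]) (simp add: c \<delta>_nz)
      also have "\<dots> = (\<Sum>i\<in>UNIV. \<Sum>j\<in>UNIV. dir_deriv \<xi> (c i j) x * P x $ i $ j + c i j x * dir_deriv \<xi> (\<lambda>x. P x $ i $ j) x)"
        by (simp add: dir_deriv_sum[OF poly_\<delta>] dir_deriv_mult[OF poly_\<delta>] localised_sum localised_mult c Pl dx)
      finally show ?thesis unfolding ent .
    qed
    have LRl: "localised \<delta> (\<lambda>x. L x $ i $ k)" "localised \<delta> (\<lambda>x. R x $ i' $ k')" for i k i' k' using LR by (simp_all add: mat_localised_def)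
    show ?thesis
    proof (rule iffD2[OF Mcong[OF e]])
      show "M (\<lambda>x. \<Sum>i\<in>UNIV. \<Sum>j\<in>UNIV. dir_deriv \<xi> (c i j) x * P x $ i $ j
        + c i j x * ((\<Sum>k\<in>UNIV. L x $ i $ k * P x $ k $ j) + (\<Sum>k\<in>UNIV. R x $ k $ j * P x $ i $ k)))"
        by (rule Msum Madd Mmult Ment localised_dir_deriv[OF poly_\<delta>] c LRl finite_class.finite_UNIV)+
    qed
  qed
  have Mp: "f p = 0" if "M f" for f using that p unfolding M_def by auto
  have "P x $ i $ j = 0" for i j
  proof -
    obtain g r where g: "poly_fun g" "\<And>x. \<delta> x \<noteq> 0 \<Longrightarrow> P x $ i $ j = g x / \<delta> x ^ r"
      using P unfolding mat_localised_def localised_def by metis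
    have "M (\<lambda>x. \<delta> x ^ r * P x $ i $ j)" by (intro Mmult Ment localised_poly poly_fun_power poly_\<delta>)
    moreover have "\<delta> x ^ r * P x $ i $ j = g x" if "x \<in> V_reg W" for x
      using g(2)[of x] that by (simp add: \<delta>_nz[symmetric])
    ultimately have "M g" using Mcong[of "\<lambda>x. \<delta> x ^ r * P x $ i $ j" g] by blast
    then have "M ((dir_deriv (x - p) ^^ s) g)" for s by (induction s) (simp_all add: Mdd)
    then have "g (p + 1 *s (x - p)) = 0" by (intro poly_fun_line_zero[OF g(1)] Mp)
    then show ?thesis using g(2)[of x] x by (simp add: \<delta>_nz)
  qed
  then show ?thesis by (simp add: vec_eq_iff)
qed

lemma flat_unique:
  assumes P: "mat_localised \<delta> P" and f: "\<And>\<xi> x. x \<in> V_reg W \<Longrightarrow> nabla k \<tau> \<xi> P x = 0"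
    and p: "p \<in> V_reg W" "P p = 0" and x: "x \<in> V_reg W"
  shows "P x = 0"
proof (rule unique_continuation[OF P _ p x])
  fix \<xi>
  show "\<exists>L R. mat_localised \<delta> L \<and> mat_localised \<delta> R \<and> (\<forall>x\<in>V_reg W. mat_deriv \<xi> P x = L x ** P x + P x ** R x)"
  proof (intro exI conjI ballI)
    show "mat_localised \<delta> (\<lambda>x. smul (- k) (Acon \<tau> \<xi> x))" by (intro mat_localised_smul mat_localised_Acon localised_const)
    show "mat_localised \<delta> (\<lambda>x. 0)" by simp
    fix x assume "x \<in> V_reg W"
    from f[OF this, of \<xi>] show "mat_deriv \<xi> P x = smul (- k) (Acon \<tau> \<xi> x) ** P x + P x ** 0"
      by (simp add: nabla_def smul_minus_left matrix_mult_minus_left eq_neg_iff_add_eq_0)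
  qed
qed

lemma mat_homog_delta: "mat_homog (int (K * card arr)) (\<lambda>x. smul (\<delta> x ^ K) C)"
proof -
  have "\<delta> (t *s x) = t ^ card arr * \<delta> x" for t x
    unfolding \<delta>_def by (simp add: prod.distrib)
  then show ?thesis by (simp add: mat_homog_def power_mult_distrib power_mult[symmetric] mult.commute[of K] power_int_mult)
qed

lemma flatD_mat_localised: "flatD j \<tau> D F \<Longrightarrow> mat_localised \<delta> F" by (simp add: flatD_def mat_localised_poly)

lemma flatD_zero: "flatD j \<tau> D (\<lambda>x. 0)"
  by (simp add: flatD_def mat_homog_def nabla_def)

lemma flatD_lin: 
  assumes "flatD j \<tau> D F" "flatD j \<tau> D G" shows "flatD j \<tau> D (\<lambda>x. smul c (F x) + G x)"
  unfolding flatD_def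
proof (intro conjI allI ballI)
  show "mat_poly (\<lambda>x. smul c (F x) + G x)" using assms by (simp add: flatD_def mat_poly_add mat_poly_smul)
  show "mat_homog D (\<lambda>x. smul c (F x) + G x)" using assms by (simp add: flatD_def mat_homog_add mat_homog_smul)
  fix \<xi> x assume x: "x \<in> V_reg W"
  have "nabla (- of_nat j) \<tau> \<xi> (\<lambda>x. smul c (F x) + G x) x = nabla (- of_nat j) \<tau> \<xi> (\<lambda>x. smul c (F x)) x + nabla (- of_nat j) \<tau> \<xi> G x"
    by (rule nabla_add[OF _ flatD_mat_localised[OF assms(2)] x]) (intro mat_localised_smul localised_const flatD_mat_localised[OF assms(1)])
  then show "nabla (- of_nat j) \<tau> \<xi> (\<lambda>x. smul c (F x) + G x) x = 0"
    unfolding nabla_smul_const[OF flatD_mat_localised[OF assms(1)] x] using assms x by (simp add: flatD_def)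
qed

text \<open>\<delta>^K times the identity is a polynomial combination of flat sections. Freezing the
  coefficients at p yields one flat section that is invertible at p, and F is its normalisation. By
  unique continuation every flat \<Phi> equals F \<Phi>(p), so the combination reads F G =
  \<delta>^K, and G / \<delta>^K inverts F on \<open>V_reg\<close>.\<close>

lemma kz_solution:
  fixes \<tau> :: "complex^'n^'n \<Rightarrow> complex^'b::finite^'b"
  assumes irr: "irreducible_representation W \<tau>" and p: "p \<in> V_reg W"
  shows "\<exists>F Fi D. flatD j \<tau> D F \<and> of_int D = of_nat j * kz_scalar \<tau> \<and> mat_localised \<delta> Fi \<and> F p = mat 1 \<and>
     (\<forall>x\<in>V_reg W. F x ** Fi x = mat 1 \<and> Fi x ** F x = mat 1)"
proof -
  note rep = irr_rep[OF irr]
  define K where "K = Kexp j"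
  define U where "U x = smul (\<delta> x ^ K) (mat 1 :: complex^'b^'b)" for x
  have U: "Elat j \<tau> U" unfolding U_def K_def by (rule Elat_delta[OF rep])
  have hU: "mat_homog (int (K * card arr)) U" unfolding U_def by (rule mat_homog_delta)
  have dp: "\<delta> p \<noteq> 0" using p by (simp add: \<delta>_nz)
  have m1: "(mat 1 :: complex^'b^'b) \<noteq> 0" by (simp add: vec_eq_iff mat_def)
  \<comment> \<open>If j \<open>kz_scalar \<tau>\<close> were not an integer, no degree would be
    exceptional, and even \<delta>^K would have to vanish.\<close>
  have "\<exists>D0. of_int D0 = of_nat j * kz_scalar \<tau>"
  proof (rule ccontr)
    assume "\<not> ?thesis"
    then have "U p = 0" using Elat_low_degree[OF irr U hU _ p] by blast
    then show False using dp m1 by (simp add: U_def smul_eq_0)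
  qed
  then obtain D0 where D0: "of_int D0 = of_nat j * kz_scalar \<tau>" by blast
  obtain V where V: "flat_span j \<tau> D0 V" "\<And>x. x \<in> V_reg W \<Longrightarrow> U x = V x"
    using Elat_flat_span[OF irr D0 U hU] by blast
  have "\<exists>\<Psi>. flatD j \<tau> D0 \<Psi> \<and> \<Psi> p = V p"
    using V(1)
  proof (induction rule: flat_span.induct)
    case zero
    show ?case using flatD_zero by blast
  next
    case (add U F g)
    then obtain \<Psi> where "flatD j \<tau> D0 \<Psi>" "\<Psi> p = U p" by blast
    then show ?case using flatD_lin[OF add.hyps(2), of \<Psi> "g p"] by (intro exI[of _ "\<lambda>x. smul (g p) (F x) + \<Psi> x"]) simp
  qed
  then obtain \<Psi> where \<Psi>: "flatD j \<tau> D0 \<Psi>" "\<Psi> p = V p" by blast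
  define F where "F x = smul (1 / \<delta> p ^ K) (\<Psi> x)" for x
  have F: "flatD j \<tau> D0 F" using flatD_lin[OF \<Psi>(1) flatD_zero] by (simp add: F_def[abs_def])
  have "V p = smul (\<delta> p ^ K) (mat 1)" using V(2)[OF p] by (simp add: U_def)
  then have Fp: "F p = mat 1" using \<Psi>(2) dp by (simp add: F_def)
  have "\<exists>G. mat_poly G \<and> (\<forall>x\<in>V_reg W. V x = F x ** G x)"
    using V(1)
  proof (induction rule: flat_span.induct)
    case zero
    show ?case by (rule exI[of _ "\<lambda>x. 0"]) simp
  next
    case (add U \<Phi> g)
    then obtain G where G: "mat_poly G" "\<forall>x\<in>V_reg W. U x = F x ** G x" by blast
    have e: "\<Phi> x = F x ** \<Phi> p" if x: "x \<in> V_reg W" for x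
    proof -
      have FP: "mat_localised \<delta> (\<lambda>x. F x ** (- \<Phi> p))" by (intro mat_localised_mult flatD_mat_localised[OF F] mat_localised_const poly_\<delta>)
      have "\<Phi> x + F x ** (- \<Phi> p) = 0"
      proof (rule flat_unique[OF _ _ p _ x])
        show "mat_localised \<delta> (\<lambda>x. \<Phi> x + F x ** (- \<Phi> p))" by (intro mat_localised_add flatD_mat_localised[OF add.hyps(2)] FP poly_\<delta>)
        show "nabla (- of_nat j) \<tau> \<xi> (\<lambda>x. \<Phi> x + F x ** (- \<Phi> p)) x = 0" if x: "x \<in> V_reg W" for \<xi> x
          unfolding nabla_add[OF flatD_mat_localised[OF add.hyps(2)] FP x] nabla_mult[OF flatD_mat_localised[OF F] mat_localised_const x]
          using F add.hyps(2) x by (simp add: flatD_def)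
        show "\<Phi> p + F p ** (- \<Phi> p) = 0" by (simp add: Fp)
      qed
      then show ?thesis by (simp add: matrix_mult_minus_right)
    qed
    show ?case
    proof (intro exI conjI ballI)
      show "mat_poly (\<lambda>x. smul (g x) (\<Phi> p) + G x)" by (intro mat_poly_add mat_poly_smul add.hyps mat_poly_const G)
      fix x assume x: "x \<in> V_reg W"
      show "smul (g x) (\<Phi> x) + U x = F x ** (smul (g x) (\<Phi> p) + G x)"
        using e[OF x] G(2) x by (simp add: mat_alg)
    qed
  qed
  then obtain G where G: "mat_poly G" "\<And>x. x \<in> V_reg W \<Longrightarrow> V x = F x ** G x" by blast
  define Fi where "Fi x = smul (1 / \<delta> x ^ K) (G x)" for x
  have "localised \<delta> (\<lambda>x. 1 / \<delta> x ^ K)" unfolding localised_def by (intro exI[of _ "\<lambda>x. 1"] exI[of _ K]) auto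
  then have "mat_localised \<delta> Fi" unfolding Fi_def by (intro mat_localised_smul mat_localised_poly G)
  moreover have r: "F x ** Fi x = mat 1" if x: "x \<in> V_reg W" for x
  proof -
    have "F x ** G x = smul (\<delta> x ^ K) (mat 1)" using V(2)[OF x] G(2)[OF x] by (simp add: U_def)
    moreover have "\<delta> x \<noteq> 0" using x by (simp add: \<delta>_nz)
    ultimately show ?thesis by (simp add: Fi_def)
  qed
  moreover have "Fi x ** F x = mat 1" if x: "x \<in> V_reg W" for x
    using r[OF x] by (rule matrix_left_right_inverse[THEN iffD1])
  ultimately show ?thesis using F D0 Fp by blast
qed

text \<open>\<open>F\<close> is a fundamental matrix of flat sections of \<open>KZ\<^bsub>-j\<^esub>(\<tau>)\<close>, so \<open>\<sigma>\<close> represents \<open>kz\<^bsub>-jm\<^esub>(\<tau>)\<close>.\<close>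

definition kz_fundamental :: "nat \<Rightarrow> (complex^'n^'n \<Rightarrow> complex^'d^'d) \<Rightarrow> (complex^'n^'n \<Rightarrow> complex^'d^'d)
    \<Rightarrow> (complex^'n \<Rightarrow> complex^'d^'d) \<Rightarrow> (complex^'n \<Rightarrow> complex^'d^'d) \<Rightarrow> bool" where
  "kz_fundamental j \<tau> \<sigma> F Fi \<longleftrightarrow> representation W \<sigma> \<and> mat_poly F \<and> mat_localised \<delta> Fi \<and>
     (\<forall>x\<in>V_reg W. F x ** Fi x = mat 1 \<and> Fi x ** F x = mat 1) \<and>
     (\<forall>\<xi>. \<forall>x\<in>V_reg W. mat_deriv \<xi> F x = smul (of_nat j) (Acon \<tau> \<xi> x ** F x)) \<and>
     (\<exists>D. mat_homog D F \<and> of_int D = of_nat j * kz_scalar \<tau>) \<and>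
     (\<forall>w\<in>W. \<forall>x\<in>V_reg W. F (w *v x) ** \<sigma> w = \<tau> w ** F x)"

text \<open>F and its translate \<tau>(w) F(w^{-1} x) are both flat, so they differ by a constant
  right factor, which evaluation at p identifies as \<sigma>(w). Since the factor is constant,
  \<sigma> is multiplicative.\<close>

lemma kz_exists:
  assumes irr: "irreducible_representation W \<tau>"
  shows "\<exists>\<sigma> F Fi. kz_fundamental j \<tau> \<sigma> F Fi"
proof -
  note rep = irr_rep[OF irr]
  obtain p where p: "p \<in> V_reg W" using V_reg_nonempty by blast
  obtain F Fi D where F: "flatD j \<tau> D F" "of_int D = of_nat j * kz_scalar \<tau>" "mat_localised \<delta> Fi" "F p = mat 1"
    "\<And>x. x \<in> V_reg W \<Longrightarrow> F x ** Fi x = mat 1" "\<And>x. x \<in> V_reg W \<Longrightarrow> Fi x ** F x = mat 1"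
    using kz_solution[OF irr p] by metis
  note Fl = flatD_mat_localised[OF F(1)]
  define \<sigma> where "\<sigma> w = \<tau> w ** F (matrix_inv w *v p)" for w
  have e: "\<tau> w ** F (matrix_inv w *v x) = F x ** \<sigma> w" if w: "w \<in> W" and x: "x \<in> V_reg W" for w x
  proof -
    have cl: "mat_localised \<delta> (\<lambda>x. \<tau> w ** F (matrix_inv w *v x))"
    proof -
      have "mat_poly F" using F(1) by (simp add: flatD_def)
      then have "mat_poly (\<lambda>x. F (matrix_inv w *v x))" unfolding mat_poly_def
        using poly_fun_compose_linear[of "\<lambda>x. F x $ i $ j" "matrix_inv w" 0 for i j] by simp
      then show ?thesis by (intro mat_localised_poly mat_poly_mult mat_poly_const)
    qed
    have cr: "mat_localised \<delta> (\<lambda>x. F x ** (- \<sigma> w))" by (intro mat_localised_mult Fl mat_localised_const poly_\<delta>)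
    have "\<tau> w ** F (matrix_inv w *v x) + F x ** (- \<sigma> w) = 0"
    proof (rule flat_unique[OF _ _ p _ x])
      show "mat_localised \<delta> (\<lambda>x. \<tau> w ** F (matrix_inv w *v x) + F x ** (- \<sigma> w))" by (intro mat_localised_add cl cr poly_\<delta>)
      show "\<tau> w ** F (matrix_inv w *v p) + F p ** (- \<sigma> w) = 0" by (simp add: \<sigma>_def F(4))
      fix \<xi> x assume x: "x \<in> V_reg W"
      have "nabla (- of_nat j) \<tau> (w *v (matrix_inv w *v \<xi>)) (\<lambda>x. \<tau> w ** F (matrix_inv w *v x)) x
        = \<tau> w ** nabla (- of_nat j) \<tau> (matrix_inv w *v \<xi>) F (matrix_inv w *v x)"
        by (rule nabla_equiv[OF rep Fl w x])
      also have "\<dots> = 0" using F(1) x V_reg_act[OF inv_W[OF w]] by (simp add: flatD_def)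
      finally have a: "nabla (- of_nat j) \<tau> \<xi> (\<lambda>x. \<tau> w ** F (matrix_inv w *v x)) x = 0" using w by simp
      show "nabla (- of_nat j) \<tau> \<xi> (\<lambda>x. \<tau> w ** F (matrix_inv w *v x) + F x ** (- \<sigma> w)) x = 0"
        unfolding nabla_add[OF cl cr x] nabla_mult[OF Fl mat_localised_const x] a
        using F(1) x by (simp add: flatD_def)
    qed
    then show ?thesis by (simp add: matrix_mult_minus_right)
  qed
  have eq: "F (w *v x) ** \<sigma> w = \<tau> w ** F x" if w: "w \<in> W" and x: "x \<in> V_reg W" for w x
    using e[OF w, of "w *v x"] x w V_reg_act[OF w] by simp
  have repS: "representation W \<sigma>" unfolding representation_def
  proof (intro conjI ballI)
    have "matrix_inv (mat 1 :: complex^'n^'n) = mat 1" by (rule matrix_inv_unique) simp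
    then show "\<sigma> (mat 1) = mat 1" by (simp add: \<sigma>_def rep_one[OF rep] F(4))
    fix w u assume w: "w \<in> W" and u: "u \<in> W"
    have p': "matrix_inv w *v p \<in> V_reg W" using p V_reg_act[OF inv_W[OF w]] by simp
    have "\<sigma> (w ** u) = \<tau> w ** (\<tau> u ** F (matrix_inv u *v (matrix_inv w *v p)))"
      unfolding \<sigma>_def inv_mult_W[OF w u] rep_mult[OF rep w u]
      by (simp add: matrix_mul_assoc matrix_vector_mul_assoc)
    also have "\<dots> = \<tau> w ** F (matrix_inv w *v p) ** \<sigma> u" unfolding e[OF u p'] by (simp add: matrix_mul_assoc)
    finally show "\<sigma> (w ** u) = \<sigma> w ** \<sigma> u" by (simp add: \<sigma>_def)
  qed
  have "mat_deriv \<xi> F x = smul (of_nat j) (Acon \<tau> \<xi> x ** F x)" if "x \<in> V_reg W" for \<xi> x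
    using F(1) that by (simp add: flatD_def nabla_def smul_minus_left)
  then have "kz_fundamental j \<tau> \<sigma> F Fi" unfolding kz_fundamental_def using repS F eq by (auto simp: flatD_def)
  then show ?thesis by blast
qed

text \<open>\<open>V_reg\<close> is dense in the region where \<open>dH H\<close> is nonzero, so an
  identity on \<open>V_reg\<close> reaches the generic points of H.\<close>

lemma localised_dH_eq_0:
  assumes "localised (dH H) f" "\<And>x. x \<in> V_reg W \<Longrightarrow> f x = 0" "dH H x \<noteq> 0" shows "f x = 0"
proof -
  obtain g r where g: "poly_fun g" "\<And>x. dH H x \<noteq> 0 \<Longrightarrow> f x = g x / dH H x ^ r" using assms(1) unfolding localised_def by metis
  have "g y = 0" if y: "y \<in> V_reg W" for y using g(2)[OF V_reg_dH[OF y]] assms(2)[OF y] V_reg_dH[OF y, of H] by simp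
  then have "g x = 0" by (rule poly_zero_on_V_reg[OF g(1)])
  then show ?thesis using g(2)[OF assms(3)] by simp
qed

lemma mat_localised_dH_eq_0:
  assumes "mat_localised (dH H) F" "\<And>x. x \<in> V_reg W \<Longrightarrow> F x = 0" "dH H x \<noteq> 0" shows "F x = 0"
proof -
  have "F x $ i $ j = 0" for i j
    using localised_dH_eq_0[of H "\<lambda>x. F x $ i $ j", OF _ _ assms(3)] assms(1,2) by (simp add: mat_localised_def)
  then show ?thesis by (simp add: vec_eq_iff)
qed

end

section \<open>Horizontal maps between connections\<close>

lemma dir_deriv_form_powi:
  assumes "form_at \<beta> x \<noteq> 0"
  shows "dir_deriv \<xi> (\<lambda>x. form_at \<beta> x powi j) x = of_int j * form_at \<beta> x powi (j - 1) * form_at \<beta> \<xi>"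
  by (rule dir_deriv_eqI) (use assms in \<open>auto intro!: derivative_eq_intros\<close>)

lemma sum_const_vec: "(\<Sum>w\<in>S. u) = of_nat (card S) *s (u :: complex^'a)"
  by (induction S rule: infinite_finite_induct) (simp_all add: vec.scale_left_distrib del: sum_constant)

text \<open>The projections cut Q into four blocks a'Qa, a'Qp, p'Qa and p'Qp, on which E multiplies
  by 0, K, -K' and K - K' respectively. A block vanishes unless j is its number; the coincidences
  are excluded by c2, c1, c1 and c3.\<close>

lemma block_decomposition_zero:
  fixes Q :: "complex^'a^'b"
  assumes r: "a' + p' = mat 1" "a + p = mat 1" "a' ** p' = 0" "p' ** a' = 0" "p' ** p' = p'" "a' ** a' = a'"
    "a ** p = 0" "p ** a = 0" "p ** p = p" "a ** a = a"
    and E: "smul (of_int j) Q = smul (of_int K) (Q ** p) - smul (of_int K') (p' ** Q)"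
    and c1: "j = K \<or> j = - K' \<Longrightarrow> a' ** Q = Q ** a"
    and c2: "j = 0 \<Longrightarrow> a' ** Q ** a = 0" and c3: "j = K - K' \<Longrightarrow> p' ** Q ** p = 0"
  shows "Q = 0"
proof -
  have z: "X = 0" if "smul (of_int i) X = smul (of_int l) X" "i \<noteq> l" for X :: "complex^'a^'b" and i l
    using that by (auto simp: vec_eq_iff)
  have E': "smul (of_int j) (x ** Q ** y) = smul (of_int K) (x ** Q ** p ** y) - smul (of_int K') (x ** p' ** Q ** y)" for x y
  proof -
    have "x ** smul (of_int j) Q ** y = x ** (smul (of_int K) (Q ** p) - smul (of_int K') (p' ** Q)) ** y" unfolding E ..
    then show ?thesis by (simp add: mat_alg)
  qed
  have assoc: "x ** Q ** p ** y = x ** Q ** (p ** y)" for x y by (simp add: matrix_mul_assoc)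
  have 1: "a' ** Q ** a = 0"
  proof (cases "j = 0")
    case False
    have "smul (of_int j) (a' ** Q ** a) = smul (of_int 0) (a' ** Q ** a)"
      using E'[of a' a] unfolding assoc by (simp add: r)
    then show ?thesis by (rule z) (use False in simp)
  qed (rule c2)
  have 2: "p' ** Q ** p = 0"
  proof (cases "j = K - K'")
    case False
    have "smul (of_int j) (p' ** Q ** p) = smul (of_int (K - K')) (p' ** Q ** p)"
      using E'[of p' p] unfolding assoc by (simp add: r smul_diff_left)
    then show ?thesis by (rule z) (use False in simp)
  qed (rule c3)
  have 3: "a' ** Q ** p = 0"
  proof (cases "j = K")
    case True
    then have "a' ** Q ** p = Q ** (a ** p)" using c1 by (simp add: matrix_mul_assoc)
    then show ?thesis by (simp add: r)
  next
    case False
    have "smul (of_int j) (a' ** Q ** p) = smul (of_int K) (a' ** Q ** p)"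
      using E'[of a' p] unfolding assoc by (simp add: r)
    then show ?thesis by (rule z) (use False in simp)
  qed
  have 4: "p' ** Q ** a = 0"
  proof (cases "j = - K'")
    case True
    then have "p' ** Q ** a = p' ** a' ** Q" using c1 by (simp add: matrix_mul_assoc[symmetric])
    then show ?thesis by (simp add: r)
  next
    case False
    have "smul (of_int j) (p' ** Q ** a) = smul (of_int (- K')) (p' ** Q ** a)"
      using E'[of p' a] unfolding assoc by (simp add: r smul_minus_left)
    then show ?thesis by (rule z) (use False in simp)
  qed
  have "Q = (a' + p') ** Q ** (a + p)" by (simp add: r)
  also have "\<dots> = 0" by (simp only: mat_alg 1 2 3 4) simp
  finally show ?thesis .
qed

context refl_arr begin

lemma localised_frm_powi: assumes H: "H \<in> arr" shows "localised \<delta> (\<lambda>x. frm H x powi j)"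
proof (cases "j \<ge> 0")
  case True
  then show ?thesis unfolding power_int_def by (simp add: localised_poly poly_fun_power)
next
  case False
  have "localised \<delta> (\<lambda>x. (1 / frm H x) ^ nat (- j))" by (rule localised_power[OF localised_frm_ratio[OF H]])
  then show ?thesis using False unfolding power_int_def by (simp add: inverse_eq_divide)
qed

text \<open>The indicial equation. For P = alpha_H^j Q the differential equation gives on H a linear
  relation for Q with exponents 0, k c, -k' c and (k - k') c. If j is k c or -k' c it is a multiple
  of n_H, so equivariance makes Q commute with the invariant projections and the off-diagonal blocks
  vanish. The hypotheses c1 and c2 exclude the remaining coincidences. So Q vanishes on H and j can
  be raised by one.\<close>

lemma pole_bound_step:
  fixes P :: "complex^'n \<Rightarrow> complex^'a::finite^'b::finite" and k k' j :: int
  assumes rep: "representation W \<tau>" "representation W \<tau>'" and H: "H \<in> arr"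
    and ode: "\<And>x. x \<in> V_reg W \<Longrightarrow> mat_deriv (coroot H) P x = smul (of_int k) (P x ** Acon \<tau> (coroot H) x)
        - smul (of_int k') (Acon \<tau>' (coroot H) x ** P x)"
    and eqv: "\<And>u x. u \<in> WH H \<Longrightarrow> x \<in> V_reg W \<Longrightarrow> P (u *v x) ** \<tau> u = \<tau>' u ** P x"
    and c1: "j = 0 \<Longrightarrow> \<forall>x\<in>V_reg W. avg \<tau>' H ** P x ** avg \<tau> H = 0"
    and c2: "j = (k - k') * int (m H * nH H) \<Longrightarrow> \<forall>x\<in>V_reg W. prj \<tau>' H ** P x ** prj \<tau> H = 0"
    and Q: "mat_localised (dH H) Q" "\<And>x. x \<in> V_reg W \<Longrightarrow> P x = smul (frm H x powi j) (Q x)"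
  shows "\<exists>Q. mat_localised (dH H) Q \<and> (\<forall>x\<in>V_reg W. P x = smul (frm H x powi (j + 1)) (Q x))"
proof -
  let ?a = "coroot H"
  define c where "c = int (m H * nH H)"
  \<comment> \<open>alpha_H^{1-j} times the difference of the two sides of the differential
    equation, written so that it extends across H.\<close>
  define X where "X x = smul (of_int j) (Q x) - smul (of_int (k * c)) (Q x ** prj \<tau> H) + smul (of_int (k' * c)) (prj \<tau>' H ** Q x)
     + smul (frm H x) (mat_deriv ?a Q x - smul (of_int k) (Q x ** Bcon \<tau> H ?a x) + smul (of_int k') (Bcon \<tau>' H ?a x ** Q x))" for x
  have mX: "mat_localised (dH H) X" unfolding X_def
    by (intro mat_localised_add mat_localised_diff mat_localised_smul mat_localised_mult mat_localised_mat_deriv mat_localised_Bcon Q localised_const mat_localised_const localised_poly poly_fun_form poly_dH)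
  have X0: "X x = 0" if x: "x \<in> V_reg W" for x
  proof -
    have f: "frm H x \<noteq> 0" by (rule V_reg_frm[OF x H])
    define g where "g = frm H x powi (j - 1)"
    have g: "g \<noteq> 0" "frm H x powi j = frm H x * g" using f by (simp_all add: g_def power_int_diff)
    have d1: "mat_deriv ?a P x = smul (of_int j * g) (Q x) + smul (frm H x * g) (mat_deriv ?a Q x)"
    proof -
      have "mat_deriv ?a P x = mat_deriv ?a (\<lambda>x. smul (frm H x powi j) (Q x)) x" by (rule mat_deriv_cong_reg[OF x Q(2)])
      also have "\<dots> = smul (of_int j * g) (Q x) + smul (frm H x powi j) (mat_deriv ?a Q x)"
        using x f by (subst mat_deriv_smul[OF poly_\<delta> localised_frm_powi[OF H] mat_localised_dH_imp[OF H Q(1)]])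
          (simp_all add: \<delta>_nz dir_deriv_form_powi frm_coroot[OF H] g_def)
      finally show ?thesis by (simp only: g)
    qed
    have K: "smul (frm H x) (Acon \<rho> ?a x) = smul (of_int c) (prj \<rho> H) + smul (frm H x) (Bcon \<rho> H ?a x)"
      if "representation W \<rho>" for \<rho> :: "complex^'n^'n \<Rightarrow> complex^'z::finite^'z"
      unfolding Acon_split[OF H] frm_coroot[OF H] Kop_eq[OF that H] using f by (simp add: mat_alg c_def)
    have "smul g (X x) = mat_deriv ?a P x - smul (of_int k) (smul g (Q x ** smul (frm H x) (Acon \<tau> ?a x)))
      + smul (of_int k') (smul g (smul (frm H x) (Acon \<tau>' ?a x) ** Q x))"
      unfolding d1 K[OF rep(1)] K[OF rep(2)] X_def by (simp add: mat_alg mult_ac)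
    also have "\<dots> = mat_deriv ?a P x - smul (of_int k) (P x ** Acon \<tau> ?a x) + smul (of_int k') (Acon \<tau>' ?a x ** P x)"
      unfolding Q(2)[OF x] g(2) by (simp add: mult_ac)
    also have "\<dots> = 0" unfolding ode[OF x] by simp
    finally show ?thesis using g(1) by (simp add: smul_eq_0)
  qed
  have ext: "Y x = 0" if "mat_localised (dH H) Y" "\<And>x. x \<in> V_reg W \<Longrightarrow> Y x = 0" "dH H x \<noteq> 0" for Y :: "complex^'n \<Rightarrow> complex^'a^'b" and x
    by (rule mat_localised_dH_eq_0[OF that])
  have Q0: "Q x = 0" if x: "frm H x = 0" "dH H x \<noteq> 0" for x
  proof (rule block_decomposition_zero[where a'="avg \<tau>' H" and p'="prj \<tau>' H" and a="avg \<tau> H" and p="prj \<tau> H" and j=j and K="k * c" and K'="k' * c"])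
    have "X x = 0" by (rule ext[OF mX X0 x(2)])
    then show "smul (of_int j) (Q x) = smul (of_int (k * c)) (Q x ** prj \<tau> H) - smul (of_int (k' * c)) (prj \<tau>' H ** Q x)"
      using x(1) by (simp add: X_def algebra_simps)
    have lead: "smul (det u powi j) (Q x) = \<tau>' u ** Q x ** \<tau> (matrix_inv u)" if u: "u \<in> WH H" for u
    proof (rule leading_coeff_eqv[OF H Q(1) x u])
      fix y assume y: "y \<in> V_reg W"
      have uy: "u *v y \<in> V_reg W" using y V_reg_act[OF WH_sub[OF u]] by simp
      have fy: "frm H y powi j \<noteq> 0" using V_reg_frm[OF y H] by simp
      have "smul (frm H (u *v y) powi j) (Q (u *v y)) ** \<tau> u = \<tau>' u ** smul (frm H y powi j) (Q y)"
        using eqv[OF u y] unfolding Q(2)[OF y] Q(2)[OF uy] .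
      then have "smul (frm H y powi j) (smul (det u powi j) (Q (u *v y)) ** \<tau> u) = smul (frm H y powi j) (\<tau>' u ** Q y)"
        unfolding WH_frm[OF H u] power_int_mult_distrib by (simp add: mult.commute)
      then have "smul (det u powi j) (Q (u *v y)) ** \<tau> u = \<tau>' u ** Q y" using smul_cancel[OF fy] by blast
      then have "smul (det u powi j) (Q (u *v y)) ** (\<tau> u ** \<tau> (matrix_inv u)) = \<tau>' u ** Q y ** \<tau> (matrix_inv u)"
        by (simp only: matrix_mul_assoc)
      then show "smul (det u powi j) (Q (u *v y)) = \<tau>' u ** Q y ** \<tau> (matrix_inv u)"
        using rep_inv[OF rep(1) WH_sub[OF u]] by simp
    qed
    show "avg \<tau>' H ** Q x = Q x ** avg \<tau> H" if "j = k * c \<or> j = - (k' * c)"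
    proof -
      have "\<exists>i. j = i * int (nH H)" using that unfolding c_def by (metis minus_mult_left mult.assoc of_nat_mult)
      then obtain i where i: "j = i * int (nH H)" by blast
      have "\<tau>' u ** Q x = Q x ** \<tau> u" if u: "u \<in> WH H" for u
      proof -
        have "det u powi j = (det u ^ nH H) powi i" unfolding i mult.commute[of i] power_int_mult by simp
        then have "det u powi j = 1" by (simp add: WH_det_power[OF u])
        then have "Q x ** \<tau> u = \<tau>' u ** Q x ** (\<tau> (matrix_inv u) ** \<tau> u)" using lead[OF u] by (simp add: matrix_mul_assoc)
        then show ?thesis using rep_inv[OF rep(1) WH_sub[OF u]] by simp
      qed
      then show ?thesis by (simp add: avg_def matrix_mult_sum_left matrix_mult_sum_right cong: sum.cong)
    qed
    have blk: "A ** Q x ** B = 0" if z: "\<forall>x\<in>V_reg W. A ** P x ** B = 0" for A B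
    proof (rule mat_localised_dH_eq_0[of H "\<lambda>x. A ** Q x ** B"])
      show "mat_localised (dH H) (\<lambda>x. A ** Q x ** B)" by (intro mat_localised_mult mat_localised_const Q poly_dH)
      fix y assume y: "y \<in> V_reg W"
      have "smul (frm H y powi j) (A ** Q y ** B) = 0" using z y by (simp add: Q(2))
      then show "A ** Q y ** B = 0" using V_reg_frm[OF y H] by (simp add: smul_eq_0)
    qed (rule x)
    show "avg \<tau>' H ** Q x ** avg \<tau> H = 0" if "j = 0" by (rule blk[OF c1[OF that]])
    show "prj \<tau>' H ** Q x ** prj \<tau> H = 0" if "j = k * c - k' * c"
      by (rule blk[OF c2]) (use that in \<open>simp add: c_def algebra_simps\<close>)
  qed (simp_all add: prj_simps rep avg_idem)
  obtain x0 where x0: "frm H x0 = 0" "dH H x0 \<noteq> 0" using hyperplane_point[OF H] by blast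
  obtain E where E: "mat_localised (dH H) E" "\<And>x. dH H x \<noteq> 0 \<Longrightarrow> Q x = smul (frm H x) (E x)"
    using mat_localised_divide_form[OF poly_dH frm_coroot[OF H] x0 Q(1) Q0] by blast
  show ?thesis
  proof (intro exI conjI ballI)
    show "mat_localised (dH H) E" by (rule E)
    fix x assume x: "x \<in> V_reg W"
    show "P x = smul (frm H x powi (j + 1)) (E x)"
      unfolding Q(2)[OF x] E(2)[OF V_reg_dH[OF x]] using V_reg_frm[OF x H] by (simp add: power_int_add)
  qed
qed

text \<open>A common denominator provides a starting order J0, and the orders below J are passed one
  by one. The block conditions exclude the exponents 0 and (k - k') m_H n_H when these lie below
  J.\<close>

lemma pole_bound:
  fixes P :: "complex^'n \<Rightarrow> complex^'a::finite^'b::finite" and k k' J :: int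
  assumes rep: "representation W \<tau>" "representation W \<tau>'" and H: "H \<in> arr" and P: "mat_localised \<delta> P"
    and ode: "\<And>x. x \<in> V_reg W \<Longrightarrow> mat_deriv (coroot H) P x = smul (of_int k) (P x ** Acon \<tau> (coroot H) x)
        - smul (of_int k') (Acon \<tau>' (coroot H) x ** P x)"
    and eqv: "\<And>u x. u \<in> WH H \<Longrightarrow> x \<in> V_reg W \<Longrightarrow> P (u *v x) ** \<tau> u = \<tau>' u ** P x"
    and c1: "0 < J \<Longrightarrow> \<forall>x\<in>V_reg W. avg \<tau>' H ** P x ** avg \<tau> H = 0"
    and c2: "(k - k') * int (m H * nH H) < J \<Longrightarrow> \<forall>x\<in>V_reg W. prj \<tau>' H ** P x ** prj \<tau> H = 0"
  shows "\<exists>Q. mat_localised (dH H) Q \<and> (\<forall>x\<in>V_reg W. P x = smul (frm H x powi J) (Q x))"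
proof -
  obtain G r where G: "mat_poly G" "\<And>x. \<delta> x \<noteq> 0 \<Longrightarrow> P x = smul (1 / \<delta> x ^ r) (G x)"
    using mat_localised_common_denominator[OF P poly_\<delta>] by blast
  \<comment> \<open>The minimum ensures J0 <= J, so that the upward induction reaches J.\<close>
  define J0 where "J0 = min (- int r) J"
  have b: "\<exists>Q. mat_localised (dH H) Q \<and> (\<forall>x\<in>V_reg W. P x = smul (frm H x powi J0) (Q x))"
  proof (intro exI conjI ballI)
    have l: "localised (dH H) (\<lambda>x. 1 / dH H x ^ r)" unfolding localised_def by (intro exI[of _ "\<lambda>x. 1"] exI[of _ r]) auto
    show "mat_localised (dH H) (\<lambda>x. smul (frm H x ^ nat (- int r - J0)) (smul (1 / dH H x ^ r) (G x)))"
      by (rule mat_localised_smul mat_localised_poly[OF G(1)] l localised_poly poly_fun_power poly_fun_form)+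
    fix x assume x: "x \<in> V_reg W"
    have f: "frm H x \<noteq> 0" by (rule V_reg_frm[OF x H])
    have "frm H x powi J0 * frm H x ^ nat (- int r - J0) = frm H x powi (- int r)"
    proof -
      have "frm H x ^ nat (- int r - J0) = frm H x powi (- int r - J0)" by (simp add: J0_def power_int_def)
      then show ?thesis using f by (simp add: power_int_add[symmetric])
    qed
    also have "\<dots> = 1 / frm H x ^ r" by (simp add: power_int_minus field_simps)
    finally have e: "frm H x powi J0 * frm H x ^ nat (- int r - J0) = 1 / frm H x ^ r" .
    have "1 / \<delta> x ^ r = frm H x powi J0 * frm H x ^ nat (- int r - J0) * (1 / dH H x ^ r)"
      unfolding e \<delta>_split[OF H] by (simp add: power_mult_distrib)
    then show "P x = smul (frm H x powi J0) (smul (frm H x ^ nat (- int r - J0)) (smul (1 / dH H x ^ r) (G x)))"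
      using G(2)[of x] x by (simp add: \<delta>_nz mult.assoc)
  qed
  have JJ: "J0 \<le> J" by (simp add: J0_def)
  have "\<exists>Q. mat_localised (dH H) Q \<and> (\<forall>x\<in>V_reg W. P x = smul (frm H x powi j) (Q x))" if "J0 \<le> j" "j \<le> J" for j
    using that
  proof (induction j rule: int_ge_induct)
    case base
    show ?case by (rule b)
  next
    case (step j)
    then obtain Q where Q: "mat_localised (dH H) Q" "\<And>x. x \<in> V_reg W \<Longrightarrow> P x = smul (frm H x powi j) (Q x)" by auto
    show ?case
      by (rule pole_bound_step[OF rep H ode eqv _ _ Q]) (use c1 c2 step.prems in auto)
  qed
  then show ?thesis using JJ by blast
qed

text \<open>\<open>P\<close> is a \<open>W\<close>-equivariant map \<open>KZ\<^sub>k(\<tau>) \<rightarrow> KZ\<^bsub>k'\<^esub>(\<tau>')\<close> of bundles with connection.\<close>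

definition horizontal :: "complex \<Rightarrow> (complex^'n^'n \<Rightarrow> complex^'a^'a) \<Rightarrow> complex \<Rightarrow> (complex^'n^'n \<Rightarrow> complex^'b^'b)
    \<Rightarrow> (complex^'n \<Rightarrow> complex^'a^'b) \<Rightarrow> bool" where
  "horizontal k \<tau> k' \<tau>' P \<longleftrightarrow> mat_localised \<delta> P \<and>
     (\<forall>\<xi>. \<forall>x\<in>V_reg W. mat_deriv \<xi> P x = smul k (P x ** Acon \<tau> \<xi> x) - smul k' (Acon \<tau>' \<xi> x ** P x)) \<and>
     (\<forall>w\<in>W. \<forall>x\<in>V_reg W. P (w *v x) ** \<tau> w = \<tau>' w ** P x)"

lemma horizontal_compose:
  assumes P: "horizontal k \<tau> k' \<tau>' P" and Q: "horizontal k' \<tau>' k'' \<tau>'' Q"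
  shows "horizontal k \<tau> k'' \<tau>'' (\<lambda>x. Q x ** P x)"
  unfolding horizontal_def
proof (intro conjI allI ballI)
  have m: "mat_localised \<delta> P" "mat_localised \<delta> Q" using P Q by (simp_all add: horizontal_def)
  then show "mat_localised \<delta> (\<lambda>x. Q x ** P x)" by (intro mat_localised_mult poly_\<delta>)
  fix x assume x: "x \<in> V_reg W"
  show "mat_deriv \<xi> (\<lambda>x. Q x ** P x) x = smul k (Q x ** P x ** Acon \<tau> \<xi> x) - smul k'' (Acon \<tau>'' \<xi> x ** (Q x ** P x))" for \<xi>
  proof -
    have "mat_deriv \<xi> (\<lambda>x. Q x ** P x) x = mat_deriv \<xi> Q x ** P x + Q x ** mat_deriv \<xi> P x"
      by (rule mat_deriv_mult[OF poly_\<delta> m(2,1)]) (use x in \<open>simp add: \<delta>_nz\<close>)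
    moreover have "mat_deriv \<xi> P x = smul k (P x ** Acon \<tau> \<xi> x) - smul k' (Acon \<tau>' \<xi> x ** P x)"
      "mat_deriv \<xi> Q x = smul k' (Q x ** Acon \<tau>' \<xi> x) - smul k'' (Acon \<tau>'' \<xi> x ** Q x)" using P Q x by (simp_all add: horizontal_def)
    ultimately show ?thesis by (simp add: mat_alg)
  qed
  fix w assume w: "w \<in> W"
  have "P (w *v x) ** \<tau> w = \<tau>' w ** P x" "Q (w *v x) ** \<tau>' w = \<tau>'' w ** Q x" using P Q w x by (simp_all add: horizontal_def)
  then show "Q (w *v x) ** P (w *v x) ** \<tau> w = \<tau>'' w ** (Q x ** P x)" by (metis matrix_mul_assoc)
qed

lemma horizontal_const: "(\<And>w. w \<in> W \<Longrightarrow> C ** \<sigma> w = \<sigma>' w ** C) \<Longrightarrow> horizontal 0 \<sigma> 0 \<sigma>' (\<lambda>x. C)"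
  by (simp add: horizontal_def)

lemma horizontal_mat_localised: "horizontal k \<tau> k' \<tau>' P \<Longrightarrow> mat_localised \<delta> P" by (simp add: horizontal_def)

lemma horizontal_cong:
  assumes "\<And>x. x \<in> V_reg W \<Longrightarrow> P x = Q x"
  shows "horizontal k \<tau> k' \<tau>' P \<longleftrightarrow> horizontal k \<tau> k' \<tau>' Q"
proof -
  have i: "horizontal k \<tau> k' \<tau>' Q" if e: "\<And>x. x \<in> V_reg W \<Longrightarrow> P x = Q x" and h: "horizontal k \<tau> k' \<tau>' P" for P Q
    unfolding horizontal_def
  proof (intro conjI allI ballI)
    show "mat_localised \<delta> Q" using h mat_localised_on_V_reg[OF e] by (simp add: horizontal_def)
    fix x assume x: "x \<in> V_reg W"
    show "mat_deriv \<xi> Q x = smul k (Q x ** Acon \<tau> \<xi> x) - smul k' (Acon \<tau>' \<xi> x ** Q x)" for \<xi>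
    proof -
      have "mat_deriv \<xi> P x = mat_deriv \<xi> Q x" by (rule mat_deriv_cong_reg[OF x e])
      moreover have "mat_deriv \<xi> P x = smul k (P x ** Acon \<tau> \<xi> x) - smul k' (Acon \<tau>' \<xi> x ** P x)"
        using h x unfolding horizontal_def by blast
      ultimately show ?thesis using e[OF x] by simp
    qed
    fix w assume w: "w \<in> W"
    have "P (w *v x) ** \<tau> w = \<tau>' w ** P x" using h x w unfolding horizontal_def by blast
    then show "Q (w *v x) ** \<tau> w = \<tau>' w ** Q x" using e[OF x] e[of "w *v x"] V_reg_act[OF w] x by simp
  qed
  show ?thesis
  proof
    show "horizontal k \<tau> k' \<tau>' P \<Longrightarrow> horizontal k \<tau> k' \<tau>' Q" by (rule i[of P Q]) (rule assms)
    show "horizontal k \<tau> k' \<tau>' Q \<Longrightarrow> horizontal k \<tau> k' \<tau>' P" by (rule i[of Q P]) (rule assms[symmetric])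
  qed
qed

text \<open>Trivialisation in both directions: F maps the trivial connection on \<sigma> to
  KZ_{-j}(\<tau>), and the equation for Fi comes from differentiating F Fi = 1.\<close>

lemma kz_fundamental_horizontal:
  assumes K: "kz_fundamental j \<tau> \<sigma> F Fi"
  shows "horizontal 0 \<sigma> (- of_nat j) \<tau> F" "horizontal (- of_nat j) \<tau> 0 \<sigma> Fi"
proof -
  have F: "mat_localised \<delta> F" "mat_localised \<delta> Fi" using K by (simp_all add: kz_fundamental_def mat_localised_poly)
  have FF: "F x ** Fi x = mat 1" "Fi x ** F x = mat 1" if "x \<in> V_reg W" for x using K that by (simp_all add: kz_fundamental_def)
  have ode: "mat_deriv \<xi> F x = smul (of_nat j) (Acon \<tau> \<xi> x ** F x)" if "x \<in> V_reg W" for x \<xi> using K that by (simp add: kz_fundamental_def)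
  have eq: "F (w *v x) ** \<sigma> w = \<tau> w ** F x" if "w \<in> W" "x \<in> V_reg W" for w x using K that by (simp add: kz_fundamental_def)
  show "horizontal 0 \<sigma> (- of_nat j) \<tau> F" unfolding horizontal_def using F(1) ode eq by (simp add: smul_minus_left)
  show "horizontal (- of_nat j) \<tau> 0 \<sigma> Fi" unfolding horizontal_def
  proof (intro conjI allI ballI)
    fix x assume x: "x \<in> V_reg W"
    show "mat_deriv \<xi> Fi x = smul (- of_nat j) (Fi x ** Acon \<tau> \<xi> x) - smul 0 (Acon \<sigma> \<xi> x ** Fi x)" for \<xi>
    proof -
      have "mat_deriv \<xi> (\<lambda>x. F x ** Fi x) x = mat_deriv \<xi> (\<lambda>x. mat 1) x" by (rule mat_deriv_cong_reg[OF x FF(1)])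
      then have "mat_deriv \<xi> F x ** Fi x + F x ** mat_deriv \<xi> Fi x = 0"
        using x by (subst (asm) mat_deriv_mult[OF poly_\<delta> F]) (simp_all add: \<delta>_nz)
      then have "F x ** mat_deriv \<xi> Fi x = - (smul (of_nat j) (Acon \<tau> \<xi> x ** (F x ** Fi x)))"
        unfolding ode[OF x] by (simp add: matrix_mul_assoc add_eq_0_iff)
      then have "Fi x ** (F x ** mat_deriv \<xi> Fi x) = Fi x ** (- (smul (of_nat j) (Acon \<tau> \<xi> x)))" by (simp add: FF[OF x])
      then have "(Fi x ** F x) ** mat_deriv \<xi> Fi x = Fi x ** (- (smul (of_nat j) (Acon \<tau> \<xi> x)))" by (simp only: matrix_mul_assoc)
      then show ?thesis by (simp add: FF[OF x] mat_alg)
    qed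
    fix w assume w: "w \<in> W"
    have wx: "w *v x \<in> V_reg W" using x V_reg_act[OF w] by simp
    have "Fi (w *v x) ** \<tau> w = Fi (w *v x) ** (\<tau> w ** F x) ** Fi x"
      using FF[OF x] by (simp add: matrix_mul_assoc[symmetric])
    also have "\<dots> = (Fi (w *v x) ** F (w *v x)) ** \<sigma> w ** Fi x" unfolding eq[OF w x, symmetric] by (simp only: matrix_mul_assoc)
    finally show "Fi (w *v x) ** \<tau> w = \<sigma> w ** Fi x" by (simp add: FF[OF wx])
  qed (rule F)
qed

lemma horizontal_order:
  fixes k k' J :: int
  assumes rep: "representation W \<tau>" "representation W \<tau>'" and horizontal: "horizontal (of_int k) \<tau> (of_int k') \<tau>' P" and H: "H \<in> arr"
    and J: "J \<le> 0" "J \<le> (k - k') * int (m H * nH H)"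
  shows "\<exists>Q. mat_localised (dH H) Q \<and> (\<forall>x\<in>V_reg W. P x = smul (frm H x powi J) (Q x))"
  by (rule pole_bound[OF rep H horizontal_mat_localised[OF horizontal]]) (use horizontal J WH_sub in \<open>auto simp: horizontal_def\<close>)

text \<open>For k' <= k the numbers 0 and (k - k') m_H n_H are both nonnegative, so there is no pole
  along any H.\<close>

lemma horizontal_mat_poly:
  fixes k k' :: int
  assumes rep: "representation W \<tau>" "representation W \<tau>'" and horizontal: "horizontal (of_int k) \<tau> (of_int k') \<tau>' P" and kk: "k' \<le> k"
  shows "\<exists>Q. mat_poly Q \<and> (\<forall>x\<in>V_reg W. P x = Q x)"
proof (rule mregular_imp_mat_poly[OF horizontal_mat_localised[OF horizontal]])
  fix H assume H: "H \<in> arr"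
  have "0 \<le> (k - k') * int (m H * nH H)" using kk by simp
  from horizontal_order[OF rep horizontal H order_refl this] show "regH H P" by (simp add: regH_def)
qed

lemma mat_poly_degree_zero_const:
  assumes P: "mat_poly P" and h: "mat_homog 0 P" and x: "x \<in> V_reg W" shows "P x = P 0"
proof -
  have "P x $ i $ j = P 0 $ i $ j" for i j
  proof -
    have "poly_fun (\<lambda>x. P x $ i $ j)" using P by (simp add: mat_poly_def)
    then obtain q where q: "\<And>t. P (0 + t *s x) $ i $ j = poly q t" using poly_fun_line by blast
    have "poly (q - [:P x $ i $ j:]) t = 0" if "t \<noteq> 0" for t
      using h x that q[of t] by (simp add: mat_homog_def)
    then have "UNIV - {0} \<subseteq> {t. poly (q - [:P x $ i $ j:]) t = 0}" by auto
    moreover have "infinite (UNIV - {0} :: complex set)" by (intro Diff_infinite_finite infinite_UNIV_char_0) simp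
    ultimately have "infinite {t. poly (q - [:P x $ i $ j:]) t = 0}" using infinite_super by blast
    then have "q - [:P x $ i $ j:] = 0" using poly_roots_finite by blast
    then have "poly q 0 = P x $ i $ j" by simp
    then show ?thesis using q[of 0] by simp
  qed
  then show ?thesis by (simp add: vec_eq_iff)
qed

section \<open>Twists of irreducible modules are irreducible\<close>

lemma mat_homog_mult: "mat_homog d F \<Longrightarrow> mat_homog e G \<Longrightarrow> mat_homog (d + e) (\<lambda>x. F x ** G x)"
  by (simp add: mat_homog_def power_int_add mult.commute)
lemma mat_homog_const: "mat_homog 0 (\<lambda>x. C)" by (simp add: mat_homog_def)

lemma mat_homog_inverse:
  assumes F: "mat_homog d F" and FF: "\<And>x. x \<in> V_reg W \<Longrightarrow> F x ** Fi x = mat 1" "\<And>x. x \<in> V_reg W \<Longrightarrow> Fi x ** F x = mat 1"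
  shows "mat_homog (- d) Fi"
  unfolding mat_homog_def
proof (intro ballI allI impI)
  fix x and t :: complex assume x: "x \<in> V_reg W" and t: "t \<noteq> 0"
  have tx: "t *s x \<in> V_reg W" using x t by (simp add: V_reg_scale)
  have "smul (t powi d) (Fi (t *s x)) = Fi (t *s x) ** smul (t powi d) (F x) ** Fi x" using FF[OF x] by (simp add: matrix_mul_assoc[symmetric])
  also have "smul (t powi d) (F x) = F (t *s x)" using F x t by (simp add: mat_homog_def)
  finally have "smul (t powi d) (Fi (t *s x)) = Fi x" using FF[OF tx] by simp
  then have "smul (t powi (- d)) (smul (t powi d) (Fi (t *s x))) = smul (t powi (- d)) (Fi x)" by simp
  then show "Fi (t *s x) = smul (t powi - d) (Fi x)" using t by (simp add: power_int_minus)
qed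

lemma subspace_projection:
  assumes U: "vec.subspace (U :: (complex^'d::finite) set)"
  shows "\<exists>p. (\<forall>x. p *v x \<in> U) \<and> (\<forall>u\<in>U. p *v u = u)"
proof -
  have "\<exists>g. g ` UNIV \<subseteq> U \<and> Vector_Spaces.linear (*s) (*s) g \<and> (\<forall>v\<in>U. g (id v) = v)"
    by (rule vec.linear_exists_left_inverse_on[OF vec.linear_id U]) simp
  then obtain g where g: "g ` UNIV \<subseteq> U" "Vector_Spaces.linear (*s) (*s) g" "\<forall>v\<in>U. g v = v" by auto
  show ?thesis by (rule exI[of _ "matrix g"]) (use g in \<open>auto simp: matrix_works\<close>)
qed

lemma bij_W_mult: assumes "u \<in> W" shows "bij_betw (\<lambda>w. u ** w) W W"
  by (rule bij_betw_byWitness[where f'="\<lambda>w. matrix_inv u ** w"])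
     (use assms mult_W inv_W W_inv_mult[OF assms] in \<open>auto simp: matrix_mul_assoc\<close>)

lemma W_average_intertwines:
  assumes rep: "representation W \<sigma>" "representation W \<sigma>'" and u: "u \<in> W"
  shows "\<sigma>' u ** (\<Sum>w\<in>W. \<sigma>' w ** C ** \<sigma> (matrix_inv w)) = (\<Sum>w\<in>W. \<sigma>' w ** C ** \<sigma> (matrix_inv w)) ** \<sigma> u"
proof -
  have "\<sigma>' u ** (\<Sum>w\<in>W. \<sigma>' w ** C ** \<sigma> (matrix_inv w)) = (\<Sum>w\<in>W. \<sigma>' (u ** w) ** C ** \<sigma> (matrix_inv (u ** w)) ** \<sigma> u)"
    unfolding matrix_mult_sum_right
  proof (rule sum.cong[OF refl])
    fix w assume w: "w \<in> W"
    have "\<sigma> (matrix_inv (u ** w)) ** \<sigma> u = \<sigma> (matrix_inv w) ** (\<sigma> (matrix_inv u) ** \<sigma> u)"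
      unfolding inv_mult_W[OF u w] rep_mult[OF rep(1) inv_W[OF w] inv_W[OF u]] by (simp only: matrix_mul_assoc)
    then show "\<sigma>' u ** (\<sigma>' w ** C ** \<sigma> (matrix_inv w)) = \<sigma>' (u ** w) ** C ** \<sigma> (matrix_inv (u ** w)) ** \<sigma> u"
      unfolding rep_mult[OF rep(2) u w] rep_inv[OF rep(1) u] by (simp add: matrix_mul_assoc[symmetric])
  qed
  also have "\<dots> = (\<Sum>w\<in>W. \<sigma>' (u ** w) ** C ** \<sigma> (matrix_inv (u ** w))) ** \<sigma> u"
    by (simp only: matrix_mult_sum_left)
  also have "(\<Sum>w\<in>W. \<sigma>' (u ** w) ** C ** \<sigma> (matrix_inv (u ** w))) = (\<Sum>w\<in>W. \<sigma>' w ** C ** \<sigma> (matrix_inv w))"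
    by (rule sum.reindex_bij_betw[OF bij_W_mult[OF u], of "\<lambda>w. \<sigma>' w ** C ** \<sigma> (matrix_inv w)"])
  finally show ?thesis .
qed

text \<open>Averaging a projection onto a \<sigma>-stable subspace U gives an endomorphism C of
  \<sigma>. Conjugated by F it becomes a horizontal endomorphism of KZ_{-j}(\<tau>), hence
  polynomial, and of degree 0, hence constant; it commutes with \<tau> and is a scalar by Schur's
  lemma. So C itself is this scalar.\<close>

lemma kz_irreducible:
  assumes irr: "irreducible_representation W \<tau>" and K: "kz_fundamental j \<tau> \<sigma> F Fi"
  shows "irreducible_representation W \<sigma>"
  unfolding irreducible_representation_def
proof (intro conjI allI impI)
  note repT = irr_rep[OF irr]
  show repS: "representation W \<sigma>" using K by (simp add: kz_fundamental_def)
  fix U assume U: "vec.subspace U \<and> (\<forall>w\<in>W. \<forall>v\<in>U. \<sigma> w *v v \<in> U)"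
  obtain p where p: "\<And>x. p *v x \<in> U" "\<And>u. u \<in> U \<Longrightarrow> p *v u = u" using subspace_projection U by blast
  define C where "C = (\<Sum>w\<in>W. \<sigma> w ** p ** \<sigma> (matrix_inv w))"
  have C: "\<sigma> w ** C = C ** \<sigma> w" if "w \<in> W" for w unfolding C_def by (rule W_average_intertwines[OF repS repS that])
  have CU: "C *v x \<in> U" for x unfolding C_def sum_matrix_vector
    by (rule vec.subspace_sum) (use U p in \<open>auto simp: matrix_vector_mul_assoc[symmetric]\<close>)
  have Cu: "C *v u = of_nat (card W) *s u" if u: "u \<in> U" for u
  proof -
    have "C *v u = (\<Sum>w\<in>W. u)" unfolding C_def sum_matrix_vector
    proof (rule sum.cong[OF refl])
      fix w assume w: "w \<in> W"
      have "p *v (\<sigma> (matrix_inv w) *v u) = \<sigma> (matrix_inv w) *v u" using U u inv_W[OF w] p by blast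
      then show "(\<sigma> w ** p ** \<sigma> (matrix_inv w)) *v u = u"
        using rep_inv[OF repS w] by (simp add: matrix_vector_mul_assoc[symmetric]) (simp add: matrix_vector_mul_assoc)
    qed
    also have "\<dots> = of_nat (card W) *s u" by (rule sum_const_vec)
    finally show ?thesis .
  qed
  have FF: "F x ** Fi x = mat 1" "Fi x ** F x = mat 1" if "x \<in> V_reg W" for x using K that by (simp_all add: kz_fundamental_def)
  define P where "P x = F x ** (C ** Fi x)" for x
  have hzP: "horizontal (of_int (- int j)) \<tau> (of_int (- int j)) \<tau> P"
    using horizontal_compose[OF horizontal_compose[OF kz_fundamental_horizontal(2)[OF K] horizontal_const[of C \<sigma> \<sigma>]] kz_fundamental_horizontal(1)[OF K]] C by (simp add: P_def[abs_def])
  obtain R where R: "mat_poly R" "\<And>x. x \<in> V_reg W \<Longrightarrow> P x = R x" using horizontal_mat_poly[OF repT repT hzP order_refl] by blast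
  obtain D where D: "mat_homog D F" using K by (auto simp: kz_fundamental_def)
  have "mat_homog (D + (0 + - D)) P" unfolding P_def
    by (intro mat_homog_mult mat_homog_const D mat_homog_inverse[OF D FF])
  then have "mat_homog 0 R" using mat_homog_cong[OF R(2), where d=0] by simp
  then have R0: "P x = R 0" if "x \<in> V_reg W" for x using mat_poly_degree_zero_const[OF R(1) _ that] R(2)[OF that] by simp
  obtain x where x: "x \<in> V_reg W" using V_reg_nonempty by blast
  have "\<tau> w ** R 0 = R 0 ** \<tau> w" if w: "w \<in> W" for w
  proof -
    have "P (w *v x) ** \<tau> w = \<tau> w ** P x" using hzP x w unfolding horizontal_def by blast
    then show ?thesis using R0 x V_reg_act[OF w, of x] by simp
  qed
  then obtain c where c: "R 0 = smul c (mat 1)" using schur[OF irr] by blast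
  have "C = Fi x ** (F x ** C ** Fi x) ** F x" by (simp add: matrix_mul_assoc FF[OF x]) (simp add: matrix_mul_assoc[symmetric] FF[OF x])
  also have "F x ** C ** Fi x = smul c (mat 1)" using R0[OF x] c by (simp add: P_def matrix_mul_assoc)
  finally have Cc: "C = smul c (mat 1)" by (simp add: FF[OF x])
  \<comment> \<open>C maps into U and acts on U as the number of elements of W; so the scalar can be
    0 only if U is zero, and otherwise U is everything.\<close>
  show "U = {0} \<or> U = UNIV"
  proof (cases "c = 0")
    case True
    have "card W \<noteq> 0" using finite_W one_W by auto
    then have "u = 0" if "u \<in> U" for u using Cu[OF that] Cc True by (simp add: vec_eq_iff)
    then show ?thesis using U vec.subspace_0 by blast
  next
    case False
    have "x \<in> U" for x
    proof -
      have "x = C *v ((1 / c) *s x)" using False by (simp add: Cc smul_vector)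
      then show ?thesis using CU by metis
    qed
    then show ?thesis by blast
  qed
qed

end

section \<open>Inverting a twist\<close>

text \<open>More vectors than coordinates are dependent: eliminating the coordinate b with a pivot k
  leaves one coordinate and one vector fewer.\<close>

lemma linear_relation_exists:
  fixes f :: "'i \<Rightarrow> 'b \<Rightarrow> complex"
  assumes "finite B" "finite I" "card B < card I"
  shows "\<exists>c. (\<exists>i\<in>I. c i \<noteq> 0) \<and> (\<forall>b\<in>B. (\<Sum>i\<in>I. c i * f i b) = 0)"
  using assms
proof (induction B arbitrary: I f rule: finite_induct)
  case empty
  then obtain i where "i \<in> I" by fastforce
  then show ?case by (intro exI[of _ "\<lambda>i. 1"]) auto
next
  case (insert b B)
  show ?case
  proof (cases "\<forall>i\<in>I. f i b = 0")
    case True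
    obtain c where "\<exists>i\<in>I. c i \<noteq> 0" "\<forall>b\<in>B. (\<Sum>i\<in>I. c i * f i b) = 0"
      using insert.IH[of I f] insert.prems insert.hyps by auto
    then show ?thesis using True by (intro exI[of _ c]) auto
  next
    case False
    then obtain k where k: "k \<in> I" "f k b \<noteq> 0" by blast
    define g where "g i x = f i x - f i b / f k b * f k x" for i x
    have "card B < card (I - {k})" using insert.prems insert.hyps k by simp
    then obtain c where c: "\<exists>i\<in>I - {k}. c i \<noteq> 0" "\<forall>b\<in>B. (\<Sum>i\<in>I - {k}. c i * g i b) = 0"
      using insert.IH[of "I - {k}" g] insert.prems by auto
    define e where "e = (\<Sum>i\<in>I - {k}. c i * (f i b / f k b))"
    define c' where "c' = c(k := - e)"
    have s: "(\<Sum>i\<in>I. c' i * f i x) = (\<Sum>i\<in>I - {k}. c i * g i x)" for x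
    proof -
      have "(\<Sum>i\<in>I. c' i * f i x) = - e * f k x + (\<Sum>i\<in>I - {k}. c' i * f i x)"
        using sum.remove[OF insert.prems(1) k(1), of "\<lambda>i. c' i * f i x"] by (simp add: c'_def)
      also have "(\<Sum>i\<in>I - {k}. c' i * f i x) = (\<Sum>i\<in>I - {k}. c i * f i x)"
        by (rule sum.cong) (auto simp: c'_def)
      finally show ?thesis by (simp add: g_def e_def algebra_simps sum_subtractf sum_distrib_left sum_distrib_right)
    qed
    show ?thesis
    proof (intro exI conjI ballI)
      show "\<exists>i\<in>I. c' i \<noteq> 0" using c(1) by (auto simp: c'_def)
      fix x assume "x \<in> insert b B"
      then show "(\<Sum>i\<in>I. c' i * f i x) = 0" unfolding s
        using c(2) k(2) by (auto simp: g_def)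
    qed
  qed
qed

text \<open>One scaling factor suffices because the powers of 2 are distinct: a monomial of total
  degree e enters the zero polynomial q with its coefficient multiplied by 2^e - 2^d.\<close>

lemma homogeneous_poly_if_scaling:
  fixes p :: "'n::finite poly_ring"
  assumes "\<And>x. eval_poly p (2 *s x) = 2 ^ d * eval_poly p x"
  shows "homogeneous_poly d p"
proof -
  let ?dg = "\<lambda>a::'n \<Rightarrow>\<^sub>0 nat. \<Sum>i\<in>UNIV. Poly_Mapping.lookup a i"
  define q where "q = (\<Sum>a\<in>Poly_Mapping.keys p. Poly_Mapping.single a (Poly_Mapping.lookup p a * (2 ^ ?dg a - 2 ^ d)))"
  have ev: "eval_poly (Poly_Mapping.single a c) x = c * (\<Prod>i\<in>UNIV. x $ i ^ Poly_Mapping.lookup a i)"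
    for a :: "'n \<Rightarrow>\<^sub>0 nat" and c x
    unfolding eval_poly_def by (subst insertion_single) simp_all
  have "eval_poly q x = 0" for x
  proof -
    have "eval_poly q x = (\<Sum>a\<in>Poly_Mapping.keys p. Poly_Mapping.lookup p a * (\<Prod>i\<in>UNIV. (2 * x $ i) ^ Poly_Mapping.lookup a i)
        - 2 ^ d * (Poly_Mapping.lookup p a * (\<Prod>i\<in>UNIV. x $ i ^ Poly_Mapping.lookup a i)))"
      unfolding q_def eval_poly_sum ev
      by (rule sum.cong) (simp_all add: power_mult_distrib prod.distrib power_sum[symmetric] algebra_simps)
    also have "\<dots> = eval_poly p (2 *s x) - 2 ^ d * eval_poly p x"
      by (simp add: eval_poly_def insertion_def sum_subtractf sum_distrib_left)
    finally show ?thesis using assms by simp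
  qed
  then have q0: "q = 0" by (rule eval_poly_eq_0_imp)
  show ?thesis unfolding homogeneous_poly_def
  proof
    fix a assume a: "a \<in> Poly_Mapping.keys p"
    have "Poly_Mapping.lookup q a = (\<Sum>b\<in>Poly_Mapping.keys p. if b = a then Poly_Mapping.lookup p a * (2 ^ ?dg a - 2 ^ d) else 0)"
      unfolding q_def lookup_sum by (rule sum.cong) (auto simp: lookup_single when_def)
    then have "Poly_Mapping.lookup p a * (2 ^ ?dg a - 2 ^ d) = 0" using a q0 by simp
    then have "(2::complex) ^ ?dg a = 2 ^ d" using a by (simp add: in_keys_iff)
    then have "(of_nat (2 ^ ?dg a) :: complex) = of_nat (2 ^ d)" by simp
    then have "(2::nat) ^ ?dg a = 2 ^ d" by (simp only: of_nat_eq_iff)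
    then show "?dg a = d" by simp
  qed
qed

lemma finite_degree_monomials: "finite {a :: 'n::finite \<Rightarrow>\<^sub>0 nat. (\<Sum>i\<in>UNIV. Poly_Mapping.lookup a i) = d}"
proof (rule finite_imageD[where f=Poly_Mapping.lookup])
  have "Poly_Mapping.lookup ` {a :: 'n \<Rightarrow>\<^sub>0 nat. (\<Sum>i\<in>UNIV. Poly_Mapping.lookup a i) = d} \<subseteq> PiE UNIV (\<lambda>_. {..d})"
    by (auto simp: PiE_def extensional_def intro!: member_le_sum[of _ UNIV])
  then show "finite (Poly_Mapping.lookup ` {a :: 'n \<Rightarrow>\<^sub>0 nat. (\<Sum>i\<in>UNIV. Poly_Mapping.lookup a i) = d})"
    by (rule finite_subset) (simp add: finite_PiE)
  show "inj_on Poly_Mapping.lookup {a :: 'n \<Rightarrow>\<^sub>0 nat. (\<Sum>i\<in>UNIV. Poly_Mapping.lookup a i) = d}"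
    by (rule inj_onI, rule poly_mapping_eqI) simp
qed

context refl_arr begin

lemma mat_homog_poly_entry:
  assumes P: "mat_poly P" and h: "mat_homog (int d) P"
  shows "\<exists>p. (\<forall>x. P x $ i $ j = eval_poly p x) \<and> homogeneous_poly d p"
proof -
  obtain p where p: "\<And>x. P x $ i $ j = eval_poly p x" using P unfolding mat_poly_def poly_fun_def by (metis (mono_tags))
  have "eval_poly p (2 *s x) = 2 ^ d * eval_poly p x" for x
  proof -
    have "poly_fun (\<lambda>x. eval_poly p (2 *s x) - 2 ^ d * eval_poly p x)"
    proof (intro poly_fun_diff poly_fun_mult poly_fun_const poly_fun_eval)
      have "poly_fun (\<lambda>x. eval_poly p (smul 2 (mat 1) *v x + 0))" by (rule poly_fun_compose_linear) simp
      then show "poly_fun (\<lambda>x. eval_poly p (2 *s x))" by (simp add: smul_vector)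
    qed
    moreover have "eval_poly p (2 *s x) - 2 ^ d * eval_poly p x = 0" if x: "x \<in> V_reg W" for x
    proof -
      have "P (2 *s x) = smul (2 powi int d) (P x)" using h x unfolding mat_homog_def by simp
      then show ?thesis unfolding p[symmetric] by simp
    qed
    ultimately have "eval_poly p (2 *s x) - 2 ^ d * eval_poly p x = 0" by (rule poly_zero_on_V_reg)
    then show ?thesis by simp
  qed
  then show ?thesis using p homogeneous_poly_if_scaling by blast
qed

text \<open>Homogeneous polynomial matrices of one degree form a finite-dimensional space; f lists
  the coefficients of the entries.\<close>

lemma mat_homog_family_relation:
  fixes P :: "nat \<Rightarrow> complex^'n \<Rightarrow> complex^'a::finite^'b::finite"
  assumes S: "infinite S" and P: "\<And>s. s \<in> S \<Longrightarrow> mat_poly (P s) \<and> mat_homog (int d) (P s)"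
  shows "\<exists>I c. finite I \<and> I \<subseteq> S \<and> (\<exists>i\<in>I. c i \<noteq> 0) \<and> (\<forall>x. (\<Sum>i\<in>I. smul (c i) (P i x)) = 0)"
proof -
  have "\<forall>s\<in>S. \<forall>i j. \<exists>p. (\<forall>x. P s x $ i $ j = eval_poly p x) \<and> homogeneous_poly d p"
    using P mat_homog_poly_entry by blast
  then obtain p where p: "\<And>s i j x. s \<in> S \<Longrightarrow> P s x $ i $ j = eval_poly (p s i j) x" "\<And>s i j. s \<in> S \<Longrightarrow> homogeneous_poly d (p s i j)"
    by metis
  define Mon where "Mon = {a :: 'n \<Rightarrow>\<^sub>0 nat. (\<Sum>i\<in>UNIV. Poly_Mapping.lookup a i) = d}"
  have M: "finite Mon" unfolding Mon_def by (rule finite_degree_monomials)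
  define B where "B = (UNIV :: ('b \<times> 'a) set) \<times> Mon"
  have B: "finite B" using M by (simp add: B_def)
  obtain I where I: "finite I" "card I = Suc (card B)" "I \<subseteq> S" using infinite_arbitrarily_large[OF S] by metis
  define f where "f s = (\<lambda>((i, j), a). Poly_Mapping.lookup (p s i j) a)" for s
  have ff: "f s ((i, j), a) = Poly_Mapping.lookup (p s i j) a" for s i j a by (simp add: f_def)
  obtain c where c: "\<exists>i\<in>I. c i \<noteq> 0" "\<And>b. b \<in> B \<Longrightarrow> (\<Sum>i\<in>I. c i * f i b) = 0"
    using linear_relation_exists[OF B I(1), of f] I(2) by auto
  have "(\<Sum>s\<in>I. smul (c s) (P s x)) $ i $ j = 0" for x i j
  proof -
    have "P s x $ i $ j = (\<Sum>a\<in>Mon. Poly_Mapping.lookup (p s i j) a * (\<Prod>k\<in>UNIV. x $ k ^ Poly_Mapping.lookup a k))" if s: "s \<in> I" for s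
    proof -
      have "Poly_Mapping.keys (p s i j) \<subseteq> Mon" using p(2)[of s i j] s I by (auto simp: homogeneous_poly_def Mon_def)
      from insertion_superset[OF M this, of "\<lambda>c. c" "\<lambda>k. x $ k"] show ?thesis
        using p(1)[of s x i j] s I by (auto simp: eval_poly_def)
    qed
    then have "(\<Sum>s\<in>I. smul (c s) (P s x)) $ i $ j = (\<Sum>s\<in>I. c s * (\<Sum>a\<in>Mon. Poly_Mapping.lookup (p s i j) a * (\<Prod>k\<in>UNIV. x $ k ^ Poly_Mapping.lookup a k)))"
      by (simp cong: sum.cong)
    also have "\<dots> = (\<Sum>a\<in>Mon. (\<Sum>s\<in>I. c s * f s ((i, j), a)) * (\<Prod>k\<in>UNIV. x $ k ^ Poly_Mapping.lookup a k))"
      unfolding sum_distrib_left sum_distrib_right ff by (subst sum.swap) (simp add: mult.assoc)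
    also have "\<dots> = 0" by (rule sum.neutral) (auto simp: c(2) B_def)
    finally show ?thesis .
  qed
  then have "(\<Sum>s\<in>I. smul (c s) (P s x)) = 0" for x by (simp add: vec_eq_iff)
  then show ?thesis using I c(1) by blast
qed

lemma mat_homog_delta_smul:
  assumes h: "mat_homog e P" shows "mat_homog (int (B * card arr) + e) (\<lambda>x. smul (\<delta> x ^ B) (P x))"
  unfolding mat_homog_def
proof (intro ballI allI impI)
  fix x and t :: complex assume x: "x \<in> V_reg W" and t: "t \<noteq> 0"
  have "P (t *s x) = smul (t powi e) (P x)" using h x t unfolding mat_homog_def by blast
  moreover have "\<delta> (t *s x) = t ^ card arr * \<delta> x" unfolding \<delta>_def by (simp add: prod.distrib)
  moreover have "t powi (int (B * card arr) + e) = (t ^ card arr) ^ B * t powi e"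
    using t by (simp only: power_int_add power_int_of_nat power_mult[symmetric] mult.commute[of B] simp_thms)
  ultimately show "smul (\<delta> (t *s x) ^ B) (P (t *s x)) = smul (t powi (int (B * card arr) + e)) (smul (\<delta> x ^ B) (P x))"
    by (simp add: power_mult_distrib mult_ac)
qed

text \<open>
  The space of horizontal maps depends on the parameter through a linear pencil on a
  finite-dimensional space: a minimal relation \<open>\<Sum> c\<^sub>i P\<^sub>i = 0\<close> between solutions at the parameters
  \<open>-i\<close> yields the nonzero solution \<open>\<Sum> c\<^sub>i / (z + i) P\<^sub>i\<close> at the parameter \<open>z\<close>.
\<close>

lemma horizontal_pencil:
  fixes P :: "nat \<Rightarrow> complex^'n \<Rightarrow> complex^'a::finite^'b::finite"
  assumes S: "infinite S" and P: "\<And>s. s \<in> S \<Longrightarrow> mat_homog e (P s)"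
    and cd: "\<And>s. s \<in> S \<Longrightarrow> \<exists>U. mat_poly U \<and> (\<forall>x\<in>V_reg W. smul (\<delta> x ^ B) (P s x) = U x)"
    and horizontal: "\<And>s. s \<in> S \<Longrightarrow> horizontal (- of_nat s) \<tau> (- of_nat s - r) \<tau>' (P s)"
    and nz: "\<And>s. s \<in> S \<Longrightarrow> \<exists>x\<in>V_reg W. P s x \<noteq> 0"
  shows "\<exists>Q. mat_homog e Q \<and> horizontal z \<tau> (z - r) \<tau>' Q \<and> (\<exists>x\<in>V_reg W. Q x \<noteq> 0)"
proof (cases "\<exists>s\<in>S. z = - of_nat s")
  case True
  then show ?thesis using P horizontal nz by blast
next
  case False
  then have z: "z + of_nat s \<noteq> 0" if "s \<in> S" for s using that by (auto simp: add_eq_0_iff2)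
  define rel where "rel I c \<longleftrightarrow> finite I \<and> I \<subseteq> S \<and> I \<noteq> {} \<and> (\<forall>i\<in>I. c i \<noteq> 0) \<and> (\<forall>x\<in>V_reg W. (\<Sum>i\<in>I. smul (c i) (P i x)) = 0)"
    for I and c :: "nat \<Rightarrow> complex"
  have "\<exists>I c. rel I c"
  proof -
    have "\<forall>s\<in>S. \<exists>U. mat_poly U \<and> (\<forall>x\<in>V_reg W. smul (\<delta> x ^ B) (P s x) = U x)" using cd by blast
    from bchoice[OF this] obtain U where "\<forall>s\<in>S. mat_poly (U s) \<and> (\<forall>x\<in>V_reg W. smul (\<delta> x ^ B) (P s x) = U s x)" ..
    then have U: "mat_poly (U s)" "x \<in> V_reg W \<Longrightarrow> smul (\<delta> x ^ B) (P s x) = U s x" if "s \<in> S" for s x using that by blast+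
    have hU: "mat_homog (int (B * card arr) + e) (U s)" if s: "s \<in> S" for s
    proof -
      have "mat_homog (int (B * card arr) + e) (\<lambda>x. smul (\<delta> x ^ B) (P s x)) \<longleftrightarrow> mat_homog (int (B * card arr) + e) (U s)"
        by (rule mat_homog_cong) (rule U(2)[OF s])
      then show ?thesis using mat_homog_delta_smul[OF P[OF s]] by blast
    qed
    \<comment> \<open>A negative total degree would force the polynomial matrix U, and with it P, to
      vanish.\<close>
    have "int (B * card arr) + e \<ge> 0"
    proof (rule ccontr)
      assume n: "\<not> int (B * card arr) + e \<ge> 0"
      obtain s where s: "s \<in> S" using infinite_imp_nonempty[OF S] by blast
      obtain x where x: "x \<in> V_reg W" "P s x \<noteq> 0" using nz[OF s] by blast
      have "U s x = 0" by (rule mat_poly_negative_degree[OF U(1)[OF s] hU[OF s]]) (use n in simp)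
      then have "smul (\<delta> x ^ B) (P s x) = 0" using U(2)[OF s x(1)] by simp
      moreover have "\<delta> x \<noteq> 0" using x by (simp add: \<delta>_nz)
      ultimately show False using x(2) by (simp add: smul_eq_0)
    qed
    then obtain d where d: "int (B * card arr) + e = int d" using nonneg_int_cases by blast
    have "\<exists>I c. finite I \<and> I \<subseteq> S \<and> (\<exists>i\<in>I. c i \<noteq> 0) \<and> (\<forall>x. (\<Sum>i\<in>I. smul (c i) (U i x)) = 0)"
      by (rule mat_homog_family_relation[OF S]) (use U(1) hU d in auto)
    then obtain I c where "finite I \<and> I \<subseteq> S \<and> (\<exists>i\<in>I. c i \<noteq> 0) \<and> (\<forall>x. (\<Sum>i\<in>I. smul (c i) (U i x)) = 0)"
      by (elim exE)
    then have I: "finite I" "I \<subseteq> S" "\<exists>i\<in>I. c i \<noteq> 0" and IU: "\<And>x. (\<Sum>i\<in>I. smul (c i) (U i x)) = 0" by simp_all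
    have IP: "(\<Sum>i\<in>I. smul (c i) (P i x)) = 0" if x: "x \<in> V_reg W" for x
    proof -
      have "smul (\<delta> x ^ B) (\<Sum>i\<in>I. smul (c i) (P i x)) = (\<Sum>i\<in>I. smul (c i) (U i x))"
        unfolding smul_sum_right
      proof (rule sum.cong[OF refl])
        fix i assume "i \<in> I"
        then have "i \<in> S" using I(2) by blast
        from U(2)[OF this x] show "smul (\<delta> x ^ B) (smul (c i) (P i x)) = smul (c i) (U i x)"
          by (metis smul_simps(4) mult.commute)
      qed
      moreover have "\<delta> x \<noteq> 0" using x by (simp add: \<delta>_nz)
      ultimately show ?thesis using IU by (simp add: smul_eq_0)
    qed
    have "(\<Sum>i\<in>{i\<in>I. c i \<noteq> 0}. smul (c i) (P i x)) = (\<Sum>i\<in>I. smul (c i) (P i x))" for x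
      by (rule sum.mono_neutral_left) (use I in auto)
    then have "rel {i\<in>I. c i \<noteq> 0} c" unfolding rel_def using I IP by auto
    then show ?thesis by blast
  qed
  then have ex: "\<exists>n I c. rel I c \<and> card I = n" by blast
  \<comment> \<open>A relation of minimal length is taken; minimality makes Q nonzero below.\<close>
  define n where "n = (LEAST n. \<exists>I c. rel I c \<and> card I = n)"
  have "\<exists>I c. rel I c \<and> card I = n" unfolding n_def by (rule LeastI_ex[OF ex])
  then obtain I c where I: "rel I c" and In: "card I = n" by blast
  have min: "card I \<le> card J" if "rel J e" for J e
    unfolding In n_def by (rule Least_le) (use that in blast)
  have If: "finite I" "I \<subseteq> S" "I \<noteq> {}" "\<And>i. i \<in> I \<Longrightarrow> c i \<noteq> 0"
    and I0: "\<And>x. x \<in> V_reg W \<Longrightarrow> (\<Sum>i\<in>I. smul (c i) (P i x)) = 0" using I unfolding rel_def by auto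
  \<comment> \<open>From (z + i) f i = c i follows -i f i = z f i - c i. So in the sum of the
    equations the parameters -i are all replaced by z, at the cost of the combination with
    coefficients c, which is zero.\<close>
  define f where "f i = c i / (z + of_nat i)" for i
  define Q where "Q x = (\<Sum>i\<in>I. smul (f i) (P i x))" for x
  have Pi: "mat_homog e (P i)" "horizontal (- of_nat i) \<tau> (- of_nat i - r) \<tau>' (P i)" if "i \<in> I" for i
    using P horizontal that If by auto
  have mP: "mat_localised \<delta> (P i)" if "i \<in> I" for i by (rule horizontal_mat_localised[OF Pi(2)[OF that]])
  have hQ: "mat_homog e Q"
    unfolding mat_homog_def Q_def
  proof (intro ballI allI impI)
    fix x and t :: complex assume x: "x \<in> V_reg W" and t: "t \<noteq> 0"
    show "(\<Sum>i\<in>I. smul (f i) (P i (t *s x))) = smul (t powi e) (\<Sum>i\<in>I. smul (f i) (P i x))"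
      unfolding smul_sum_right
    proof (rule sum.cong[OF refl])
      fix i assume "i \<in> I"
      then have "P i (t *s x) = smul (t powi e) (P i x)" using Pi(1) x t unfolding mat_homog_def by blast
      then show "smul (f i) (P i (t *s x)) = smul (t powi e) (smul (f i) (P i x))" by (simp add: mult.commute)
    qed
  qed
  have horizontalQ: "horizontal z \<tau> (z - r) \<tau>' Q" unfolding horizontal_def
  proof (intro conjI allI ballI)
    show "mat_localised \<delta> Q" unfolding Q_def by (intro mat_localised_sum mat_localised_smul localised_const mP poly_\<delta>)
    fix x assume x: "x \<in> V_reg W"
    show "mat_deriv \<xi> Q x = smul z (Q x ** Acon \<tau> \<xi> x) - smul (z - r) (Acon \<tau>' \<xi> x ** Q x)" for \<xi>
    proof -
      let ?A = "Acon \<tau> \<xi> x" and ?A' = "Acon \<tau>' \<xi> x"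
      have "mat_deriv \<xi> Q x = (\<Sum>i\<in>I. mat_deriv \<xi> (\<lambda>x. smul (f i) (P i x)) x)"
        unfolding Q_def by (rule mat_deriv_sum[OF poly_\<delta> mat_localised_smul[OF localised_const mP]]) (use x in \<open>simp_all add: \<delta>_nz\<close>)
      also have "\<dots> = (\<Sum>i\<in>I. smul (f i) (smul z (P i x ** ?A) - smul (z - r) (?A' ** P i x)) - (smul (c i) (P i x) ** ?A - ?A' ** smul (c i) (P i x)))"
      proof (rule sum.cong[OF refl])
        fix i assume i: "i \<in> I"
        have "mat_deriv \<xi> (\<lambda>x. smul (f i) (P i x)) x = smul (f i) (mat_deriv \<xi> (P i) x)"
          using x by (subst mat_deriv_smul[OF poly_\<delta> localised_const mP[OF i]]) (simp_all add: \<delta>_nz)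
        also have "mat_deriv \<xi> (P i) x = smul (- of_nat i) (P i x ** ?A) - smul (- of_nat i - r) (?A' ** P i x)"
          using Pi(2)[OF i] x unfolding horizontal_def by blast
        finally have m: "mat_deriv \<xi> (\<lambda>x. smul (f i) (P i x)) x = smul (f i) (smul (- of_nat i) (P i x ** ?A) - smul (- of_nat i - r) (?A' ** P i x))" .
        have ci: "c i = f i * (z + of_nat i)" using z i If by (auto simp: f_def)
        show "mat_deriv \<xi> (\<lambda>x. smul (f i) (P i x)) x = smul (f i) (smul z (P i x ** ?A) - smul (z - r) (?A' ** P i x)) - (smul (c i) (P i x) ** ?A - ?A' ** smul (c i) (P i x))"
          unfolding m ci by (simp add: vec_eq_iff algebra_simps)
      qed
      also have "\<dots> = smul z (Q x ** ?A) - smul (z - r) (?A' ** Q x) - ((\<Sum>i\<in>I. smul (c i) (P i x)) ** ?A - ?A' ** (\<Sum>i\<in>I. smul (c i) (P i x)))"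
        unfolding Q_def matrix_mult_sum_left matrix_mult_sum_right smul_sum_right sum_subtractf[symmetric]
        by (rule sum.cong[OF refl]) (simp add: mat_alg algebra_simps)
      finally show ?thesis unfolding I0[OF x] by simp
    qed
    fix w assume w: "w \<in> W"
    show "Q (w *v x) ** \<tau> w = \<tau>' w ** Q x"
      unfolding Q_def matrix_mult_sum_left matrix_mult_sum_right
    proof (rule sum.cong[OF refl])
      fix i assume "i \<in> I"
      then have "P i (w *v x) ** \<tau> w = \<tau>' w ** P i x" using Pi(2) x w unfolding horizontal_def by blast
      then show "smul (f i) (P i (w *v x)) ** \<tau> w = \<tau>' w ** smul (f i) (P i x)" by simp
    qed
  qed
  have "\<exists>x\<in>V_reg W. Q x \<noteq> 0"
  proof (rule ccontr)
    assume "\<not> ?thesis"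
    then have Q0: "\<And>x. x \<in> V_reg W \<Longrightarrow> Q x = 0" by blast
    obtain k where k: "k \<in> I" using If by blast
    \<comment> \<open>If Q vanished, subtracting (z + k) Q from the relation would cancel its k-th
      term and leave a shorter relation.\<close>
    define g where "g i = c i - (z + of_nat k) * f i" for i
    have g: "g i = c i * (of_nat i - of_nat k) / (z + of_nat i)" if "i \<in> I" for i
    proof -
      have "z + of_nat i \<noteq> 0" using z that If(2) by blast
      then show ?thesis by (simp add: g_def f_def diff_eq_eq add_divide_distrib[symmetric]) (simp add: field_simps)
    qed
    have gz: "g k = 0" using g[OF k] by simp
    have gs: "(\<Sum>i\<in>I - {k}. smul (g i) (P i x)) = 0" if x: "x \<in> V_reg W" for x
    proof -
      have "(\<Sum>i\<in>I. smul (g i) (P i x)) = (\<Sum>i\<in>I. smul (c i) (P i x)) - smul (z + of_nat k) (Q x)"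
        unfolding Q_def smul_sum_right sum_subtractf[symmetric] by (rule sum.cong[OF refl]) (simp add: g_def smul_diff_left)
      then have "(\<Sum>i\<in>I. smul (g i) (P i x)) = 0" using I0[OF x] Q0[OF x] by simp
      then show ?thesis using sum.remove[OF If(1) k, of "\<lambda>i. smul (g i) (P i x)"] gz by simp
    qed
    have ne: "I - {k} \<noteq> {}"
    proof
      assume "I - {k} = {}"
      then have "I = {k}" using k by blast
      then have "smul (c k) (P k x) = 0" if "x \<in> V_reg W" for x using I0[OF that] by simp
      then have "\<forall>x\<in>V_reg W. P k x = 0" using If(4)[OF k] by (simp add: smul_eq_0)
      then show False using nz k If by blast
    qed
    have "g i \<noteq> 0" if "i \<in> I - {k}" for i using g[of i] that If(4)[of i] z[of i] If(2) by auto
    then have "rel (I - {k}) g" unfolding rel_def using If gs ne by auto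
    then have "card I \<le> card (I - {k})" by (rule min)
    moreover have "card (I - {k}) < card I" by (rule card_Diff1_less[OF If(1) k])
    ultimately show False by simp
  qed
  then show ?thesis using hQ horizontalQ by blast
qed

definition intertwiner :: "(complex^'n^'n \<Rightarrow> complex^'d^'d) \<Rightarrow> (complex^'n^'n \<Rightarrow> complex^'d^'d) \<Rightarrow> complex^'d^'d \<Rightarrow> bool" where
  "intertwiner \<sigma> \<sigma>' T \<longleftrightarrow> (\<forall>w\<in>W. T ** \<sigma> w = \<sigma>' w ** T)"

text \<open>Otherwise one matrix coefficient from each module would give card W + 1 independent
  functions on W. Independence is Schur orthogonality: the average of a matrix unit over W is an
  intertwiner and hence 0.\<close>

lemma irreps_repeat:
  fixes \<sigma> :: "nat \<Rightarrow> complex^'n^'n \<Rightarrow> complex^'d::finite^'d"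
  assumes irr: "\<And>i. irreducible_representation W (\<sigma> i)"
  shows "\<exists>i j. i < j \<and> j \<le> card W \<and> (\<exists>T. T \<noteq> 0 \<and> intertwiner (\<sigma> i) (\<sigma> j) T)"
proof (rule ccontr)
  assume no: "\<not> ?thesis"
  note rep = irr_rep[OF irr]
  \<comment> \<open>Some matrix coefficient pairs nontrivially with its dual one: summed over b the
    pairings give a diagonal entry of the sum of \<sigma>(w) \<sigma>(w^{-1}), which is the number
    of elements of W.\<close>
  have "\<exists>a b. (\<Sum>w\<in>W. \<sigma> i w $ a $ b * \<sigma> i (matrix_inv w) $ b $ a) \<noteq> 0" for i
  proof (rule ccontr)
    assume "\<not> ?thesis"
    then have z: "(\<Sum>w\<in>W. \<sigma> i w $ a $ b * \<sigma> i (matrix_inv w) $ b $ a) = 0" for a b by blast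
    have "(\<Sum>b\<in>UNIV. \<sigma> i w $ a $ b * \<sigma> i (matrix_inv w) $ b $ a) = 1" if w: "w \<in> W" for w a
    proof -
      have "(\<sigma> i w ** \<sigma> i (matrix_inv w)) $ a $ a = 1" unfolding rep_inv[OF rep w] by (simp add: mat_def)
      then show ?thesis by (simp add: matrix_matrix_mult_def)
    qed
    then have "(\<Sum>w\<in>W. \<Sum>b\<in>UNIV. \<sigma> i w $ a $ b * \<sigma> i (matrix_inv w) $ b $ a) = of_nat (card W)" for a by simp
    then have "(of_nat (card W) :: complex) = 0" by (subst (asm) sum.swap) (simp add: z)
    then show False using finite_W one_W by auto
  qed
  then have "\<forall>i. \<exists>q. (\<Sum>w\<in>W. \<sigma> i w $ fst q $ snd q * \<sigma> i (matrix_inv w) $ snd q $ fst q) \<noteq> 0" by simp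
  from choice[OF this] obtain q where
    q: "\<forall>i. (\<Sum>w\<in>W. \<sigma> i w $ fst (q i) $ snd (q i) * \<sigma> i (matrix_inv w) $ snd (q i) $ fst (q i)) \<noteq> 0" ..
  define a b where "a i = fst (q i)" and "b i = snd (q i)" for i
  have ab: "(\<Sum>w\<in>W. \<sigma> i w $ a i $ b i * \<sigma> i (matrix_inv w) $ b i $ a i) \<noteq> 0" for i
    using q by (simp add: a_def b_def)
  obtain c where c: "\<exists>i\<in>{..card W}. c i \<noteq> 0" "\<And>w. w \<in> W \<Longrightarrow> (\<Sum>i\<in>{..card W}. c i * \<sigma> i w $ a i $ b i) = 0"
    using linear_relation_exists[OF finite_W, of "{..card W}" "\<lambda>i w. \<sigma> i w $ a i $ b i"] by auto
  \<comment> \<open>Intertwiners are excluded only from a smaller index to a larger one. With k the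
    least index in the relation all other terms have i > k, which is the available
    direction.\<close>
  define k where "k = (LEAST i. c i \<noteq> 0)"
  obtain i0 where i0: "c i0 \<noteq> 0" "i0 \<le> card W" using c(1) by auto
  have k: "c k \<noteq> 0" unfolding k_def by (rule LeastI[of "\<lambda>i. c i \<noteq> 0"]) (rule i0)
  have kle: "k \<le> i0" unfolding k_def by (rule Least_le) (rule i0)
  have klt: "c i = 0" if "i < k" for i using not_less_Least[of i "\<lambda>i. c i \<noteq> 0"] that unfolding k_def by blast
  have kW: "k \<le> card W" using kle i0(2) by simp
  have orth: "(\<Sum>w\<in>W. \<sigma> i w $ a i $ b i * \<sigma> k (matrix_inv w) $ b k $ a k) = 0" if i: "k < i" "i \<le> card W" for i
  proof -
    \<comment> \<open>The entry at (a i, a k) of the average of this matrix unit is the pairing of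
      the two matrix coefficients.\<close>
    define E :: "complex^'d^'d" where "E = (\<chi> p q. if p = b i \<and> q = b k then 1 else 0)"
    define T where "T = (\<Sum>w\<in>W. \<sigma> i w ** E ** \<sigma> k (matrix_inv w))"
    have "intertwiner (\<sigma> k) (\<sigma> i) T" unfolding intertwiner_def T_def
      by (intro ballI W_average_intertwines[OF rep rep, symmetric])
    then have T0: "T = 0" using no i by blast
    have "(X ** E ** Y) $ a i $ a k = X $ a i $ b i * Y $ b k $ a k" for X Y :: "complex^'d^'d"
    proof -
      have "(X ** E) $ a i $ q = (if q = b k then X $ a i $ b i else 0)" for q
      proof -
        have "(\<Sum>p\<in>UNIV. X $ a i $ p * E $ p $ q) = (\<Sum>p\<in>UNIV. if p = b i then (if q = b k then X $ a i $ b i else 0) else 0)"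
          by (rule sum.cong) (auto simp: E_def)
        then show ?thesis by (simp add: matrix_matrix_mult_def)
      qed
      moreover have "(X ** E ** Y) $ a i $ a k = (\<Sum>q\<in>UNIV. (X ** E) $ a i $ q * Y $ q $ a k)"
        by (simp only: matrix_matrix_mult_def[of "X ** E" Y] vec_lambda_beta)
      ultimately have "(X ** E ** Y) $ a i $ a k = (\<Sum>q\<in>UNIV. if q = b k then X $ a i $ b i * Y $ b k $ a k else 0)"
        by (simp add: if_distrib[of "\<lambda>z. z * _"] cong: if_cong)
      then show ?thesis by simp
    qed
    then have "T $ a i $ a k = (\<Sum>w\<in>W. \<sigma> i w $ a i $ b i * \<sigma> k (matrix_inv w) $ b k $ a k)" by (simp add: T_def)
    then show ?thesis using T0 by simp
  qed
  have "0 = (\<Sum>w\<in>W. (\<Sum>i\<in>{..card W}. c i * \<sigma> i w $ a i $ b i) * \<sigma> k (matrix_inv w) $ b k $ a k)"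
    by (simp add: c(2))
  also have "\<dots> = (\<Sum>i\<in>{..card W}. c i * (\<Sum>w\<in>W. \<sigma> i w $ a i $ b i * \<sigma> k (matrix_inv w) $ b k $ a k))"
    unfolding sum_distrib_right sum_distrib_left by (subst sum.swap) (simp add: mult.assoc)
  also have "\<dots> = (\<Sum>i\<in>{..card W}. if i = k then c k * (\<Sum>w\<in>W. \<sigma> k w $ a k $ b k * \<sigma> k (matrix_inv w) $ b k $ a k) else 0)"
  proof (rule sum.cong[OF refl])
    fix i assume i: "i \<in> {..card W}"
    show "c i * (\<Sum>w\<in>W. \<sigma> i w $ a i $ b i * \<sigma> k (matrix_inv w) $ b k $ a k) =
      (if i = k then c k * (\<Sum>w\<in>W. \<sigma> k w $ a k $ b k * \<sigma> k (matrix_inv w) $ b k $ a k) else 0)"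
      using klt[of i] orth[of i] i by (cases i k rule: linorder_cases) auto
  qed
  also have "\<dots> \<noteq> 0" using k kW ab by simp
  finally show False by simp
qed

text \<open>The kernel of T is \<sigma>-stable and proper, hence 0, and T is square.\<close>

lemma intertwiner_invertible:
  assumes irr: "irreducible_representation W \<sigma>" and T: "intertwiner \<sigma> \<sigma>' T" "T \<noteq> 0"
  shows "\<exists>T'. T ** T' = mat 1 \<and> T' ** T = mat 1 \<and> intertwiner \<sigma>' \<sigma> T'"
proof -
  have "vec.subspace {v. T *v v = 0}" by (simp add: vec.subspace_def matrix_vector_right_distrib mv_smult)
  moreover have "\<forall>w\<in>W. \<forall>v\<in>{v. T *v v = 0}. \<sigma> w *v v \<in> {v. T *v v = 0}"
    using T(1) by (auto simp: intertwiner_def matrix_vector_mul_assoc) (simp add: matrix_vector_mul_assoc[symmetric])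
  ultimately have "{v. T *v v = 0} = {0} \<or> {v. T *v v = 0} = UNIV" using irr unfolding irreducible_representation_def by blast
  moreover have "{v. T *v v = 0} \<noteq> UNIV"
  proof
    assume "{v. T *v v = 0} = UNIV"
    then have "\<forall>v. T *v v = 0 *v v" by auto
    then show False using T(2) by (simp add: matrix_eq)
  qed
  ultimately have "\<forall>v. T *v v = 0 \<longrightarrow> v = 0" by blast
  then obtain T' where T': "T' ** T = mat 1" using matrix_left_invertible_ker by blast
  then have T'': "T ** T' = mat 1" by (rule matrix_left_right_inverse[THEN iffD1])
  have "T' ** \<sigma>' w = \<sigma> w ** T'" if w: "w \<in> W" for w
  proof -
    have "T' ** (T ** \<sigma> w) ** T' = T' ** (\<sigma>' w ** T) ** T'" using T(1) w by (simp add: intertwiner_def)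
    then have "(T' ** T) ** \<sigma> w ** T' = T' ** \<sigma>' w ** (T ** T')" by (simp only: matrix_mul_assoc)
    then show ?thesis by (simp add: T' T'')
  qed
  then show ?thesis using T' T'' by (auto simp: intertwiner_def)
qed

lemma intertwiner_horizontal: "intertwiner \<sigma> \<sigma>' T \<Longrightarrow> horizontal 0 \<sigma> 0 \<sigma>' (\<lambda>x. T)"
  by (rule horizontal_const) (simp add: intertwiner_def)

text \<open>Both connections are trivial, so P has zero derivative in every direction and is
  constant by unique continuation, also across the removed hyperplanes.\<close>

lemma horizontal_zero_const:
  assumes "horizontal 0 \<sigma> 0 \<sigma>' P" shows "\<exists>T. intertwiner \<sigma> \<sigma>' T \<and> (\<forall>x\<in>V_reg W. P x = T)"
proof -
  obtain p where p: "p \<in> V_reg W" using V_reg_nonempty by blast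
  have P: "mat_localised \<delta> P" using assms by (simp add: horizontal_def)
  have c: "P x = P p" if x: "x \<in> V_reg W" for x
  proof -
    have "P x - P p = 0"
    proof (rule unique_continuation[OF _ _ p _ x])
      show "mat_localised \<delta> (\<lambda>x. P x - P p)" by (intro mat_localised_diff P mat_localised_const poly_\<delta>)
      fix \<xi>
      have "mat_deriv \<xi> (\<lambda>x. P x - P p) x = 0" if x: "x \<in> V_reg W" for x
        using assms x by (subst mat_deriv_diff[OF poly_\<delta> P mat_localised_const]) (simp_all add: horizontal_def \<delta>_nz)
      then show "\<exists>L R. mat_localised \<delta> L \<and> mat_localised \<delta> R \<and> (\<forall>x\<in>V_reg W. mat_deriv \<xi> (\<lambda>x. P x - P p) x = L x ** (P x - P p) + (P x - P p) ** R x)"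
        by (intro exI[of _ "\<lambda>x. 0"]) simp
    qed simp
    then show ?thesis by simp
  qed
  have "intertwiner \<sigma> \<sigma>' (P p)" unfolding intertwiner_def
  proof
    fix w assume w: "w \<in> W"
    have "P (w *v p) ** \<sigma> w = \<sigma>' w ** P p" using assms w p unfolding horizontal_def by blast
    then show "P p ** \<sigma> w = \<sigma>' w ** P p" using c[of "w *v p"] V_reg_act[OF w] p by simp
  qed
  then show ?thesis using c by blast
qed

text \<open>Among card W + 1 consecutive twists two are isomorphic, and by the pigeonhole principle
  one pair of offsets, hence one difference r, recurs infinitely often. For these s there are
  horizontal maps KZ_{-s}(\<tau>) -> KZ_{-s-r}(\<tau>) of one fixed degree. The pencil argument
  provides such maps for every s, and after trivialisation they are intertwiners again.\<close>

lemma kz_periodic: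
  assumes irr: "irreducible_representation W \<tau>" and K: "\<And>s. kz_fundamental s \<tau> (\<sigma> s) (F s) (Fi s)"
  shows "\<exists>r>0. \<forall>s. \<exists>T. intertwiner (\<sigma> s) (\<sigma> (s + r)) T \<and> T \<noteq> 0"
proof -
  note irrS = kz_irreducible[OF irr K]
  note rep = irr_rep[OF irr]
  define N where "N = card W"
  have "\<exists>i j. i < j \<and> j \<le> N \<and> (\<exists>T. T \<noteq> 0 \<and> intertwiner (\<sigma> (q * Suc N + i)) (\<sigma> (q * Suc N + j)) T)" for q
    using irreps_repeat[of "\<lambda>i. \<sigma> (q * Suc N + i)"] irrS unfolding N_def by blast
  then have "\<forall>q. \<exists>g. fst g < snd g \<and> snd g \<le> N \<and> (\<exists>T. T \<noteq> 0 \<and> intertwiner (\<sigma> (q * Suc N + fst g)) (\<sigma> (q * Suc N + snd g)) T)"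
    by simp
  from choice[OF this] obtain g where g: "\<forall>q. fst (g q) < snd (g q) \<and> snd (g q) \<le> N \<and>
    (\<exists>T. T \<noteq> 0 \<and> intertwiner (\<sigma> (q * Suc N + fst (g q))) (\<sigma> (q * Suc N + snd (g q))) T)" ..
  define fi fj where "fi q = fst (g q)" and "fj q = snd (g q)" for q
  have f: "fi q < fj q" "fj q \<le> N" "\<exists>T. T \<noteq> 0 \<and> intertwiner (\<sigma> (q * Suc N + fi q)) (\<sigma> (q * Suc N + fj q)) T" for q
    using g by (simp_all add: fi_def fj_def)
  have "\<exists>q0\<in>UNIV. infinite {q\<in>UNIV. (fi q, fj q) = (fi q0, fj q0)}"
  proof (rule pigeonhole_infinite)
    have "fi q \<le> N" for q using f(1,2)[of q] by linarith
    then have "range (\<lambda>q. (fi q, fj q)) \<subseteq> {..N} \<times> {..N}" using f(2) by auto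
    then show "finite (range (\<lambda>q. (fi q, fj q)))" by (rule finite_subset) simp
  qed simp
  then obtain q0 where q0: "infinite {q. fi q = fi q0 \<and> fj q = fj q0}" by auto
  define r where "r = fj q0 - fi q0"
  have r: "r > 0" using f(1)[of q0] by (simp add: r_def)
  define S where "S = (\<lambda>q. q * Suc N + fi q0) ` {q. fi q = fi q0 \<and> fj q = fj q0}"
  have S: "infinite S" unfolding S_def using q0 by (subst finite_image_iff) (auto simp: inj_on_def simp del: mult_Suc_right)
  have ST: "\<exists>T. T \<noteq> 0 \<and> intertwiner (\<sigma> s) (\<sigma> (s + r)) T" if s: "s \<in> S" for s
  proof -
    obtain q where q: "s = q * Suc N + fi q0" "fi q = fi q0" "fj q = fj q0" using s unfolding S_def by blast
    have "s + r = q * Suc N + fj q0" using f(1)[of q0] by (simp add: q r_def)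
    then show ?thesis using f(3)[of q] unfolding q(2,3) q(1)[symmetric] by auto
  qed
  then have "\<forall>s\<in>S. \<exists>T. T \<noteq> 0 \<and> intertwiner (\<sigma> s) (\<sigma> (s + r)) T" by blast
  from bchoice[OF this] obtain T where "\<forall>s\<in>S. T s \<noteq> 0 \<and> intertwiner (\<sigma> s) (\<sigma> (s + r)) (T s)" ..
  then have T: "T s \<noteq> 0" "intertwiner (\<sigma> s) (\<sigma> (s + r)) (T s)" if "s \<in> S" for s using that by blast+
  have FF: "F s x ** Fi s x = mat 1" "Fi s x ** F s x = mat 1" if "x \<in> V_reg W" for s x using K[of s] that by (simp_all add: kz_fundamental_def)
  have "\<forall>s. \<exists>d. mat_homog d (F s) \<and> of_int d = of_nat s * kz_scalar \<tau>" using K unfolding kz_fundamental_def by blast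
  from choice[OF this] obtain D where "\<forall>s. mat_homog (D s) (F s) \<and> of_int (D s) = of_nat s * kz_scalar \<tau>" ..
  then have D: "mat_homog (D s) (F s)" "of_int (D s) = of_nat s * kz_scalar \<tau>" for s by blast+
  define P where "P s x = F (s + r) x ** (T s ** Fi s x)" for s x
  have hzP: "horizontal (- of_nat s) \<tau> (- of_nat s - of_nat r) \<tau> (P s)" if "s \<in> S" for s
    using horizontal_compose[OF horizontal_compose[OF kz_fundamental_horizontal(2)[OF K] intertwiner_horizontal[OF T(2)[OF that]]] kz_fundamental_horizontal(1)[OF K]]
    by (simp add: P_def[abs_def])
  have PT: "Fi (s + r) x ** P s x ** F s x = T s" if "x \<in> V_reg W" for s x
  proof -
    have "Fi (s + r) x ** P s x ** F s x = (Fi (s + r) x ** F (s + r) x) ** T s ** (Fi s x ** F s x)"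
      unfolding P_def by (simp only: matrix_mul_assoc)
    then show ?thesis by (simp add: FF[OF that])
  qed
  obtain p where p: "p \<in> V_reg W" using V_reg_nonempty by blast
  have Pnz: "P s p \<noteq> 0" if "s \<in> S" for s
  proof
    assume "P s p = 0"
    then show False using PT[OF p, of s] T(1)[OF that] by simp
  qed
  \<comment> \<open>The degree of \<open>F s\<close> is s times \<open>kz_scalar \<tau>\<close>, so
    this difference depends on r only.\<close>
  have DD: "D (s + r) + (0 + - D s) = D r" for s
  proof -
    have "(of_int (D (s + r) + (0 + - D s)) :: complex) = of_int (D r)" by (simp add: D(2) algebra_simps)
    then show ?thesis by (simp only: of_int_eq_iff)
  qed
  have hP: "mat_homog (D r) (P s)" for s
    unfolding DD[of s, symmetric] P_def by (intro mat_homog_mult mat_homog_const D(1) mat_homog_inverse[OF D(1) FF])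
  have "\<exists>T. intertwiner (\<sigma> s) (\<sigma> (s + r)) T \<and> T \<noteq> 0" for s
  proof -
    have "\<exists>R. mat_homog (D r) R \<and> horizontal (- of_nat s) \<tau> (- of_nat s - of_nat r) \<tau> R \<and> (\<exists>x\<in>V_reg W. R x \<noteq> 0)"
    proof (rule horizontal_pencil[OF S, where P=P and B=0])
      fix s assume s: "s \<in> S"
      show "mat_homog (D r) (P s)" by (rule hP)
      show "\<exists>U. mat_poly U \<and> (\<forall>x\<in>V_reg W. smul (\<delta> x ^ 0) (P s x) = U x)"
        using horizontal_mat_poly[OF rep rep, of "- int s" "- int (s + r)" "P s"] hzP[OF s] by simp
      show "horizontal (- of_nat s) \<tau> (- of_nat s - of_nat r) \<tau> (P s)" by (rule hzP[OF s])
      show "\<exists>x\<in>V_reg W. P s x \<noteq> 0" using p Pnz[OF s] by blast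
    qed
    then obtain R y where R: "horizontal (- of_nat s) \<tau> (- of_nat s - of_nat r) \<tau> R" "y \<in> V_reg W" "R y \<noteq> 0" by blast
    have "horizontal (- of_nat s) \<tau> (- of_nat (s + r)) \<tau> R" using R(1) by simp
    from horizontal_compose[OF horizontal_compose[OF kz_fundamental_horizontal(1)[OF K[of s]] this] kz_fundamental_horizontal(2)[OF K]]
    have "horizontal 0 (\<sigma> s) 0 (\<sigma> (s + r)) (\<lambda>x. Fi (s + r) x ** (R x ** F s x))" .
    from horizontal_zero_const[OF this] obtain U where
      U0: "intertwiner (\<sigma> s) (\<sigma> (s + r)) U \<and> (\<forall>x\<in>V_reg W. Fi (s + r) x ** (R x ** F s x) = U)" ..
    then have U: "intertwiner (\<sigma> s) (\<sigma> (s + r)) U" "\<And>x. x \<in> V_reg W \<Longrightarrow> Fi (s + r) x ** (R x ** F s x) = U" by simp_all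
    have "U \<noteq> 0"
    proof
      assume "U = 0"
      then have "F (s + r) y ** (Fi (s + r) y ** (R y ** F s y)) ** Fi s y = 0" using U(2)[OF R(2)] by simp
      then have "(F (s + r) y ** Fi (s + r) y) ** R y ** (F s y ** Fi s y) = 0" by (simp only: matrix_mul_assoc)
      then show False using R(3) by (simp add: FF[OF R(2)])
    qed
    then show ?thesis using U by blast
  qed
  then show ?thesis using r by blast
qed

section \<open>Isomorphic twists and uniform bounds for horizontal maps\<close>

definition iso_reps :: "(complex^'n^'n \<Rightarrow> complex^'d^'d) \<Rightarrow> (complex^'n^'n \<Rightarrow> complex^'d^'d) \<Rightarrow> bool" where
  "iso_reps \<sigma> \<sigma>' \<longleftrightarrow> (\<exists>T T'. T ** T' = mat 1 \<and> T' ** T = mat 1 \<and> intertwiner \<sigma> \<sigma>' T \<and> intertwiner \<sigma>' \<sigma> T')"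

lemma iso_reps_refl: "iso_reps \<sigma> \<sigma>"
  unfolding iso_reps_def by (intro exI[of _ "mat 1"]) (simp add: intertwiner_def)

lemma iso_reps_trans:
  assumes "iso_reps \<sigma> \<sigma>'" "iso_reps \<sigma>' \<sigma>''" shows "iso_reps \<sigma> \<sigma>''"
proof -
  obtain T T' where T: "T ** T' = mat 1" "T' ** T = mat 1" "intertwiner \<sigma> \<sigma>' T" "intertwiner \<sigma>' \<sigma> T'"
    using assms(1) unfolding iso_reps_def by blast
  obtain S S' where S: "S ** S' = mat 1" "S' ** S = mat 1" "intertwiner \<sigma>' \<sigma>'' S" "intertwiner \<sigma>'' \<sigma>' S'"
    using assms(2) unfolding iso_reps_def by blast
  have i: "intertwiner \<rho> \<rho>'' (B ** A)" if "intertwiner \<rho> \<rho>' A" "intertwiner \<rho>' \<rho>'' B"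
    for \<rho> \<rho>' \<rho>'' :: "complex^'n^'n \<Rightarrow> complex^'a^'a" and A B
    unfolding intertwiner_def
  proof
    fix w assume "w \<in> W"
    then have "A ** \<rho> w = \<rho>' w ** A" "B ** \<rho>' w = \<rho>'' w ** B" using that by (simp_all add: intertwiner_def)
    then show "B ** A ** \<rho> w = \<rho>'' w ** (B ** A)" by (metis matrix_mul_assoc)
  qed
  have "(S ** T) ** (T' ** S') = S ** (T ** T') ** S'" "(T' ** S') ** (S ** T) = T' ** (S' ** S) ** T"
    by (simp_all only: matrix_mul_assoc)
  then show ?thesis unfolding iso_reps_def
    by (intro exI[of _ "S ** T"] exI[of _ "T' ** S'"]) (use T S i in auto)
qed

lemma iso_reps_chain:
  fixes \<sigma> :: "nat \<Rightarrow> complex^'n^'n \<Rightarrow> complex^'d::finite^'d"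
  assumes irr: "\<And>s. irreducible_representation W (\<sigma> s)"
    and T: "\<And>s. \<exists>T. intertwiner (\<sigma> s) (\<sigma> (s + r)) T \<and> T \<noteq> 0"
  shows "iso_reps (\<sigma> s) (\<sigma> (s + r * q))"
proof (induction q)
  case (Suc q)
  obtain A where "intertwiner (\<sigma> (s + r * q)) (\<sigma> (s + r * q + r)) A" "A \<noteq> 0" using T by blast
  then have "iso_reps (\<sigma> (s + r * q)) (\<sigma> (s + r * q + r))"
    using intertwiner_invertible[OF irr] unfolding iso_reps_def by blast
  then show ?case using iso_reps_trans[OF Suc] by (simp add: algebra_simps)
qed (simp add: iso_reps_refl)

text \<open>The numbers 0 and (k - k') m_H n_H bound the pole along H by m_H n_H =
  \<open>resH 1 H\<close>, independently of k and k'. So one power of \<delta> serves an infinite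
  family.\<close>

lemma horizontal_clear_denominators:
  fixes k k' :: int
  assumes rep: "representation W \<tau>" "representation W \<tau>'" and horizontal: "horizontal (of_int k) \<tau> (of_int k') \<tau>' P"
    and kk: "k - k' \<ge> -1"
  shows "\<exists>R. mat_poly R \<and> (\<forall>x\<in>V_reg W. smul (\<delta> x ^ Kexp 1) (P x) = R x)"
proof -
  define B where "B = Kexp 1"
  define U where "U x = smul (\<delta> x ^ B) (P x)" for x
  have "\<exists>R. mat_poly R \<and> (\<forall>x\<in>V_reg W. U x = R x)"
  proof (rule mregular_imp_mat_poly)
    show "mat_localised \<delta> U" unfolding U_def by (intro mat_localised_smul horizontal_mat_localised[OF horizontal] localised_poly poly_fun_power poly_\<delta>)
    fix H assume H: "H \<in> arr"
    let ?c = "resH 1 H"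
    have le: "?c \<le> B" unfolding B_def Kexp_def by (rule member_le_sum) (use H finite_arr in auto)
    have "- 1 * int (m H * nH H) \<le> (k - k') * int (m H * nH H)" by (rule mult_right_mono) (use kk in simp_all)
    then have "- int ?c \<le> (k - k') * int (m H * nH H)" by (simp add: resH_def)
    then obtain Q where Q: "mat_localised (dH H) Q" "\<And>x. x \<in> V_reg W \<Longrightarrow> P x = smul (frm H x powi (- int ?c)) (Q x)"
      using horizontal_order[OF rep horizontal H, of "- int ?c"] by auto
    show "regH H U"
    proof (rule regH_I)
      show "mat_localised (dH H) (\<lambda>x. smul (frm H x ^ (B - ?c) * dH H x ^ B) (Q x))"
        by (intro mat_localised_smul Q localised_poly poly_fun_mult poly_fun_power poly_dH poly_fun_form)
      fix x assume x: "x \<in> V_reg W"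
      have f: "frm H x \<noteq> 0" by (rule V_reg_frm[OF x H])
      have "\<delta> x ^ B * frm H x powi (- int ?c) = frm H x ^ (B - ?c) * dH H x ^ B"
        unfolding \<delta>_split[OF H] power_mult_distrib using f le by (simp add: power_int_minus power_diff divide_inverse)
      then show "U x = smul (frm H x ^ (B - ?c) * dH H x ^ B) (Q x)" by (simp add: U_def Q(2)[OF x])
    qed
  qed
  then show ?thesis by (simp add: U_def B_def)
qed

text \<open>Multiplication by the fixed power of \<delta> yields a nonzero polynomial matrix, whose
  degree cannot be negative.\<close>

lemma horizontal_degree_bound:
  fixes k k' :: int
  assumes rep: "representation W \<tau>" "representation W \<tau>'" and horizontal: "horizontal (of_int k) \<tau> (of_int k') \<tau>' P"
    and h: "mat_homog e P" and nz: "x \<in> V_reg W" "P x \<noteq> 0" and kk: "k - k' \<ge> -1"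
  shows "e \<ge> - int (Kexp 1 * card arr)"
proof (rule ccontr)
  assume n: "\<not> ?thesis"
  have "\<exists>R. mat_poly R \<and> (\<forall>x\<in>V_reg W. smul (\<delta> x ^ Kexp 1) (P x) = R x)"
    by (rule horizontal_clear_denominators[OF rep horizontal kk])
  then obtain R where R: "mat_poly R" "\<And>x. x \<in> V_reg W \<Longrightarrow> smul (\<delta> x ^ Kexp 1) (P x) = R x" by blast
  have "mat_homog (int (Kexp 1 * card arr) + e) (\<lambda>x. smul (\<delta> x ^ Kexp 1) (P x)) \<longleftrightarrow> mat_homog (int (Kexp 1 * card arr) + e) R"
    by (rule mat_homog_cong) (rule R(2))
  then have "mat_homog (int (Kexp 1 * card arr) + e) R" using mat_homog_delta_smul[OF h] by blast
  then have "R x = 0" by (rule mat_poly_negative_degree[OF R(1)]) (use n in simp)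
  moreover have "\<delta> x \<noteq> 0" using nz(1) by (simp add: \<delta>_nz)
  ultimately show False using R(2)[OF nz(1)] nz(2) by (simp add: smul_eq_0)
qed

lemma kz_family: assumes "irreducible_representation W \<tau>"
  shows "\<exists>\<sigma> F Fi. \<forall>s. kz_fundamental s \<tau> (\<sigma> s) (F s) (Fi s)"
proof -
  have "\<forall>s. \<exists>q. kz_fundamental s \<tau> (fst q) (fst (snd q)) (snd (snd q))" using kz_exists[OF assms] by simp
  from choice[OF this] obtain q where "\<forall>s. kz_fundamental s \<tau> (fst (q s)) (fst (snd (q s))) (snd (snd (q s)))" ..
  then show ?thesis by (intro exI[of _ "\<lambda>s. fst (q s)"] exI[of _ "\<lambda>s. fst (snd (q s))"] exI[of _ "\<lambda>s. snd (snd (q s))"])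
qed

lemma kz_fundamental_degree:
  assumes "kz_fundamental s \<tau> \<sigma> F Fi" shows "\<exists>D. mat_homog D F \<and> mat_homog (- D) Fi \<and> of_int D = of_nat s * kz_scalar \<tau>"
proof -
  have FF: "F x ** Fi x = mat 1" "Fi x ** F x = mat 1" if "x \<in> V_reg W" for x using assms that by (simp_all add: kz_fundamental_def)
  obtain D where "mat_homog D F" "of_int D = of_nat s * kz_scalar \<tau>" using assms unfolding kz_fundamental_def by blast
  moreover have "mat_homog (- D) Fi" by (rule mat_homog_inverse[OF \<open>mat_homog D F\<close>]) (rule FF, assumption)+
  ultimately show ?thesis by blast
qed

text \<open>The twists of \<tau> and those of \<Phi> are periodic, which makes KZ_{-s}(\<Phi>) and
  KZ_{-s-1}(\<tau>) isomorphic for all s divisible by a common period. M is obtained from the family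
  of these isomorphisms, N from the family of their inverses; N is what later inverts M.\<close>

lemma inverse_kz_solution:
  assumes irr: "irreducible_representation W \<tau>"
  shows "\<exists>\<sigma> F Fi M d. kz_fundamental 1 \<tau> \<sigma> F Fi \<and> irreducible_representation W \<sigma> \<and> mat_poly M \<and> mat_homog (int d) M \<and>
     of_nat d = kz_scalar \<tau> \<and> horizontal 1 \<sigma> 0 \<tau> M \<and> (\<exists>x\<in>V_reg W. M x \<noteq> 0) \<and>
     (\<exists>N. horizontal 0 \<tau> 1 \<sigma> N \<and> (\<exists>x\<in>V_reg W. N x \<noteq> 0))"
proof -
  note rep = irr_rep[OF irr]
  obtain \<sigma> F Fi where K: "\<And>s. kz_fundamental s \<tau> (\<sigma> s) (F s) (Fi s)" using kz_family[OF irr] by blast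
  note irrS = kz_irreducible[OF irr K]
  define \<Phi> where "\<Phi> = \<sigma> 1"
  have irrF: "irreducible_representation W \<Phi>" unfolding \<Phi>_def by (rule irrS)
  note repF = irr_rep[OF irrF]
  obtain \<rho> G Gi where L: "\<And>s. kz_fundamental s \<Phi> (\<rho> s) (G s) (Gi s)" using kz_family[OF irrF] by blast
  note irrR = kz_irreducible[OF irrF L]
  obtain r1 where r1: "r1 > 0" "\<And>s. \<exists>T. intertwiner (\<sigma> s) (\<sigma> (s + r1)) T \<and> T \<noteq> 0" using kz_periodic[OF irr K] by blast
  obtain r2 where r2: "r2 > 0" "\<And>s. \<exists>T. intertwiner (\<rho> s) (\<rho> (s + r2)) T \<and> T \<noteq> 0" using kz_periodic[OF irrF L] by blast
  \<comment> \<open>A common period of both families of twists.\<close>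
  define R where "R = r1 * r2"
  have R: "R > 0" using r1 r2 by (simp add: R_def)
  have FF: "F s x ** Fi s x = mat 1" "Fi s x ** F s x = mat 1" if "x \<in> V_reg W" for s x using K[of s] that by (simp_all add: kz_fundamental_def)
  have GG: "G s x ** Gi s x = mat 1" "Gi s x ** G s x = mat 1" if "x \<in> V_reg W" for s x using L[of s] that by (simp_all add: kz_fundamental_def)
  obtain p where p: "p \<in> V_reg W" using V_reg_nonempty by blast
  have ex: "\<exists>P Pi e. horizontal (- of_nat (R * q)) \<Phi> (- of_nat (R * q) - 1) \<tau> P \<and> horizontal (- of_nat (R * q) - 1) \<tau> (- of_nat (R * q)) \<Phi> Pi
     \<and> P p \<noteq> 0 \<and> Pi p \<noteq> 0 \<and> mat_homog e P \<and> mat_homog (- e) Pi \<and> of_int e = kz_scalar \<tau> + of_nat (R * q) * (kz_scalar \<tau> - kz_scalar \<Phi>)" for q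
  proof -
    have "iso_reps (\<sigma> 1) (\<sigma> (1 + r1 * (r2 * q)))" by (rule iso_reps_chain) (rule irrS, rule r1(2))
    then obtain T T' where T: "T ** T' = mat 1" "T' ** T = mat 1" "intertwiner \<Phi> (\<sigma> (Suc (R * q))) T" "intertwiner (\<sigma> (Suc (R * q))) \<Phi> T'"
      unfolding iso_reps_def \<Phi>_def R_def by (auto simp: mult.assoc)
    have "iso_reps (\<rho> 0) (\<rho> (0 + r2 * (r1 * q)))" by (rule iso_reps_chain) (rule irrR, rule r2(2))
    then obtain S S' where S: "S ** S' = mat 1" "S' ** S = mat 1" "intertwiner (\<rho> 0) (\<rho> (R * q)) S" "intertwiner (\<rho> (R * q)) (\<rho> 0) S'"
      unfolding iso_reps_def R_def by (auto simp: mult_ac)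
    \<comment> \<open>The chain KZ_{-Rq}(\<Phi>) -> \<rho>(Rq) -> \<rho>(0) -> \<Phi> -> \<sigma>(Rq
      + 1) -> KZ_{-Rq-1}(\<tau>). The trivial twist \<open>\<rho> 0\<close> is identified with
      \<Phi> by \<open>G 0\<close>, but need not be equal to it.\<close>
    define P where "P x = F (Suc (R * q)) x ** (T ** (G 0 x ** (S' ** Gi (R * q) x)))" for x
    define Pi where "Pi x = G (R * q) x ** (S ** (Gi 0 x ** (T' ** Fi (Suc (R * q)) x)))" for x
    have G0: "horizontal 0 (\<rho> 0) 0 \<Phi> (G 0)" "horizontal 0 \<Phi> 0 (\<rho> 0) (Gi 0)" using kz_fundamental_horizontal[OF L[of 0]] by simp_all
    have hP: "horizontal (- of_nat (R * q)) \<Phi> (- of_nat (Suc (R * q))) \<tau> P" unfolding P_def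
      by (rule horizontal_compose[OF horizontal_compose[OF horizontal_compose[OF horizontal_compose[OF kz_fundamental_horizontal(2)[OF L] intertwiner_horizontal[OF S(4)]] G0(1)] intertwiner_horizontal[OF T(3)]] kz_fundamental_horizontal(1)[OF K]])
    have hPi: "horizontal (- of_nat (Suc (R * q))) \<tau> (- of_nat (R * q)) \<Phi> Pi" unfolding Pi_def
      by (rule horizontal_compose[OF horizontal_compose[OF horizontal_compose[OF horizontal_compose[OF kz_fundamental_horizontal(2)[OF K] intertwiner_horizontal[OF T(4)]] G0(2)] intertwiner_horizontal[OF S(3)]] kz_fundamental_horizontal(1)[OF L]])
    have sh: "(- of_nat (Suc (R * q)) :: complex) = - of_nat (R * q) - 1" by simp
    have "P p ** Pi p = F (Suc (R * q)) p ** (T ** (G 0 p ** (S' ** (Gi (R * q) p ** G (R * q) p) ** S) ** Gi 0 p) ** T') ** Fi (Suc (R * q)) p"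
      unfolding P_def Pi_def by (simp only: matrix_mul_assoc)
    also have "\<dots> = mat 1" by (simp add: GG[OF p] FF[OF p] S T)
    finally have PP: "P p ** Pi p = mat 1" .
    have "(mat 1 :: complex^'a^'a) \<noteq> 0" by (simp add: vec_eq_iff mat_def)
    then have nz: "P p \<noteq> 0" "Pi p \<noteq> 0" using PP by auto
    obtain D where D: "mat_homog D (F (Suc (R * q)))" "mat_homog (- D) (Fi (Suc (R * q)))" "of_int D = of_nat (Suc (R * q)) * kz_scalar \<tau>"
      using kz_fundamental_degree[OF K] by blast
    obtain E where E: "mat_homog E (G (R * q))" "mat_homog (- E) (Gi (R * q))" "of_int E = of_nat (R * q) * kz_scalar \<Phi>"
      using kz_fundamental_degree[OF L] by blast
    obtain Z where Z: "mat_homog Z (G 0)" "mat_homog (- Z) (Gi 0)" "of_int Z = of_nat 0 * kz_scalar \<Phi>"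
      using kz_fundamental_degree[OF L] by blast
    have Z0: "Z = 0" using Z(3) by simp
    have "mat_homog (D + (0 + (Z + (0 + - E)))) P" unfolding P_def by (intro mat_homog_mult mat_homog_const D E Z)
    then have d1: "mat_homog (D - E) P" by (simp add: Z0)
    have "mat_homog (E + (0 + (- Z + (0 + - D)))) Pi" unfolding Pi_def by (intro mat_homog_mult mat_homog_const D E Z)
    then have d2: "mat_homog (- (D - E)) Pi" by (simp add: Z0)
    have "of_int (D - E) = kz_scalar \<tau> + of_nat (R * q) * (kz_scalar \<tau> - kz_scalar \<Phi>)" by (simp add: D E algebra_simps)
    then show ?thesis using hP hPi nz d1 d2 unfolding sh by blast
  qed
  have "\<forall>q. \<exists>g. horizontal (- of_nat (R * q)) \<Phi> (- of_nat (R * q) - 1) \<tau> (fst g) \<and> horizontal (- of_nat (R * q) - 1) \<tau> (- of_nat (R * q)) \<Phi> (fst (snd g))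
     \<and> fst g p \<noteq> 0 \<and> fst (snd g) p \<noteq> 0 \<and> mat_homog (snd (snd g)) (fst g) \<and> mat_homog (- snd (snd g)) (fst (snd g))
     \<and> of_int (snd (snd g)) = kz_scalar \<tau> + of_nat (R * q) * (kz_scalar \<tau> - kz_scalar \<Phi>)"
    using ex by simp
  from choice[OF this] obtain g where g: "\<forall>q. horizontal (- of_nat (R * q)) \<Phi> (- of_nat (R * q) - 1) \<tau> (fst (g q)) \<and> horizontal (- of_nat (R * q) - 1) \<tau> (- of_nat (R * q)) \<Phi> (fst (snd (g q)))
     \<and> fst (g q) p \<noteq> 0 \<and> fst (snd (g q)) p \<noteq> 0 \<and> mat_homog (snd (snd (g q))) (fst (g q)) \<and> mat_homog (- snd (snd (g q))) (fst (snd (g q)))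
     \<and> of_int (snd (snd (g q))) = kz_scalar \<tau> + of_nat (R * q) * (kz_scalar \<tau> - kz_scalar \<Phi>)" ..
  define P Pi e where "P q = fst (g q)" and "Pi q = fst (snd (g q))" and "e q = snd (snd (g q))" for q
  have P: "horizontal (- of_nat (R * q)) \<Phi> (- of_nat (R * q) - 1) \<tau> (P q)" "horizontal (- of_nat (R * q) - 1) \<tau> (- of_nat (R * q)) \<Phi> (Pi q)"
    "P q p \<noteq> 0" "Pi q p \<noteq> 0" "mat_homog (e q) (P q)" "mat_homog (- e q) (Pi q)" "of_int (e q) = kz_scalar \<tau> + of_nat (R * q) * (kz_scalar \<tau> - kz_scalar \<Phi>)" for q
    using g unfolding P_def Pi_def e_def by blast+
  define B where "B = int (Kexp 1 * card arr)"
  have Pint: "horizontal (of_int (- int (R * q))) \<Phi> (of_int (- int (R * q) - 1)) \<tau> (P q)"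
    "horizontal (of_int (- int (R * q) - 1)) \<tau> (of_int (- int (R * q))) \<Phi> (Pi q)" for q
    using P(1,2)[of q] by simp_all
  \<comment> \<open>P and Pi have opposite degrees, and each of the two degrees is bounded
    below.\<close>
  have b: "\<bar>e q\<bar> \<le> B" for q
  proof -
    have "e q \<ge> - B" unfolding B_def
      by (rule horizontal_degree_bound[OF repF rep Pint(1)[of q] P(5) p P(3)]) simp
    moreover have "- e q \<ge> - B" unfolding B_def
      by (rule horizontal_degree_bound[OF rep repF Pint(2)[of q] P(6) p P(4)]) simp
    ultimately show ?thesis by simp
  qed
  \<comment> \<open>The degree is affine in q and bounded, so its slope is zero; in particular it
    does not depend on q.\<close>
  have cc: "kz_scalar \<tau> = kz_scalar \<Phi>"
  proof (rule ccontr)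
    assume "kz_scalar \<tau> \<noteq> kz_scalar \<Phi>"
    then have n0: "norm (kz_scalar \<tau> - kz_scalar \<Phi>) > 0" by simp
    obtain q :: nat where q: "(of_int B + norm (kz_scalar \<tau>)) / norm (kz_scalar \<tau> - kz_scalar \<Phi>) < real q" using reals_Archimedean2 by blast
    have "real q * norm (kz_scalar \<tau> - kz_scalar \<Phi>) \<le> real (R * q) * norm (kz_scalar \<tau> - kz_scalar \<Phi>)"
    proof (rule mult_right_mono)
      have "q \<le> R * q" using R by simp
      then show "real q \<le> real (R * q)" by (simp only: of_nat_le_iff)
    qed simp
    also have "\<dots> = norm (of_int (e q) - kz_scalar \<tau>)" unfolding P(7) by (simp add: norm_mult)
    also have "\<dots> \<le> norm (of_int (e q) :: complex) + norm (kz_scalar \<tau>)" by (rule norm_triangle_ineq4)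
    also have "\<dots> \<le> of_int B + norm (kz_scalar \<tau>)" using b[of q] by (simp add: norm_of_int)
    finally show False using q n0 by (simp add: pos_divide_less_eq)
  qed
  have e0: "e q = e 0" for q
  proof -
    have "(of_int (e q) :: complex) = of_int (e 0)" unfolding P(7) cc by simp
    then show ?thesis by (simp only: of_int_eq_iff)
  qed
  define S where "S = range (\<lambda>q. R * q)"
  have S: "infinite S" unfolding S_def using R by (intro range_inj_infinite) (simp add: inj_def)
  \<comment> \<open>The parameter z = 1 and the shift r = 1 give a map from KZ_1(\<Phi>) to the
    trivial connection on \<tau>.\<close>
  have "\<exists>M. mat_homog (e 0) M \<and> horizontal 1 \<Phi> (1 - 1) \<tau> M \<and> (\<exists>x\<in>V_reg W. M x \<noteq> 0)"
  proof (rule horizontal_pencil[OF S, where P="\<lambda>s. P (s div R)" and B="Kexp 1"])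
    fix s assume "s \<in> S"
    then obtain q where q: "s = R * q" unfolding S_def by blast
    then have sq: "s div R = q" using R by simp
    show "mat_homog (e 0) (P (s div R))" using P(5)[of "s div R"] e0[of "s div R"] by simp
    show "\<exists>U. mat_poly U \<and> (\<forall>x\<in>V_reg W. smul (\<delta> x ^ Kexp 1) (P (s div R) x) = U x)"
      by (rule horizontal_clear_denominators[OF repF rep Pint(1)]) simp
    show "horizontal (- of_nat s) \<Phi> (- of_nat s - 1) \<tau> (P (s div R))" unfolding sq using P(1)[of q] by (simp add: q)
    show "\<exists>x\<in>V_reg W. P (s div R) x \<noteq> 0" using p P(3) by blast
  qed
  then obtain M where M: "mat_homog (e 0) M" "horizontal 1 \<Phi> 0 \<tau> M" "\<exists>x\<in>V_reg W. M x \<noteq> 0" by auto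
  have "\<exists>Q. mat_poly Q \<and> (\<forall>x\<in>V_reg W. M x = Q x)"
    by (rule horizontal_mat_poly[OF repF rep, of 1 0]) (use M in simp_all)
  then obtain Q where Q: "mat_poly Q" "\<And>x. x \<in> V_reg W \<Longrightarrow> M x = Q x" by blast
  have "mat_homog (e 0) M \<longleftrightarrow> mat_homog (e 0) Q" by (rule mat_homog_cong) (rule Q(2))
  then have hQ: "mat_homog (e 0) Q" using M by blast
  have "horizontal 1 \<Phi> 0 \<tau> M \<longleftrightarrow> horizontal 1 \<Phi> 0 \<tau> Q" by (rule horizontal_cong) (rule Q(2))
  then have horizontalQ: "horizontal 1 \<Phi> 0 \<tau> Q" using M by blast
  obtain x where x: "x \<in> V_reg W" "Q x \<noteq> 0" using M(3) Q(2) by auto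
  have "e 0 \<ge> 0"
  proof (rule ccontr)
    assume "\<not> e 0 \<ge> 0"
    then have "Q x = 0" by (intro mat_poly_negative_degree[OF Q(1) hQ]) simp
    then show False using x by simp
  qed
  then obtain d where d: "e 0 = int d" using nonneg_int_cases by blast
  have dc: "of_nat d = kz_scalar \<tau>" using P(7)[of 0] d by simp
  \<comment> \<open>The inverse maps start at the parameters -(Rq + 1), hence the successors of S as
    index set; z = 0 and the shift -1 give a map from the trivial connection on \<tau> to
    KZ_1(\<Phi>).\<close>
  have "\<exists>N. mat_homog (- e 0) N \<and> horizontal 0 \<tau> (0 - (-1)) \<Phi> N \<and> (\<exists>x\<in>V_reg W. N x \<noteq> 0)"
  proof (rule horizontal_pencil[where S="Suc ` S" and P="\<lambda>s. Pi ((s - 1) div R)" and B="Kexp 1"])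
    show "infinite (Suc ` S)" using S by (simp add: finite_image_iff)
    fix s assume "s \<in> Suc ` S"
    then obtain q where q: "s = Suc (R * q)" unfolding S_def by blast
    then have sq: "(s - 1) div R = q" using R by simp
    show "mat_homog (- e 0) (Pi ((s - 1) div R))" using P(6)[of "(s - 1) div R"] e0[of "(s - 1) div R"] by simp
    show "\<exists>U. mat_poly U \<and> (\<forall>x\<in>V_reg W. smul (\<delta> x ^ Kexp 1) (Pi ((s - 1) div R) x) = U x)"
      by (rule horizontal_clear_denominators[OF rep repF Pint(2)]) simp
    show "horizontal (- of_nat s) \<tau> (- of_nat s - (-1)) \<Phi> (Pi ((s - 1) div R))"
    proof -
      have "(- of_nat s :: complex) = - of_nat (R * q) - 1" "(- of_nat s - (-1) :: complex) = - of_nat (R * q)"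
        by (simp_all add: q)
      then show ?thesis unfolding sq using P(2)[of q] by (simp only:)
    qed
    show "\<exists>x\<in>V_reg W. Pi ((s - 1) div R) x \<noteq> 0" using p P(4) by blast
  qed
  then obtain N where N: "horizontal 0 \<tau> 1 \<Phi> N" "\<exists>x\<in>V_reg W. N x \<noteq> 0" by auto
  have K1: "kz_fundamental 1 \<tau> \<Phi> (F 1) (Fi 1)" using K[of 1] by (simp add: \<Phi>_def)
  show ?thesis
    by (intro exI[of _ \<Phi>] exI[of _ "F 1"] exI[of _ "Fi 1"] exI[of _ Q] exI[of _ d])
      (use K1 irrF Q(1) hQ d dc horizontalQ x N in auto)
qed

end

section \<open>Derivations and quasi-invariants\<close>

text \<open>Links the formal derivative with differentiation of functions; the algebraic rules for
  \<open>partial\<close> then follow from the uniqueness of derivatives.\<close>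

lemma eval_partial:
  "((\<lambda>t. eval_poly p (x + t *s axis i 1)) has_field_derivative eval_poly (partial i p) x) (at 0)"
proof -
  let ?l = Poly_Mapping.lookup
  have e: "eval_poly (Poly_Mapping.single a c) x = c * (\<Prod>j\<in>UNIV. x $ j ^ ?l a j)" for a c
    unfolding eval_poly_def by (subst insertion_single) simp_all
  have s: "(\<Prod>j\<in>UNIV. g j) = g i * (\<Prod>j\<in>UNIV - {i}. g j)" for g :: "'a \<Rightarrow> complex"
    by (rule prod.remove) auto
  have r: "(\<Prod>j\<in>UNIV - {i}. x $ j ^ ?l (a - Poly_Mapping.single i 1) j) = (\<Prod>j\<in>UNIV - {i}. x $ j ^ ?l a j)" for a
    by (rule prod.cong) (auto simp: lookup_minus lookup_single when_def)
  have "((\<lambda>t. \<Sum>a\<in>Poly_Mapping.keys p. ?l p a * ((x $ i + t) ^ ?l a i * (\<Prod>j\<in>UNIV - {i}. x $ j ^ ?l a j)))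
      has_field_derivative (\<Sum>a\<in>Poly_Mapping.keys p. ?l p a * (of_nat (?l a i) * x $ i ^ (?l a i - 1) * (\<Prod>j\<in>UNIV - {i}. x $ j ^ ?l a j)))) (at 0)"
    by (auto intro!: derivative_eq_intros sum.cong)
  moreover have "eval_poly p (x + t *s axis i 1)
      = (\<Sum>a\<in>Poly_Mapping.keys p. ?l p a * ((x $ i + t) ^ ?l a i * (\<Prod>j\<in>UNIV - {i}. x $ j ^ ?l a j)))" for t
    unfolding eval_poly_def insertion_def s
    by (intro sum.cong refl arg_cong2[where f="(*)"] prod.cong) (auto simp: axis_def)
  moreover have "eval_poly (partial i p) x
      = (\<Sum>a\<in>Poly_Mapping.keys p. ?l p a * (of_nat (?l a i) * x $ i ^ (?l a i - 1) * (\<Prod>j\<in>UNIV - {i}. x $ j ^ ?l a j)))"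
    unfolding partial_def eval_poly_sum e s r by (intro sum.cong refl) (simp add: lookup_minus lookup_single mult_ac)
  ultimately show ?thesis by simp
qed

lemma partial_eqI:
  assumes "\<And>x. ((\<lambda>t. eval_poly p (x + t *s axis i 1)) has_field_derivative eval_poly q x) (at 0)"
  shows "partial i p = q"
  unfolding eval_poly_inject[symmetric] using DERIV_unique[OF eval_partial assms] by (intro ext)

lemma partial_add: "partial i (p + q :: 'n::finite poly_ring) = partial i p + partial i q"
  by (rule partial_eqI) (auto intro!: derivative_eq_intros eval_partial)

lemma partial_mult: "partial i (p * q :: 'n::finite poly_ring) = partial i p * q + p * partial i q"
  by (rule partial_eqI) (auto intro!: derivative_eq_intros eval_partial)

lemma partial_const: "partial i (const c) = (0 :: 'n::finite poly_ring)"
  by (rule partial_eqI) auto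

lemma partial_coord: "partial i (coord j) = (if i = j then 1 else 0 :: 'n::finite poly_ring)"
  by (rule partial_eqI) (auto intro!: derivative_eq_intros simp: axis_def)

lemma DerD:
  assumes "L \<in> Der"
  shows "L (p + q) = L p + L q" "L (const c * p) = const c * L p" "L (p * q) = L p * q + p * L q" "L (const c) = 0"
proof -
  show "L (p + q) = L p + L q" "L (const c * p) = const c * L p" "L (p * q) = L p * q + p * L q"
    using assms by (auto simp: Der_def)
  have "L (1 * 1) = L 1 * 1 + 1 * L 1" using assms unfolding Der_def by blast
  then have "L 1 = 0" by simp
  moreover have "L (const c * 1) = const c * L 1" using assms unfolding Der_def by blast
  ultimately show "L (const c) = 0" by simp
qed

lemma Der_sum: "L \<in> Der \<Longrightarrow> L (\<Sum>i\<in>S. f i) = (\<Sum>i\<in>S. L (f i))"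
proof (induction S rule: infinite_finite_induct)
  case (insert x F) then show ?case by (simp add: DerD(1))
qed (use DerD(4)[of L 0] in auto)

lemma Der_form: "L \<in> Der \<Longrightarrow> L (form_poly a) = (\<Sum>i\<in>UNIV. const (a $ i) * L (coord i))"
  by (simp add: form_poly_def Der_sum DerD(2))

lemma Der_eqI:
  fixes L :: "'n::finite poly_ring \<Rightarrow> 'n poly_ring"
  assumes L: "L \<in> Der" "L' \<in> Der" and e: "\<And>i. L (coord i) = L' (coord i)"
  shows "L = L'"
proof
  fix p show "L p = L' p"
    by (induction p rule: poly_ring_induct) (simp_all add: e DerD[OF L(1)] DerD[OF L(2)])
qed

lemma vector_field_Der: "vector_field f \<in> Der"
  unfolding Der_def vector_field_def
  by (auto simp: partial_add partial_mult partial_const sum.distrib sum_distrib_left sum_distrib_right algebra_simps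
      intro!: sum.cong)

lemma vector_field_coord: "vector_field f (coord i) = f i"
  by (simp add: vector_field_def partial_coord if_distrib cong: if_cong)

lemma Der_eq_vector_field: "L \<in> Der \<Longrightarrow> L = vector_field (\<lambda>i. L (coord i))"
  by (rule Der_eqI[OF _ vector_field_Der]) (simp_all add: vector_field_coord)

text \<open>This is \<rho>: it sends the i-th basis vector of V to the partial derivative in
  x_i.\<close>

definition tensor_field :: "'n::finite poly_ring^'n \<Rightarrow> 'n poly_ring \<Rightarrow> 'n poly_ring" where
  "tensor_field \<phi> = vector_field (\<lambda>i. \<phi> $ i)"

lemma tensor_field_coord [simp]: "tensor_field \<phi> (coord i) = \<phi> $ i"
  by (simp add: tensor_field_def vector_field_coord)

lemma tensor_field_Der: "tensor_field \<phi> \<in> Der" unfolding tensor_field_def by (rule vector_field_Der)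

lemma tensor_field_inject: "tensor_field \<phi> = tensor_field \<psi> \<longleftrightarrow> \<phi> = \<psi>"
  by (metis tensor_field_coord vec_eq_iff)

lemma tensor_field_add: "tensor_field (\<phi> + \<psi>) = tensor_field \<phi> + tensor_field \<psi>"
  by (simp add: tensor_field_def vector_field_def fun_eq_iff sum.distrib algebra_simps)

lemma tensor_field_scale: "tensor_field (f *s \<phi>) = der_scale f (tensor_field \<phi>)"
  by (simp add: tensor_field_def vector_field_def der_scale_def fun_eq_iff sum_distrib_left mult.assoc)

lemma tensor_field_0: "tensor_field 0 = 0"
  by (simp add: tensor_field_def vector_field_def fun_eq_iff)

lemma tensor_field_sum: "tensor_field (\<Sum>k\<in>S. \<phi> k) = (\<Sum>k\<in>S. tensor_field (\<phi> k))"
  by (induction S rule: infinite_finite_induct) (simp_all add: tensor_field_0 tensor_field_add)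

definition tensor_eval :: "'n::finite poly_ring^'n \<Rightarrow> complex^'n \<Rightarrow> complex^'n" where
  "tensor_eval \<phi> x = (\<chi> i. eval_poly (\<phi> $ i) x)"

lemma tensor_eval_nth [simp]: "tensor_eval \<phi> x $ i = eval_poly (\<phi> $ i) x" by (simp add: tensor_eval_def)

lemma tensor_eval_inject: "(\<And>x. tensor_eval \<phi> x = tensor_eval \<psi> x) \<Longrightarrow> \<phi> = \<psi>"
  by (simp add: vec_eq_iff fun_eq_iff flip: eval_poly_inject)

lemma eval_tensor_field_form: "eval_poly (tensor_field \<phi> (form_poly a)) x = form_at a (tensor_eval \<phi> x)"
  by (simp add: Der_form[OF tensor_field_Der] form_at_def)

lemma act_poly_simps:
  "act_poly w (p + q) = act_poly w p + act_poly w q"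
  "act_poly w (p * q) = act_poly w p * act_poly w q"
  "act_poly w (const c) = const c"
  "act_poly w (coord i) = form_poly (matrix_inv w $ i)"
  unfolding act_poly_def by (simp_all add: insertion_add insertion_mult insertion_const insertion_coord const_add const_mult const_1)

lemma act_poly_sum: "act_poly w (\<Sum>i\<in>S. f i) = (\<Sum>i\<in>S. act_poly w (f i))"
  unfolding act_poly_def by (rule insertion_sum) (rule const_add)

lemma eval_act_poly: "eval_poly (act_poly w p) x = eval_poly p (matrix_inv w *v x)"
  by (induction p rule: poly_ring_induct) (simp_all add: act_poly_simps form_at_def matrix_vector_mult_def)

lemma eval_act_tensor: "tensor_eval (act_tensor w \<phi>) x = w *v tensor_eval \<phi> (matrix_inv w *v x)"
  by (simp add: vec_eq_iff act_tensor_def one_tensor_def eval_act_poly matrix_vector_mult_def)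

context refl_arr begin

text \<open>Both sides are derivations, so the coordinates suffice. There the row of w that expands
  the function x_j(w x) is also the one by which w acts on components.\<close>

lemma act_der_tensor_field:
  assumes w: "w \<in> W" shows "act_der w (tensor_field \<phi>) = tensor_field (act_tensor w \<phi>)"
proof (rule Der_eqI[OF _ tensor_field_Der])
  note D = DerD[OF tensor_field_Der]
  have i: "act_poly w (act_poly (matrix_inv w) p) = p" for p
    unfolding eval_poly_inject[symmetric] by (rule ext) (simp add: eval_act_poly inv_inv_W w)
  show "act_der w (tensor_field \<phi>) \<in> Der"
    unfolding Der_def act_der_def by (simp add: act_poly_simps D i)
  fix j
  show "act_der w (tensor_field \<phi>) (coord j) = tensor_field (act_tensor w \<phi>) (coord j)"
    by (simp add: act_der_def act_poly_simps inv_inv_W w Der_form[OF tensor_field_Der] act_poly_sum act_tensor_def one_tensor_def)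
qed

lemma WH_entry:
  assumes H: "H \<in> arr" and w: "w \<in> WH H"
  shows "w $ i $ j = (if i = j then 1 else 0) + (det w - 1) * (coroot H $ i * \<alpha> H $ j)"
proof -
  have "form_at (\<alpha> H) (axis j 1) = \<alpha> H $ j"
    unfolding form_at_def axis_def by (simp add: if_distrib cong: if_cong)
  moreover have "w $ i $ j = (w *v axis j 1) $ i"
    unfolding matrix_vector_mult_def axis_def by (simp add: if_distrib cong: if_cong)
  ultimately show ?thesis unfolding WH_apply[OF H w] by (simp add: axis_def mult_ac)
qed

text \<open>Under W_H the space V is the sum of a trivial part and a line of type det, and e_{H,i}
  is n_H times the projection onto type det^{-i}. In the range of i this meets V only for i = n_H -
  1.\<close>

lemma e_op_entry:
  assumes H: "H \<in> arr" and i: "i \<in> {1..nH H - 1}"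
  shows "e_op W (\<lambda>w. w) H i $ a $ b = (if i = nH H - 1 then of_nat (nH H) else 0) * (coroot H $ a * \<alpha> H $ b)"
proof -
  have n: "nH H \<ge> 2" by (rule nH_ge_2[OF H])
  have z: "(\<Sum>w\<in>WH H. det w ^ i) = 0" using i n by (intro WH_det_sum_power(2)[OF H]) auto
  have z': "(\<Sum>w\<in>WH H. det w ^ Suc i) = (if i = nH H - 1 then of_nat (nH H) else 0)"
  proof (cases "i = nH H - 1")
    case True then show ?thesis using WH_det_sum_power(1)[OF H] n by simp
  next
    case False then show ?thesis using i n WH_det_sum_power(2)[OF H, of "Suc i"] by auto
  qed
  have "e_op W (\<lambda>w. w) H i $ a $ b = (\<Sum>w\<in>WH H. det w ^ i * w $ a $ b)"
    unfolding e_op_def mat_mult_eq_smul by simp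
  also have "\<dots> = (\<Sum>w\<in>WH H. det w ^ i * (if a = b then 1 else 0) + (det w ^ Suc i - det w ^ i) * (coroot H $ a * \<alpha> H $ b))"
    by (rule sum.cong[OF refl]) (simp add: WH_entry[OF H] algebra_simps)
  also have "\<dots> = (\<Sum>w\<in>WH H. det w ^ i) * (if a = b then 1 else 0)
      + ((\<Sum>w\<in>WH H. det w ^ Suc i) - (\<Sum>w\<in>WH H. det w ^ i)) * (coroot H $ a * \<alpha> H $ b)"
    by (simp only: sum.distrib sum_distrib_right sum_subtractf[symmetric])
  finally show ?thesis unfolding z z' by simp
qed

text \<open>Among the operators e_{H,i} only i = n_H - 1 gives a condition, and it concerns n_H
  alpha_H(\<phi>) times the coroot. So quasi-invariance of \<phi> is the condition defining
  logarithmic fields.\<close>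

lemma quasi_invariants_iff_dvd:
  "\<phi> \<in> quasi_invariants W \<alpha> m \<longleftrightarrow>
     (\<forall>H\<in>arr. form_poly (\<alpha> H) ^ (m H * nH H) dvd tensor_field \<phi> (form_poly (\<alpha> H)))"
proof -
  have "(\<forall>i\<in>{1..nH H - 1}. \<forall>a. d dvd one_tensor (e_op W (\<lambda>w. w) H i) \<phi> $ a) \<longleftrightarrow> d dvd tensor_field \<phi> (form_poly (\<alpha> H))"
    if H: "H \<in> arr" for H d
  proof -
    let ?l = "tensor_field \<phi> (form_poly (\<alpha> H))"
    have n: "nH H \<ge> 2" by (rule nH_ge_2[OF H])
    have e: "one_tensor (e_op W (\<lambda>w. w) H i) \<phi> $ a
        = const ((if i = nH H - 1 then of_nat (nH H) else 0) * coroot H $ a) * ?l" if "i \<in> {1..nH H - 1}" for i a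
      unfolding one_tensor_def Der_form[OF tensor_field_Der]
      by (simp add: e_op_entry[OF H that] sum_distrib_left const_mult mult.assoc)
    \<comment> \<open>Pairing with alpha_H recovers \<open>?l\<close>, because alpha_H has the value
      1 on the coroot.\<close>
    have "?l = const (1 / of_nat (nH H)) * (\<Sum>a\<in>UNIV. const (\<alpha> H $ a) * one_tensor (e_op W (\<lambda>w. w) H (nH H - 1)) \<phi> $ a)"
    proof -
      have "(\<Sum>a\<in>UNIV. const (\<alpha> H $ a) * (const (of_nat (nH H) * coroot H $ a) * ?l))
          = const (of_nat (nH H)) * (form_poly (\<alpha> H) * 0 + (\<Sum>a\<in>UNIV. const (\<alpha> H $ a * coroot H $ a)) * ?l)"
        by (simp add: sum_distrib_left sum_distrib_right const_mult mult_ac)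
      also have "(\<Sum>a\<in>UNIV. const (\<alpha> H $ a * coroot H $ a)) = const (frm H (coroot H))"
        unfolding form_at_def by (induction rule: infinite_finite_induct[where A=UNIV]) (simp_all add: const_add)
      finally have "(\<Sum>a\<in>UNIV. const (\<alpha> H $ a) * (const (of_nat (nH H) * coroot H $ a) * ?l)) = const (of_nat (nH H)) * ?l"
        by (simp add: frm_coroot[OF H] const_1)
      moreover have "const (1 / of_nat (nH H)) * (const (of_nat (nH H)) * ?l) = ?l"
        using n by (simp add: const_mult[symmetric] mult.assoc[symmetric] const_1)
      ultimately show ?thesis using n by (simp add: e)
    qed
    moreover have "nH H - 1 \<in> {1..nH H - 1}" using n by simp
    ultimately show ?thesis using e by (metis (no_types, lifting) dvd_mult dvd_sum)
  qed
  then show ?thesis unfolding quasi_invariants_def by blast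
qed

lemma quasi_invariants_iff_eval:
  "\<phi> \<in> quasi_invariants W \<alpha> m \<longleftrightarrow>
     (\<forall>H\<in>arr. \<exists>g. poly_fun g \<and> (\<forall>x. frm H (tensor_eval \<phi> x) = frm H x ^ (m H * nH H) * g x))"
  unfolding quasi_invariants_iff_dvd dvd_iff_eval eval_tensor_field_form eval_poly_power eval_form_poly ..

text \<open>The required order of vanishing is the same along H and along w^{-1} H because m_H and
  n_H are invariant; the factor c between the two forms goes into the cofactor.\<close>

lemma act_tensor_quasi_invariant:
  assumes w: "w \<in> W" and \<phi>: "\<phi> \<in> quasi_invariants W \<alpha> m"
  shows "act_tensor w \<phi> \<in> quasi_invariants W \<alpha> m"
  unfolding quasi_invariants_iff_eval
proof
  fix H assume H: "H \<in> arr"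
  define H' where "H' = act (matrix_inv w) H"
  have H': "H' \<in> arr" "act w H' = H" unfolding H'_def using act_arr[OF inv_W[OF w] H] act_inv(2)[OF w] by auto
  have mn: "m H' * nH H' = m H * nH H" using m_act[OF w H'(1)] nH_act[OF w, of H'] by (simp add: H'(2))
  obtain c where c: "c \<noteq> 0" "\<And>x. frm H (w *v x) = c * frm H' x" using act_frm[OF w H'(1)] H'(2) by auto
  obtain g where g: "poly_fun g" "\<And>x. frm H' (tensor_eval \<phi> x) = frm H' x ^ (m H * nH H) * g x"
    using \<phi> H'(1) mn unfolding quasi_invariants_iff_eval by metis
  have f: "frm H' (matrix_inv w *v x) = frm H x / c" for x using c(2)[of "matrix_inv w *v x"] c(1) w by simp
  show "\<exists>g. poly_fun g \<and> (\<forall>x. frm H (tensor_eval (act_tensor w \<phi>) x) = frm H x ^ (m H * nH H) * g x)"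
  proof (intro exI conjI allI)
    show "poly_fun (\<lambda>x. c / c ^ (m H * nH H) * g (matrix_inv w *v x))"
      using poly_fun_compose_linear[OF g(1), of "matrix_inv w" 0] by (intro poly_fun_mult poly_fun_const) simp
    fix x
    show "frm H (tensor_eval (act_tensor w \<phi>) x) = frm H x ^ (m H * nH H) * (c / c ^ (m H * nH H) * g (matrix_inv w *v x))"
      by (simp add: eval_act_tensor c(2) g(2) f power_divide)
  qed
qed

lemma log_derivations_iff: "L \<in> log_derivations W \<alpha> m \<longleftrightarrow> (\<exists>\<phi>\<in>quasi_invariants W \<alpha> m. L = tensor_field \<phi>)"
proof
  assume L: "L \<in> log_derivations W \<alpha> m"
  have e: "L = tensor_field (\<chi> i. L (coord i))"
    using L by (simp add: tensor_field_def log_derivations_def Der_eq_vector_field[symmetric])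
  moreover have "(\<chi> i. L (coord i)) \<in> quasi_invariants W \<alpha> m"
    unfolding quasi_invariants_iff_dvd e[symmetric] using L by (simp add: log_derivations_def)
  ultimately show "\<exists>\<phi>\<in>quasi_invariants W \<alpha> m. L = tensor_field \<phi>" by blast
next
  assume "\<exists>\<phi>\<in>quasi_invariants W \<alpha> m. L = tensor_field \<phi>"
  then show "L \<in> log_derivations W \<alpha> m"
    by (auto simp: log_derivations_def tensor_field_Der quasi_invariants_iff_dvd)
qed

lemma tensor_field_iso: "SV_module_iso (quasi_invariants W \<alpha> m) (log_derivations W \<alpha> m) tensor_field"
  unfolding SV_module_iso_def bij_betw_def
  by (auto simp: tensor_field_add tensor_field_scale inj_on_def tensor_field_inject log_derivations_iff)

end

section \<open>The basis\<close>

context refl_arr begin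

text \<open>The common kernel of all constant matrices that annihilate M from the left is
  \<tau>-stable by equivariance and contains the columns of all M(x), so it is the whole
  space.\<close>

lemma horizontal_left_kernel:
  fixes M :: "complex^'n \<Rightarrow> complex^'d::finite^'d" and C :: "complex^'d^'d"
  assumes irr: "irreducible_representation W \<tau>" and repS: "representation W \<sigma>" and horizontal: "horizontal 1 \<sigma> 0 \<tau> M"
    and nz: "\<exists>x\<in>V_reg W. M x \<noteq> 0" and C: "\<And>x. x \<in> V_reg W \<Longrightarrow> C ** M x = 0"
  shows "C = 0"
proof -
  note rep = irr_rep[OF irr]
  define K where "K = {v. \<forall>C. (\<forall>x\<in>V_reg W. C ** M x = 0) \<longrightarrow> C *v v = (0 :: complex^'d)}"
  have "vec.subspace K"
    unfolding vec.subspace_def K_def by (auto simp: matrix_vector_right_distrib mv_smult)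
  moreover have "\<tau> w *v v \<in> K" if w: "w \<in> W" and v: "v \<in> K" for w v
    unfolding K_def
  proof (intro CollectI allI impI)
    fix C assume C: "\<forall>x\<in>V_reg W. C ** M x = (0 :: complex^'d^'d)"
    have "C ** \<tau> w ** M x = 0" if x: "x \<in> V_reg W" for x
    proof -
      have "\<tau> w ** M x = M (w *v x) ** \<sigma> w" using horizontal w x by (simp add: horizontal_def)
      then have "C ** \<tau> w ** M x = (C ** M (w *v x)) ** \<sigma> w" by (simp add: matrix_mul_assoc[symmetric])
      then show ?thesis using C V_reg_act[OF w] x by simp
    qed
    then have "(C ** \<tau> w) *v v = 0" using v unfolding K_def by blast
    then show "C *v (\<tau> w *v v) = 0" by (simp add: matrix_vector_mul_assoc)
  qed
  ultimately have "K = {0} \<or> K = UNIV" using irr unfolding irreducible_representation_def by blast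
  moreover have "K \<noteq> {0}"
  proof
    assume K0: "K = {0}"
    obtain x where x: "x \<in> V_reg W" "M x \<noteq> 0" using nz by blast
    have "M x *v v \<in> K" for v unfolding K_def using x(1) by (simp add: matrix_vector_mul_assoc)
    then have "M x *v v = 0" for v using K0 by blast
    then show False using x(2) by (simp add: matrix_eq)
  qed
  ultimately have "v \<in> K" for v by blast
  then have "C *v v = 0" for v using C unfolding K_def by simp
  then show "C = 0" by (simp add: matrix_eq)
qed

text \<open>If a row vector v annihilates M(p), then v M satisfies the linear equation of M and
  vanishes at p, hence on \<open>V_reg\<close>; \<open>horizontal_left_kernel\<close> excludes
  this.\<close>

lemma horizontal_invertible:
  fixes M :: "complex^'n \<Rightarrow> complex^'d::finite^'d"
  assumes irr: "irreducible_representation W \<tau>" and repS: "representation W \<sigma>" and horizontal: "horizontal 1 \<sigma> 0 \<tau> M"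
    and nz: "\<exists>x\<in>V_reg W. M x \<noteq> 0" and p: "p \<in> V_reg W"
  shows "invertible (M p)"
proof (rule ccontr)
  assume "\<not> invertible (M p)"
  then have "\<not> invertible (transpose (M p))" by (simp add: invertible_iff_det)
  then obtain v where v: "v \<noteq> 0" "transpose (M p) *v v = 0"
    using matrix_left_invertible_ker[of "transpose (M p)"] by (auto simp: invertible_left_inverse)
  \<comment> \<open>All rows are equal to v, which turns the vector into a square matrix.\<close>
  define C :: "complex^'d^'d" where "C = (\<chi> i. v)"
  have "C ** M p = 0"
    using v(2) by (simp add: C_def vec_eq_iff matrix_matrix_mult_def matrix_vector_mult_def transpose_def mult.commute)
  have hm: "mat_localised \<delta> M" by (rule horizontal_mat_localised[OF horizontal])
  have "C ** M x = 0" if x: "x \<in> V_reg W" for x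
  proof (rule unique_continuation[where P="\<lambda>x. C ** M x", OF _ _ p \<open>C ** M p = 0\<close> x])
    show "mat_localised \<delta> (\<lambda>x. C ** M x)" by (intro mat_localised_mult hm mat_localised_const poly_\<delta>)
    fix \<xi>
    show "\<exists>L R. mat_localised \<delta> L \<and> mat_localised \<delta> R \<and> (\<forall>x\<in>V_reg W. mat_deriv \<xi> (\<lambda>x. C ** M x) x = L x ** (C ** M x) + C ** M x ** R x)"
    proof (intro exI conjI ballI)
      show "mat_localised \<delta> (\<lambda>x. 0)" by simp
      show "mat_localised \<delta> (Acon \<sigma> \<xi>)" by (rule mat_localised_Acon)
      fix x assume x: "x \<in> V_reg W"
      have "mat_deriv \<xi> (\<lambda>x. C ** M x) x = C ** mat_deriv \<xi> M x"
        using x by (subst mat_deriv_mult[OF poly_\<delta> mat_localised_const hm]) (simp_all add: \<delta>_nz)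
      moreover have "mat_deriv \<xi> M x = M x ** Acon \<sigma> \<xi> x" using horizontal x by (simp add: horizontal_def)
      ultimately show "mat_deriv \<xi> (\<lambda>x. C ** M x) x = 0 ** (C ** M x) + C ** M x ** Acon \<sigma> \<xi> x"
        by (simp add: matrix_mul_assoc)
    qed
  qed
  then have "C = 0" using horizontal_left_kernel[OF irr repS horizontal nz, of C] by blast
  then show False using v(1) by (simp add: C_def vec_eq_iff)
qed

text \<open>M N is a horizontal endomorphism of the trivial connection on \<tau>, so it is a
  constant scalar. The scalar is nonzero since M is invertible on \<open>V_reg\<close> and N is not
  zero; dividing N by it gives the inverse of M.\<close>

lemma inverse_kz_fundamental:
  fixes \<tau> :: "complex^'n^'n \<Rightarrow> complex^'d::finite^'d"
  assumes irr: "irreducible_representation W \<tau>"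
  shows "\<exists>\<sigma> F Fi M Mi d. kz_fundamental 1 \<tau> \<sigma> F Fi \<and> irreducible_representation W \<sigma> \<and> mat_poly M \<and> mat_homog (int d) M \<and>
     of_nat d = kz_scalar \<tau> \<and> horizontal 1 \<sigma> 0 \<tau> M \<and> horizontal 0 \<tau> 1 \<sigma> Mi \<and>
     (\<forall>x\<in>V_reg W. M x ** Mi x = mat 1 \<and> Mi x ** M x = mat 1)"
proof -
  obtain \<sigma> F Fi M d N where K: "kz_fundamental 1 \<tau> \<sigma> F Fi" and irrS: "irreducible_representation W \<sigma>" and M: "mat_poly M" "mat_homog (int d) M"
    "of_nat d = kz_scalar \<tau>" "horizontal 1 \<sigma> 0 \<tau> M" "\<exists>x\<in>V_reg W. M x \<noteq> 0" and N: "horizontal 0 \<tau> 1 \<sigma> N" "\<exists>x\<in>V_reg W. N x \<noteq> 0"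
    using inverse_kz_solution[OF irr] by blast
  have inv: "invertible (M x)" if "x \<in> V_reg W" for x
    by (rule horizontal_invertible[OF irr irr_rep[OF irrS] M(4,5) that])
  obtain T where T: "intertwiner \<tau> \<tau> T" "\<forall>x\<in>V_reg W. M x ** N x = T" using horizontal_zero_const[OF horizontal_compose[OF N(1) M(4)]] by blast
  obtain c where c: "T = smul c (mat 1)" using schur[OF irr, of T] T(1) unfolding intertwiner_def by metis
  have "c \<noteq> 0"
  proof
    assume "c = 0"
    obtain x where x: "x \<in> V_reg W" "N x \<noteq> 0" using N(2) by blast
    have "M x ** N x = 0" using T(2) x(1) c \<open>c = 0\<close> by simp
    then have "matrix_inv (M x) ** (M x ** N x) = 0" by simp
    then show False using x matrix_inv_mult(2)[OF inv[OF x(1)]] by (simp add: matrix_mul_assoc)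
  qed
  define Mi where "Mi x = N x ** smul (1 / c) (mat 1)" for x
  have "horizontal 0 \<tau> 1 \<sigma> Mi" unfolding Mi_def by (rule horizontal_compose[OF horizontal_const N(1)]) simp
  moreover have "M x ** Mi x = mat 1 \<and> Mi x ** M x = mat 1" if "x \<in> V_reg W" for x
  proof -
    have "M x ** Mi x = mat 1" using T(2) that c \<open>c \<noteq> 0\<close> by (simp add: Mi_def)
    then show ?thesis by (simp add: matrix_left_right_inverse)
  qed
  ultimately show ?thesis using K irrS M(1-4) by blast
qed

lemma avg_apply: assumes H: "H \<in> arr" shows "avg (\<lambda>w. w) H *v y = y - frm H y *s coroot H"
proof -
  have n: "nH H \<ge> 2" by (rule nH_ge_2[OF H])
  have "(\<Sum>w\<in>WH H. w) *v y = (\<Sum>w\<in>WH H. y + ((det w - 1) * frm H y) *s coroot H)"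
    unfolding sum_matrix_vector by (rule sum.cong[OF refl]) (rule WH_apply[OF H])
  also have "\<dots> = of_nat (nH H) *s y + (((\<Sum>w\<in>WH H. det w) - of_nat (nH H)) * frm H y) *s coroot H"
    using sum_constant[of "1 :: complex" "WH H"]
    by (simp add: sum.distrib n_H_def sum_const_vec del: sum_constant add: vec.scale_sum_left[symmetric] sum_distrib_right[symmetric] sum_subtractf)
  also have "(\<Sum>w\<in>WH H. det w) = 0" using WH_det_sum_power(2)[OF H, of 1] n by simp
  finally have "(\<Sum>w\<in>WH H. w) *v y = of_nat (nH H) *s (y - frm H y *s coroot H)"
    by (simp add: vec.scale_right_diff_distrib)
  then show ?thesis using n by (simp add: avg_def smul_vector)
qed

lemma prj_apply: assumes H: "H \<in> arr" shows "prj (\<lambda>w. w) H *v y = frm H y *s coroot H"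
  by (simp add: prj_def matrix_vector_mult_diff_rdistrib avg_apply[OF H])

lemma trace_prj: assumes H: "H \<in> arr" shows "trace (prj (\<lambda>w. w) H) = 1"
proof -
  have "prj (\<lambda>w. w) H $ i $ i = \<alpha> H $ i * coroot H $ i" for i
  proof -
    have "form_at (\<alpha> H) (axis i 1) = \<alpha> H $ i" unfolding form_at_def axis_def by (simp add: if_distrib cong: if_cong)
    moreover have "prj (\<lambda>w. w) H $ i $ i = (prj (\<lambda>w. w) H *v axis i 1) $ i"
      unfolding matrix_vector_mult_def axis_def by (simp add: if_distrib cong: if_cong)
    ultimately show ?thesis by (simp add: prj_apply[OF H])
  qed
  then show ?thesis using frm_coroot[OF H] by (simp add: trace_def form_at_def)
qed

text \<open>Comparison of traces on V: each \<open>prj\<close> has trace 1, so the residue at H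
  contributes n_H. This is the origin of the factor 1/N in the degree.\<close>

lemma kz_scalar_reflection: "of_nat CARD('n) * kz_scalar (\<lambda>w. w :: complex^'n^'n) = (\<Sum>H\<in>arr. of_nat (m H * nH H))"
proof -
  have irr: "irreducible_representation W (\<lambda>w. w)" using irrW by (simp add: irreducible_reflection_group_def)
  have t: "trace (smul c A) = c * trace A" for c and A :: "complex^'n^'n" by (simp add: trace_def sum_distrib_left)
  have "trace (Csum (\<lambda>w. w)) = (\<Sum>H\<in>arr. trace (smul (of_nat (m H)) (Kop (\<lambda>w. w) H)))"
    unfolding Csum_def trace_def sum_component by (rule sum.swap)
  also have "\<dots> = (\<Sum>H\<in>arr. of_nat (m H * nH H))"
    by (rule sum.cong[OF refl]) (simp add: Kop_eq[OF rep_id] t trace_prj)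
  finally have "trace (smul (kz_scalar (\<lambda>w. w :: complex^'n^'n)) (mat 1 :: complex^'n^'n)) = (\<Sum>H\<in>arr. of_nat (m H * nH H))"
    using Csum_kz_scalar[OF irr] by simp
  then show ?thesis by (simp add: t trace_def mat_def mult.commute)
qed

lemma form_at_mv_axis: "A *v axis k 1 = (\<chi> i. (A :: complex^'n^'m) $ i $ k)"
  unfolding matrix_vector_mult_def axis_def by (simp add: if_distrib cong: if_cong)

text \<open>A constant left factor is compatible with dM = M A, so \<open>prj\<close> M satisfies
  the same equation. For it the exponent 0 is excluded, partly because \<open>avg\<close> times
  \<open>prj\<close> is zero and partly by equivariance. The next exponent is m_H n_H, so
  \<open>prj\<close> M vanishes to this order along H, and alpha_H only sees the \<open>prj\<close>
  part.\<close>

lemma horizontal_columns_quasi_invariant: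
  assumes rep: "representation W \<sigma>" and horizontal: "horizontal 1 \<sigma> 0 (\<lambda>w. w) M" and M: "mat_poly M" and H: "H \<in> arr"
  shows "\<exists>g. poly_fun g \<and> (\<forall>x. frm H (M x *v v) = frm H x ^ (m H * nH H) * g x)"
proof -
  let ?p = "prj (\<lambda>w. w) H" and ?N = "m H * nH H"
  have pc: "?p ** u = u ** ?p" if "u \<in> WH H" for u
  proof -
    have "u ** avg (\<lambda>w. w) H = avg (\<lambda>w. w) H ** u" using avg_absorb[OF rep_id that] by simp
    then show ?thesis by (simp add: prj_def mat_alg)
  qed
  have "\<exists>Q. mat_localised (dH H) Q \<and> (\<forall>x\<in>V_reg W. ?p ** M x = smul (frm H x powi int ?N) (Q x))"
  proof (rule pole_bound[where k=1 and k'=0, OF rep rep_id H])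
    show "mat_localised \<delta> (\<lambda>x. ?p ** M x)" by (intro mat_localised_mult horizontal_mat_localised[OF horizontal] mat_localised_const poly_\<delta>)
    fix x assume x: "x \<in> V_reg W"
    have "mat_deriv (coroot H) (\<lambda>x. ?p ** M x) x = ?p ** mat_deriv (coroot H) M x"
      using x by (subst mat_deriv_mult[OF poly_\<delta> mat_localised_const horizontal_mat_localised[OF horizontal]]) (simp_all add: \<delta>_nz)
    then show "mat_deriv (coroot H) (\<lambda>x. ?p ** M x) x = smul (of_int 1) (?p ** M x ** Acon \<sigma> (coroot H) x) - smul (of_int 0) (Acon (\<lambda>w. w) (coroot H) x ** (?p ** M x))"
      using horizontal x by (simp add: horizontal_def matrix_mul_assoc)
  next
    fix u x assume u: "u \<in> WH H" and x: "x \<in> V_reg W"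
    have "M (u *v x) ** \<sigma> u = u ** M x" using horizontal WH_sub[OF u] x by (simp add: horizontal_def)
    then show "?p ** M (u *v x) ** \<sigma> u = u ** (?p ** M x)" by (metis matrix_mul_assoc pc[OF u])
  next
    show "\<forall>x\<in>V_reg W. avg (\<lambda>w. w) H ** (?p ** M x) ** avg \<sigma> H = 0"
      by (simp add: matrix_mul_assoc prj_simps(2)[OF rep_id])
  qed simp
  then obtain Q where Q: "mat_localised (dH H) Q" "\<And>x. x \<in> V_reg W \<Longrightarrow> ?p ** M x = smul (frm H x ^ ?N) (Q x)"
    by (auto simp only: power_int_of_nat)
  have v: "frm H (M x *v v) = frm H x ^ ?N * frm H (Q x *v v)" if "x \<in> V_reg W" for x
  proof -
    have "frm H (M x *v v) = frm H (?p *v (M x *v v))" by (simp add: prj_apply[OF H] frm_coroot[OF H])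
    also have "?p *v (M x *v v) = frm H x ^ ?N *s (Q x *v v)"
      by (simp only: matrix_vector_mul_assoc Q(2)[OF that] smul_vector)
    finally show ?thesis by simp
  qed
  have "localised (dH H) (\<lambda>x. frm H (Q x *v v))"
    unfolding form_at_def matrix_vector_mult_def using Q(1)
    by (auto simp: mat_localised_def intro!: localised_sum localised_mult)
  then obtain q r where q: "poly_fun q" "\<And>x. dH H x \<noteq> 0 \<Longrightarrow> frm H (Q x *v v) = q x / dH H x ^ r"
    unfolding localised_def by blast
  have g: "poly_fun (\<lambda>x. frm H (M x *v v))"
    unfolding form_at_def matrix_vector_mult_def vec_lambda_beta using M
    by (intro poly_fun_sum poly_fun_mult poly_fun_const) (simp add: mat_poly_def)
  obtain x0 where x0: "frm H x0 = 0" "dH H x0 \<noteq> 0" using hyperplane_point[OF H] by blast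
  \<comment> \<open>The order of vanishing found for a localised function is transferred to the
    polynomial itself.\<close>
  show ?thesis
  proof (rule poly_fun_power_divide_form[OF g _ q(1) frm_coroot[OF H] x0(1)])
    show "poly_fun (\<lambda>x. dH H x ^ r)" by (intro poly_fun_power poly_dH)
    show "dH H x0 ^ r \<noteq> 0" using x0 by simp
    fix x
    have "frm H (M x *v v) * dH H x ^ r - frm H x ^ ?N * q x = 0"
    proof (rule poly_zero_on_V_reg)
      show "poly_fun (\<lambda>x. frm H (M x *v v) * dH H x ^ r - frm H x ^ ?N * q x)"
        by (intro poly_fun_diff poly_fun_mult g q(1) poly_fun_power poly_dH poly_fun_form)
      fix x assume x: "x \<in> V_reg W"
      show "frm H (M x *v v) * dH H x ^ r - frm H x ^ ?N * q x = 0"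
        using V_reg_dH[OF x, of H] by (simp add: v[OF x] q(2))
    qed
    then show "frm H (M x *v v) * dH H x ^ r = frm H x ^ ?N * q x" by simp
  qed
qed

text \<open>M^{-1} \<phi> is regular along H: on the \<open>avg\<close> part of \<phi> the inverse
  of M has no pole, and on the \<open>prj\<close> part it has a pole of order at most m_H n_H, which
  the divisibility of alpha_H(\<phi>) compensates.\<close>

lemma quasi_invariant_coefficients:
  assumes rep: "representation W \<sigma>" and horizontal: "horizontal 0 (\<lambda>w. w) 1 \<sigma> Mi" and M: "mat_poly M"
    and MM: "\<And>x. x \<in> V_reg W \<Longrightarrow> M x ** Mi x = mat 1"
    and \<phi>: "\<phi> \<in> quasi_invariants W \<alpha> m"
  shows "\<exists>p. \<forall>x. tensor_eval \<phi> x = M x *v (\<chi> k. eval_poly (p k) x)"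
proof -
  \<comment> \<open>\<phi> is repeated in every column, so that the statements about square matrices
    apply.\<close>
  define Y where "Y x = (\<chi> i j. eval_poly (\<phi> $ i) x :: complex^'n^'n)" for x
  have Y: "mat_poly Y" by (simp add: mat_poly_def Y_def)
  have YV: "Y x *v axis j 1 = tensor_eval \<phi> x" for x j
    by (simp add: form_at_mv_axis Y_def vec_eq_iff)
  have hm: "mat_localised \<delta> Mi" by (rule horizontal_mat_localised[OF horizontal])
  have ode: "mat_deriv \<xi> (\<lambda>x. Mi x ** C) x = - (Acon \<sigma> \<xi> x ** (Mi x ** C))" if "x \<in> V_reg W" for x \<xi> and C :: "complex^'n^'n"
  proof -
    have "mat_deriv \<xi> (\<lambda>x. Mi x ** C) x = mat_deriv \<xi> Mi x ** C"
      using that by (subst mat_deriv_mult[OF poly_\<delta> hm mat_localised_const]) (simp_all add: \<delta>_nz)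
    then show ?thesis using horizontal that by (simp add: horizontal_def mat_alg)
  qed
  have "\<exists>P. mat_poly P \<and> (\<forall>x\<in>V_reg W. Mi x ** Y x = P x)"
  proof (rule mregular_imp_mat_poly)
    show "mat_localised \<delta> (\<lambda>x. Mi x ** Y x)" by (intro mat_localised_mult hm mat_localised_poly Y poly_\<delta>)
    fix H assume H: "H \<in> arr"
    let ?p = "prj (\<lambda>w. w) H" and ?a = "avg (\<lambda>w. w) H" and ?N = "m H * nH H"
    have eqv: "Mi (u *v x) ** u = \<sigma> u ** Mi x" if "u \<in> WH H" "x \<in> V_reg W" for u x
      using horizontal WH_sub[OF that(1)] that(2) by (simp add: horizontal_def)
    \<comment> \<open>The exponent -m_H n_H is excluded: on the \<open>prj\<close> part because
      \<open>avg\<close> times \<open>prj\<close> is zero, on the \<open>avg\<close> part by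
      equivariance.\<close>
    have "\<exists>Q. mat_localised (dH H) Q \<and> (\<forall>x\<in>V_reg W. Mi x ** ?a = smul (frm H x powi 0) (Q x))"
    proof (rule pole_bound[where k=0 and k'=1, OF rep_id rep H])
      show "mat_localised \<delta> (\<lambda>x. Mi x ** ?a)" by (intro mat_localised_mult hm mat_localised_const poly_\<delta>)
      show "mat_deriv (coroot H) (\<lambda>x. Mi x ** ?a) x = smul (of_int 0) (Mi x ** ?a ** Acon (\<lambda>w. w) (coroot H) x) - smul (of_int 1) (Acon \<sigma> (coroot H) x ** (Mi x ** ?a))"
        if "x \<in> V_reg W" for x using ode[OF that] by simp
      show "Mi (u *v x) ** ?a ** u = \<sigma> u ** (Mi x ** ?a)" if "u \<in> WH H" "x \<in> V_reg W" for u x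
        using eqv[OF that] avg_absorb[OF rep_id that(1)] by (metis matrix_mul_assoc)
      show "\<forall>x\<in>V_reg W. prj \<sigma> H ** (Mi x ** ?a) ** ?p = 0"
        by (simp add: matrix_mul_assoc[symmetric] prj_simps(2)[OF rep_id])
    qed simp
    then obtain Q0 where Q0: "mat_localised (dH H) Q0" "\<And>x. x \<in> V_reg W \<Longrightarrow> Mi x ** ?a = Q0 x" by auto
    have "\<exists>Q. mat_localised (dH H) Q \<and> (\<forall>x\<in>V_reg W. Mi x = smul (frm H x powi (- int ?N)) (Q x))"
      by (rule horizontal_order[where k=0 and k'=1, OF rep_id rep _ H]) (use horizontal in auto)
    then obtain Q1 where Q1: "mat_localised (dH H) Q1" "\<And>x. x \<in> V_reg W \<Longrightarrow> Mi x = smul (frm H x powi (- int ?N)) (Q1 x)" by blast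
    obtain g where g: "poly_fun g" "\<And>x. frm H (tensor_eval \<phi> x) = frm H x ^ ?N * g x"
      using \<phi> H unfolding quasi_invariants_iff_eval by blast
    \<comment> \<open>Every column is the coroot, since \<open>prj\<close> sends \<phi> to
      alpha_H(\<phi>) times the coroot.\<close>
    define C where "C = (\<chi> i j. coroot H $ i :: complex^'n^'n)"
    have pY: "?p ** Y x = smul (frm H x ^ ?N * g x) C" for x
    proof -
      have "(?p ** Y x) $ i $ j = (?p *v (Y x *v axis j 1)) $ i" for i j
        unfolding matrix_vector_mul_assoc by (simp add: form_at_mv_axis)
      then show ?thesis by (simp add: vec_eq_iff YV prj_apply[OF H] g(2) C_def)
    qed
    show "regH H (\<lambda>x. Mi x ** Y x)"
    proof (rule regH_I)
      show "mat_localised (dH H) (\<lambda>x. Q0 x ** Y x + smul (g x) (Q1 x ** C))"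
        by (intro mat_localised_add mat_localised_mult mat_localised_smul Q0(1) Q1(1) mat_localised_const mat_localised_poly Y localised_poly g(1) poly_dH)
      fix x assume x: "x \<in> V_reg W"
      have "Mi x ** Y x = Mi x ** (?a + ?p) ** Y x" by (simp add: prj_simps(4)[OF rep_id])
      also have "\<dots> = Q0 x ** Y x + Mi x ** (?p ** Y x)" using Q0(2)[OF x] by (simp add: mat_alg)
      also have "Mi x ** (?p ** Y x) = smul (g x) (Q1 x ** C)"
        unfolding pY Q1(2)[OF x] using V_reg_frm[OF x H] by (simp add: power_int_minus field_simps del: of_nat_mult)
      finally show "Mi x ** Y x = Q0 x ** Y x + smul (g x) (Q1 x ** C)" .
    qed
  qed
  then obtain P where P: "mat_poly P" "\<And>x. x \<in> V_reg W \<Longrightarrow> Mi x ** Y x = P x" by blast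
  fix j :: 'n
  have "\<exists>p. \<forall>k. (\<lambda>x. P x $ k $ j) = eval_poly (p k)"
    by (rule choice) (use P(1) in \<open>auto simp: mat_poly_def poly_fun_def\<close>)
  then obtain p where p: "\<And>k x. P x $ k $ j = eval_poly (p k) x" by metis
  have YP: "Y x = M x ** P x" for x
  proof -
    have "Y x + smul (- 1) (M x ** P x) = 0"
    proof (rule mat_poly_zero_on_V_reg[where F="\<lambda>x. Y x + smul (- 1) (M x ** P x)"])
      show "mat_poly (\<lambda>x. Y x + smul (- 1) (M x ** P x))"
        by (intro mat_poly_add Y mat_poly_smul poly_fun_const mat_poly_mult M P(1))
      fix x assume x: "x \<in> V_reg W"
      have "M x ** P x = Y x" unfolding P(2)[OF x, symmetric] by (simp add: matrix_mul_assoc MM[OF x])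
      then show "Y x + smul (- 1) (M x ** P x) = 0" by (simp add: smul_minus_left)
    qed
    then show ?thesis by (simp add: smul_minus_left)
  qed
  show ?thesis
  proof (intro exI allI)
    fix x
    have "tensor_eval \<phi> x = M x *v (P x *v axis j 1)" unfolding matrix_vector_mul_assoc YP[symmetric] YV ..
    also have "P x *v axis j 1 = (\<chi> k. eval_poly (p k) x)" by (simp add: form_at_mv_axis p)
    finally show "tensor_eval \<phi> x = M x *v (\<chi> k. eval_poly (p k) x)" .
  qed
qed

end

context refl_arr begin

section \<open>Regular sections and the module kz_{-m}\<close>

lemma regular_functions_iff: "f \<in> regular_functions W \<alpha> \<longleftrightarrow> localised \<delta> f \<and> (\<forall>x. x \<notin> V_reg W \<longrightarrow> f x = 0)"
proof
  assume "f \<in> regular_functions W \<alpha>"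
  then obtain p r where f: "f = (\<lambda>x. if x \<in> V_reg W then eval_poly p x / \<delta> x ^ r else 0)"
    unfolding regular_functions_def \<delta>_def by blast
  show "localised \<delta> f \<and> (\<forall>x. x \<notin> V_reg W \<longrightarrow> f x = 0)"
    unfolding localised_def f by (intro conjI exI[of _ "eval_poly p"] exI[of _ r]) (auto simp: \<delta>_nz)
next
  assume f: "localised \<delta> f \<and> (\<forall>x. x \<notin> V_reg W \<longrightarrow> f x = 0)"
  then obtain p r where p: "\<And>x. \<delta> x \<noteq> 0 \<Longrightarrow> f x = eval_poly p x / \<delta> x ^ r" unfolding localised_def poly_fun_def by blast
  have "f = (\<lambda>x. if x \<in> V_reg W then eval_poly p x / \<delta> x ^ r else 0)" using f p \<delta>_nz by auto
  then show "f \<in> regular_functions W \<alpha>" unfolding regular_functions_def \<delta>_def by blast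
qed

lemma regular_sections_iff:
  "G \<in> regular_sections W \<alpha> \<longleftrightarrow> (\<forall>j. localised \<delta> (\<lambda>x. G x $ j)) \<and> (\<forall>x. x \<notin> V_reg W \<longrightarrow> G x = 0)"
  by (auto simp: regular_sections_def regular_functions_iff vec_eq_iff)

lemma regular_section_mult:
  assumes A: "mat_localised \<delta> A" and G: "G \<in> regular_sections W \<alpha>"
  shows "(\<lambda>x. A x *v G x) \<in> regular_sections W \<alpha>"
  using A G unfolding regular_sections_iff matrix_vector_mult_def
  by (auto simp: mat_localised_def vec_eq_iff intro!: localised_sum localised_mult)

text \<open>A vector repeated as all columns of a square matrix, so that \<open>mat_deriv\<close>
  and its product rule apply to sections.\<close>

definition columns :: "complex^'d \<Rightarrow> complex^'d^'d" where "columns v = (\<chi> i j. v $ i)"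

lemma columns_simps: "columns v $ i $ j = v $ i" "A ** columns v = columns (A *v v)"
    "columns v + columns v' = columns (v + v')" "- columns v = columns (- v)"
    "columns v = columns v' \<longleftrightarrow> v = v'"
  by (auto simp: columns_def vec_eq_iff matrix_matrix_mult_def matrix_vector_mult_def)

lemma KZ_connection_eq:
  assumes x: "x \<in> V_reg W"
  shows "KZ_connection W \<alpha> (\<lambda>H. - int (m H)) \<tau> \<xi> G x = trivial_connection W \<xi> G x - Acon \<tau> \<xi> x *v G x"
proof -
  have "(\<Sum>H\<in>arr. (of_int (- int (m H)) * frm H \<xi> / frm H x) *s (\<Sum>i\<in>{1..nH H - 1}. e_op W \<tau> H i *v G x))
      = (\<Sum>H\<in>arr. - ((of_nat (m H) * (frm H \<xi> / frm H x)) *s (Kop \<tau> H *v G x)))"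
    unfolding Kop_def sum_matrix_vector by (rule sum.cong[OF refl]) (simp add: vec_eq_iff)
  also have "\<dots> = - (Acon \<tau> \<xi> x *v G x)"
    unfolding Acon_def sum_matrix_vector by (simp add: sum_negf smul_vector)
  finally show ?thesis using x by (simp add: KZ_connection_def)
qed

lemma kz_fundamental_intertwines_connections:
  assumes K: "kz_fundamental 1 \<tau> \<sigma> F Fi" and G: "G \<in> regular_sections W \<alpha>"
  shows "Fi x *v KZ_connection W \<alpha> (\<lambda>H. - int (m H)) \<tau> \<xi> G x = trivial_connection W \<xi> (\<lambda>x. Fi x *v G x) x"
proof (cases "x \<in> V_reg W")
  case False then show ?thesis by (simp add: KZ_connection_def trivial_connection_def)
next
  case x: True
  have horizontal: "horizontal (- 1) \<tau> 0 \<sigma> Fi" using kz_fundamental_horizontal(2)[OF K] by simp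
  note hm = horizontal_mat_localised[OF horizontal]
  have c: "columns (trivial_connection W \<xi> U x) = mat_deriv \<xi> (\<lambda>x. columns (U x)) x" for U :: "complex^'n \<Rightarrow> complex^'a"
    using x by (simp add: vec_eq_iff columns_simps trivial_connection_def dir_deriv_def)
  have cG: "mat_localised \<delta> (\<lambda>x. columns (G x))" using G by (simp add: mat_localised_def columns_simps regular_sections_iff)
  have n: "(- A) *v v = - (A *v v)" for A :: "complex^'a^'a" and v
    by (simp add: vec_eq_iff matrix_vector_mult_def sum_negf)
  have "columns (trivial_connection W \<xi> (\<lambda>x. Fi x *v G x) x) = mat_deriv \<xi> (\<lambda>x. Fi x ** columns (G x)) x"
    unfolding c columns_simps ..
  also have "\<dots> = mat_deriv \<xi> Fi x ** columns (G x) + Fi x ** mat_deriv \<xi> (\<lambda>x. columns (G x)) x"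
    using x by (intro mat_deriv_mult[OF poly_\<delta> hm cG]) (simp add: \<delta>_nz)
  also have "mat_deriv \<xi> Fi x = - (Fi x ** Acon \<tau> \<xi> x)" using horizontal x by (simp add: horizontal_def mat_alg)
  also have "mat_deriv \<xi> (\<lambda>x. columns (G x)) x = columns (trivial_connection W \<xi> G x)" by (rule c[symmetric])
  also have "- (Fi x ** Acon \<tau> \<xi> x) ** columns (G x) + Fi x ** columns (trivial_connection W \<xi> G x)
      = columns (Fi x *v (trivial_connection W \<xi> G x - Acon \<tau> \<xi> x *v G x))"
    by (simp add: columns_simps n matrix_vector_mul_assoc matrix_vector_mult_diff_distrib)
  finally show ?thesis unfolding columns_simps KZ_connection_eq[OF x] ..
qed

text \<open>The isomorphism is multiplication by the inverse fundamental matrix. Outside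
  \<open>V_reg\<close>, where Fi is arbitrary, sections are zero.\<close>

lemma is_kz_kz_fundamental:
  fixes \<tau> :: "complex^'n^'n \<Rightarrow> complex^'d::finite^'d"
  assumes irr: "irreducible_representation W \<tau>" and K: "kz_fundamental 1 \<tau> \<sigma> F Fi"
  shows "is_kz W \<alpha> (\<lambda>H. - int (m H)) \<tau> \<sigma>"
  unfolding is_kz_def
proof (intro conjI kz_irreducible[OF irr K] exI[of _ "\<lambda>G x. Fi x *v G x"] ballI allI)
  have mF: "mat_localised \<delta> F" "mat_localised \<delta> Fi" using K by (auto simp: kz_fundamental_def mat_localised_poly)
  have FF: "F x ** Fi x = mat 1" "Fi x ** F x = mat 1" if "x \<in> V_reg W" for x using K that by (auto simp: kz_fundamental_def)
  have z: "G x = 0" if "G \<in> regular_sections W \<alpha>" "x \<notin> V_reg W" for G x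
    using that by (simp add: regular_sections_iff)
  show "bij_betw (\<lambda>G x. Fi x *v G x) (regular_sections W \<alpha>) (regular_sections W \<alpha>)"
  proof (rule bij_betw_byWitness[where f'="\<lambda>G x. F x *v G x"])
    show "\<forall>G\<in>regular_sections W \<alpha>. (\<lambda>x. F x *v (Fi x *v G x)) = G"
    proof (intro ballI ext)
      fix G :: "complex^'n \<Rightarrow> complex^'d" and x
      assume "G \<in> regular_sections W \<alpha>"
      then show "F x *v (Fi x *v G x) = G x"
        by (cases "x \<in> V_reg W") (simp_all add: matrix_vector_mul_assoc FF z)
    qed
    show "\<forall>G\<in>regular_sections W \<alpha>. (\<lambda>x. Fi x *v (F x *v G x)) = G"
    proof (intro ballI ext)
      fix G :: "complex^'n \<Rightarrow> complex^'d" and x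
      assume "G \<in> regular_sections W \<alpha>"
      then show "Fi x *v (F x *v G x) = G x"
        by (cases "x \<in> V_reg W") (simp_all add: matrix_vector_mul_assoc FF z)
    qed
  qed (use regular_section_mult mF in blast)+
  fix G :: "complex^'n \<Rightarrow> complex^'d"
  assume G: "G \<in> regular_sections W \<alpha>"
  show "(\<lambda>x. Fi x *v (G + G') x) = (\<lambda>x. Fi x *v G x) + (\<lambda>x. Fi x *v G' x)" for G'
    by (simp add: fun_eq_iff matrix_vector_right_distrib)
  show "(\<lambda>x. Fi x *v (g x *s G x)) = (\<lambda>x. g x *s (Fi x *v G x))" for g
    by (simp add: mv_smult)
  show "(\<lambda>x. Fi x *v act_section \<tau> w G x) = act_section \<sigma> w (\<lambda>x. Fi x *v G x)" if w: "w \<in> W" for w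
  proof
    fix x
    define y where "y = matrix_inv w *v x"
    have x: "x = w *v y" using w by (simp add: y_def)
    show "Fi x *v act_section \<tau> w G x = act_section \<sigma> w (\<lambda>x. Fi x *v G x) x"
    proof (cases "y \<in> V_reg W")
      case True
      then have "Fi x ** \<tau> w = \<sigma> w ** Fi y" using kz_fundamental_horizontal(2)[OF K] w by (simp add: horizontal_def x)
      then show ?thesis by (simp add: act_section_def y_def[symmetric] matrix_vector_mul_assoc)
    qed (simp add: act_section_def y_def[symmetric] z[OF G])
  qed
  show "(\<lambda>x. Fi x *v KZ_connection W \<alpha> (\<lambda>H. - int (m H)) \<tau> \<xi> G x) = trivial_connection W \<xi> (\<lambda>x. Fi x *v G x)" for \<xi>
    by (rule ext) (rule kz_fundamental_intertwines_connections[OF K G])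
qed

section \<open>Assembly of the free basis\<close>

lemma log_derivations_subspace: "der.subspace (log_derivations W \<alpha> m)"
  unfolding der.subspace_def
proof (intro conjI ballI allI)
  have 0: "(0 :: 'n poly_ring^'n) \<in> quasi_invariants W \<alpha> m" by (simp add: quasi_invariants_iff_dvd tensor_field_0)
  show "0 \<in> log_derivations W \<alpha> m" unfolding log_derivations_iff by (rule bexI[OF _ 0]) (simp add: tensor_field_0)
  fix L assume "L \<in> log_derivations W \<alpha> m"
  then obtain \<phi> where \<phi>: "\<phi> \<in> quasi_invariants W \<alpha> m" "L = tensor_field \<phi>" unfolding log_derivations_iff by blast
  show "L + L' \<in> log_derivations W \<alpha> m" if L': "L' \<in> log_derivations W \<alpha> m" for L'
  proof -
    obtain \<psi> where \<psi>: "\<psi> \<in> quasi_invariants W \<alpha> m" "L' = tensor_field \<psi>" using L' unfolding log_derivations_iff by blast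
    have "\<phi> + \<psi> \<in> quasi_invariants W \<alpha> m" using \<phi>(1) \<psi>(1) by (simp add: quasi_invariants_iff_dvd tensor_field_add)
    then show ?thesis unfolding log_derivations_iff \<phi>(2) \<psi>(2) tensor_field_add[symmetric] by blast
  qed
  show "der_scale c L \<in> log_derivations W \<alpha> m" for c
  proof -
    have "c *s \<phi> \<in> quasi_invariants W \<alpha> m" using \<phi>(1) by (simp add: quasi_invariants_iff_dvd tensor_field_scale der_scale_def)
    then show ?thesis unfolding log_derivations_iff \<phi>(2) tensor_field_scale[symmetric] by blast
  qed
qed

end

lemma homogeneous_poly_const_mult: "homogeneous_poly d p \<Longrightarrow> homogeneous_poly d (const c * p)"
  unfolding homogeneous_poly_def const_def using keys_mult[of "Poly_Mapping.single 0 c" p] by (fastforce split: if_splits)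

lemma homogeneous_poly_sum: "(\<And>i. i \<in> S \<Longrightarrow> homogeneous_poly d (f i)) \<Longrightarrow> homogeneous_poly d (\<Sum>i\<in>S. f i)"
proof (induction S rule: infinite_finite_induct)
  case (insert i S)
  then show ?case using keys_add[of "f i" "\<Sum>i\<in>S. f i"] unfolding homogeneous_poly_def by fastforce
qed (simp_all add: homogeneous_poly_def)

lemma (in module) independent_rangeI:
  fixes L :: "'i::finite \<Rightarrow> 'b"
  assumes inj: "inj L" and z: "\<And>p. (\<Sum>k\<in>UNIV. scale (p k) (L k)) = 0 \<Longrightarrow> (\<forall>k. p k = 0)"
  shows "independent (range L)"
proof
  assume "dependent (range L)"
  then obtain t u v where t: "finite t" "t \<subseteq> range L" "(\<Sum>v\<in>t. scale (u v) v) = 0" "v \<in> t" "u v \<noteq> 0"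
    unfolding dependent_explicit by blast
  define p where "p k = (if L k \<in> t then u (L k) else 0)" for k
  have "(\<Sum>k\<in>UNIV. scale (p k) (L k)) = (\<Sum>k\<in>{k. L k \<in> t}. scale (u (L k)) (L k))"
    unfolding p_def by (rule sum.mono_neutral_cong_right) auto
  also have "\<dots> = (\<Sum>v\<in>L ` {k. L k \<in> t}. scale (u v) v)"
    by (rule sum.reindex_cong[symmetric, OF inj_on_subset[OF inj]]) auto
  also have "L ` {k. L k \<in> t} = t" using t(2) by auto
  finally have "\<forall>k. p k = 0" using t(3) by (intro z) simp
  moreover obtain k where "v = L k" using t(2,4) by blast
  ultimately have "u v = 0" using t(4) unfolding p_def by metis
  then show False using t(5) by simp
qed

context refl_arr begin

text \<open>The columns of M form the basis. They are independent since M is invertible on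
  \<open>V_reg\<close>, logarithmic by their order of vanishing along each H, and generating since
  M^{-1} \<phi> is polynomial for every quasi-invariant \<phi>.\<close>

lemma log_derivations_free:
  "\<exists>(L :: 'n \<Rightarrow> 'n poly_ring \<Rightarrow> 'n poly_ring) (f :: 'n \<Rightarrow> 'n \<Rightarrow> 'n poly_ring) (d :: nat).
     inj L \<and> der.independent (range L) \<and> der.span (range L) = log_derivations W \<alpha> m \<and>
     (\<forall>k. L k = vector_field (f k) \<and> homogeneous_der d (L k) \<and> (\<forall>i. homogeneous_poly d (f k i))) \<and>
     real d = 1 / real CARD('n) * (\<Sum>H\<in>arrangement W. real (m H * n_H W H)) \<and>
     (\<exists>\<sigma> :: complex^'n^'n \<Rightarrow> complex^'n^'n.
        is_kz W \<alpha> (\<lambda>H. - int (m H)) (\<lambda>w. w) \<sigma> \<and> CW_isomorphic W (der_c.span (range L)) \<sigma>)"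
proof -
  have irr: "irreducible_representation W (\<lambda>w. w)" using irrW by (simp add: irreducible_reflection_group_def)
  obtain \<sigma> F Fi M Mi d where K: "kz_fundamental 1 (\<lambda>w. w) \<sigma> F Fi" and irrS: "irreducible_representation W \<sigma>"
    and M: "mat_poly M" "mat_homog (int d) M" "of_nat d = kz_scalar (\<lambda>w. w :: complex^'n^'n)" "horizontal 1 \<sigma> 0 (\<lambda>w. w) M"
    and Mi: "horizontal 0 (\<lambda>w. w) 1 \<sigma> Mi" "\<And>x. x \<in> V_reg W \<Longrightarrow> M x ** Mi x = mat 1" "\<And>x. x \<in> V_reg W \<Longrightarrow> Mi x ** M x = mat 1"
    using inverse_kz_fundamental[OF irr] by blast
  note repS = irr_rep[OF irrS]
  have Minj: "u = v" if "x \<in> V_reg W" "M x *v u = M x *v v" for x u v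
  proof -
    have "Mi x *v (M x *v u) = Mi x *v (M x *v v)" using that(2) by simp
    then show ?thesis by (simp add: matrix_vector_mul_assoc Mi(3)[OF that(1)])
  qed
  have "\<exists>f. \<forall>ki. (\<forall>x. M x $ snd ki $ fst ki = eval_poly (f ki) x) \<and> homogeneous_poly d (f ki)"
    by (rule choice) (use mat_homog_poly_entry[OF M(1,2)] in blast)
  then obtain f0 where f0: "\<And>ki x. M x $ snd ki $ fst ki = eval_poly (f0 ki) x" "\<And>ki. homogeneous_poly d (f0 ki)" by blast
  define f where "f k i = f0 (k, i)" for k i
  have f: "M x $ i $ k = eval_poly (f k i) x" "homogeneous_poly d (f k i)" for x i k
    using f0(1)[of x "(k, i)"] f0(2)[of "(k, i)"] by (simp_all add: f_def)
  define \<phi> where "\<phi> k = (\<chi> i. f k i)" for k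
  define L where "L k = tensor_field (\<phi> k)" for k
  have Lf: "L k = vector_field (f k)" for k by (simp add: L_def \<phi>_def tensor_field_def)
  have comb: "tensor_eval (\<Sum>k\<in>UNIV. p k *s \<phi> k) x = M x *v (\<chi> k. eval_poly (p k) x)" for p x
    by (simp add: vec_eq_iff \<phi>_def matrix_vector_mult_def f(1) mult.commute)
  have comb_field: "tensor_field (\<Sum>k\<in>UNIV. p k *s \<phi> k) = (\<Sum>k\<in>UNIV. der_scale (p k) (L k))" for p
    by (simp add: tensor_field_sum tensor_field_scale L_def)
  have \<phi>M: "tensor_eval (\<phi> k) x = M x *v axis k 1" for k x
    by (simp add: form_at_mv_axis vec_eq_iff \<phi>_def f(1))
  obtain p0 where p0: "p0 \<in> V_reg W" using V_reg_nonempty by blast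
  have injL: "inj L"
  proof
    fix k l assume "L k = L l"
    then have "\<phi> k = \<phi> l" by (simp add: L_def tensor_field_inject)
    then have "M p0 *v axis k 1 = M p0 *v axis l 1" unfolding \<phi>M[symmetric] by simp
    then have "axis k (1::complex) = axis l 1" by (rule Minj[OF p0])
    then show "k = l" by (simp add: axis_eq_axis)
  qed
  have indep: "der.independent (range L)"
  proof (rule der.independent_rangeI[OF injL])
    fix p assume "(\<Sum>k\<in>UNIV. der_scale (p k) (L k)) = 0"
    then have z: "(\<Sum>k\<in>UNIV. p k *s \<phi> k) = 0"
      using tensor_field_inject[of "\<Sum>k\<in>UNIV. p k *s \<phi> k" 0] by (simp add: comb_field tensor_field_0)
    have "eval_poly (p k) x = 0" if x: "x \<in> V_reg W" for k x
    proof -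
      have "M x *v (\<chi> k. eval_poly (p k) x) = M x *v 0"
        unfolding comb[symmetric] z by (simp add: vec_eq_iff)
      then have "(\<chi> k. eval_poly (p k) x) = 0" by (rule Minj[OF x])
      then show ?thesis by (simp add: vec_eq_iff)
    qed
    then have "eval_poly (p k) x = 0" for k x by (rule poly_zero_on_V_reg[OF poly_fun_eval])
    then show "\<forall>k. p k = 0" using eval_poly_eq_0_imp by blast
  qed
  have QI: "\<phi> k \<in> quasi_invariants W \<alpha> m" for k
    unfolding quasi_invariants_iff_eval \<phi>M using horizontal_columns_quasi_invariant[OF repS M(4,1)] by blast
  have span: "der.span (range L) = log_derivations W \<alpha> m"
  proof
    show "der.span (range L) \<subseteq> log_derivations W \<alpha> m"
    proof (rule der.span_minimal[OF image_subsetI log_derivations_subspace])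
      show "L k \<in> log_derivations W \<alpha> m" for k unfolding log_derivations_iff L_def using QI by blast
    qed
    show "log_derivations W \<alpha> m \<subseteq> der.span (range L)"
    proof
      fix D assume "D \<in> log_derivations W \<alpha> m"
      then obtain \<psi> where \<psi>: "\<psi> \<in> quasi_invariants W \<alpha> m" "D = tensor_field \<psi>" unfolding log_derivations_iff by blast
      obtain p where p: "\<And>x. tensor_eval \<psi> x = M x *v (\<chi> k. eval_poly (p k) x)"
        using quasi_invariant_coefficients[OF repS Mi(1) M(1) Mi(2) \<psi>(1)] by blast
      have "\<psi> = (\<Sum>k\<in>UNIV. p k *s \<phi> k)" by (rule tensor_eval_inject) (simp only: p comb)
      then have "D = (\<Sum>k\<in>UNIV. der_scale (p k) (L k))" by (simp only: \<psi>(2) comb_field)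
      then show "D \<in> der.span (range L)"
        by (simp only:) (intro der.span_sum der.span_scale der.span_base rangeI)
    qed
  qed
  have homog: "homogeneous_der d (L k)" for k
    unfolding homogeneous_der_def
  proof (intro conjI allI)
    show "L k \<noteq> 0"
    proof
      assume "L k = 0"
      then have "\<phi> k = 0" using tensor_field_inject[of "\<phi> k" 0] by (simp add: L_def tensor_field_0)
      then have "M p0 *v axis k 1 = M p0 *v 0" unfolding \<phi>M[symmetric] by (simp add: vec_eq_iff)
      then have "axis k (1::complex) = 0" by (rule Minj[OF p0])
      then show False by (simp add: axis_eq_0_iff)
    qed
    show "homogeneous_poly d (L k (form_poly a))" for a
      unfolding L_def Der_form[OF tensor_field_Der]
      by (intro homogeneous_poly_sum homogeneous_poly_const_mult) (simp add: \<phi>_def f(2))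
  qed
  have deg: "real d = 1 / real CARD('n) * (\<Sum>H\<in>arr. real (m H * nH H))"
  proof -
    have "(of_nat (CARD('n) * d) :: complex) = of_nat (\<Sum>H\<in>arr. m H * nH H)"
      using kz_scalar_reflection M(3) by simp
    then have "CARD('n) * d = (\<Sum>H\<in>arr. m H * nH H)" unfolding of_nat_eq_iff .
    then have "real (CARD('n) * d) = (\<Sum>H\<in>arr. real (m H * nH H))" by simp
    then show ?thesis by (simp add: field_simps)
  qed
  \<comment> \<open>Constant coefficient vectors c parametrise the complex span by M c; E is the
    inverse of the isomorphism onto the underlying space of \<sigma>.\<close>
  define \<psi> where "\<psi> c = (\<Sum>k\<in>UNIV. const (c $ k) *s \<phi> k)" for c
  define E where "E c = tensor_field (\<psi> c)" for c
  have \<psi>M: "tensor_eval (\<psi> c) x = M x *v c" for c x unfolding \<psi>_def comb by (simp add: vec_lambda_eta)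
  have E: "E c = (\<Sum>k\<in>UNIV. der_cscale (c $ k) (L k))" for c unfolding E_def \<psi>_def comb_field der_cscale_def ..
  have E_add: "E (c + c') = E c + E c'" for c c' by (simp add: E der_c.scale_left_distrib sum.distrib)
  have E_scale: "E (a *s c) = der_cscale a (E c)" for a c by (simp add: E der_c.scale_sum_right)
  have injE: "inj E"
  proof
    fix c c' assume "E c = E c'"
    then have "\<psi> c = \<psi> c'" by (simp add: E_def tensor_field_inject)
    then have "M p0 *v c = M p0 *v c'" unfolding \<psi>M[symmetric] by simp
    then show "c = c'" by (rule Minj[OF p0])
  qed
  have span_c: "der_c.span (range L) = range E"
  proof
    have "der_c.subspace (range E)" unfolding der_c.subspace_def
    proof (intro conjI ballI allI)
      have "E 0 = 0" by (simp add: E)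
      then show "0 \<in> range E" by (metis rangeI)
      fix D assume "D \<in> range E"
      then obtain c where c: "D = E c" by blast
      show "D + D' \<in> range E" if "D' \<in> range E" for D'
      proof -
        from that obtain c' where c': "D' = E c'" by blast
        show ?thesis unfolding c c' E_add[symmetric] by blast
      qed
      show "der_cscale a D \<in> range E" for a unfolding c E_scale[symmetric] by blast
    qed
    moreover have "L k \<in> range E" for k
    proof -
      have "\<phi> k = \<psi> (axis k 1)" by (rule tensor_eval_inject) (simp only: \<psi>M \<phi>M)
      then have "L k = E (axis k 1)" by (simp add: L_def E_def)
      then show ?thesis by blast
    qed
    ultimately show "der_c.span (range L) \<subseteq> range E" by (intro der_c.span_minimal) auto
    show "range E \<subseteq> der_c.span (range L)"
    proof (rule image_subsetI)
      fix c
      show "E c \<in> der_c.span (range L)"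
        unfolding E by (rule der_c.span_sum) (rule der_c.span_scale[OF der_c.span_base[OF rangeI]])
    qed
  qed
  \<comment> \<open>M(w y) \<sigma>(w) = w M(y) says that w takes the field of M c to the field of M
    \<sigma>(w) c.\<close>
  have act: "act_der w (E c) = E (\<sigma> w *v c)" if w: "w \<in> W" for w c
  proof -
    have e: "tensor_eval (act_tensor w (\<psi> c)) x = tensor_eval (\<psi> (\<sigma> w *v c)) x" if x: "x \<in> V_reg W" for x
    proof -
      define y where "y = matrix_inv w *v x"
      have y: "x = w *v y" using w by (simp add: y_def)
      have "M x ** \<sigma> w = w ** M y" using M(4) w x unfolding y V_reg_act[OF w] by (simp add: horizontal_def)
      then show ?thesis unfolding eval_act_tensor \<psi>M y_def[symmetric] by (simp add: matrix_vector_mul_assoc)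
    qed
    have "act_tensor w (\<psi> c) = \<psi> (\<sigma> w *v c)"
    proof (rule tensor_eval_inject)
      fix x
      have "eval_poly (act_tensor w (\<psi> c) $ i - \<psi> (\<sigma> w *v c) $ i) x = 0" for i
        by (rule poly_zero_on_V_reg[OF poly_fun_eval]) (use e in \<open>simp add: vec_eq_iff\<close>)
      then show "tensor_eval (act_tensor w (\<psi> c)) x = tensor_eval (\<psi> (\<sigma> w *v c)) x" by (simp add: vec_eq_iff)
    qed
    then show ?thesis unfolding E_def act_der_tensor_field[OF w] by simp
  qed
  have CW: "CW_isomorphic W (der_c.span (range L)) \<sigma>"
    unfolding CW_isomorphic_def
  proof (intro conjI ballI allI exI[of _ "inv_into UNIV E"])
    show "der_c.subspace (der_c.span (range L))" by (rule der_c.subspace_span)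
    show "bij_betw (inv_into UNIV E) (der_c.span (range L)) UNIV"
      unfolding span_c by (intro bij_betw_inv_into inj_on_imp_bij_betw injE)
    note inv_E = inv_f_f[OF injE]
    fix D assume "D \<in> der_c.span (range L)"
    then obtain c where c: "D = E c" unfolding span_c by blast
    show "act_der w D \<in> der_c.span (range L)" if "w \<in> W" for w unfolding span_c c act[OF that] by blast
    show "inv_into UNIV E (D + D') = inv_into UNIV E D + inv_into UNIV E D'" if D': "D' \<in> der_c.span (range L)" for D'
    proof -
      obtain c' where "D' = E c'" using D' unfolding span_c by blast
      then show ?thesis unfolding c by (simp only: E_add[symmetric] inv_E)
    qed
    show "inv_into UNIV E (der_cscale a D) = a *s inv_into UNIV E D" for a unfolding c by (simp only: E_scale[symmetric] inv_E)
    show "inv_into UNIV E (act_der w D) = \<sigma> w *v inv_into UNIV E D" if "w \<in> W" for w unfolding c by (simp only: act[OF that] inv_E)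
  qed
  show ?thesis
    using injL indep span Lf homog f(2) deg is_kz_kz_fundamental[OF irr K] CW by blast
qed

end

theorem theorem3p12:
  fixes W :: "(complex^'n::finite^'n) set"
    and \<alpha> :: "(complex^'n) set \<Rightarrow> complex^'n"
    and m :: "(complex^'n) set \<Rightarrow> nat"
  assumes "irreducible_reflection_group W"
    and "defines_arrangement W \<alpha>"
    and "invariant_on_arrangement W m"
  shows "(\<exists>\<rho>. SV_module_iso (quasi_invariants W \<alpha> m) (log_derivations W \<alpha> m) \<rho> \<and>
              (\<forall>w\<in>W. \<forall>\<phi>\<in>quasi_invariants W \<alpha> m.
                 act_tensor w \<phi> \<in> quasi_invariants W \<alpha> m \<and>
                 \<rho> (act_tensor w \<phi>) = act_der w (\<rho> \<phi>))) \<and>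
         (\<exists>(L :: 'n \<Rightarrow> 'n poly_ring \<Rightarrow> 'n poly_ring) (f :: 'n \<Rightarrow> 'n \<Rightarrow> 'n poly_ring) (d :: nat).
              inj L \<and> der.independent (range L) \<and> der.span (range L) = log_derivations W \<alpha> m \<and>
              (\<forall>k. L k = vector_field (f k) \<and> homogeneous_der d (L k) \<and>
                   (\<forall>i. homogeneous_poly d (f k i))) \<and>
              real d = 1 / real CARD('n) * (\<Sum>H\<in>arrangement W. real (m H * n_H W H)) \<and>
              (\<exists>\<sigma> :: complex^'n^'n \<Rightarrow> complex^'n^'n.
                 is_kz W \<alpha> (\<lambda>H. - int (m H)) (\<lambda>w. w) \<sigma> \<and>
                 CW_isomorphic W (der_c.span (range L)) \<sigma>))"
proof -
  interpret refl_arr W \<alpha> m by (rule refl_arr.intro[OF assms])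
  show ?thesis
    using tensor_field_iso act_tensor_quasi_invariant act_der_tensor_field
    by (intro conjI log_derivations_free exI[of _ tensor_field]) auto
qed

end
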